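(* Let $k\in\mathbb C^\times$, $l\in\mathbb C$, $(\mathcal V,\pi)\in\mathfrak C_{k,l}$. The operators $\mathcal Z_i^\pm(z,\mathcal V)$ $(i\in I)$ satisfy the following relations. For $g(h,P)\in\mathbb F$ and $i,j\in I$, 1. $[\alpha_{i,m},\mathcal Z_j^\pm(z,\mathcal V)]=0$ for $m\in\mathbb Z\setminus\{0\}$; 2. $[\prod_{i\in I}(K_i^\pm)^{a_i^\vee},\mathcal Z_j^+(z,\mathcal V)]=0$; 3. $g(h,P)\mathcal Z_i^+(z,\mathcal V)=\mathcal Z_i^+(z,\mathcal V)g(h+\langle\alpha_i,h\rangle,P-\langle Q_i,P\rangle)$, $\ g(h,P)\mathcal Z_i^-(z,\mathcal V)=\mathcal Z_i^-(z,\mathcal V)g(h-\langle\alpha_i,h\rangle,P)$, $\ g(h,P)K_i^\pm=K_i^\pm g(h,P-\langle Q_i,P\rangle)$; 4. $K_i^\pm\mathcal Z_j^+(z,\mathcal V)(K_i^\pm)^{-1}=q^{\pm\langle\alpha_j,h_i\rangle}\mathcal Z_j^+(z,\mathcal V)$, $\ K_i^\pm\mathcal Z_j^-(z,\mathcal V)(K_i^\pm)^{-1}=q^{\mp\langle\alpha_j,h_i\rangle}\mathcal Z_j^-(z,\mathcal V)$; 5. $$z\frac{(q^{-b_{ij}}\kappa^{-m_{ij}}\frac wz;q^{2k})_\infty}{(q^{2k}q^{b_{ij}}\kappa^{-m_{ij}}\frac wz;q^{2k})_\infty}\mathcal Z_i^\pm(z,\mathcal V)\mathcal Z_j^\pm(w,\mathcal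 V)=-w\kappa^{-m_{ij}}\frac{(q^{-b_{ij}}\kappa^{m_{ij}}\frac zw;q^{2k})_\infty}{(q^{2k}q^{b_{ij}}\kappa^{m_{ij}}\frac zw;q^{2k})_\infty}\mathcal Z_j^\pm(w,\mathcal V)\mathcal Z_i^\pm(z,\mathcal V);$$ 6. $$\frac{(q^{b_{ij}}q^k\kappa^{-m_{ij}}\frac wz;q^{2k})_\infty}{(q^{-b_{ij}}q^k\kappa^{-m_{ij}}\frac wz;q^{2k})_\infty}\mathcal Z_i^+(z,\mathcal V)\mathcal Z_j^-(w,\mathcal V)-\frac{(q^{b_{ij}}q^k\kappa^{m_{ij}}\frac zw;q^{2k})_\infty}{(q^{-b_{ij}}q^k\kappa^{m_{ij}}\frac zw;q^{2k})_\infty}\mathcal Z_j^-(w,\mathcal V)\mathcal Z_i^+(z,\mathcal V)=\frac{\delta_{i,j}}{q_i-q_i^{-1}}\Big\{\delta\big(q^k\tfrac wz\big)K_i^+-\delta\big(q^{-k}\tfrac wz\big)K_i^-\Big\};$$ 7. for $i\ne j$ and $a=1-a_{ij}$, $$\sum_{\sigma\in\mathfrak S_a}\prod_{1\le t<m\le a}\frac{(q^{-2}\frac{z_{\sigma(m)}}{z_{\sigma(t)}};q^{2k})_\infty}{(q^{2}\frac{z_{\sigma(m)}}{z_{\sigma(t)}};q^{2k})_\infty}\sum_{r=0}^a(-1)^r\left[{a\atop r}\right]_i\prod_{1\le s\le r}\frac{(q^{-b_{ij}}\kappa^{-m_{ij}}\frac w{z_{\sigma(s)}};q^{2k})_\infty}{(q^{b_{ij}}\kappa^{-m_{ij}}\frac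 w{z_{\sigma(s)}};q^{2k})_\infty}\prod_{r+1\le s\le a}\frac{(q^{-b_{ij}}\kappa^{m_{ij}}\frac{z_{\sigma(s)}}w;q^{2k})_\infty}{(q^{b_{ij}}\kappa^{m_{ij}}\frac{z_{\sigma(s)}}w;q^{2k})_\infty}$$ $$\times\mathcal Z_i^+(z_{\sigma(1)},\mathcal V)\cdots\mathcal Z_i^+(z_{\sigma(r)},\mathcal V)\mathcal Z_j^+(w,\mathcal V)\mathcal Z_i^+(z_{\sigma(r+1)},\mathcal V)\cdots\mathcal Z_i^+(z_{\sigma(a)},\mathcal V)=0,$$ $$\sum_{\sigma\in\mathfrak S_a}\prod_{1\le t<m\le a}\frac{(q^{-2}q^{2k}\frac{z_{\sigma(m)}}{z_{\sigma(t)}};q^{2k})_\infty}{(q^{2}q^{2k}\frac{z_{\sigma(m)}}{z_{\sigma(t)}};q^{2k})_\infty}\sum_{r=0}^a(-1)^r\left[{a\atop r}\right]_i\prod_{1\le s\le r}\frac{(q^{-b_{ij}}q^{2k}\kappa^{-m_{ij}}\frac w{z_{\sigma(s)}};q^{2k})_\infty}{(q^{b_{ij}}q^{2k}\kappa^{-m_{ij}}\frac w{z_{\sigma(s)}};q^{2k})_\infty}\prod_{r+1\le s\le a}\frac{(q^{-b_{ij}}q^{2k}\kappa^{m_{ij}}\frac{z_{\sigma(s)}}w;q^{2k})_\infty}{(q^{b_{ij}}q^{2k}\kappa^{m_{ij}}\frac{z_{\sigma(s)}}w;q^{2k})_\infty}$$ $$\times\mathcal Z_i^-(z_{\sigma(1)},\mathcal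 V)\cdots\mathcal Z_i^-(z_{\sigma(r)},\mathcal V)\mathcal Z_j^-(w,\mathcal V)\mathcal Z_i^-(z_{\sigma(r+1)},\mathcal V)\cdots\mathcal Z_i^-(z_{\sigma(a)},\mathcal V)=0.$$
   Context: **Data.** $\mathfrak g$ is a simple Lie algebra over $\mathbb C$, $\widehat{\mathfrak g}$ the corresponding untwisted affine Lie algebra with generalized Cartan matrix $A=(a_{ij})_{i,j\in I}$, $I=\{0,1,\dots,N\}$, $\operatorname{rank}A=N$; $b_{ij}=d_ia_{ij}$ is its symmetrization, $q_i=q^{d_i}$, and $(a_i^\vee)_{i\in I}$ is the co-label of the affine Dynkin diagram. $q,p,\kappa\in\mathbb C^\times$ are generic. $[n]=\frac{q^n-q^{-n}}{q-q^{-1}}$, $[n]_i=\frac{q_i^n-q_i^{-n}}{q_i-q_i^{-1}}$, $\left[{n\atop r}\right]_i$ is the corresponding $q_i$-binomial coefficient, $\delta(z)=\sum_{n\in\mathbb Z}z^n$, $(z;s)_\infty=\prod_{n\ge0}(1-zs^n)$. $m_{ij}=\delta_{i,j+1}-\delta_{i+1,j}$ (indices modulo $N+1$) if $\mathfrak g$ is of type $A_N$, and $m_{ij}=0$ otherwise. $\mathfrak h$ ($\dim N+2$) with simple roots $\alpha_i\in\mathfrak h^*$ and simple coroots $h_i\in\mathfrak h$ is a realization of $A$: $\langle\alpha_j,h_i\rangle=a_{ij}$. $H_P$ is the $\mathbb C$-vector space spanned by $P_0,\dots,P_N$ and $H_P^*$ its dual, spanned by $Q_0,\dots,Q_N$,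 with pairing $\langle Q_i,P_j\rangle=a_{ij}$; $Q_\alpha=\sum_i c_iQ_i$ for $\alpha=\sum_i c_i\alpha_i$ (used also for general $\alpha\in\mathfrak h^*$). $H=\mathfrak h\oplus H_P$, $H^*=\mathfrak h^*\oplus H_P^*$ with $\langle\mathfrak h^*,H_P\rangle=0=\langle H_P^*,\mathfrak h\rangle$. $\mathbb F=\mathcal M_{H^*}$ is the field of meromorphic functions on $H^*$; a meromorphic function $g(h,P)$ of $h,P\in H$ is regarded as an element of it by $g(h,P)(\mu)=g(\langle\mu,h\rangle,\langle\mu,P\rangle)$. **The algebra.** $U_{q,\kappa,p}(\mathfrak g_{tor})$ is the topological ($p$-adic) algebra over $\mathbb F[[p]]$ generated by $\alpha^\vee_{i,l},x^\pm_{i,n},K_i^\pm$ (invertible), $q^{\pm c/2},q^d$ $(i\in I,l\in\mathbb Z\setminus\{0\},n\in\mathbb Z)$. Put $p^*=pq^{-2c}$, $x_i^\pm(z)=\sum_n x^\pm_{i,n}z^{-n}$, $$\phi_i^+(q^{c/2}z)=K_i^+\exp\Big(-(q_i-q_i^{-1})\sum_{n>0}\tfrac{p^n\alpha^\vee_{i,-n}}{1-p^n}z^n\Big)\exp\Big((q_i-q_i^{-1})\sum_{n>0}\tfrac{\alpha^\vee_{i,n}}{1-p^n}z^{-n}\Big),$$ $$\phi_i^-(q^{-c/2}z)=K_i^-\exp\Big(-(q_i-q_i^{-1})\sum_{n>0}\tfrac{\alpha^\vee_{i,-n}}{1-p^n}z^n\Big)\exp\Big((q_i-q_i^{-1})\sum_{n>0}\tfrac{p^n\alpha^\vee_{i,n}}{1-p^n}z^{-n}\Big),$$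 $g_{ij}(z;s)=\exp\big(-\sum_{m>0}\frac1m\frac{q^{b_{ij}m}-q^{-b_{ij}m}}{1-s^m}(sz)^m\big)\in\mathbb C[[s]][[z]]$. Defining relations (formal Laurent series in $z,w,z_a$): - $q^{\pm c/2}$ and $\prod_{i\in I}(K_i^\pm)^{a_i^\vee}$ are central; $g(h,P)x_j^+(z)=x_j^+(z)g(h+\langle\alpha_j,h\rangle,P-\langle Q_j,P\rangle)$; $g(h,P)x_j^-(z)=x_j^-(z)g(h-\langle\alpha_j,h\rangle,P)$; $g(h,P)K_j^\pm=K_j^\pm g(h,P-\langle Q_j,P\rangle)$; $[g(P),\alpha^\vee_{i,m}]=0$; $[g(h,P),q^d]=0$; - $q^d\alpha^\vee_{j,m}q^{-d}=q^m\alpha^\vee_{j,m}$, $q^dx_j^\pm(z)q^{-d}=x_j^\pm(q^{-1}z)$; the $K$'s commute with each other and with $\alpha^\vee_{j,m}$; $K_i^\pm x_j^+(z)(K_i^\pm)^{-1}=q^{\pm\langle\alpha_j,h_i\rangle}x_j^+(z)$, $K_i^\pm x_j^-(z)(K_i^\pm)^{-1}=q^{\mp\langle\alpha_j,h_i\rangle}x_j^-(z)$; - $[\alpha^\vee_{i,l},\alpha^\vee_{j,m}]=\delta_{l+m,0}\frac{[a_{ij}l]_i}{l}\frac{q^{lc}-q^{-lc}}{q_j-q_j^{-1}}\frac{1-p^l}{1-p^{*l}}\kappa^{-lm_{ij}}q^{-lc}$; $[\alpha^\vee_{i,l},x_j^+(z)]=\frac{[a_{ij}l]_i}{l}\frac{1-p^l}{1-p^{*l}}q^{-lc}\kappa^{-lm_{ij}}z^lx_j^+(z)$;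 $[\alpha^\vee_{i,l},x_j^-(z)]=-\frac{[a_{ij}l]_i}{l}\kappa^{-lm_{ij}}z^lx_j^-(z)$; - $(\kappa^{m_{ij}}z-q^{b_{ij}}w)g_{ij}(\kappa^{-m_{ij}}w/z;p^* )x_i^+(z)x_j^+(w)=(\kappa^{m_{ij}}q^{b_{ij}}z-w)g_{ij}(\kappa^{m_{ij}}z/w;p^* )x_j^+(w)x_i^+(z)$; $(\kappa^{m_{ij}}z-q^{-b_{ij}}w)g_{ij}(\kappa^{-m_{ij}}w/z;p)^{-1}x_i^-(z)x_j^-(w)=(\kappa^{m_{ij}}q^{-b_{ij}}z-w)g_{ij}(\kappa^{m_{ij}}z/w;p)^{-1}x_j^-(w)x_i^-(z)$; - $[x_i^+(z),x_j^-(w)]=\frac{\delta_{i,j}}{q_i-q_i^{-1}}\big(\delta(q^cw/z)\phi_i^+(q^{c/2}w)-\delta(q^{-c}w/z)\phi_i^-(q^{c/2}z)\big)$; - (Serre) for $i\ne j$, $a=1-a_{ij}$, with $G^+_{ij}(\cdot)=g_{ij}(\cdot;p^* )$ and $G^-_{ij}(\cdot)=g_{ij}(\cdot;p)^{-1}$: $\sum_{\sigma\in\mathfrak S_a}\prod_{1\le t<m\le a}G^\pm_{ii}(z_{\sigma(m)}/z_{\sigma(t)})\sum_{r=0}^a(-1)^r\left[{a\atop r}\right]_i\prod_{s=1}^rG^\pm_{ij}(\kappa^{-m_{ij}}w/z_{\sigma(s)})\prod_{s=r+1}^aG^\pm_{ij}(\kappa^{m_{ij}}z_{\sigma(s)}/w)\,x_i^\pm(z_{\sigma(1)})\cdots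 x_i^\pm(z_{\sigma(r)})x_j^\pm(w)x_i^\pm(z_{\sigma(r+1)})\cdots x_i^\pm(z_{\sigma(a)})=0$. **Dynamical representations and $\mathfrak C_{k,l}$.** For $P=\sum c_iP_i$ write $P+h=\sum c_i(P_i+h_i)$. The algebra $\mathcal U=U_{q,\kappa,p}(\mathfrak g_{tor})$ is bigraded by $\mathcal U_{\alpha\beta}=\{x\mid q^{P+h}xq^{-(P+h)}=q^{\langle\alpha,P+h\rangle}x,\ q^Pxq^{-P}=q^{\langle Q_\beta,P\rangle}x\ \ \forall P+h,P\in H\}$, $\alpha,\beta\in\mathfrak h^*$, with moment maps $\mu_l(\hat f)=f(h,P+h,p)$, $\mu_r(\hat f)=f(h,P,p^* )$ for $\hat f=f(h,P,p^* )$. Let $\mathcal V=\bigoplus_{\lambda,\mu\in\mathfrak h^*}\mathcal V_{\lambda,\mu}$ be a vector space over $\mathbb F$, where $q^{P+h}v=q^{\langle\lambda,P+h\rangle}v$, $q^Pv=q^{\langle Q_\mu,P\rangle}v$ for $v\in\mathcal V_{\lambda,\mu}$. $\mathcal D_{H,\mathcal V}=\bigoplus_{\alpha,\beta\in\mathfrak h^*}(\mathcal D_{H,\mathcal V})_{\alpha\beta}$, where $(\mathcal D_{H,\mathcal V})_{\alpha\beta}$ consists of the $X\in\mathrm{End}_{\mathbb C}\mathcal V$ with $q^{P+h}Xq^{-(P+h)}=q^{\langle\alpha,P+h\rangle}X$, $q^PXq^{-P}=q^{\langle Q_\beta,P\rangle}X$, $X\mathcal V_{\lambda,\mu}\subseteq\mathcal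 V_{\lambda+\alpha,\mu+\beta}$; its moment maps are $\mu_l(\hat f)v=f(\langle\lambda,h\rangle,\langle\lambda,P+h\rangle,p)v$, $\mu_r(\hat f)v=f(\langle\lambda,h\rangle,\langle Q_\mu,P\rangle,p^* )v$ for $v\in\mathcal V_{\lambda,\mu}$. A dynamical representation on $\mathcal V$ is an algebra homomorphism $\pi:\mathcal U\to\mathcal D_{H,\mathcal V}$ preserving the bigrading and the moment maps. It has level $(k,l)$ if $q^{c/2}$ acts as $q^{k/2}$ and $\prod_{i\in I}(K_i^+)^{a_i^\vee}$ acts as $q^{-l}$. Put $\mathcal V_\omega=\{v\mid q^{-d}v=q^\omega v\}$, $\omega\in\mathbb C$. $\mathfrak C_{k,l}$ is the full subcategory of the category of $U_{q,\kappa,p}(\mathfrak g_{tor})$-modules consisting of those $\mathcal V$ such that: (i) $\mathcal V$ has level $(k,l)$; (ii) $\mathcal V=\bigsqcup_{\omega\in\mathbb C}\mathcal V_\omega$; (iii) for every $\omega\in\mathbb C$ there is $n_0\in\mathbb N$ with $\mathcal V_{\omega+n}=0$ for all $n>n_0$. On level $(k,l)$ modules $p^*=pq^{-2k}$, and one assumes $|p|,|p^*|,|q^{2k}|<1$. **Operators $\mathcal Z_i^\pm(z,\mathcal V)$.** Set $\alpha_{i,m}=[d_i]\alpha^\vee_{i,m}$, $\alpha'_{i,m}=\frac{1-p^{*m}}{1-p^m}q^{cm}\alpha_{i,m}$, $E^\pm(\alpha_i,z)=\exp\{\pm\sum_{m\ge1}\frac{q-q^{-1}}{q^{km}-q^{-km}}\alpha_{i,\pm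 m}z^{\mp m}\}$, $E^\pm(\alpha'_i,z)=\exp\{\mp\sum_{m\ge1}\frac{q-q^{-1}}{q^{km}-q^{-km}}\alpha'_{i,\pm m}z^{\mp m}\}$. For $\mathcal V\in\mathfrak C_{k,l}$, $k\neq0$: $\mathcal Z_i^+(z,\mathcal V)=E^-(\alpha_i,z)x_i^+(z)E^+(\alpha_i,z)$, $\mathcal Z_i^-(z,\mathcal V)=E^-(\alpha'_i,z)x_i^-(z)E^+(\alpha'_i,z)$, elements of $\mathcal D_{H,\mathcal V}[[z,z^{-1}]]$. The relations are read as formal Laurent series in $z,w$ and the $z_s$.
   Formalization: V_ω is defined by q^d v = q^ω v instead of q^{-d} v = q^ω v (as printed, the Z_i^± would be undefined infinite sums), and in relation 7 the factors q^{∓2} in the products over z_{σ(m)}/z_{σ(t)} are read as q_i^{∓2} (the same when d_i = 1). *)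

theory Defs
  imports
    "HOL-Complex_Analysis.Complex_Analysis"
    "HOL-Library.Groups_Big_Fun"
    "HOL-Combinatorics.Permutations"
begin

section \<open>Untwisted affine Cartan data\<close>

text \<open>Simple Lie algebras over the complex numbers by Cartan--Killing type, and the generalized
  Cartan matrices of the corresponding untwisted affine Lie algebras. Nodes \<open>1..N\<close> are numbered as
  in Bourbaki, \<open>0\<close> is the affine node. An entry \<open>(i, j, x, y)\<close> of \<open>bonds\<close> says that \<open>i\<close> and \<open>j\<close> are
  linked with \<open>a\<^sub>i\<^sub>j = x\<close> and \<open>a\<^sub>j\<^sub>i = y\<close>, where \<open>a\<^sub>i\<^sub>j = \<langle>\<alpha>\<^sub>j, h\<^sub>i\<rangle>\<close>.\<close>

datatype lie_type = TA nat | TB nat | TC nat | TD nat | TE6 | TE7 | TE8 | TF4 | TG2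

fun is_simple_type :: "lie_type \<Rightarrow> bool" where
  "is_simple_type (TA n) \<longleftrightarrow> n \<ge> 1"
| "is_simple_type (TB n) \<longleftrightarrow> n \<ge> 3"
| "is_simple_type (TC n) \<longleftrightarrow> n \<ge> 2"
| "is_simple_type (TD n) \<longleftrightarrow> n \<ge> 4"
| "is_simple_type _ \<longleftrightarrow> True"

fun rk :: "lie_type \<Rightarrow> nat" where
  "rk (TA n) = n" | "rk (TB n) = n" | "rk (TC n) = n" | "rk (TD n) = n"
| "rk TE6 = 6" | "rk TE7 = 7" | "rk TE8 = 8" | "rk TF4 = 4" | "rk TG2 = 2"

definition simple_bond :: "nat \<Rightarrow> nat \<Rightarrow> nat \<times> nat \<times> int \<times> int" where
  "simple_bond i j = (i, j, -1, -1)"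

fun bonds :: "lie_type \<Rightarrow> (nat \<times> nat \<times> int \<times> int) list" where
  "bonds (TA n) = (if n = 1 then [(0, 1, -2, -2)]
     else simple_bond 0 n # map (\<lambda>i. simple_bond i (i + 1)) [0..<n])"
| "bonds (TB n) = simple_bond 0 2 # map (\<lambda>i. simple_bond i (i + 1)) [1..<n - 1] @ [(n - 1, n, -1, -2)]"
| "bonds (TC n) = (0, 1, -1, -2) # map (\<lambda>i. simple_bond i (i + 1)) [1..<n - 1] @ [(n - 1, n, -2, -1)]"
| "bonds (TD n) = simple_bond 0 2 # map (\<lambda>i. simple_bond i (i + 1)) [1..<n - 1] @ [simple_bond (n - 2) n]"
| "bonds TE6 = [simple_bond 0 2, simple_bond 1 3, simple_bond 3 4, simple_bond 4 5, simple_bond 5 6,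
     simple_bond 2 4]"
| "bonds TE7 = [simple_bond 0 1, simple_bond 1 3, simple_bond 3 4, simple_bond 4 5, simple_bond 5 6,
     simple_bond 6 7, simple_bond 2 4]"
| "bonds TE8 = [simple_bond 0 8, simple_bond 1 3, simple_bond 3 4, simple_bond 4 5, simple_bond 5 6,
     simple_bond 6 7, simple_bond 7 8, simple_bond 2 4]"
| "bonds TF4 = [simple_bond 0 1, simple_bond 1 2, (2, 3, -1, -2), simple_bond 3 4]"
| "bonds TG2 = [simple_bond 0 2, (1, 2, -3, -1)]"

definition affine_cartan :: "lie_type \<Rightarrow> nat \<Rightarrow> nat \<Rightarrow> int" where
  "affine_cartan X i j = (if i = j then 2 else
     (\<Sum>(a, b, x, y)\<leftarrow>bonds X. if (i, j) = (a, b) then x else if (i, j) = (b, a) then y else 0))"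

text \<open>The co-labels: the coprime positive integers with \<open>\<Sum>\<^sub>i a\<^sub>i\<^sup>\<or> a\<^sub>i\<^sub>j = 0\<close>.\<close>

definition colabel :: "lie_type \<Rightarrow> nat \<Rightarrow> nat" where
  "colabel X = (THE c. (\<forall>i\<le>rk X. c i > 0) \<and> (\<forall>i>rk X. c i = 0) \<and> Gcd (c ` {..rk X}) = 1 \<and>
     (\<forall>j\<le>rk X. (\<Sum>i\<le>rk X. int (c i) * affine_cartan X i j) = 0))"

fun kappa_exponent :: "lie_type \<Rightarrow> nat \<Rightarrow> nat \<Rightarrow> int" where
  "kappa_exponent (TA n) i j =
     of_bool (i mod (n + 1) = (j + 1) mod (n + 1)) - of_bool ((i + 1) mod (n + 1) = j mod (n + 1))"
| "kappa_exponent _ i j = 0"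

text \<open>The parameters of the algebra. On the modules considered here \<open>p\<close> is a complex number and
  all formal power series in \<open>p\<close> and \<open>p\<^sup>*\<close> are evaluated.\<close>

record toroidal_data =
  ltype :: lie_type
  symm :: "nat \<Rightarrow> nat"
  qq :: complex
  kap :: complex
  pp :: complex

definition nodes :: "toroidal_data \<Rightarrow> nat set" where
  "nodes D = {..rk (ltype D)}"

definition aa :: "toroidal_data \<Rightarrow> nat \<Rightarrow> nat \<Rightarrow> int" where
  "aa D i j = affine_cartan (ltype D) i j"

definition mm :: "toroidal_data \<Rightarrow> nat \<Rightarrow> nat \<Rightarrow> int" where
  "mm D i j = kappa_exponent (ltype D) i j"

definition bb :: "toroidal_data \<Rightarrow> nat \<Rightarrow> nat \<Rightarrow> int" where
  "bb D i j = int (symm D i) * aa D i j"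

text \<open>The symmetrizers \<open>d\<^sub>i\<close> are normalized to be coprime positive integers. Genericity is used in
  the form that \<open>q\<close> is not a root of unity.\<close>

definition toroidal_data_ok :: "toroidal_data \<Rightarrow> bool" where
  "toroidal_data_ok D \<longleftrightarrow>
     is_simple_type (ltype D) \<and>
     (\<forall>i\<in>nodes D. symm D i > 0) \<and> Gcd (symm D ` nodes D) = 1 \<and>
     (\<forall>i\<in>nodes D. \<forall>j\<in>nodes D. bb D i j = bb D j i) \<and>
     qq D \<noteq> 0 \<and> kap D \<noteq> 0 \<and> pp D \<noteq> 0 \<and> (\<forall>n>0. qq D ^ n \<noteq> 1)"

definition qi :: "toroidal_data \<Rightarrow> nat \<Rightarrow> complex" where
  "qi D i = qq D ^ symm D i"

definition qint :: "complex \<Rightarrow> int \<Rightarrow> complex" where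
  "qint t n = (t powi n - t powi (- n)) / (t - inverse t)"

definition qbinomial :: "complex \<Rightarrow> nat \<Rightarrow> nat \<Rightarrow> complex" where
  "qbinomial t a r = (\<Prod>n=1..a. qint t (int n)) /
     ((\<Prod>n=1..r. qint t (int n)) * (\<Prod>n=1..a - r. qint t (int n)))"

text \<open>Complex powers of \<open>q\<close> are taken with the principal logarithm; \<open>p\<^sup>* = p q\<^sup>-\<^sup>2\<^sup>k\<close> on level \<open>k\<close>.\<close>

definition pstar :: "toroidal_data \<Rightarrow> complex \<Rightarrow> complex" where
  "pstar D k = pp D * qq D powr (- 2 * k)"


section \<open>The space \<open>H\<^sup>*\<close> and the field of meromorphic functions on it\<close>

text \<open>\<open>H = \<hh> \<oplus> H\<^sub>P\<close> has the basis \<open>h\<^sub>0,\<dots>,h\<^sub>N,d,P\<^sub>0,\<dots>,P\<^sub>N\<close>, where \<open>d\<close> is the scaling element of the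
  standard realization: \<open>\<langle>\<alpha>\<^sub>j, h\<^sub>i\<rangle> = a\<^sub>i\<^sub>j\<close>, \<open>\<langle>\<alpha>\<^sub>j, d\<rangle> = \<delta>\<^sub>j\<^sub>0\<close>. An element of \<open>H\<^sup>*\<close> is given by its values on
  this basis.\<close>

datatype hbasis = Bh nat | Bd | BP nat

type_synonym hweight = "hbasis \<Rightarrow> complex"

definition hbasis_set :: "toroidal_data \<Rightarrow> hbasis set" where
  "hbasis_set D = Bh ` nodes D \<union> {Bd} \<union> BP ` nodes D"

definition Hdual :: "toroidal_data \<Rightarrow> hweight set" where
  "Hdual D = {\<eta>. \<forall>b. b \<notin> hbasis_set D \<longrightarrow> \<eta> b = 0}"

fun alpha_wt :: "toroidal_data \<Rightarrow> nat \<Rightarrow> hweight" where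
  "alpha_wt D j (Bh i) = (if i \<in> nodes D then of_int (aa D i j) else 0)"
| "alpha_wt D j Bd = (if j = 0 then 1 else 0)"
| "alpha_wt D j (BP i) = 0"

fun Q_wt :: "toroidal_data \<Rightarrow> nat \<Rightarrow> hweight" where
  "Q_wt D j (BP i) = (if i \<in> nodes D then of_int (aa D j i) else 0)"
| "Q_wt D j (Bh i) = 0"
| "Q_wt D j Bd = 0"

definition translate :: "hweight \<Rightarrow> (hweight \<Rightarrow> complex) \<Rightarrow> hweight \<Rightarrow> complex" where
  "translate \<theta> g \<eta> = g (\<lambda>b. \<eta> b + \<theta> b)"

definition hol_on :: "toroidal_data \<Rightarrow> hweight set \<Rightarrow> (hweight \<Rightarrow> complex) \<Rightarrow> bool" where
  "hol_on D U f \<longleftrightarrow> continuous_on U f \<and>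
     (\<forall>\<eta>\<in>U. \<forall>b\<in>hbasis_set D. (\<lambda>t. f (\<eta>(b := t))) holomorphic_on {t. \<eta>(b := t) \<in> U})"

definition nbhd :: "toroidal_data \<Rightarrow> hweight \<Rightarrow> hweight set \<Rightarrow> bool" where
  "nbhd D \<eta> U \<longleftrightarrow> openin (top_of_set (Hdual D)) U \<and> \<eta> \<in> U"

definition densely_on :: "toroidal_data \<Rightarrow> hweight set \<Rightarrow> (hweight \<Rightarrow> bool) \<Rightarrow> bool" where
  "densely_on D U R \<longleftrightarrow> (\<forall>W. openin (top_of_set (Hdual D)) W \<and> W \<subseteq> U \<and> W \<noteq> {} \<longrightarrow> (\<exists>\<psi>\<in>W. R \<psi>))"

text \<open>Elements of \<open>\<bbbF>\<close> are represented by normalized functions: they are locally quotients of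
  holomorphic functions, they take the limiting value at removable singularities, and the value
  \<open>0\<close> (a mere convention) at all other singular points.\<close>

definition merF :: "toroidal_data \<Rightarrow> (hweight \<Rightarrow> complex) set" where
  "merF D = {g. \<forall>\<eta>\<in>Hdual D.
     (\<exists>U f1 f2. nbhd D \<eta> U \<and> hol_on D U f1 \<and> hol_on D U f2 \<and> densely_on D U (\<lambda>\<psi>. f2 \<psi> \<noteq> 0) \<and>
        (\<forall>\<psi>\<in>U. f2 \<psi> \<noteq> 0 \<longrightarrow> g \<psi> = f1 \<psi> / f2 \<psi>)) \<and>
     (\<forall>U f. nbhd D \<eta> U \<and> hol_on D U f \<and> densely_on D U (\<lambda>\<psi>. f \<psi> = g \<psi>) \<longrightarrow> g \<eta> = f \<eta>) \<and>
     (g \<eta> = 0 \<or> (\<exists>U. nbhd D \<eta> U \<and> hol_on D U g))}"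


section \<open>Formal series\<close>

text \<open>A formal distribution assigns to an exponent the coefficient (an operator) of the
  corresponding monomial. In one variable exponents are integers; in several variables they are
  functions \<open>nat \<Rightarrow> int\<close>, and the variables are identified with natural numbers. All coefficients of
  products are sums over finitely many nonzero terms when applied to a vector of a module in the
  category considered below, so \<^const>\<open>Sum_any\<close> gives them their meaning.\<close>

type_synonym 'v op = "'v \<Rightarrow> 'v"
type_synonym expo = "nat \<Rightarrow> int"

definition dprod :: "('e::minus \<Rightarrow> ('v::comm_monoid_add) op) \<Rightarrow> ('e \<Rightarrow> 'v op) \<Rightarrow> 'e \<Rightarrow> 'v op"
    (infixr \<open>\<circledast>\<close> 70) where
  "(X \<circledast> Y) e v = Sum_any (\<lambda>f. X f (Y (e - f) v))"

definition dscale :: "(complex \<Rightarrow> ('v::comm_monoid_add) op) \<Rightarrow> (expo \<Rightarrow> complex) \<Rightarrow> (expo \<Rightarrow> 'v op) \<Rightarrow>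
    expo \<Rightarrow> 'v op" where
  "dscale sc S X e v = Sum_any (\<lambda>f. sc (S f) (X (e - f) v))"

definition dscales :: "(complex \<Rightarrow> ('v::comm_monoid_add) op) \<Rightarrow> (expo \<Rightarrow> complex) list \<Rightarrow>
    (expo \<Rightarrow> 'v op) \<Rightarrow> expo \<Rightarrow> 'v op" where
  "dscales sc Ss X = foldr (dscale sc) Ss X"

text \<open>\<open>current X\<close> is \<open>\<Sum>\<^sub>n X\<^sub>n z\<^sup>-\<^sup>n\<close>, \<open>in_var a X\<close> is \<open>X(z\<^sub>a)\<close> as a distribution in several variables, and
  \<open>rescale c X\<close> is \<open>X(cz)\<close>.\<close>

definition current :: "(int \<Rightarrow> 'v op) \<Rightarrow> int \<Rightarrow> 'v op" where
  "current X n = X (- n)"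

definition rescale :: "(complex \<Rightarrow> 'v op) \<Rightarrow> complex \<Rightarrow> (int \<Rightarrow> 'v op) \<Rightarrow> int \<Rightarrow> 'v op" where
  "rescale sc c X n v = sc (c powi n) (X n v)"

definition in_var :: "nat \<Rightarrow> (int \<Rightarrow> ('v::zero) op) \<Rightarrow> expo \<Rightarrow> 'v op" where
  "in_var a X e v = (if \<forall>b. b \<noteq> a \<longrightarrow> e b = 0 then X (e a) v else 0)"

definition unit_dist :: "expo \<Rightarrow> ('v::zero) op" where
  "unit_dist e v = (if e = (\<lambda>_. 0) then v else 0)"

definition dprods :: "(expo \<Rightarrow> ('v::comm_monoid_add) op) list \<Rightarrow> expo \<Rightarrow> 'v op" where
  "dprods Xs = foldr (\<circledast>) Xs unit_dist"

text \<open>The scalar series \<open>c z\<^sub>a\<close>, \<open>F(c z\<^sub>a / z\<^sub>b)\<close> and \<open>\<delta>(c z\<^sub>a / z\<^sub>b)\<close>, for \<open>a \<noteq> b\<close>.\<close>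

definition ratio_expo :: "int \<Rightarrow> nat \<Rightarrow> nat \<Rightarrow> expo" where
  "ratio_expo r a b = (\<lambda>s. if s = a then r else if s = b then - r else 0)"

definition var :: "complex \<Rightarrow> nat \<Rightarrow> expo \<Rightarrow> complex" where
  "var c a e = (if e = (\<lambda>s. if s = a then 1 else 0) then c else 0)"

definition in_ratio :: "complex fps \<Rightarrow> complex \<Rightarrow> nat \<Rightarrow> nat \<Rightarrow> expo \<Rightarrow> complex" where
  "in_ratio F c a b e =
     (if e a \<ge> 0 \<and> e = ratio_expo (e a) a b then fps_nth F (nat (e a)) * c ^ nat (e a) else 0)"

definition delta_ratio :: "complex \<Rightarrow> nat \<Rightarrow> nat \<Rightarrow> expo \<Rightarrow> complex" where
  "delta_ratio c a b e = (if e = ratio_expo (e a) a b then c powi e a else 0)"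

text \<open>The exponential \<open>exp (\<Sum>\<^sub>m\<^sub>\<ge>\<^sub>1 A\<^sub>m u\<^sup>m)\<close> of an operator-valued power series, and its placement as a
  series in \<open>u = z\<close> or \<open>u = z\<^sup>-\<^sup>1\<close>.\<close>

fun op_pow :: "(nat \<Rightarrow> ('v::comm_monoid_add) op) \<Rightarrow> nat \<Rightarrow> nat \<Rightarrow> 'v op" where
  "op_pow A 0 n v = (if n = 0 then v else 0)"
| "op_pow A (Suc r) n v = (\<Sum>m=1..n. A m (op_pow A r (n - m) v))"

definition op_exp :: "(complex \<Rightarrow> ('v::comm_monoid_add) op) \<Rightarrow> (nat \<Rightarrow> 'v op) \<Rightarrow> nat \<Rightarrow> 'v op" where
  "op_exp sc A n v = (\<Sum>r\<le>n. sc (1 / fact r) (op_pow A r n v))"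

definition in_z :: "(nat \<Rightarrow> ('v::zero) op) \<Rightarrow> int \<Rightarrow> 'v op" where
  "in_z X n v = (if n \<ge> 0 then X (nat n) v else 0)"

definition in_inv_z :: "(nat \<Rightarrow> ('v::zero) op) \<Rightarrow> int \<Rightarrow> 'v op" where
  "in_inv_z X n v = (if n \<le> 0 then X (nat (- n)) v else 0)"

text \<open>\<open>(xu; s)\<^sub>\<infinity>\<close> and \<open>(xu; s)\<^sub>\<infinity> / (yu; s)\<^sub>\<infinity>\<close> as power series in \<open>u\<close>.\<close>

definition qpoch :: "complex \<Rightarrow> complex \<Rightarrow> complex fps" where
  "qpoch x s = fps_expansion (\<lambda>u. prodinf (\<lambda>n. 1 - x * u * s ^ n)) 0"

definition qpoch_quot :: "complex \<Rightarrow> complex \<Rightarrow> complex \<Rightarrow> complex fps" where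
  "qpoch_quot x y s = qpoch x s / qpoch y s"

definition gser :: "toroidal_data \<Rightarrow> nat \<Rightarrow> nat \<Rightarrow> complex \<Rightarrow> complex fps" where
  "gser D i j s = fps_compose (fps_exp 1) (Abs_fps (\<lambda>m. if m = 0 then 0 else
     - (1 / of_nat m) * ((qq D powi (bb D i j * int m) - qq D powi (- bb D i j * int m)) / (1 - s ^ m))
       * s ^ m))"


section \<open>Dynamical representations\<close>

text \<open>The action of the generators \<open>\<alpha>\<^sup>\<or>\<^sub>i\<^sub>,\<^sub>l\<close>, \<open>x\<^sup>\<plusminus>\<^sub>i\<^sub>,\<^sub>n\<close>, \<open>K\<^sub>i\<^sup>\<plusminus>\<close>, \<open>q\<^sup>c\<^sup>/\<^sup>2\<close>, \<open>q\<^sup>d\<close> on a complex vector space with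
  scalar multiplication \<open>scl\<close>, and the weight spaces. The weight space \<open>\<V>\<^sub>\<lambda>\<^sub>,\<^sub>\<mu>\<close> is \<open>wsp V \<eta>\<close> for the
  \<open>\<eta> \<in> H\<^sup>*\<close> with \<open>\<eta>(P + h) = \<langle>\<lambda>, P + h\<rangle>\<close> and \<open>\<eta>(P) = \<langle>Q\<^sub>\<mu>, P\<rangle>\<close>. Indexing by \<open>\<eta>\<close> avoids listing one and the
  same space several times, as \<open>Q\<^sub>\<mu>\<close> does not determine \<open>\<mu>\<close>.\<close>

record 'v tor_rep =
  scl :: "complex \<Rightarrow> 'v \<Rightarrow> 'v"
  wsp :: "hweight \<Rightarrow> 'v set"
  av :: "nat \<Rightarrow> int \<Rightarrow> 'v \<Rightarrow> 'v"
  xp :: "nat \<Rightarrow> int \<Rightarrow> 'v \<Rightarrow> 'v"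
  xm :: "nat \<Rightarrow> int \<Rightarrow> 'v \<Rightarrow> 'v"
  Kp :: "nat \<Rightarrow> 'v \<Rightarrow> 'v"
  Km :: "nat \<Rightarrow> 'v \<Rightarrow> 'v"
  qc2 :: "'v \<Rightarrow> 'v"
  qd :: "'v \<Rightarrow> 'v"

definition decomposes :: "('v::ab_group_add) tor_rep \<Rightarrow> 'v \<Rightarrow> (hweight \<Rightarrow> 'v) \<Rightarrow> bool" where
  "decomposes V v c \<longleftrightarrow> finite {\<eta>. c \<eta> \<noteq> 0} \<and> (\<forall>\<eta>. c \<eta> \<in> wsp V \<eta>) \<and> v = Sum_any c"

text \<open>The action of \<open>g \<in> \<bbbF>\<close>: on the weight space of \<open>\<eta>\<close> it is multiplication by \<open>g(\<eta>)\<close>. For \<open>g = f(h, P)\<close>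
  this is the moment map \<open>\<mu>\<^sub>r\<close>, and for \<open>g = f(h, P + h)\<close> it is \<open>\<mu>\<^sub>l\<close>.\<close>

definition act :: "('v::ab_group_add) tor_rep \<Rightarrow> (hweight \<Rightarrow> complex) \<Rightarrow> 'v \<Rightarrow> 'v" where
  "act V g v = Sum_any (\<lambda>\<eta>. scl V (g \<eta>) ((THE c. decomposes V v c) \<eta>))"

definition shifts_weights :: "'v tor_rep \<Rightarrow> hweight \<Rightarrow> ('v \<Rightarrow> 'v) \<Rightarrow> bool" where
  "shifts_weights V \<theta> X \<longleftrightarrow> (\<forall>\<eta>. \<forall>v\<in>wsp V \<eta>. X v \<in> wsp V (\<lambda>b. \<eta> b + \<theta> b))"

text \<open>\<open>\<Prod>\<^sub>i (K\<^sub>i)\<^bsup>a\<^sub>i\<^sup>\<or>\<^esup>\<close>; the factors commute.\<close>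

definition Kprod :: "toroidal_data \<Rightarrow> (nat \<Rightarrow> 'v op) \<Rightarrow> 'v op" where
  "Kprod D K = foldr (\<lambda>i f. (K i ^^ colabel (ltype D) i) \<circ> f) [0..<rk (ltype D) + 1] id"

text \<open>\<open>phi_plus\<close> is \<open>\<phi>\<^sub>i\<^sup>+(q\<^sup>c\<^sup>/\<^sup>2 z)\<close> and \<open>phi_minus\<close> is \<open>\<phi>\<^sub>i\<^sup>-(q\<^sup>-\<^sup>c\<^sup>/\<^sup>2 z)\<close>, as series in \<open>z\<close>.\<close>

definition phi_plus :: "toroidal_data \<Rightarrow> ('v::ab_group_add) tor_rep \<Rightarrow> nat \<Rightarrow> int \<Rightarrow> 'v op" where
  "phi_plus D V i n v = Kp V i
     ((in_z (op_exp (scl V) (\<lambda>m v. scl V (- (qi D i - inverse (qi D i)) * pp D ^ m / (1 - pp D ^ m))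
          (av V i (- int m) v))) \<circledast>
       in_inv_z (op_exp (scl V) (\<lambda>m v. scl V ((qi D i - inverse (qi D i)) / (1 - pp D ^ m))
          (av V i (int m) v)))) n v)"

definition phi_minus :: "toroidal_data \<Rightarrow> ('v::ab_group_add) tor_rep \<Rightarrow> nat \<Rightarrow> int \<Rightarrow> 'v op" where
  "phi_minus D V i n v = Km V i
     ((in_z (op_exp (scl V) (\<lambda>m v. scl V (- (qi D i - inverse (qi D i)) / (1 - pp D ^ m))
          (av V i (- int m) v))) \<circledast>
       in_inv_z (op_exp (scl V) (\<lambda>m v. scl V ((qi D i - inverse (qi D i)) * pp D ^ m / (1 - pp D ^ m))
          (av V i (int m) v)))) n v)"

text \<open>The left hand side of a Serre relation with structure functions \<open>Gii\<close>, \<open>Gij\<close>. Variable \<open>0\<close> is \<open>w\<close>,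
  variable \<open>s\<close> is \<open>z\<^sub>s\<close> for \<open>1 \<le> s \<le> a\<close>.\<close>

definition serre_sum :: "toroidal_data \<Rightarrow> (complex \<Rightarrow> ('v::ab_group_add) op) \<Rightarrow> nat \<Rightarrow> nat \<Rightarrow>
    complex fps \<Rightarrow> complex fps \<Rightarrow> (int \<Rightarrow> 'v op) \<Rightarrow> (int \<Rightarrow> 'v op) \<Rightarrow> expo \<Rightarrow> 'v op" where
  "serre_sum D sc i j Gii Gij Xi Xj = (let a = nat (1 - aa D i j); \<kappa> = kap D; m\<^sub>i\<^sub>j = mm D i j in
     (\<lambda>e v. \<Sum>\<sigma> | \<sigma> permutes {1..a}.
        dscales sc [in_ratio Gii 1 (\<sigma> m) (\<sigma> t). m \<leftarrow> [1..<a + 1], t \<leftarrow> [1..<m]]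
          (\<lambda>e v. \<Sum>r\<le>a. sc ((- 1) ^ r * qbinomial (qi D i) a r)
             (dscales sc
                ([in_ratio Gij (\<kappa> powi (- m\<^sub>i\<^sub>j)) 0 (\<sigma> s). s \<leftarrow> [1..<r + 1]] @
                 [in_ratio Gij (\<kappa> powi m\<^sub>i\<^sub>j) (\<sigma> s) 0. s \<leftarrow> [r + 1..<a + 1]])
                (dprods ([in_var (\<sigma> s) Xi. s \<leftarrow> [1..<r + 1]] @ [in_var 0 Xj] @
                         [in_var (\<sigma> s) Xi. s \<leftarrow> [r + 1..<a + 1]]))
                e v)) e v))"

text \<open>Dynamical representations on which \<open>q\<^sup>c\<^sup>/\<^sup>2\<close> acts as \<open>q\<^sup>k\<^sup>/\<^sup>2\<close>; accordingly \<open>q\<^sup>c\<close> and \<open>p\<^sup>*\<close> are replaced by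
  their values. The assumptions \<open>shift_*\<close> say that the generators act by elements of \<open>\<D>\<^sub>H\<^sub>,\<^sub>\<V>\<close> of the
  right bidegree; in particular \<open>\<alpha>\<^sup>\<or>\<^sub>i\<^sub>,\<^sub>l\<close> and \<open>q\<^sup>d\<close> have bidegree \<open>(0, 0)\<close>, so that they commute with all
  \<open>g(h, P)\<close>. In the relations in two variables, \<open>z\<close> is variable \<open>1\<close> and \<open>w\<close> is variable \<open>0\<close>.\<close>

locale dynamical_rep =
  fixes D :: toroidal_data and k :: complex and V :: "('v::ab_group_add) tor_rep"
  assumes vector_space: "vector_space (scl V)"
    and linear_av: "\<And>i l. i \<in> nodes D \<Longrightarrow> l \<noteq> 0 \<Longrightarrow> Vector_Spaces.linear (scl V) (scl V) (av V i l)"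
    and linear_x: "\<And>i n. i \<in> nodes D \<Longrightarrow> Vector_Spaces.linear (scl V) (scl V) (xp V i n) \<and>
      Vector_Spaces.linear (scl V) (scl V) (xm V i n)"
    and linear_K: "\<And>i. i \<in> nodes D \<Longrightarrow> Vector_Spaces.linear (scl V) (scl V) (Kp V i) \<and>
      Vector_Spaces.linear (scl V) (scl V) (Km V i)"
    and linear_qd: "Vector_Spaces.linear (scl V) (scl V) (qd V)"
    and invertible: "\<And>i. i \<in> nodes D \<Longrightarrow> bij (Kp V i) \<and> bij (Km V i)" "bij (qd V)"
    and level_c: "qc2 V v = scl V (qq D powr (k / 2)) v"
    \<comment> \<open>weight spaces and bigrading\<close>
    and wsp_subspace: "\<And>\<eta>. module.subspace (scl V) (wsp V \<eta>)"
    and wsp_Hdual: "\<And>\<eta>. \<eta> \<notin> Hdual D \<Longrightarrow> wsp V \<eta> = {0}"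
    and wsp_direct_sum: "\<And>v. \<exists>!c. decomposes V v c"
    and shift_av: "\<And>i l. i \<in> nodes D \<Longrightarrow> l \<noteq> 0 \<Longrightarrow> shifts_weights V (\<lambda>_. 0) (av V i l)"
    and shift_xp: "\<And>j n. j \<in> nodes D \<Longrightarrow>
      shifts_weights V (\<lambda>b. alpha_wt D j b - Q_wt D j b) (xp V j n)"
    and shift_xm: "\<And>j n. j \<in> nodes D \<Longrightarrow> shifts_weights V (\<lambda>b. - alpha_wt D j b) (xm V j n)"
    and shift_K: "\<And>j. j \<in> nodes D \<Longrightarrow> shifts_weights V (\<lambda>b. - Q_wt D j b) (Kp V j) \<and>
      shifts_weights V (\<lambda>b. - Q_wt D j b) (Km V j)"
    and shift_qd: "shifts_weights V (\<lambda>_. 0) (qd V)"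
    \<comment> \<open>defining relations\<close>
    and act_av: "\<And>g i l v. g \<in> merF D \<Longrightarrow> i \<in> nodes D \<Longrightarrow> l \<noteq> 0 \<Longrightarrow>
      act V g (av V i l v) = av V i l (act V g v)"
    and act_xp: "\<And>g j n v. g \<in> merF D \<Longrightarrow> j \<in> nodes D \<Longrightarrow>
      act V g (xp V j n v) = xp V j n (act V (translate (\<lambda>b. alpha_wt D j b - Q_wt D j b) g) v)"
    and act_xm: "\<And>g j n v. g \<in> merF D \<Longrightarrow> j \<in> nodes D \<Longrightarrow>
      act V g (xm V j n v) = xm V j n (act V (translate (\<lambda>b. - alpha_wt D j b) g) v)"
    and act_K: "\<And>g j v K. g \<in> merF D \<Longrightarrow> j \<in> nodes D \<Longrightarrow> K \<in> {Kp V, Km V} \<Longrightarrow>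
      act V g (K j v) = K j (act V (translate (\<lambda>b. - Q_wt D j b) g) v)"
    and act_qd: "\<And>g v. g \<in> merF D \<Longrightarrow> act V g (qd V v) = qd V (act V g v)"
    and Kprod_central: "\<And>K. K \<in> {Kp V, Km V} \<Longrightarrow>
      (\<forall>j\<in>nodes D. (\<forall>n v. Kprod D K (xp V j n v) = xp V j n (Kprod D K v) \<and>
                             Kprod D K (xm V j n v) = xm V j n (Kprod D K v)) \<and>
                   (\<forall>l v. l \<noteq> 0 \<longrightarrow> Kprod D K (av V j l v) = av V j l (Kprod D K v)) \<and>
                   (\<forall>v. Kprod D K (Kp V j v) = Kp V j (Kprod D K v) \<and>
                        Kprod D K (Km V j v) = Km V j (Kprod D K v))) \<and>
      (\<forall>v. Kprod D K (qd V v) = qd V (Kprod D K v)) \<and>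
      (\<forall>g v. g \<in> merF D \<longrightarrow> Kprod D K (act V g v) = act V g (Kprod D K v))"
    and qd_av: "\<And>j m v. j \<in> nodes D \<Longrightarrow> m \<noteq> 0 \<Longrightarrow>
      qd V (av V j m v) = scl V (qq D powi m) (av V j m (qd V v))"
    and qd_x: "\<And>j n v X. j \<in> nodes D \<Longrightarrow> X \<in> {xp V, xm V} \<Longrightarrow>
      qd V (X j n v) = scl V (qq D powi n) (X j n (qd V v))"
    and K_K: "\<And>i j v K K'. i \<in> nodes D \<Longrightarrow> j \<in> nodes D \<Longrightarrow> K \<in> {Kp V, Km V} \<Longrightarrow> K' \<in> {Kp V, Km V} \<Longrightarrow>
      K i (K' j v) = K' j (K i v)"
    and K_av: "\<And>i j m v K. i \<in> nodes D \<Longrightarrow> j \<in> nodes D \<Longrightarrow> m \<noteq> 0 \<Longrightarrow> K \<in> {Kp V, Km V} \<Longrightarrow>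
      K i (av V j m v) = av V j m (K i v)"
    and Kp_xp: "\<And>i j n v. i \<in> nodes D \<Longrightarrow> j \<in> nodes D \<Longrightarrow>
      Kp V i (xp V j n (inv (Kp V i) v)) = scl V (qq D powi aa D i j) (xp V j n v)"
    and Km_xp: "\<And>i j n v. i \<in> nodes D \<Longrightarrow> j \<in> nodes D \<Longrightarrow>
      Km V i (xp V j n (inv (Km V i) v)) = scl V (qq D powi (- aa D i j)) (xp V j n v)"
    and Kp_xm: "\<And>i j n v. i \<in> nodes D \<Longrightarrow> j \<in> nodes D \<Longrightarrow>
      Kp V i (xm V j n (inv (Kp V i) v)) = scl V (qq D powi (- aa D i j)) (xm V j n v)"
    and Km_xm: "\<And>i j n v. i \<in> nodes D \<Longrightarrow> j \<in> nodes D \<Longrightarrow>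
      Km V i (xm V j n (inv (Km V i) v)) = scl V (qq D powi aa D i j) (xm V j n v)"
    and av_av: "\<And>i j l m v. i \<in> nodes D \<Longrightarrow> j \<in> nodes D \<Longrightarrow> l \<noteq> 0 \<Longrightarrow> m \<noteq> 0 \<Longrightarrow>
      av V i l (av V j m v) - av V j m (av V i l v) = scl V (if l + m = 0 then
        qint (qi D i) (aa D i j * l) / of_int l
        * ((qq D powr (of_int l * k) - qq D powr (- of_int l * k)) / (qi D j - inverse (qi D j)))
        * ((1 - pp D powi l) / (1 - pstar D k powi l))
        * kap D powi (- l * mm D i j) * qq D powr (- of_int l * k) else 0) v"
    and av_xp: "\<And>i j l n v. i \<in> nodes D \<Longrightarrow> j \<in> nodes D \<Longrightarrow> l \<noteq> 0 \<Longrightarrow>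
      av V i l (xp V j n v) - xp V j n (av V i l v) = scl V
        (qint (qi D i) (aa D i j * l) / of_int l * ((1 - pp D powi l) / (1 - pstar D k powi l))
         * qq D powr (- of_int l * k) * kap D powi (- l * mm D i j)) (xp V j (n + l) v)"
    and av_xm: "\<And>i j l n v. i \<in> nodes D \<Longrightarrow> j \<in> nodes D \<Longrightarrow> l \<noteq> 0 \<Longrightarrow>
      av V i l (xm V j n v) - xm V j n (av V i l v) = scl V
        (- (qint (qi D i) (aa D i j * l) / of_int l) * kap D powi (- l * mm D i j)) (xm V j (n + l) v)"
    and xp_xp: "\<And>i j. i \<in> nodes D \<Longrightarrow> j \<in> nodes D \<Longrightarrow>
      dscale (scl V) (\<lambda>e. var (kap D powi mm D i j) 1 e - var (qq D powi bb D i j) 0 e)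
        (dscale (scl V) (in_ratio (gser D i j (pstar D k)) (kap D powi (- mm D i j)) 0 1)
          (in_var 1 (current (xp V i)) \<circledast> in_var 0 (current (xp V j)))) =
      dscale (scl V) (\<lambda>e. var (kap D powi mm D i j * qq D powi bb D i j) 1 e - var 1 0 e)
        (dscale (scl V) (in_ratio (gser D i j (pstar D k)) (kap D powi mm D i j) 1 0)
          (in_var 0 (current (xp V j)) \<circledast> in_var 1 (current (xp V i))))"
    and xm_xm: "\<And>i j. i \<in> nodes D \<Longrightarrow> j \<in> nodes D \<Longrightarrow>
      dscale (scl V) (\<lambda>e. var (kap D powi mm D i j) 1 e - var (qq D powi (- bb D i j)) 0 e)
        (dscale (scl V) (in_ratio (inverse (gser D i j (pp D))) (kap D powi (- mm D i j)) 0 1)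
          (in_var 1 (current (xm V i)) \<circledast> in_var 0 (current (xm V j)))) =
      dscale (scl V) (\<lambda>e. var (kap D powi mm D i j * qq D powi (- bb D i j)) 1 e - var 1 0 e)
        (dscale (scl V) (in_ratio (inverse (gser D i j (pp D))) (kap D powi mm D i j) 1 0)
          (in_var 0 (current (xm V j)) \<circledast> in_var 1 (current (xm V i))))"
    and xp_xm: "\<And>i j e v. i \<in> nodes D \<Longrightarrow> j \<in> nodes D \<Longrightarrow>
      (in_var 1 (current (xp V i)) \<circledast> in_var 0 (current (xm V j))) e v
        - (in_var 0 (current (xm V j)) \<circledast> in_var 1 (current (xp V i))) e v =
      scl V (of_bool (i = j) / (qi D i - inverse (qi D i)))
        (dscale (scl V) (delta_ratio (qq D powr k) 0 1) (in_var 0 (phi_plus D V i)) e v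
         - dscale (scl V) (delta_ratio (qq D powr (- k)) 0 1)
             (in_var 1 (rescale (scl V) (qq D powr k) (phi_minus D V i))) e v)"
    and serre_p: "\<And>i j. i \<in> nodes D \<Longrightarrow> j \<in> nodes D \<Longrightarrow> i \<noteq> j \<Longrightarrow>
      serre_sum D (scl V) i j (gser D i i (pstar D k)) (gser D i j (pstar D k))
        (current (xp V i)) (current (xp V j)) = (\<lambda>e v. 0)"
    and serre_m: "\<And>i j. i \<in> nodes D \<Longrightarrow> j \<in> nodes D \<Longrightarrow> i \<noteq> j \<Longrightarrow>
      serre_sum D (scl V) i j (inverse (gser D i i (pp D))) (inverse (gser D i j (pp D)))
        (current (xm V i)) (current (xm V j)) = (\<lambda>e v. 0)"

text \<open>The energy grading. The generators of mode \<open>n\<close> map \<open>omega_space D V \<omega>\<close> to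
  \<open>omega_space D V (\<omega> + n)\<close>, so the truncation condition in \<open>category_C\<close> makes the modes \<open>n \<gg> 0\<close> kill any
  given vector. This is what the series in \<open>\<Z>\<^sub>i\<^sup>\<plusminus>\<close> and the expansions in \<open>w/z\<close> need; with \<open>q\<^sup>-\<^sup>d\<close> in place
  of \<open>q\<^sup>d\<close> they would not be defined. Since \<open>q powr \<omega>\<close> is periodic in \<open>\<omega>\<close>, different \<open>\<omega>\<close> may give the same
  space; distinct spaces are independent, being eigenspaces for different eigenvalues.\<close>

definition omega_space :: "toroidal_data \<Rightarrow> 'v tor_rep \<Rightarrow> complex \<Rightarrow> 'v set" where
  "omega_space D V \<omega> = {v. qd V v = scl V (qq D powr \<omega>) v}"

definition category_C :: "toroidal_data \<Rightarrow> complex \<Rightarrow> complex \<Rightarrow> ('v::ab_group_add) tor_rep \<Rightarrow> bool" where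
  "category_C D k l V \<longleftrightarrow> dynamical_rep D k V \<and>
     (\<forall>v. Kprod D (Kp V) v = scl V (qq D powr (- l)) v) \<and>
     module.span (scl V) (\<Union>\<omega>. omega_space D V \<omega>) = UNIV \<and>
     (\<forall>\<omega>. \<exists>n0::nat. \<forall>n>n0. omega_space D V (\<omega> + of_nat n) = {0})"


section \<open>The operators \<open>\<Z>\<^sub>i\<^sup>\<plusminus>(z, \<V>)\<close>\<close>

definition alpha :: "toroidal_data \<Rightarrow> 'v tor_rep \<Rightarrow> nat \<Rightarrow> int \<Rightarrow> 'v op" where
  "alpha D V i m v = scl V (qint (qq D) (int (symm D i))) (av V i m v)"

definition alpha' :: "toroidal_data \<Rightarrow> complex \<Rightarrow> 'v tor_rep \<Rightarrow> nat \<Rightarrow> int \<Rightarrow> 'v op" where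
  "alpha' D k V i m v = scl V ((1 - pstar D k powi m) / (1 - pp D powi m) * qq D powr (of_int m * k))
     (alpha D V i m v)"

text \<open>\<open>vertex_plus D k V c A\<close> is \<open>exp (c \<Sum>\<^sub>m\<^sub>\<ge>\<^sub>1 (q - q\<^sup>-\<^sup>1) / (q\<^sup>k\<^sup>m - q\<^sup>-\<^sup>k\<^sup>m) A\<^sub>m z\<^sup>-\<^sup>m)\<close>, and \<open>vertex_minus\<close> is the same
  with \<open>A\<^sub>-\<^sub>m z\<^sup>m\<close>.\<close>

definition vertex_plus :: "toroidal_data \<Rightarrow> complex \<Rightarrow> ('v::ab_group_add) tor_rep \<Rightarrow> complex \<Rightarrow>
    (int \<Rightarrow> 'v op) \<Rightarrow> int \<Rightarrow> 'v op" where
  "vertex_plus D k V c A = in_inv_z (op_exp (scl V) (\<lambda>m v. scl V (c * (qq D - inverse (qq D)) /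
     (qq D powr (k * of_nat m) - qq D powr (- k * of_nat m))) (A (int m) v)))"

definition vertex_minus :: "toroidal_data \<Rightarrow> complex \<Rightarrow> ('v::ab_group_add) tor_rep \<Rightarrow> complex \<Rightarrow>
    (int \<Rightarrow> 'v op) \<Rightarrow> int \<Rightarrow> 'v op" where
  "vertex_minus D k V c A = in_z (op_exp (scl V) (\<lambda>m v. scl V (c * (qq D - inverse (qq D)) /
     (qq D powr (k * of_nat m) - qq D powr (- k * of_nat m))) (A (- int m) v)))"

text \<open>The coefficient of \<open>z\<^sup>n\<close> in \<open>\<Z>\<^sub>i\<^sup>\<plusminus>(z, \<V>)\<close>.\<close>

definition Zplus :: "toroidal_data \<Rightarrow> complex \<Rightarrow> ('v::ab_group_add) tor_rep \<Rightarrow> nat \<Rightarrow> int \<Rightarrow> 'v op" where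
  "Zplus D k V i = vertex_minus D k V (- 1) (alpha D V i) \<circledast> current (xp V i) \<circledast>
     vertex_plus D k V 1 (alpha D V i)"

definition Zminus :: "toroidal_data \<Rightarrow> complex \<Rightarrow> ('v::ab_group_add) tor_rep \<Rightarrow> nat \<Rightarrow> int \<Rightarrow> 'v op" where
  "Zminus D k V i = vertex_minus D k V 1 (alpha' D k V i) \<circledast> current (xm V i) \<circledast>
     vertex_plus D k V (- 1) (alpha' D k V i)"

end

theory Submission
  imports Defs
begin

text \<open>Write \<open>\<Z>(z) = E\<^sup>-(z) x(z) E\<^sup>+(z)\<close>. The coefficients of the exponents are chosen such that the \<open>\<alpha>\<^sub>i\<^sub>,\<^sub>m\<close> commute with all
  \<open>\<Z>\<close>; as \<open>E\<^sup>+\<close> is built from the \<open>\<alpha>\<^sub>i\<^sub>,\<^sub>m\<close> with \<open>m > 0\<close>, it commutes with \<open>\<Z>\<close> as well. Hence in a product of several \<open>\<Z>\<close>s all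
  \<open>E\<^sup>+\<close> can be moved to the right, and the \<open>E\<^sup>-\<close> to the left past the \<open>x\<close>s, which costs a scalar factor \<open>H(w/z)\<close> per pair.
  The quotients of infinite products in the relations are the structure functions of the \<open>x\<close>s divided by \<open>H\<close>: this is
  a comparison of the logarithms of power series. So each relation among the \<open>\<Z>\<close>s is the relation among the \<open>x\<close>s,
  multiplied by all \<open>E\<^sup>-\<close> on the left and by all \<open>E\<^sup>+\<close> on the right. For \<open>[x\<^sub>i\<^sup>+(z), x\<^sub>i\<^sup>-(w)]\<close> these exponentials cancel those
  in \<open>\<phi>\<^sub>i\<^sup>\<plusminus>\<close> on the support of the delta functions, which leaves \<open>K\<^sub>i\<^sup>\<plusminus>\<close>.\<close>

unbundle no vec_syntax

section \<open>Exponentials of power series\<close>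

text \<open>The obstacle is that the series are infinite: a coefficient of a product is a
  \<open>Sum_any\<close>, which is 0 on infinite support, so every rearrangement must first be shown
  to be finite on the given vector. The energy operator supplies this, but only through a
  filtration, because \<open>q powr \<omega>\<close> does not determine \<omega>. Moreover a series
  in w/z may multiply products with z to the left of w and not those in the opposite order, so the
  terms of one relation live in different spaces of series. They meet because sandwiching between
  all E^- and all E^+ is linear and independent of the order of the factors; it is applied to the
  relation among the x as a whole. Put Y = q^(km), P = p^m and S = pstar^m, so that P = S Y^2. The
  scalar part then rests on the partial fraction (1 - P)/((1 - Y^2)(1 - S)) = 1/(1 - Y^2) + S/(1 -
  S) and its analogue for x^-: the pole in Y^2 accounts for the infinite products with base q^(2k),
  the other pole for the structure function.\<close>

definition pexp :: "(nat \<Rightarrow> complex) \<Rightarrow> complex fps" where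
  "pexp g = fps_compose (fps_exp 1) (Abs_fps (\<lambda>m. if m = 0 then 0 else g m))"

lemma pexp_nth_0 [simp]: "pexp g $ 0 = 1"
  by (simp add: pexp_def)

lemma fps_deriv_pexp: "fps_deriv (pexp g) = Abs_fps (\<lambda>n. of_nat (n + 1) * g (n + 1)) * pexp g"
proof -
  have "fps_deriv (Abs_fps (\<lambda>m. if m = 0 then 0 else g m)) = Abs_fps (\<lambda>n. of_nat (n + 1) * g (n + 1))"
    by (rule fps_ext) simp
  thus ?thesis unfolding pexp_def
    by (subst fps_compose_deriv) (simp_all add: mult.commute)
qed

text \<open>In characteristic zero F' = L F determines each coefficient of F from the lower ones.
  Identities between exponentials are therefore proved by comparing constant terms and logarithmic
  derivatives; no logarithm of a series is ever formed.\<close>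

lemma fps_eq_if_same_log_deriv:
  fixes F G L :: "complex fps"
  assumes "F $ 0 = G $ 0" "fps_deriv F = L * F" "fps_deriv G = L * G"
  shows "F = G"
proof (rule fps_ext)
  fix n show "F $ n = G $ n"
  proof (induction n rule: less_induct)
    case (less n)
    show ?case
    proof (cases n)
      case (Suc m)
      have "fps_deriv F $ m = fps_deriv G $ m"
        unfolding assms(2,3) fps_mult_nth using less Suc by (intro sum.cong) auto
      thus ?thesis using Suc by (auto simp: of_nat_neq_0 simp del: of_nat_Suc)
    qed (use assms in auto)
  qed
qed

lemma pexp_eqI:
  assumes "F $ 0 = 1" "fps_deriv F = Abs_fps (\<lambda>n. of_nat (n + 1) * g (n + 1)) * F"
  shows "F = pexp g"
  by (rule fps_eq_if_same_log_deriv[OF _ assms(2) fps_deriv_pexp]) (simp add: assms(1))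

text \<open>The term of the exponent at 0 is overwritten by 0, so formulas containing 1/m need to
  agree for positive m only.\<close>

lemma pexp_cong: "(\<And>m. m > 0 \<Longrightarrow> g m = h m) \<Longrightarrow> pexp g = pexp h"
proof -
  assume "\<And>m. m > 0 \<Longrightarrow> g m = h m"
  hence "(\<lambda>m. if m = 0 then 0 else g m) = (\<lambda>m. if m = 0 then 0 else h m)" by auto
  thus ?thesis by (simp only: pexp_def)
qed

lemma pexp_mult: "pexp g * pexp h = pexp (\<lambda>m. g m + h m)"
proof (rule pexp_eqI)
  have "Abs_fps (\<lambda>n. of_nat (n + 1) * (g (n + 1) + h (n + 1))) =
     Abs_fps (\<lambda>n. of_nat (n + 1) * g (n + 1)) + Abs_fps (\<lambda>n. of_nat (n + 1) * h (n + 1))"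
    by (rule fps_ext) (simp add: algebra_simps)
  thus "fps_deriv (pexp g * pexp h) =
     Abs_fps (\<lambda>n. of_nat (n + 1) * (g (n + 1) + h (n + 1))) * (pexp g * pexp h)"
    by (simp add: fps_deriv_pexp algebra_simps)
qed simp

lemma pexp_zero: "pexp (\<lambda>_. 0) = 1"
  by (rule pexp_eqI[symmetric]) (auto simp: fps_eq_iff fps_mult_nth)

lemma pexp_inverse: "inverse (pexp g) = pexp (\<lambda>m. - g m)"
  by (rule fps_inverse_unique) (simp add: pexp_mult pexp_zero)

lemma pexp_divide: "pexp g / pexp h = pexp (\<lambda>m. g m - h m)"
  by (simp add: fps_divide_unit pexp_inverse pexp_mult)

text \<open>Coefficients of u F' = (u g') F. This is the form in which
  \<open>exp_of_exchange\<close> asks for its scalar factor.\<close>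

lemma pexp_rec: "of_nat n * pexp g $ n = (\<Sum>m\<le>n. of_nat m * g m * pexp g $ (n - m))"
proof (cases n)
  case (Suc k)
  have "of_nat n * pexp g $ n = fps_deriv (pexp g) $ k" using Suc by simp
  also have "\<dots> = (\<Sum>m=0..k. of_nat (Suc m) * g (Suc m) * pexp g $ (n - Suc m))"
    unfolding fps_deriv_pexp fps_mult_nth using Suc by (intro sum.cong) auto
  also have "\<dots> = (\<Sum>m\<le>n. of_nat m * g m * pexp g $ (n - m))"
    unfolding Suc atMost_atLeast0 by (subst sum.atLeast0_atMost_Suc_shift) (simp del: of_nat_Suc)
  finally show ?thesis .
qed simp

text \<open>The exponent is the series of log (1 - x u). With it the linear factors of the quadratic
  relations join the comparison of exponents.\<close>

lemma pexp_linear: "pexp (\<lambda>m. - (x ^ m) / of_nat m) = 1 - fps_const x * fps_X"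
proof (rule pexp_eqI[symmetric], goal_cases)
  case 2
  have "Abs_fps (\<lambda>n. of_nat (n + 1) * (- (x ^ (n + 1)) / of_nat (n + 1))) = - (fps_const x) * Abs_fps (\<lambda>n. x ^ n)"
    by (rule fps_ext) (simp add: of_nat_neq_0 del: of_nat_Suc)
  moreover have "Abs_fps (\<lambda>n. x ^ n) * (1 - fps_const x * fps_X) = 1"
  proof (rule fps_ext)
    fix n show "(Abs_fps (\<lambda>n. x ^ n) * (1 - fps_const x * fps_X)) $ n = 1 $ n"
      by (cases n) (simp_all add: algebra_simps fps_mult_fps_X_deriv_shift)
  qed
  ultimately show ?case by (simp add: mult.assoc)
qed simp

text \<open>Substitution of c u for u, done coefficient by coefficient as in
  \<open>in_ratio\<close>. It moves the constant in the argument of \<open>in_ratio\<close> into the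
  series, so that afterwards only plain ratios of variables occur.\<close>

definition fps_dilate :: "complex \<Rightarrow> complex fps \<Rightarrow> complex fps" where
  "fps_dilate c F = Abs_fps (\<lambda>n. F $ n * c ^ n)"

lemma fps_dilate_nth [simp]: "fps_dilate c F $ n = F $ n * c ^ n"
  by (simp add: fps_dilate_def)

lemma fps_dilate_pexp: "fps_dilate c (pexp g) = pexp (\<lambda>m. c ^ m * g m)"
proof (rule pexp_eqI)
  show "fps_deriv (fps_dilate c (pexp g)) =
    Abs_fps (\<lambda>n. of_nat (n + 1) * (c ^ (n + 1) * g (n + 1))) * fps_dilate c (pexp g)"
  proof (rule fps_ext)
    fix n
    have "fps_deriv (fps_dilate c (pexp g)) $ n = fps_deriv (pexp g) $ n * c ^ (n + 1)"
      by (simp add: mult_ac)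
    also have "\<dots> = (Abs_fps (\<lambda>n. of_nat (n + 1) * (c ^ (n + 1) * g (n + 1))) * fps_dilate c (pexp g)) $ n"
      unfolding fps_deriv_pexp fps_mult_nth sum_distrib_right
    proof (intro sum.cong refl)
      fix i assume "i \<in> {0..n}"
      hence "c ^ (n + 1) = c ^ (i + 1) * c ^ (n - i)" by (simp add: power_add[symmetric])
      thus "Abs_fps (\<lambda>n. of_nat (n + 1) * g (n + 1)) $ i * pexp g $ (n - i) * c ^ (n + 1) =
        Abs_fps (\<lambda>n. of_nat (n + 1) * (c ^ (n + 1) * g (n + 1))) $ i * fps_dilate c (pexp g) $ (n - i)"
        by (auto simp: mult_ac)
    qed
    finally show "fps_deriv (fps_dilate c (pexp g)) $ n =
      (Abs_fps (\<lambda>n. of_nat (n + 1) * (c ^ (n + 1) * g (n + 1))) * fps_dilate c (pexp g)) $ n" .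
  qed
qed simp

lemma gser_eq_pexp: "gser D i j s = pexp (\<lambda>m. - (1 / of_nat m) *
    ((qq D powi (bb D i j * int m) - qq D powi (- bb D i j * int m)) / (1 - s ^ m)) * s ^ m)"
  unfolding gser_def pexp_def ..

section \<open>Infinite q-products as exponentials\<close>

lemma power_neq_1_if_norm_less:
  fixes s :: complex assumes "norm s < 1" "m > 0" shows "s ^ m \<noteq> 1"
  by (metis assms norm_one norm_power power_less_one_iff norm_ge_zero less_irrefl)

text \<open>Both sides have constant term 1 and satisfy F(u) = (1 - x u) F(s u), and this equation
  determines all coefficients because 1 - s^n is nonzero for n > 0. The analytic part of the proof
  serves to show that the Taylor series of the product inherits the equation.\<close>

lemma qpoch_eq_pexp:
  assumes "norm s < 1"
  shows "qpoch x s = pexp (\<lambda>m. - (x ^ m) / (of_nat m * (1 - s ^ m)))"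
proof -
  define f where "f = (\<lambda>u. prodinf (\<lambda>n. 1 - x * u * s ^ n))"
  have sm: "summable (\<lambda>n. norm (x * u * s ^ n))" for u
    using assms by (simp add: norm_mult norm_power summable_mult)
  have cv: "convergent_prod (\<lambda>n. 1 - x * u * s ^ n)" for u
    using sm[of u] by (intro abs_convergent_prod_imp_convergent_prod summable_imp_abs_convergent_prod) simp
  have pr: "prodinf (\<lambda>n. 1 - x * u * s ^ n) = lim (\<lambda>n. \<Prod>k<n. 1 - x * u * s ^ k)" for u
    using convergent_prod_LIMSEQ[OF cv[of u]]
    by (intro limI[symmetric]) (subst LIMSEQ_lessThan_iff_atMost[where f = "prod _"])
  have hol: "f holomorphic_on ball 0 1"
  proof (rule holomorphic_uniform_sequence[OF open_ball])
    show "(\<lambda>u. \<Prod>i<n. 1 - x * u * s ^ i) holomorphic_on ball 0 1" for n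
      by (intro holomorphic_intros)
    fix y :: complex assume "y \<in> ball 0 1"
    then obtain d where d: "d > 0" "cball y d \<subseteq> ball 0 1" by (meson open_ball open_contains_cball)
    \<comment> \<open>Weierstrass test on a disc inside the unit disc, with the summable majorant |x
      s^n|.\<close>
    have "uniformly_convergent_on (cball y d) (\<lambda>N u. \<Prod>n<N. 1 - x * u * s ^ n)"
    proof (rule uniformly_convergent_on_prod')
      show "uniformly_convergent_on (cball y d) (\<lambda>N u. \<Sum>n<N. norm (1 - x * u * s ^ n - 1))"
      proof (rule Weierstrass_m_test')
        fix n u assume "u \<in> cball y d"
        hence "norm u \<le> 1" using d by fastforce
        thus "norm (norm (1 - x * u * s ^ n - 1)) \<le> norm (x * 1 * s ^ n)"
          by (simp add: norm_mult mult_left_le mult_right_mono)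
      qed (rule sm)
    qed (auto intro!: continuous_intros)
    hence "uniform_limit (cball y d) (\<lambda>n u. \<Prod>i<n. 1 - x * u * s ^ i) f sequentially"
      unfolding f_def pr uniformly_convergent_uniform_limit_iff .
    with d show "\<exists>d>0. cball y d \<subseteq> ball 0 1 \<and> uniform_limit (cball y d) (\<lambda>n u. \<Prod>i<n. 1 - x * u * s ^ i) f sequentially"
      by blast
  qed
  define F where "F = qpoch x s"
  have F: "f has_fps_expansion F"
    unfolding F_def qpoch_def f_def[symmetric]
    by (rule has_fps_expansion_fps_expansion[of "ball 0 1"]) (use hol in auto)
  \<comment> \<open>Splitting off the factor with n = 0 leaves the product at s u. The side
    condition holds near 0, which is all the expansion sees.\<close>
  have split: "f u = (1 - x * u) * f (s * u)" if "1 - x * u \<noteq> 0" for u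
    using prodinf_split_head[OF cv[of u]] that unfolding f_def by (simp add: mult_ac)
  have "\<forall>\<^sub>F u in nhds 0. 1 - x * u \<noteq> 0"
  proof -
    have "open {u. 1 - x * u \<noteq> 0}" by (intro open_Collect_neq continuous_intros)
    from eventually_nhds_in_open[OF this, of 0] show ?thesis by simp
  qed
  hence ev: "\<forall>\<^sub>F u in nhds 0. f u = (1 - x * u) * f (s * u)"
    by eventually_elim (rule split)
  have "(f \<circ> (\<lambda>u. s * u)) has_fps_expansion (F oo (fps_const s * fps_X))"
    by (rule has_fps_expansion_compose[OF F]) (auto intro!: fps_expansion_intros)
  hence "(\<lambda>u. (1 - x * u) * f (s * u)) has_fps_expansion (1 - fps_const x * fps_X) * (F oo (fps_const s * fps_X))"
    unfolding o_def by (intro fps_expansion_intros)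
  hence "f has_fps_expansion (1 - fps_const x * fps_X) * (F oo (fps_const s * fps_X))"
    using ev by (subst has_fps_expansion_cong[OF _ refl]) auto
  hence "F = (1 - fps_const x * fps_X) * (F oo (fps_const s * fps_X))"
    using F fps_expansion_unique_complex by blast
  moreover have "F oo (fps_const s * fps_X) = fps_dilate s F"
    unfolding fps_compose_linear by (rule fps_ext) (simp add: mult.commute)
  ultimately have Feq: "F = (1 - fps_const x * fps_X) * fps_dilate s F" by simp
  define g where "g = (\<lambda>m. - (x ^ m) / (of_nat m * (1 - s ^ m)))"
  have Geq: "pexp g = (1 - fps_const x * fps_X) * fps_dilate s (pexp g)"
    unfolding pexp_linear[symmetric] fps_dilate_pexp pexp_mult
  proof (rule pexp_cong)
    fix m :: nat assume "m > 0"
    with power_neq_1_if_norm_less[OF assms, of m] show "g m = - (x ^ m) / of_nat m + s ^ m * g m"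
      by (simp add: g_def field_simps)
  qed
  \<comment> \<open>The functional equation read at u^(n+1): a recursion with leading factor 1 -
    s^(n+1).\<close>
  have rec: "H $ Suc n * (1 - s ^ Suc n) = - x * (H $ n * s ^ n)"
    if "H = (1 - fps_const x * fps_X) * fps_dilate s H" for H n
  proof -
    have "H $ Suc n = ((1 - fps_const x * fps_X) * fps_dilate s H) $ Suc n"
      using that by simp
    also have "\<dots> = H $ Suc n * s ^ Suc n - x * (H $ n * s ^ n)"
      by (simp add: left_diff_distrib mult.assoc)
    finally show ?thesis by (simp add: algebra_simps)
  qed
  have "F $ n = pexp g $ n" for n
  proof (induction n)
    case 0
    have "f 0 = F $ 0" using F has_fps_expansion_imp_0_eq_fps_nth_0 by blast
    thus ?case by (simp add: f_def)
  next
    case (Suc n)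
    have "F $ Suc n * (1 - s ^ Suc n) = pexp g $ Suc n * (1 - s ^ Suc n)"
      unfolding rec[OF Feq] rec[OF Geq] Suc ..
    moreover have "1 - s ^ Suc n \<noteq> 0" using power_neq_1_if_norm_less[OF assms, of "Suc n"] by simp
    ultimately show ?case by simp
  qed
  thus ?thesis by (simp add: fps_eq_iff F_def g_def)
qed

section \<open>Operators on a filtered space\<close>

lemma sum_triangle_swap:
  fixes f :: "nat \<Rightarrow> nat \<Rightarrow> 'a::comm_monoid_add"
  shows "(\<Sum>m\<le>n. \<Sum>s\<le>n - m. f m s) = (\<Sum>s\<le>n. \<Sum>m\<le>n - s. f m s)"
proof -
  have "(\<Sum>m\<le>n. \<Sum>s\<le>n - m. f m s) = (\<Sum>m\<le>n. \<Sum>s | s \<in> {..n} \<and> m + s \<le> n. f m s)"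
    by (intro sum.cong refl) auto
  also have "\<dots> = (\<Sum>s\<le>n. \<Sum>m | m \<in> {..n} \<and> m + s \<le> n. f m s)"
    by (rule sum.swap_restrict) auto
  also have "\<dots> = (\<Sum>s\<le>n. \<Sum>m\<le>n - s. f m s)"
    by (intro sum.cong refl) auto
  finally show ?thesis .
qed

lemma sum_triangle_flip:
  fixes f :: "nat \<Rightarrow> nat \<Rightarrow> 'a::comm_monoid_add"
  shows "(\<Sum>r\<le>n. \<Sum>s\<le>r. f s (r - s)) = (\<Sum>s\<le>n. \<Sum>r\<le>n - s. f s r)"
proof -
  have "(\<Sum>r\<le>n. \<Sum>s\<le>r. f s (r - s)) = (\<Sum>r\<le>n. \<Sum>s | s \<in> {..n} \<and> s \<le> r. f s (r - s))"
    by (intro sum.cong refl) auto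
  also have "\<dots> = (\<Sum>s\<le>n. \<Sum>r | r \<in> {..n} \<and> s \<le> r. f s (r - s))"
    by (rule sum.swap_restrict) auto
  also have "\<dots> = (\<Sum>s\<le>n. \<Sum>r\<le>n - s. f s r)"
  proof (rule sum.cong[OF refl])
    fix s assume "s \<in> {..n}"
    hence "{r \<in> {..n}. s \<le> r} = (\<lambda>r. r + s) ` {..n - s}"
    proof (intro equalityI subsetI)
      fix r assume "r \<in> {r \<in> {..n}. s \<le> r}"
      thus "r \<in> (\<lambda>r. r + s) ` {..n - s}" by (intro image_eqI[of _ _ "r - s"]) auto
    qed auto
    thus "(\<Sum>r | r \<in> {..n} \<and> s \<le> r. f s (r - s)) = (\<Sum>r\<le>n - s. f s r)"
      by (simp add: sum.reindex)
  qed
  finally show ?thesis .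
qed

text \<open>Every vector lies in some \<open>W N\<close>, and an operator lowering the filtration by more than \<open>N\<close> kills \<open>W N\<close>. This
  is what makes all series of annihilation modes finite on each vector.\<close>

locale filtered_space = vector_space sc for sc :: "complex \<Rightarrow> 'v::ab_group_add \<Rightarrow> 'v" +
  fixes W :: "int \<Rightarrow> 'v set"
  assumes W_subspace: "subspace (W N)"
    and W_mono: "M \<le> N \<Longrightarrow> W M \<subseteq> W N"
    and W_neg: "N < 0 \<Longrightarrow> W N = {0}"
    and W_exhaust: "\<exists>N. v \<in> W N"
begin

section \<open>Linear and filtered operators\<close>

definition lin :: "'v op \<Rightarrow> bool" where
  "lin f \<longleftrightarrow> (\<forall>x y. f (x + y) = f x + f y) \<and> (\<forall>c x. f (sc c x) = sc c (f x))"

lemma linD: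
  assumes "lin f"
  shows "f (x + y) = f x + f y" "f (sc c x) = sc c (f x)" "f 0 = 0" "f (- x) = - f x" "f (x - y) = f x - f y"
    and lin_sum: "f (sum g A) = (\<Sum>a\<in>A. f (g a))"
proof -
  show add: "f (x + y) = f x + f y" for x y
    using assms by (auto simp: lin_def)
  show sc: "f (sc c x) = sc c (f x)" for c x
    using assms by (auto simp: lin_def)
  show z: "f 0 = 0" using sc[of 0 0] by simp
  show m: "f (- x) = - f x" for x using sc[of "-1" x] by (simp add: scale_minus_left)
  show "f (x - y) = f x - f y" using add[of x "- y"] m by simp
  show "f (sum g A) = (\<Sum>a\<in>A. f (g a))"
    by (induction A rule: infinite_finite_induct) (auto simp: z add)
qed

lemma lin_id: "lin (\<lambda>v. v)" and lin_zero: "lin (\<lambda>v. 0)"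
  and lin_comp: "lin f \<Longrightarrow> lin g \<Longrightarrow> lin (\<lambda>v. f (g v))"
  and lin_add: "lin f \<Longrightarrow> lin g \<Longrightarrow> lin (\<lambda>v. f v + g v)"
  and lin_scale: "lin f \<Longrightarrow> lin (\<lambda>v. sc c (f v))"
  by (auto simp: lin_def scale_right_distrib mult.commute algebra_simps)

lemma lin_Sum_any:
  assumes "lin f" "finite {a. g a \<noteq> 0}"
  shows "f (Sum_any g) = Sum_any (\<lambda>a. f (g a))"
proof -
  have "Sum_any (\<lambda>a. f (g a)) = (\<Sum>a | g a \<noteq> 0. f (g a))"
    using assms by (intro Sum_any.expand_superset) (auto simp: linD)
  thus ?thesis using assms by (simp add: Sum_any.expand_set linD lin_sum)
qed

text \<open>Only an upper bound on the level is recorded. In the application \<open>W N\<close>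
  collects vectors at most N steps below the top of the spectrum; negative degree means motion
  towards the top, beyond which \<open>W_neg\<close> leaves nothing.\<close>

definition graded :: "int \<Rightarrow> 'v op \<Rightarrow> bool" where
  "graded d f \<longleftrightarrow> lin f \<and> (\<forall>N v. v \<in> W N \<longrightarrow> f v \<in> W (N + d))"

lemma gradedD: "graded d f \<Longrightarrow> lin f" "graded d f \<Longrightarrow> v \<in> W N \<Longrightarrow> f v \<in> W (N + d)"
  by (auto simp: graded_def)

lemma graded_zero_vec: "graded d f \<Longrightarrow> v \<in> W N \<Longrightarrow> N + d < 0 \<Longrightarrow> f v = 0"
  using gradedD(2) W_neg by blast

lemma graded_id: "graded 0 (\<lambda>v. v)" and graded_0: "graded d (\<lambda>v. 0)"
  and graded_comp: "graded d f \<Longrightarrow> graded d' g \<Longrightarrow> graded (d + d') (\<lambda>v. f (g v))"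
  and graded_add: "graded d f \<Longrightarrow> graded d f' \<Longrightarrow> graded d (\<lambda>v. f v + f' v)"
  and graded_scale: "graded d f \<Longrightarrow> graded d (\<lambda>v. sc c (f v))"
  using W_subspace
  by (auto simp: graded_def lin_id lin_zero lin_comp lin_add lin_scale subspace_def algebra_simps)
     (metis add.assoc add.commute)

lemma graded_sum: "(\<And>a. a \<in> A \<Longrightarrow> graded d (f a)) \<Longrightarrow> graded d (\<lambda>v. \<Sum>a\<in>A. f a v)"
  by (induction A rule: infinite_finite_induct) (auto intro: graded_0 graded_add)

text \<open>The coefficients of \<open>u E'(u) = u A'(u) E(u)\<close>, which determine \<open>E(u) = exp A(u)\<close> when the \<open>A m\<close> commute with each
  other. All properties of \<^const>\<open>op_exp\<close> are derived from this recursion.\<close>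

definition exp_of :: "(nat \<Rightarrow> 'v op) \<Rightarrow> (nat \<Rightarrow> 'v op) \<Rightarrow> bool" where
  "exp_of A E \<longleftrightarrow> (\<forall>v. E 0 v = v) \<and>
     (\<forall>n v. sc (of_nat n) (E n v) = (\<Sum>m\<le>n. sc (of_nat m) (A m (E (n - m) v))))"

section \<open>Exponentials of operator series\<close>

lemma exp_ofD:
  assumes "exp_of A E"
  shows "E 0 v = v" "sc (of_nat n) (E n v) = (\<Sum>m\<le>n. sc (of_nat m) (A m (E (n - m) v)))"
  using assms by (auto simp: exp_of_def)

lemma op_pow_eq_0: "(\<And>m. m > 0 \<Longrightarrow> lin (A m)) \<Longrightarrow> r > n \<Longrightarrow> op_pow A r n v = 0"
proof (induction r arbitrary: n)
  case (Suc r)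
  have "A m (op_pow A r (n - m) v) = 0" if "m \<in> {1..n}" for m
    using Suc that by (subst Suc.IH) (auto intro: linD)
  thus ?case by simp
qed simp

text \<open>Coefficientwise form of u (A^r)' = r (u A') A^(r-1); collecting the r equal terms is
  where commutativity of the coefficients enters.\<close>

lemma op_pow_rec:
  assumes lin: "\<And>m. m > 0 \<Longrightarrow> lin (A m)"
    and comm: "\<And>m s v. m > 0 \<Longrightarrow> s > 0 \<Longrightarrow> A m (A s v) = A s (A m v)"
  shows "sc (of_nat n) (op_pow A r n v) =
    sc (of_nat r) (\<Sum>m\<le>n. sc (of_nat m) (A m (op_pow A (r - 1) (n - m) v)))"
proof (induction r arbitrary: n)
  case (Suc r)
  define T where "T = (\<Sum>m\<le>n. sc (of_nat m) (A m (op_pow A r (n - m) v)))"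
  have T: "T = (\<Sum>m=1..n. sc (of_nat m) (A m (op_pow A r (n - m) v)))"
    unfolding T_def by (rule sum.mono_neutral_right) auto
  \<comment> \<open>Leibniz rule: the weight n is split as m + (n - m), with m for the new factor
    and n - m for the remaining power.\<close>
  have "sc (of_nat n) (op_pow A (Suc r) n v) =
      (\<Sum>m=1..n. sc (of_nat m) (A m (op_pow A r (n - m) v)) + A m (sc (of_nat (n - m)) (op_pow A r (n - m) v)))"
    by (auto simp: scale_sum_right linD[OF lin] of_nat_diff scale_left_diff_distrib intro!: sum.cong)
  also have "\<dots> = T + (\<Sum>m=1..n. A m (sc (of_nat (n - m)) (op_pow A r (n - m) v)))"
    by (simp add: sum.distrib T)
  also have "(\<Sum>m=1..n. A m (sc (of_nat (n - m)) (op_pow A r (n - m) v))) =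
      (\<Sum>m=1..n. \<Sum>s\<le>n - m. sc (of_nat r) (sc (of_nat s) (A s (A m (op_pow A (r - 1) (n - m - s) v)))))"
  proof (rule sum.cong[OF refl])
    fix m assume m: "m \<in> {1..n}"
    have "A m (sc (of_nat (n - m)) (op_pow A r (n - m) v)) =
      (\<Sum>s\<le>n - m. sc (of_nat r) (sc (of_nat s) (A m (A s (op_pow A (r - 1) (n - m - s) v)))))"
      using m by (subst Suc.IH) (simp add: linD[OF lin] lin_sum[OF lin] scale_sum_right)
    also have "\<dots> = (\<Sum>s\<le>n - m. sc (of_nat r) (sc (of_nat s) (A s (A m (op_pow A (r - 1) (n - m - s) v)))))"
      using m by (intro sum.cong refl) (metis comm gr0I atLeastAtMost_iff le_zero_eq not_one_le_zero of_nat_0 scale_zero_left)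
    finally show "A m (sc (of_nat (n - m)) (op_pow A r (n - m) v)) = \<dots>" .
  qed
  also have "\<dots> = (\<Sum>m\<in>{..n} - {0}. \<Sum>s | s \<in> {..n} \<and> m + s \<le> n. sc (of_nat r) (sc (of_nat s) (A s (A m (op_pow A (r - 1) (n - m - s) v)))))"
    by (intro sum.cong) auto
  also have "\<dots> = (\<Sum>s\<le>n. \<Sum>m | m \<in> {..n} - {0} \<and> m + s \<le> n. sc (of_nat r) (sc (of_nat s) (A s (A m (op_pow A (r - 1) (n - m - s) v)))))"
    by (rule sum.swap_restrict) auto
  also have "\<dots> = (\<Sum>s\<le>n. \<Sum>m=1..n - s. sc (of_nat r) (sc (of_nat s) (A s (A m (op_pow A (r - 1) (n - s - m) v)))))"
    by (intro sum.cong refl) (auto simp: algebra_simps)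
  also have "\<dots> = sc (of_nat r) T"
    unfolding T_def scale_sum_right
  proof (rule sum.cong[OF refl])
    fix s assume s: "s \<in> {..n}"
    show "(\<Sum>m=1..n - s. sc (of_nat r) (sc (of_nat s) (A s (A m (op_pow A (r - 1) (n - s - m) v))))) =
      sc (of_nat r) (sc (of_nat s) (A s (op_pow A r (n - s) v)))"
    proof (cases "r = 0 \<or> s = 0")
      case False
      then obtain r' where "r = Suc r'" using not0_implies_Suc by auto
      with False show ?thesis
        by (simp add: lin_sum[OF lin] scale_sum_right)
    qed auto
  qed
  finally show ?case by (simp add: T_def scale_left_distrib)
qed simp

text \<open>This is \<open>op_pow_rec\<close> summed over r with weights 1/r!, using r/r! =
  1/(r-1)!. The truncation at r \<le> n in \<open>op_exp\<close> loses nothing, since the exponent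
  starts in degree 1.\<close>

lemma exp_of_op_exp:
  assumes lin: "\<And>m. m > 0 \<Longrightarrow> lin (A m)"
    and comm: "\<And>m s v. m > 0 \<Longrightarrow> s > 0 \<Longrightarrow> A m (A s v) = A s (A m v)"
  shows "exp_of A (op_exp sc A)"
  unfolding exp_of_def
proof (intro conjI allI)
  fix n v
  have "sc (of_nat n) (op_exp sc A n v) = (\<Sum>r\<le>n. sc (1 / fact r) (sc (of_nat n) (op_pow A r n v)))"
    by (simp add: op_exp_def scale_sum_right mult.commute)
  also have "\<dots> = (\<Sum>r\<le>n. sc (of_nat r / fact r) (\<Sum>m\<le>n. sc (of_nat m) (A m (op_pow A (r - 1) (n - m) v))))"
    by (subst op_pow_rec[OF assms]) auto
  also have "\<dots> = (\<Sum>r\<in>Suc ` {..<n}. sc (of_nat r / fact r) (\<Sum>m\<le>n. sc (of_nat m) (A m (op_pow A (r - 1) (n - m) v))))"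
  proof (rule sum.mono_neutral_right)
    show "\<forall>r\<in>{..n} - Suc ` {..<n}. sc (of_nat r / fact r) (\<Sum>m\<le>n. sc (of_nat m) (A m (op_pow A (r - 1) (n - m) v))) = 0"
    proof
      fix r assume "r \<in> {..n} - Suc ` {..<n}"
      hence "r = 0" by (cases r) auto
      thus "sc (of_nat r / fact r) (\<Sum>m\<le>n. sc (of_nat m) (A m (op_pow A (r - 1) (n - m) v))) = 0" by simp
    qed
  qed auto
  also have "\<dots> = (\<Sum>r<n. sc (1 / fact r) (\<Sum>m\<le>n. sc (of_nat m) (A m (op_pow A r (n - m) v))))"
    by (subst sum.reindex) (auto simp: fact_Suc of_nat_neq_0 simp del: of_nat_Suc)
  also have "\<dots> = (\<Sum>m\<le>n. \<Sum>r<n. sc (of_nat m) (sc (1 / fact r) (A m (op_pow A r (n - m) v))))"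
    by (subst sum.swap) (simp add: scale_sum_right mult.commute)
  also have "\<dots> = (\<Sum>m\<le>n. sc (of_nat m) (A m (op_exp sc A (n - m) v)))"
  proof (rule sum.cong[OF refl])
    fix m assume m: "m \<in> {..n}"
    show "(\<Sum>r<n. sc (of_nat m) (sc (1 / fact r) (A m (op_pow A r (n - m) v)))) = sc (of_nat m) (A m (op_exp sc A (n - m) v))"
    proof (cases "m = 0")
      case False
      \<comment> \<open>For m > 0 the bound r < n may be lowered to r \<le> n - m: a power of A
        higher than the degree has zero coefficient.\<close>
      have "(\<Sum>r<n. sc (of_nat m) (sc (1 / fact r) (A m (op_pow A r (n - m) v)))) =
        (\<Sum>r\<le>n - m. sc (of_nat m) (sc (1 / fact r) (A m (op_pow A r (n - m) v))))"
        using False m by (intro sum.mono_neutral_right) (auto simp: op_pow_eq_0[OF lin] linD[OF lin])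
      thus ?thesis using False by (simp add: op_exp_def scale_sum_right lin_sum[OF lin] linD[OF lin])
    qed simp
  qed
  finally show "sc (of_nat n) (op_exp sc A n v) = (\<Sum>m\<le>n. sc (of_nat m) (A m (op_exp sc A (n - m) v)))" .
qed (simp add: op_exp_def)

lemma exp_of_unique:
  assumes "exp_of A E" "exp_of A' E'" "\<And>m v. m > 0 \<Longrightarrow> A m v = A' m v"
  shows "E n v = E' n v"
proof (induction n rule: less_induct)
  case (less n)
  show ?case
  proof (cases "n = 0")
    case False
    have "sc (of_nat m) (A m (E (n - m) v)) = sc (of_nat m) (A' m (E' (n - m) v))" if "m \<le> n" for m
      using that assms(3)[of m] less[of "n - m"] by (cases "m = 0") auto
    hence "sc (of_nat n) (E n v) = sc (of_nat n) (E' n v)"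
      unfolding exp_ofD(2)[OF assms(1)] exp_ofD(2)[OF assms(2)] by (intro sum.cong) auto
    thus ?thesis using False by simp
  qed (simp add: exp_ofD(1)[OF assms(1)] exp_ofD(1)[OF assms(2)])
qed

lemma exp_of_graded:
  assumes "exp_of A E" "\<And>m. m > 0 \<Longrightarrow> graded (d * int m) (A m)"
  shows "graded (d * int n) (E n)"
proof (induction n rule: less_induct)
  case (less n)
  show ?case
  proof (cases "n = 0")
    case True
    have "E 0 = (\<lambda>v. v)" using exp_ofD(1)[OF assms(1)] by auto
    thus ?thesis using True graded_id by simp
  next
    case False
    have "graded (d * int n) (\<lambda>v. sc (of_nat m) (A m (E (n - m) v)))" if "m \<le> n" for m
    proof (cases "m = 0")
      case False
      hence "graded (d * int m + d * int (n - m)) (\<lambda>v. A m (E (n - m) v))"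
        using that less[of "n - m"] assms(2)[of m] by (intro graded_comp) auto
      thus ?thesis using that by (intro graded_scale) (simp add: of_nat_diff algebra_simps)
    qed (simp add: graded_0)
    hence "graded (d * int n) (\<lambda>v. sc (1 / of_nat n) (\<Sum>m\<le>n. sc (of_nat m) (A m (E (n - m) v))))"
      by (rule graded_scale[OF graded_sum]) auto
    thus ?thesis using False by (simp add: exp_ofD(2)[OF assms(1), symmetric])
  qed
qed

lemma exp_of_commute:
  assumes "exp_of A E" "lin B" "\<And>m v. m > 0 \<Longrightarrow> A m (B v) = B (A m v)"
  shows "E n (B v) = B (E n v)"
proof (induction n rule: less_induct)
  case (less n)
  show ?case
  proof (cases "n = 0")
    case False
    have "sc (of_nat m) (A m (E (n - m) (B v))) = sc (of_nat m) (B (A m (E (n - m) v)))" if "m \<le> n" for m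
      using that assms(3)[of m] less[of "n - m"] by (cases "m = 0") auto
    hence "sc (of_nat n) (E n (B v)) = (\<Sum>m\<le>n. sc (of_nat m) (B (A m (E (n - m) v))))"
      unfolding exp_ofD(2)[OF assms(1)] by (intro sum.cong) auto
    also have "\<dots> = B (sc (of_nat n) (E n v))"
      unfolding exp_ofD(2)[OF assms(1)] by (simp add: lin_sum[OF assms(2)] linD[OF assms(2)])
    also have "\<dots> = sc (of_nat n) (B (E n v))" by (simp add: linD[OF assms(2)])
    finally show ?thesis using False by simp
  qed (simp add: exp_ofD(1)[OF assms(1)])
qed

lemma exp_of_zero: "exp_of (\<lambda>m v. 0) (\<lambda>n v. if n = 0 then v else 0)"
  by (auto simp: exp_of_def)

lemma exp_of_rescale:
  assumes "exp_of A E" "\<And>m. m > 0 \<Longrightarrow> lin (A m)"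
  shows "exp_of (\<lambda>m v. sc (c ^ m) (A m v)) (\<lambda>m v. sc (c ^ m) (E m v))"
  unfolding exp_of_def
proof (intro conjI allI)
  fix n v
  have "sc (of_nat m) (sc (c ^ m) (A m (sc (c ^ (n - m)) (E (n - m) v)))) =
    sc (c ^ n) (sc (of_nat m) (A m (E (n - m) v)))" if "m \<le> n" for m
  proof (cases "m = 0")
    case False
    have "c ^ n = c ^ m * c ^ (n - m)" using that by (simp add: power_add[symmetric])
    thus ?thesis using False by (simp add: linD[OF assms(2)] mult_ac)
  qed simp
  hence "(\<Sum>m\<le>n. sc (of_nat m) (sc (c ^ m) (A m (sc (c ^ (n - m)) (E (n - m) v))))) =
    sc (c ^ n) (\<Sum>m\<le>n. sc (of_nat m) (A m (E (n - m) v)))"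
    unfolding scale_sum_right by (intro sum.cong) auto
  thus "sc (of_nat n) (sc (c ^ n) (E n v)) =
    (\<Sum>m\<le>n. sc (of_nat m) (sc (c ^ m) (A m (sc (c ^ (n - m)) (E (n - m) v)))))"
    unfolding exp_ofD(2)[OF assms(1), symmetric] by (simp add: mult.commute)
qed (simp add: exp_ofD(1)[OF assms(1)])

text \<open>Leibniz rule for the product. Since E commutes with the coefficients of A', the latter
  can be pulled out to the left.\<close>

lemma exp_of_mult:
  assumes E: "exp_of A E" and E': "exp_of A' E'" and lin: "\<And>m. m > 0 \<Longrightarrow> lin (A m)" "\<And>n. lin (E n)"
    and comm: "\<And>n m v. m > 0 \<Longrightarrow> E n (A' m v) = A' m (E n v)" and lin': "\<And>m. m > 0 \<Longrightarrow> lin (A' m)"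
  shows "exp_of (\<lambda>m v. A m v + A' m v) (\<lambda>n v. \<Sum>r\<le>n. E r (E' (n - r) v))"
  unfolding exp_of_def
proof (intro conjI allI)
  fix n v
  define R where "R n = (\<Sum>r\<le>n. E r (E' (n - r) v))" for n
  have "sc (of_nat n) (R n) = (\<Sum>r\<le>n. sc (of_nat r) (E r (E' (n - r) v)) + E r (sc (of_nat (n - r)) (E' (n - r) v)))"
    unfolding R_def scale_sum_right
    by (intro sum.cong refl) (auto simp: linD[OF lin(2)] scale_left_distrib[symmetric] of_nat_add[symmetric] simp del: of_nat_add)
  also have "\<dots> = (\<Sum>r\<le>n. \<Sum>m\<le>r. sc (of_nat m) (A m (E (r - m) (E' (n - r) v)))) +
      (\<Sum>r\<le>n. \<Sum>m\<le>n - r. sc (of_nat m) (A' m (E r (E' (n - r - m) v))))"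
  proof -
    have *: "E r (sc (of_nat m) (A' m x)) = sc (of_nat m) (A' m (E r x))" for r m x
      by (cases "m = 0") (simp_all add: linD[OF lin(2)] comm)
    show ?thesis
      unfolding sum.distrib exp_ofD(2)[OF E] exp_ofD(2)[OF E'] lin_sum[OF lin(2)] * ..
  qed
  also have "(\<Sum>r\<le>n. \<Sum>m\<le>r. sc (of_nat m) (A m (E (r - m) (E' (n - r) v)))) =
      (\<Sum>r\<le>n. \<Sum>m\<le>r. sc (of_nat m) (A m (E (r - m) (E' (n - (m + (r - m))) v))))"
    by (intro sum.cong) auto
  also have "\<dots> = (\<Sum>m\<le>n. \<Sum>r\<le>n - m. sc (of_nat m) (A m (E r (E' (n - (m + r)) v))))"
    by (rule sum_triangle_flip)
  also have "\<dots> = (\<Sum>m\<le>n. sc (of_nat m) (A m (R (n - m))))"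
  proof (rule sum.cong[OF refl])
    fix m show "(\<Sum>r\<le>n - m. sc (of_nat m) (A m (E r (E' (n - (m + r)) v)))) = sc (of_nat m) (A m (R (n - m)))"
      by (cases "m = 0") (simp_all add: R_def lin_sum[OF lin(1)] scale_sum_right)
  qed
  also have "(\<Sum>r\<le>n. \<Sum>m\<le>n - r. sc (of_nat m) (A' m (E r (E' (n - r - m) v)))) =
    (\<Sum>m\<le>n. \<Sum>r\<le>n - m. sc (of_nat m) (A' m (E r (E' (n - r - m) v))))"
    by (rule sum_triangle_swap)
  also have "\<dots> = (\<Sum>m\<le>n. sc (of_nat m) (A' m (R (n - m))))"
  proof (rule sum.cong[OF refl])
    fix m show "(\<Sum>r\<le>n - m. sc (of_nat m) (A' m (E r (E' (n - r - m) v)))) = sc (of_nat m) (A' m (R (n - m)))"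
      by (cases "m = 0") (simp_all add: R_def lin_sum[OF lin'] scale_sum_right add_ac)
  qed
  finally show "sc (of_nat n) (\<Sum>r\<le>n. E r (E' (n - r) v)) = (\<Sum>m\<le>n. sc (of_nat m)
      (A m (\<Sum>r\<le>n - m. E r (E' (n - m - r) v)) + A' m (\<Sum>r\<le>n - m. E r (E' (n - m - r) v))))"
    by (simp add: R_def sum.distrib scale_right_distrib)
qed (simp add: exp_ofD(1)[OF E] exp_ofD(1)[OF E'])

text \<open>The commutator says that ad A multiplies X by a scalar series, so moving X past exp A
  costs the exponential h of minus that series. Both h and E enter through their recursions, which
  are matched degree by degree; n is kept arbitrary in the induction because the commutator shifts
  it.\<close>

lemma exp_of_exchange:
  fixes h :: "complex fps"
  assumes E: "exp_of A E" and lin: "\<And>m. m > 0 \<Longrightarrow> lin (A m)" "\<And>n. lin (X n)"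
    and com: "\<And>m n v. m > 0 \<Longrightarrow> A m (X n v) - X n (A m v) = sc (g m) (X (n + int m) v)"
    and h: "fps_nth h 0 = 1" "\<And>n. of_nat n * fps_nth h n = (\<Sum>m\<le>n. of_nat m * (- g m) * fps_nth h (n - m))"
  shows "X n (E m v) = (\<Sum>r\<le>m. sc (fps_nth h r) (E (m - r) (X (n + int r) v)))"
proof (induction m arbitrary: n rule: less_induct)
  case (less p)
  define R where "R m n = (\<Sum>r\<le>m. sc (fps_nth h r) (E (m - r) (X (n + int r) v)))" for m n
  have IH: "X n (E m v) = R m n" if "m < p" for m n
    using less[OF that] by (simp add: R_def)
  show ?case
  proof (cases "p = 0")
    case False
    have "sc (of_nat p) (R p n) = (\<Sum>r\<le>p. sc (of_nat r * fps_nth h r) (E (p - r) (X (n + int r) v)) +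
        sc (fps_nth h r) (sc (of_nat (p - r)) (E (p - r) (X (n + int r) v))))"
      unfolding R_def scale_sum_right
    proof (rule sum.cong[OF refl])
      fix r assume "r \<in> {..p}"
      hence *: "(of_nat p :: complex) = of_nat r + of_nat (p - r)" by simp
      show "sc (of_nat p) (sc (fps_nth h r) (E (p - r) (X (n + int r) v))) =
        sc (of_nat r * fps_nth h r) (E (p - r) (X (n + int r) v)) +
        sc (fps_nth h r) (sc (of_nat (p - r)) (E (p - r) (X (n + int r) v)))"
        by (subst *) (simp only: distrib_right distrib_left scale_left_distrib scale_scale mult.commute)
    qed
    also have "\<dots> = (\<Sum>r\<le>p. \<Sum>m\<le>r. sc (of_nat m * (- g m) * fps_nth h (r - m)) (E (p - (m + (r - m))) (X (n + int (m + (r - m))) v))) +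
       (\<Sum>r\<le>p. \<Sum>m\<le>p - r. sc (fps_nth h r) (sc (of_nat m) (A m (E (p - r - m) (X (n + int r) v)))))"
    proof -
      have 1: "sc (of_nat r * fps_nth h r) (E (p - r) (X (n + int r) v)) =
        (\<Sum>m\<le>r. sc (of_nat m * (- g m) * fps_nth h (r - m)) (E (p - (m + (r - m))) (X (n + int (m + (r - m))) v)))" for r
        unfolding h(2) scale_sum_left by (intro sum.cong) auto
      have 2: "sc (fps_nth h r) (sc (of_nat (p - r)) (E (p - r) (X (n + int r) v))) =
        (\<Sum>m\<le>p - r. sc (fps_nth h r) (sc (of_nat m) (A m (E (p - r - m) (X (n + int r) v)))))" for r
        unfolding exp_ofD(2)[OF E] scale_sum_right ..
      show ?thesis unfolding sum.distrib 1 2 ..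
    qed
    also have "(\<Sum>r\<le>p. \<Sum>m\<le>r. sc (of_nat m * (- g m) * fps_nth h (r - m)) (E (p - (m + (r - m))) (X (n + int (m + (r - m))) v))) =
       (\<Sum>m\<le>p. \<Sum>r\<le>p - m. sc (of_nat m * (- g m) * fps_nth h r) (E (p - (m + r)) (X (n + int (m + r)) v)))"
      by (rule sum_triangle_flip)
    also have "\<dots> = (\<Sum>m\<le>p. sc (of_nat m) (- sc (g m) (R (p - m) (n + int m))))"
      by (intro sum.cong refl) (simp add: R_def scale_sum_right sum_negf[symmetric] mult_ac add_ac)
    also have "(\<Sum>r\<le>p. \<Sum>m\<le>p - r. sc (fps_nth h r) (sc (of_nat m) (A m (E (p - r - m) (X (n + int r) v))))) =
       (\<Sum>m\<le>p. \<Sum>r\<le>p - m. sc (fps_nth h r) (sc (of_nat m) (A m (E (p - r - m) (X (n + int r) v)))))"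
      by (rule sum_triangle_swap)
    also have "\<dots> = (\<Sum>m\<le>p. sc (of_nat m) (A m (R (p - m) n)))"
    proof (rule sum.cong[OF refl])
      fix m show "(\<Sum>r\<le>p - m. sc (fps_nth h r) (sc (of_nat m) (A m (E (p - r - m) (X (n + int r) v))))) =
        sc (of_nat m) (A m (R (p - m) n))"
        by (cases "m = 0") (simp_all add: R_def lin_sum[OF lin(1)] linD[OF lin(1)] scale_sum_right mult.commute add_ac)
    qed
    finally have "sc (of_nat p) (R p n) = (\<Sum>m\<le>p. sc (of_nat m) (A m (R (p - m) n) - sc (g m) (R (p - m) (n + int m))))"
      by (simp add: sum.distrib[symmetric] scale_right_diff_distrib)
    also have "\<dots> = (\<Sum>m\<le>p. X n (sc (of_nat m) (A m (E (p - m) v))))"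
    proof (rule sum.cong[OF refl])
      fix m assume m: "m \<in> {..p}"
      show "sc (of_nat m) (A m (R (p - m) n) - sc (g m) (R (p - m) (n + int m))) = X n (sc (of_nat m) (A m (E (p - m) v)))"
      proof (cases "m = 0")
        case False
        hence "p - m < p" using m by auto
        \<comment> \<open>By the induction hypothesis R is X E in lower degree, and the commutator
          moves \<open>A m\<close> through X.\<close>
        hence "A m (R (p - m) n) - sc (g m) (R (p - m) (n + int m)) = X n (A m (E (p - m) v))"
          unfolding IH[symmetric, OF \<open>p - m < p\<close>] using com[of m n "E (p - m) v"] False by (simp add: algebra_simps)
        thus ?thesis by (simp add: linD[OF lin(2)])
      qed (simp add: linD[OF lin(2)])
    qed
    also have "\<dots> = X n (sc (of_nat p) (E p v))"
      unfolding exp_ofD(2)[OF E] by (simp add: lin_sum[OF lin(2)])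
    also have "\<dots> = sc (of_nat p) (X n (E p v))" by (simp add: linD[OF lin(2)])
    finally show ?thesis using False by (simp add: R_def)
  qed (simp add: exp_ofD(1)[OF E] h(1))
qed

text \<open>The commutator with B is a derivation. Its value on the exponent is the scalar c in
  degree p, hence its value on exp A is c u^p exp A.\<close>

lemma exp_of_derive:
  assumes E: "exp_of A E" and lin: "\<And>m. m > 0 \<Longrightarrow> lin (A m)" "lin B" "\<And>n. lin (E n)" and p: "p > 0"
    and com: "\<And>m v. m > 0 \<Longrightarrow> B (A m v) - A m (B v) = (if m = p then sc c v else 0)"
  shows "B (E n v) = E n (B v) + (if p \<le> n then sc c (E (n - p) v) else 0)"
proof (induction n rule: less_induct)
  case (less n)
  show ?case
  proof (cases "n = 0")
    case False
    have step: "sc (of_nat m) (B (A m (E (n - m) v))) = sc (of_nat m) (A m (E (n - m) (B v))) +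
        (if m + p \<le> n then sc c (sc (of_nat m) (A m (E (n - p - m) v))) else 0) +
        (if m = p then sc (of_nat p) (sc c (E (n - p) v)) else 0)" if "m \<le> n" for m
    proof (cases "m = 0")
      case False
      have B: "B (A m x) = A m (B x) + (if m = p then sc c x else 0)" for x
        using com[OF neq0_conv[THEN iffD1, OF False], of x] by (simp add: algebra_simps)
      have lm: "lin (A m)" using False lin(1) by simp
      have "n - m < n" using that False by simp
      moreover have "n - m - p = n - p - m" "p \<le> n - m \<longleftrightarrow> m + p \<le> n" using that by auto
      ultimately show ?thesis
        unfolding B using less[of "n - m"] by (auto simp: linD[OF lm] linD[OF lin(1)[OF p]] scale_right_distrib mult.commute)
    qed (use p in simp)
    have "sc (of_nat n) (B (E n v)) = (\<Sum>m\<le>n. sc (of_nat m) (B (A m (E (n - m) v))))"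
      unfolding linD(2)[OF lin(2), symmetric] exp_ofD(2)[OF E] lin_sum[OF lin(2)] by simp
    also have "\<dots> = (\<Sum>m\<le>n. sc (of_nat m) (A m (E (n - m) (B v))) +
        (if m + p \<le> n then sc c (sc (of_nat m) (A m (E (n - p - m) v))) else 0) +
        (if m = p then sc (of_nat p) (sc c (E (n - p) v)) else 0))"
      by (intro sum.cong refl step) auto
    also have "\<dots> = sc (of_nat n) (E n (B v)) + (\<Sum>m\<le>n. if m + p \<le> n then sc c (sc (of_nat m) (A m (E (n - p - m) v))) else 0) +
        (if p \<le> n then sc (of_nat p) (sc c (E (n - p) v)) else 0)"
      by (simp add: sum.distrib exp_ofD(2)[OF E])
    also have "(\<Sum>m\<le>n. if m + p \<le> n then sc c (sc (of_nat m) (A m (E (n - p - m) v))) else 0) =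
        (if p \<le> n then sc (of_nat (n - p)) (sc c (E (n - p) v)) else 0)"
    proof (cases "p \<le> n")
      case True
      have "(\<Sum>m\<le>n. if m + p \<le> n then sc c (sc (of_nat m) (A m (E (n - p - m) v))) else 0) =
        (\<Sum>m\<le>n - p. sc c (sc (of_nat m) (A m (E (n - p - m) v))))"
        using True by (intro sum.mono_neutral_cong_right) auto
      also have "\<dots> = sc c (sc (of_nat (n - p)) (E (n - p) v))"
        unfolding exp_ofD(2)[OF E] by (simp add: scale_sum_right)
      finally show ?thesis using True by (simp add: mult.commute)
    qed (auto intro!: sum.neutral)
    finally have "sc (of_nat n) (B (E n v)) = sc (of_nat n) (E n (B v) + (if p \<le> n then sc c (E (n - p) v) else 0))"
      by (auto simp: scale_right_distrib scale_left_distrib[symmetric] of_nat_diff add.assoc)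
         (auto simp: scale_left_distrib[symmetric] algebra_simps)
    thus ?thesis using False by (simp del: scale_right_distrib)
  qed (use p in \<open>simp add: exp_ofD(1)[OF E]\<close>)
qed

end

section \<open>Operator-valued series in several variables\<close>

lemma Sum_any_reindex_inj:
  assumes "inj h" "\<And>x. x \<notin> range h \<Longrightarrow> g x = 0"
  shows "Sum_any g = Sum_any (\<lambda>y. g (h y))"
proof -
  have "{x. g x \<noteq> 0} = h ` {y. g (h y) \<noteq> 0}"
  proof (intro equalityI subsetI)
    fix x assume x: "x \<in> {x. g x \<noteq> 0}"
    hence "x \<in> range h" using assms(2) by auto
    thus "x \<in> h ` {y. g (h y) \<noteq> 0}" using x by auto
  qed auto
  thus ?thesis
    unfolding Sum_any.expand_set using assms(1)
    by (simp add: sum.reindex inj_on_def)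
qed

lemma Sum_any_sum:
  assumes "finite A" "\<And>i. i \<in> A \<Longrightarrow> finite {r. f i r \<noteq> 0}"
  shows "Sum_any (\<lambda>r. \<Sum>i\<in>A. f i r) = (\<Sum>i\<in>A. Sum_any (f i))"
proof -
  define B where "B = (\<Union>i\<in>A. {r. f i r \<noteq> 0})"
  have B: "finite B" "\<And>i. i \<in> A \<Longrightarrow> {r. f i r \<noteq> 0} \<subseteq> B" using assms by (auto simp: B_def)
  have "(\<Sum>i\<in>A. f i r) = 0" if "r \<notin> B" for r
    using that by (intro sum.neutral) (auto simp: B_def)
  hence "Sum_any (\<lambda>r. \<Sum>i\<in>A. f i r) = (\<Sum>r\<in>B. \<Sum>i\<in>A. f i r)"
    by (intro Sum_any.expand_superset B) auto
  also have "\<dots> = (\<Sum>i\<in>A. \<Sum>r\<in>B. f i r)" by (rule sum.swap)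
  also have "\<dots> = (\<Sum>i\<in>A. Sum_any (f i))"
    by (intro sum.cong refl Sum_any.expand_superset[symmetric] B)
  finally show ?thesis .
qed

text \<open>The exponent that the r-th power of the monomial with exponent d carries to e.\<close>

definition eshift :: "expo \<Rightarrow> int \<Rightarrow> expo \<Rightarrow> expo" where
  "eshift e r d = (\<lambda>s. e s - r * d s)"

lemma eshift_apply: "eshift e r d s = e s - r * d s"
  by (simp add: eshift_def)

lemma eshift_commute: "eshift (eshift e r d) s d' = eshift (eshift e s d') r d"
  by (auto simp: eshift_def)

lemma eshift_add: "eshift (eshift e r d) s d = eshift e (r + s) d"
  by (auto simp: eshift_def algebra_simps)

lemma eshift_0: "eshift e 0 d = e"
  by (simp add: eshift_def)

lemma sum_eshift: "sum (eshift e r d) U = sum e U - r * sum d U"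
  by (simp add: eshift_def sum_subtractf sum_distrib_left)

definition unitv :: "nat \<Rightarrow> expo" where
  "unitv a = (\<lambda>s. if s = a then 1 else 0)"

text \<open>One scheme for multiplication by a scalar series, by an operator series on the left and
  by one on the right: \<phi> says how the r-th coefficient acts on an operator, d is the exponent
  of the expansion monomial. A single interchange lemma then covers all pairs of these
  operations.\<close>

definition shop :: "(nat \<Rightarrow> ('v::comm_monoid_add) op \<Rightarrow> 'v op) \<Rightarrow> expo \<Rightarrow> (expo \<Rightarrow> 'v op) \<Rightarrow> expo \<Rightarrow> 'v op" where
  "shop \<phi> d M e v = Sum_any (\<lambda>r::nat. \<phi> r (M (eshift e (int r) d)) v)"

text \<open>Multiplication by the variable with number \<open>a\<close>.\<close>

definition VS :: "nat \<Rightarrow> (expo \<Rightarrow> 'v op) \<Rightarrow> expo \<Rightarrow> 'v op" where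
  "VS a M e = M (eshift e 1 (unitv a))"

context filtered_space
begin

section \<open>Admissible series and their multiplication by series\<close>

lemma graded_mono: "graded d f \<Longrightarrow> d \<le> d' \<Longrightarrow> graded d' f"
  unfolding graded_def by (meson W_mono add_left_mono subsetD)

text \<open>The coefficients of a product of fields in the variables \<open>S\<close>. Each member of \<open>T\<close> consists of the variables of a
  right-hand factor of the product, whose total exponent is bounded below on \<open>W N\<close>.\<close>

definition adm1 :: "nat set \<Rightarrow> nat set set \<Rightarrow> expo \<Rightarrow> 'v op \<Rightarrow> bool" where
  "adm1 S T e X \<longleftrightarrow> graded (sum e S) X \<and>
     (\<forall>N v. v \<in> W N \<longrightarrow> X v \<noteq> 0 \<longrightarrow> (\<forall>a. a \<notin> S \<longrightarrow> e a = 0) \<and> (\<forall>U\<in>T. - N \<le> sum e U))"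

lemma adm1D:
  assumes "adm1 S T e X"
  shows "graded (sum e S) X" "lin X" "v \<in> W N \<Longrightarrow> X v \<noteq> 0 \<Longrightarrow> a \<notin> S \<Longrightarrow> e a = 0"
    "v \<in> W N \<Longrightarrow> X v \<noteq> 0 \<Longrightarrow> U \<in> T \<Longrightarrow> - N \<le> sum e U"
    "v \<in> W N \<Longrightarrow> X v \<in> W (N + sum e S)"
  using assms unfolding adm1_def by (auto simp: graded_def)

lemma adm1_zero: "adm1 S T e (\<lambda>v. 0)"
  by (auto simp: adm1_def graded_0)

lemma adm1_add:
  assumes "adm1 S T e X" "adm1 S T e Y" shows "adm1 S T e (\<lambda>v. X v + Y v)"
proof -
  have "X v \<noteq> 0 \<or> Y v \<noteq> 0" if "X v + Y v \<noteq> 0" for v using that by auto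
  moreover have "graded (sum e S) (\<lambda>v. X v + Y v)"
    using assms by (auto simp: adm1_def intro: graded_add)
  ultimately show ?thesis using assms unfolding adm1_def by meson
qed

lemma adm1_scale: "adm1 S T e X \<Longrightarrow> adm1 S T e (\<lambda>v. sc c (X v))"
  unfolding adm1_def by (auto intro: graded_scale)

lemma adm1_sum: "(\<And>i. i \<in> A \<Longrightarrow> adm1 S T e (X i)) \<Longrightarrow> adm1 S T e (\<lambda>v. \<Sum>i\<in>A. X i v)"
  by (induction A rule: infinite_finite_induct) (auto intro: adm1_zero adm1_add)

text \<open>Needed for infinite sums: on each \<open>W N\<close> such a sum agrees with a finite
  one, but the cutoff depends on N, so admissibility is checked level by level.\<close>

lemma adm1_local:
  assumes "\<And>N. \<exists>Y. adm1 S T e Y \<and> (\<forall>v\<in>W N. X v = Y v)"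
  shows "adm1 S T e X"
proof -
  have "X (x + y) = X x + X y" for x y
  proof -
    obtain N1 N2 where "x \<in> W N1" "y \<in> W N2" using W_exhaust by meson
    hence xy: "x \<in> W (max N1 N2)" "y \<in> W (max N1 N2)"
      using W_mono[of N1 "max N1 N2"] W_mono[of N2 "max N1 N2"] by auto
    moreover have "x + y \<in> W (max N1 N2)" using xy W_subspace by (auto simp: subspace_def)
    moreover obtain Y where "adm1 S T e Y" "\<forall>v\<in>W (max N1 N2). X v = Y v" using assms by blast
    ultimately show ?thesis using adm1D(2) linD(1) by metis
  qed
  moreover have "X (sc c x) = sc c (X x)" for c x
  proof -
    obtain N where x: "x \<in> W N" using W_exhaust by meson
    moreover have "sc c x \<in> W N" using x W_subspace by (auto simp: subspace_def)
    moreover obtain Y where "adm1 S T e Y" "\<forall>v\<in>W N. X v = Y v" using assms by blast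
    ultimately show ?thesis using adm1D(2) linD(2) by metis
  qed
  ultimately have "lin X" by (simp add: lin_def)
  have loc: "X v \<in> W (N + sum e S)" "X v \<noteq> 0 \<Longrightarrow> a \<notin> S \<Longrightarrow> e a = 0" "X v \<noteq> 0 \<Longrightarrow> U \<in> T \<Longrightarrow> - N \<le> sum e U"
    if v: "v \<in> W N" for v N a U
  proof -
    obtain Y where Y: "adm1 S T e Y" "X v = Y v" using assms v by blast
    show "X v \<in> W (N + sum e S)" "X v \<noteq> 0 \<Longrightarrow> a \<notin> S \<Longrightarrow> e a = 0" "X v \<noteq> 0 \<Longrightarrow> U \<in> T \<Longrightarrow> - N \<le> sum e U"
      unfolding Y(2) using adm1D(3-5)[OF Y(1) v] by blast+
  qed
  show ?thesis unfolding adm1_def graded_def using \<open>lin X\<close> loc by blast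
qed

definition adm :: "nat set \<Rightarrow> nat set set \<Rightarrow> (expo \<Rightarrow> 'v op) \<Rightarrow> bool" where
  "adm S T M \<longleftrightarrow> (\<forall>e. adm1 S T e (M e))"

lemma adm_mono: "adm S T M \<Longrightarrow> T' \<subseteq> T \<Longrightarrow> adm S T' M"
  unfolding adm_def adm1_def by blast

lemma adm_lin: "adm S T M \<Longrightarrow> lin (M e)"
  unfolding adm_def using adm1D(2) by blast

lemma adm_scale: "adm S T M \<Longrightarrow> adm S T (\<lambda>e v. sc c (M e v))"
  and adm_sum: "(\<And>i. i \<in> A \<Longrightarrow> adm S T (Ms i)) \<Longrightarrow> adm S T (\<lambda>e v. \<Sum>i\<in>A. Ms i e v)"
  unfolding adm_def by (auto intro: adm1_scale adm1_sum)

text \<open>The conditions under which \<open>\<Sum>\<^sub>r \<phi>\<^sub>r (z\<^sup>r\<^sup>d M)\<close> is finite on each vector and two such sums can be interchanged.\<close>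

definition gop :: "nat set \<Rightarrow> nat set set \<Rightarrow> (nat \<Rightarrow> 'v op \<Rightarrow> 'v op) \<Rightarrow> expo \<Rightarrow> bool" where
  "gop S T \<phi> d \<longleftrightarrow>
     (\<forall>r X Y. \<phi> r (\<lambda>v. X v + Y v) = (\<lambda>v. \<phi> r X v + \<phi> r Y v)) \<and>
     (\<forall>r c X. \<phi> r (\<lambda>v. sc c (X v)) = (\<lambda>v. sc c (\<phi> r X v))) \<and>
     (\<forall>r X Y N. (\<forall>v\<in>W N. X v = Y v) \<longrightarrow> (\<forall>v\<in>W N. \<phi> r X v = \<phi> r Y v)) \<and>
     (\<forall>r e X. adm1 S T (eshift e (int r) d) X \<longrightarrow> adm1 S T e (\<phi> r X)) \<and>
     (\<exists>B. \<forall>e N r X v. adm1 S T (eshift e (int r) d) X \<longrightarrow> v \<in> W N \<longrightarrow> \<phi> r X v \<noteq> 0 \<longrightarrow> int r \<le> B e N)"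

lemma gopD:
  assumes "gop S T \<phi> d"
  shows "\<phi> r (\<lambda>v. X v + Y v) v = \<phi> r X v + \<phi> r Y v"
    "\<phi> r (\<lambda>v. sc c (X v)) v = sc c (\<phi> r X v)"
    "(\<And>v. v \<in> W N \<Longrightarrow> X v = Y v) \<Longrightarrow> v \<in> W N \<Longrightarrow> \<phi> r X v = \<phi> r Y v"
    "adm1 S T (eshift e (int r) d) X \<Longrightarrow> adm1 S T e (\<phi> r X)"
    "\<phi> r (\<lambda>v. 0) v = 0"
    "\<phi> r (\<lambda>v. \<Sum>a\<in>A. Xs a v) v = (\<Sum>a\<in>A. \<phi> r (Xs a) v)"
proof -
  note g = assms[unfolded gop_def]
  show add: "\<phi> r (\<lambda>v. X v + Y v) v = \<phi> r X v + \<phi> r Y v" for X Y v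
    using conjunct1[OF g] by metis
  show scl: "\<phi> r (\<lambda>v. sc c (X v)) v = sc c (\<phi> r X v)" for c X v
    using conjunct1[OF conjunct2[OF g]] by metis
  show "(\<And>v. v \<in> W N \<Longrightarrow> X v = Y v) \<Longrightarrow> v \<in> W N \<Longrightarrow> \<phi> r X v = \<phi> r Y v"
    using conjunct1[OF conjunct2[OF conjunct2[OF g]]] by metis
  show "adm1 S T (eshift e (int r) d) X \<Longrightarrow> adm1 S T e (\<phi> r X)"
    using g by blast
  show z: "\<phi> r (\<lambda>v. 0) v = 0" for v
    using scl[of 0 "\<lambda>v. 0" v] by simp
  show "\<phi> r (\<lambda>v. \<Sum>a\<in>A. Xs a v) v = (\<Sum>a\<in>A. \<phi> r (Xs a) v)"
    by (induction A rule: infinite_finite_induct) (simp_all add: z add)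
qed

lemma gop_bound:
  assumes "gop S T \<phi> d"
  shows "\<exists>K::nat. \<forall>r X v. adm1 S T (eshift e (int r) d) X \<longrightarrow> v \<in> W N \<longrightarrow> r > K \<longrightarrow> \<phi> r X v = 0"
proof -
  from assms have "\<exists>B. \<forall>e N r X v. adm1 S T (eshift e (int r) d) X \<longrightarrow> v \<in> W N \<longrightarrow> \<phi> r X v \<noteq> 0 \<longrightarrow> int r \<le> B e N"
    unfolding gop_def by (elim conjE)
  then obtain B where B: "\<And>e N r X v. adm1 S T (eshift e (int r) d) X \<Longrightarrow> v \<in> W N \<Longrightarrow> \<phi> r X v \<noteq> 0 \<Longrightarrow> int r \<le> B e N"
    by (elim exE) blast
  show ?thesis
  proof (intro exI[of _ "nat (B e N)"] allI impI)
    fix r X v assume "adm1 S T (eshift e (int r) d) X" "v \<in> W N" "r > nat (B e N)"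
    thus "\<phi> r X v = 0" using B[of e r X v N] by linarith
  qed
qed

lemma shop_eq_sum:
  assumes "\<And>r. r > K \<Longrightarrow> \<phi> r (M (eshift e (int r) d)) v = 0" "K \<le> K'"
  shows "shop \<phi> d M e v = (\<Sum>r\<le>K'. \<phi> r (M (eshift e (int r) d)) v)"
  unfolding shop_def
proof (rule Sum_any.expand_superset)
  have "r \<le> K'" if "\<phi> r (M (eshift e (int r) d)) v \<noteq> 0" for r
    using assms(1)[of r] assms(2) that by linarith
  thus "{r. \<phi> r (M (eshift e (int r) d)) v \<noteq> 0} \<subseteq> {..K'}" by auto
qed simp

definition shop_bd :: "(nat \<Rightarrow> 'v op \<Rightarrow> 'v op) \<Rightarrow> expo \<Rightarrow> (expo \<Rightarrow> 'v op) \<Rightarrow> int \<Rightarrow> expo \<Rightarrow> nat \<Rightarrow> bool" where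
  "shop_bd \<phi> d M N e K \<longleftrightarrow> (\<forall>v\<in>W N. (\<forall>r>K. \<phi> r (M (eshift e (int r) d)) v = 0) \<and>
     (\<forall>K'\<ge>K. shop \<phi> d M e v = (\<Sum>r\<le>K'. \<phi> r (M (eshift e (int r) d)) v)))"

lemma shop_bound:
  assumes "gop S T \<phi> d" "adm S T M"
  shows "\<exists>K. shop_bd \<phi> d M N e K"
proof -
  obtain K where K: "\<forall>r X v. adm1 S T (eshift e (int r) d) X \<longrightarrow> v \<in> W N \<longrightarrow> r > K \<longrightarrow> \<phi> r X v = 0"
    using gop_bound[OF assms(1)] by blast
  have z: "\<phi> r (M (eshift e (int r) d)) v = 0" if "v \<in> W N" "r > K" for r v
    using that assms(2) by (intro K[rule_format]) (auto simp: adm_def)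
  show ?thesis unfolding shop_bd_def by (rule exI[of _ K]) (use z in \<open>auto intro: shop_eq_sum\<close>)
qed

lemma shop_finite:
  assumes "gop S T \<phi> d" "adm S T M"
  shows "finite {r. \<phi> r (M (eshift e (int r) d)) v \<noteq> 0}"
proof -
  obtain N where "v \<in> W N" using W_exhaust by blast
  moreover obtain K where "shop_bd \<phi> d M N e K" using shop_bound[OF assms] by blast
  ultimately have "\<phi> r (M (eshift e (int r) d)) v = 0" if "r > K" for r
    using that by (auto simp: shop_bd_def)
  hence "{r. \<phi> r (M (eshift e (int r) d)) v \<noteq> 0} \<subseteq> {..K}" by (auto simp: not_le[symmetric])
  thus ?thesis by (rule finite_subset) simp
qed

lemma shop_adm:
  assumes "gop S T \<phi> d" "adm S T M"
  shows "adm S T (shop \<phi> d M)"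
  unfolding adm_def
proof
  fix e show "adm1 S T e (shop \<phi> d M e)"
  proof (rule adm1_local)
    fix N
    obtain K where K: "shop_bd \<phi> d M N e K" using shop_bound[OF assms] by blast
    have "adm1 S T e (\<lambda>v. \<Sum>r\<le>K. \<phi> r (M (eshift e (int r) d)) v)"
      using assms(2) by (intro adm1_sum gopD(4)[OF assms(1)]) (auto simp: adm_def)
    moreover have "\<forall>v\<in>W N. shop \<phi> d M e v = (\<Sum>r\<le>K. \<phi> r (M (eshift e (int r) d)) v)"
      using K unfolding shop_bd_def by blast
    ultimately show "\<exists>Y. adm1 S T e Y \<and> (\<forall>v\<in>W N. shop \<phi> d M e v = Y v)" by blast
  qed
qed

text \<open>On a fixed level both indices can be cut off at a common K, which turns the iterated
  series into a finite double sum over a square.\<close>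

lemma shop_shop:
  assumes g: "gop S T \<phi> d" "gop S T \<psi> d'" and M: "adm S T M" and v: "v \<in> W N"
  shows "\<exists>K. (\<forall>r s. r > K \<or> s > K \<longrightarrow> \<phi> r (\<psi> s (M (eshift (eshift e (int r) d) (int s) d'))) v = 0) \<and>
    (\<forall>K'\<ge>K. shop \<phi> d (shop \<psi> d' M) e v =
       (\<Sum>r\<le>K'. \<Sum>s\<le>K'. \<phi> r (\<psi> s (M (eshift (eshift e (int r) d) (int s) d'))) v))"
proof -
  obtain K1 where "\<forall>r X v. adm1 S T (eshift e (int r) d) X \<longrightarrow> v \<in> W N \<longrightarrow> r > K1 \<longrightarrow> \<phi> r X v = 0"
    using gop_bound[OF g(1)] by blast
  hence K1: "\<phi> r X v = 0" if "adm1 S T (eshift e (int r) d) X" "r > K1" for r X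
    using that v by blast
  define K2 where "K2 r = (SOME K. shop_bd \<psi> d' M N (eshift e (int r) d) K)" for r :: nat
  have bd: "shop_bd \<psi> d' M N (eshift e (int r) d) (K2 r)" for r
    unfolding K2_def by (rule someI_ex) (rule shop_bound[OF g(2) M])
  \<comment> \<open>The inner cutoff depends on the outer index, but only the finitely many outer
    indices up to K1 matter.\<close>
  define K where "K = Max (insert K1 (K2 ` {..K1}))"
  have K1K: "K1 \<le> K" by (simp add: K_def)
  have K2K: "K2 r \<le> K" if "r \<le> K1" for r
    using that unfolding K_def by (intro Max_ge) auto
  have a1: "adm1 S T (eshift e (int r) d) (\<psi> s (M (eshift (eshift e (int r) d) (int s) d')))" for r s
    using M by (intro gopD(4)[OF g(2)]) (auto simp: adm_def)
  have a2: "adm1 S T (eshift e (int r) d) (shop \<psi> d' M (eshift e (int r) d))" for r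
    using shop_adm[OF g(2) M] by (auto simp: adm_def)
  have z: "\<phi> r (\<psi> s (M (eshift (eshift e (int r) d) (int s) d'))) v = 0" if "r > K \<or> s > K" for r s
  proof (cases "r > K1")
    case False
    hence "s > K2 r" using that K1K K2K[of r] by linarith
    hence "\<psi> s (M (eshift (eshift e (int r) d) (int s) d')) x = 0" if "x \<in> W N" for x
      using bd[of r] that unfolding shop_bd_def by blast
    hence "\<phi> r (\<psi> s (M (eshift (eshift e (int r) d) (int s) d'))) v = \<phi> r (\<lambda>v. 0) v"
      by (rule gopD(3)[OF g(1) _ v])
    thus ?thesis by (simp add: gopD(5)[OF g(1)])
  qed (simp add: K1[OF a1])
  have "shop \<phi> d (shop \<psi> d' M) e v =
      (\<Sum>r\<le>K'. \<Sum>s\<le>K'. \<phi> r (\<psi> s (M (eshift (eshift e (int r) d) (int s) d'))) v)" if K': "K \<le> K'" for K'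
  proof -
    have "shop \<phi> d (shop \<psi> d' M) e v = (\<Sum>r\<le>K'. \<phi> r (shop \<psi> d' M (eshift e (int r) d)) v)"
      by (rule shop_eq_sum[of K1]) (use K1[OF a2] K1K K' in auto)
    also have "\<dots> = (\<Sum>r\<le>K'. \<Sum>s\<le>K'. \<phi> r (\<psi> s (M (eshift (eshift e (int r) d) (int s) d'))) v)"
    proof (rule sum.cong[OF refl])
      fix r
      show "\<phi> r (shop \<psi> d' M (eshift e (int r) d)) v = (\<Sum>s\<le>K'. \<phi> r (\<psi> s (M (eshift (eshift e (int r) d) (int s) d'))) v)"
      proof (cases "r > K1")
        case False
        hence "K2 r \<le> K'" using K2K[of r] K' by simp
        hence "shop \<psi> d' M (eshift e (int r) d) x = (\<Sum>s\<le>K'. \<psi> s (M (eshift (eshift e (int r) d) (int s) d')) x)"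
          if "x \<in> W N" for x using bd[of r] that unfolding shop_bd_def by blast
        hence "\<phi> r (shop \<psi> d' M (eshift e (int r) d)) v = \<phi> r (\<lambda>v. \<Sum>s\<le>K'. \<psi> s (M (eshift (eshift e (int r) d) (int s) d')) v) v"
          by (rule gopD(3)[OF g(1) _ v])
        thus ?thesis by (simp add: gopD(6)[OF g(1)])
      qed (simp add: K1[OF a1] K1[OF a2])
    qed
    finally show ?thesis .
  qed
  thus ?thesis using z by blast
qed

text \<open>Beyond both cutoffs the two iterated series are the same finite square sum, with the
  order of summation exchanged.\<close>

lemma shop_commute:
  assumes g: "gop S T \<phi> d" "gop S T \<psi> d'" and M: "adm S T M"
    and comm: "\<And>r s X v. lin X \<Longrightarrow> \<phi> r (\<psi> s X) v = \<psi> s (\<phi> r X) v"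
  shows "shop \<phi> d (shop \<psi> d' M) = shop \<psi> d' (shop \<phi> d M)"
proof (intro ext)
  fix e v
  obtain N where v: "v \<in> W N" using W_exhaust by blast
  obtain K where K: "\<forall>K'\<ge>K. shop \<phi> d (shop \<psi> d' M) e v =
       (\<Sum>r\<le>K'. \<Sum>s\<le>K'. \<phi> r (\<psi> s (M (eshift (eshift e (int r) d) (int s) d'))) v)"
    using shop_shop[OF g M v, of e] by (elim exE conjE) blast
  obtain L where L: "\<forall>K'\<ge>L. shop \<psi> d' (shop \<phi> d M) e v =
       (\<Sum>r\<le>K'. \<Sum>s\<le>K'. \<psi> r (\<phi> s (M (eshift (eshift e (int r) d') (int s) d))) v)"
    using shop_shop[OF g(2,1) M v, of e] by (elim exE conjE) blast
  define m where "m = max K L"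
  have "shop \<phi> d (shop \<psi> d' M) e v =
      (\<Sum>r\<le>m. \<Sum>s\<le>m. \<phi> r (\<psi> s (M (eshift (eshift e (int r) d) (int s) d'))) v)"
    by (rule K[rule_format]) (simp add: m_def)
  also have "\<dots> = (\<Sum>s\<le>m. \<Sum>r\<le>m. \<phi> r (\<psi> s (M (eshift (eshift e (int r) d) (int s) d'))) v)"
    by (rule sum.swap)
  also have "\<dots> = (\<Sum>s\<le>m. \<Sum>r\<le>m. \<psi> s (\<phi> r (M (eshift (eshift e (int s) d') (int r) d))) v)"
    by (simp only: comm[OF adm_lin[OF M]] eshift_commute[of e _ d])
  also have "\<dots> = shop \<psi> d' (shop \<phi> d M) e v"
    by (rule L[rule_format, symmetric]) (simp add: m_def)
  finally show "shop \<phi> d (shop \<psi> d' M) e v = shop \<psi> d' (shop \<phi> d M) e v" .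
qed

lemma shop_compose:
  assumes g: "gop S T \<phi> d" "gop S T \<psi> d" and M: "adm S T M"
  shows "shop \<phi> d (shop \<psi> d M) = shop (\<lambda>n X v. \<Sum>r\<le>n. \<phi> r (\<psi> (n - r) X) v) d M"
proof (intro ext)
  fix e v
  obtain N where v: "v \<in> W N" using W_exhaust by blast
  define f where "f r s = \<phi> r (\<psi> s (M (eshift e (int (r + s)) d))) v" for r s
  obtain K where z': "\<forall>r s. r > K \<or> s > K \<longrightarrow> f r s = 0"
    and K: "\<forall>K'\<ge>K. shop \<phi> d (shop \<psi> d M) e v = (\<Sum>r\<le>K'. \<Sum>s\<le>K'. f r s)"
    using shop_shop[OF g M v, of e] unfolding f_def eshift_add of_nat_add by (elim exE conjE) blast
  have z: "f r s = 0" if "r > K \<or> s > K" for r s using z' that by blast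
  \<comment> \<open>For n > 2K one of r and n - r exceeds K, so the Cauchy product is supported in n
    \<le> 2K.\<close>
  have "shop (\<lambda>n X v. \<Sum>r\<le>n. \<phi> r (\<psi> (n - r) X) v) d M e v = (\<Sum>n\<le>2*K. \<Sum>r\<le>n. f r (n - r))"
  proof -
    have "shop (\<lambda>n X v. \<Sum>r\<le>n. \<phi> r (\<psi> (n - r) X) v) d M e v =
       (\<Sum>n\<le>2*K. \<Sum>r\<le>n. \<phi> r (\<psi> (n - r) (M (eshift e (int n) d))) v)"
    proof (rule shop_eq_sum[of "2*K"])
      fix n assume n: "n > 2 * K"
      show "(\<Sum>r\<le>n. \<phi> r (\<psi> (n - r) (M (eshift e (int n) d))) v) = 0"
      proof (rule sum.neutral, rule ballI)
        fix r assume "r \<in> {..n}"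
        thus "\<phi> r (\<psi> (n - r) (M (eshift e (int n) d))) v = 0"
          using z[of r "n - r"] n by (cases "r > K") (auto simp: f_def)
      qed
    qed simp
    also have "\<dots> = (\<Sum>n\<le>2*K. \<Sum>r\<le>n. f r (n - r))"
      by (intro sum.cong refl) (auto simp: f_def)
    finally show ?thesis .
  qed
  also have "\<dots> = (\<Sum>r\<le>2*K. \<Sum>s\<le>2*K - r. f r s)"
    by (rule sum_triangle_flip)
  also have "\<dots> = (\<Sum>r\<le>K. \<Sum>s\<le>2*K - r. f r s)"
    by (rule sum.mono_neutral_right) (auto simp: z)
  also have "\<dots> = (\<Sum>r\<le>K. \<Sum>s\<le>K. f r s)"
    by (intro sum.cong refl sum.mono_neutral_right) (auto simp: z)
  finally show "shop \<phi> d (shop \<psi> d M) e v = shop (\<lambda>n X v. \<Sum>r\<le>n. \<phi> r (\<psi> (n - r) X) v) d M e v"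
    using K by simp
qed

lemma shop_scale:
  assumes "gop S T \<phi> d" "adm S T M"
  shows "shop \<phi> d (\<lambda>e v. sc c (M e v)) e v = sc c (shop \<phi> d M e v)"
  unfolding shop_def gopD(2)[OF assms(1)]
  by (rule lin_Sum_any[symmetric]) (use shop_finite[OF assms] in \<open>auto intro: lin_scale[OF lin_id]\<close>)

text \<open>The family T varies with the summand, because in a Serre relation every summand has its
  own order of the variables. T0 is the instance from which additivity of \<phi> is taken.\<close>

lemma shop_sum:
  assumes "\<And>i. i \<in> A \<Longrightarrow> gop S (T i) \<phi> d" "\<And>i. i \<in> A \<Longrightarrow> adm S (T i) (Ms i)" "finite A" "gop S T0 \<phi> d"
  shows "shop \<phi> d (\<lambda>e v. \<Sum>i\<in>A. Ms i e v) e v = (\<Sum>i\<in>A. shop \<phi> d (Ms i) e v)"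
proof -
  show ?thesis
    unfolding shop_def gopD(6)[OF assms(4)]
    by (rule Sum_any_sum[OF assms(3)]) (rule shop_finite[OF assms(1,2)])
qed

text \<open>\<open>RAT h a b\<close> is multiplication by \<open>h(z\<^sub>a/z\<^sub>b)\<close>; \<open>LF a E\<close> is multiplication by \<open>\<Sum>\<^sub>r E\<^sub>r z\<^sub>a\<^sup>r\<close> from the left, and
  \<open>RG a E\<close> by \<open>\<Sum>\<^sub>r E\<^sub>r z\<^sub>a\<^sup>-\<^sup>r\<close> from the right. Series in \<open>z\<^sub>a/z\<^sub>b\<close> can only multiply products in which \<open>z\<^sub>b\<close> stands to
  the left of \<open>z\<^sub>a\<close>, as recorded by \<open>before\<close>.\<close>

definition RAT :: "complex fps \<Rightarrow> nat \<Rightarrow> nat \<Rightarrow> (expo \<Rightarrow> 'v op) \<Rightarrow> expo \<Rightarrow> 'v op" where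
  "RAT h a b = shop (\<lambda>r X v. sc (fps_nth h r) (X v)) (ratio_expo 1 a b)"

definition LF :: "nat \<Rightarrow> (nat \<Rightarrow> 'v op) \<Rightarrow> (expo \<Rightarrow> 'v op) \<Rightarrow> expo \<Rightarrow> 'v op" where
  "LF a E = shop (\<lambda>r X v. E r (X v)) (unitv a)"

definition RG :: "nat \<Rightarrow> (nat \<Rightarrow> 'v op) \<Rightarrow> (expo \<Rightarrow> 'v op) \<Rightarrow> expo \<Rightarrow> 'v op" where
  "RG a E = shop (\<lambda>r X v. X (E r v)) (\<lambda>s. - unitv a s)"

definition before :: "nat set \<Rightarrow> nat set set \<Rightarrow> nat \<Rightarrow> nat \<Rightarrow> bool" where
  "before S T b a \<longleftrightarrow> sum (ratio_expo 1 a b) S = 0 \<and> (\<forall>s. s \<notin> S \<longrightarrow> ratio_expo 1 a b s = 0) \<and>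
     (\<forall>U\<in>T. 0 \<le> sum (ratio_expo 1 a b) U) \<and> (\<exists>U\<in>T. 0 < sum (ratio_expo 1 a b) U)"

text \<open>Going back r steps along z_a/z_b lowers the total exponent of a suitable tail U by at
  least r, and on \<open>W N\<close> this total is at least -N. Hence r \<le> N + sum e U for every
  nonzero term.\<close>

lemma gop_RAT:
  assumes "before S T b a"
  shows "gop S T (\<lambda>r X v. sc (fps_nth h r) (X v)) (ratio_expo 1 a b)"
  unfolding gop_def
proof (intro conjI allI impI)
  define d where "d = ratio_expo 1 a b"
  obtain U where U: "U \<in> T" "0 < sum d U" using assms by (auto simp: before_def d_def)
  have d: "sum d S = 0" "\<And>s. s \<notin> S \<Longrightarrow> d s = 0" "\<And>U. U \<in> T \<Longrightarrow> 0 \<le> sum d U"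
    using assms by (auto simp: before_def d_def)
  show "adm1 S T e (\<lambda>v. sc (fps_nth h r) (X v))" if "adm1 S T (eshift e (int r) (ratio_expo 1 a b)) X" for r e X
  proof (rule adm1_scale)
    have X: "adm1 S T (eshift e (int r) d) X" using that by (simp add: d_def)
    have "- N \<le> sum e U" if "v \<in> W N" "X v \<noteq> 0" "U \<in> T" for v N U
    proof -
      have "0 \<le> int r * sum d U" using d(3)[OF that(3)] by simp
      thus ?thesis using adm1D(4)[OF X that] unfolding sum_eshift by linarith
    qed
    moreover have "graded (sum e S) X" using adm1D(1)[OF X] by (simp only: sum_eshift d(1) mult_zero_right diff_zero)
    moreover have "e b = 0" if "v \<in> W N" "X v \<noteq> 0" "b \<notin> S" for v N b
      using adm1D(3)[OF X that] d(2)[OF that(3)] by (simp add: eshift_apply)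
    ultimately show "adm1 S T e X"
      unfolding adm1_def by blast
  qed
  show "\<exists>B. \<forall>e N r X v. adm1 S T (eshift e (int r) (ratio_expo 1 a b)) X \<longrightarrow> v \<in> W N \<longrightarrow>
      sc (fps_nth h r) (X v) \<noteq> 0 \<longrightarrow> int r \<le> B e N"
  proof (intro exI[of _ "\<lambda>e N. N + sum e U"] allI impI)
    fix e N r X v assume *: "adm1 S T (eshift e (int r) (ratio_expo 1 a b)) X" "v \<in> W N" "sc (fps_nth h r) (X v) \<noteq> 0"
    hence "- N \<le> sum e U - int r * sum d U"
      using adm1D(4)[OF *(1,2) _ U(1)] by (auto simp: sum_eshift d_def)
    moreover have "int r * 1 \<le> int r * sum d U" using U(2) by (intro mult_left_mono) auto
    ultimately show "int r \<le> N + sum e U" by linarith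
  qed
qed (auto simp: scale_right_distrib mult.commute)

text \<open>Finiteness comes from the degree: before E_r is applied the operator has degree sum e S
  - r, and it kills \<open>W N\<close> already when r > N + sum e S.\<close>

lemma gop_LF:
  assumes E: "\<And>r. graded (int r) (E r)" and a: "a \<in> S" "finite S"
  shows "gop S T (\<lambda>r X v. E r (X v)) (unitv a)"
  unfolding gop_def
proof (intro conjI allI impI)
  have L: "lin (E r)" for r using E gradedD by blast
  have u: "sum (unitv a) S = 1" "0 \<le> sum (unitv a) U" "s \<notin> S \<Longrightarrow> unitv a s = 0" for U s
    using a by (auto simp: unitv_def intro!: sum_nonneg)
  show "adm1 S T e (\<lambda>v. E r (X v))" if X: "adm1 S T (eshift e (int r) (unitv a)) X" for r e X
    unfolding adm1_def
  proof (intro conjI allI impI ballI)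
    show "graded (sum e S) (\<lambda>v. E r (X v))"
      using graded_comp[OF E[of r] adm1D(1)[OF X]] by (simp add: sum_eshift u)
    fix N v assume v: "v \<in> W N" "E r (X v) \<noteq> 0"
    hence nz: "X v \<noteq> 0" using linD(3)[OF L] by auto
    show "e b = 0" if "b \<notin> S" for b
      using adm1D(3)[OF X v(1) nz that] u(3)[OF that] by (simp add: eshift_apply)
    show "- N \<le> sum e U" if "U \<in> T" for U
    proof -
      have "0 \<le> int r * sum (unitv a) U" using u(2)[of U] by simp
      thus ?thesis using adm1D(4)[OF X v(1) nz that] unfolding sum_eshift by linarith
    qed
  qed
  show "\<exists>B. \<forall>e N r X v. adm1 S T (eshift e (int r) (unitv a)) X \<longrightarrow> v \<in> W N \<longrightarrow>
      E r (X v) \<noteq> 0 \<longrightarrow> int r \<le> B e N"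
  proof (intro exI[of _ "\<lambda>e N. N + sum e S"] allI impI)
    fix e N r X v assume *: "adm1 S T (eshift e (int r) (unitv a)) X" "v \<in> W N" "E r (X v) \<noteq> 0"
    have "X v \<noteq> 0" using * linD(3)[OF L] by auto
    moreover have "X v \<in> W (N + (sum e S - int r))" using adm1D(5)[OF *(1,2)] by (simp add: sum_eshift u)
    ultimately show "int r \<le> N + sum e S" using W_neg[of "N + (sum e S - int r)"] by fastforce
  qed
  show "(\<lambda>v. E r (X v + Y v)) = (\<lambda>v. E r (X v) + E r (Y v))" for r X Y by (simp add: linD[OF L])
  show "(\<lambda>v. E r (sc c (X v))) = (\<lambda>v. sc c (E r (X v)))" for r c X by (simp add: linD[OF L])
qed auto

text \<open>Here finiteness comes from the vector, as E_r v lies in \<open>W (N - r)\<close>. The r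
  levels lost in this way compensate the at most r by which the total exponent of a tail grows, so
  the bounds for the tails persist.\<close>

lemma gop_RG:
  assumes E: "\<And>r. graded (- int r) (E r)" and a: "a \<in> S" "finite S"
  shows "gop S T (\<lambda>r X v. X (E r v)) (\<lambda>s. - unitv a s)"
  unfolding gop_def
proof (intro conjI allI impI)
  have u: "sum (unitv a) S = 1" "sum (unitv a) U \<le> 1" "s \<notin> S \<Longrightarrow> unitv a s = 0" for U s
  proof -
    show "sum (unitv a) U \<le> 1" by (cases "finite U") (auto simp: unitv_def)
  qed (use a in \<open>auto simp: unitv_def\<close>)
  have su: "sum (\<lambda>s. - unitv a s) U = - sum (unitv a) U" for U by (simp add: sum_negf)
  have Ev: "E r v \<in> W (N - int r)" if "v \<in> W N" for r v N
    using gradedD(2)[OF E that, of r] by simp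
  show "adm1 S T e (\<lambda>v. X (E r v))" if X: "adm1 S T (eshift e (int r) (\<lambda>s. - unitv a s)) X" for r e X
    unfolding adm1_def
  proof (intro conjI allI impI ballI)
    show "graded (sum e S) (\<lambda>v. X (E r v))"
      using graded_comp[OF adm1D(1)[OF X] E[of r]] by (simp add: sum_eshift su u)
    fix N v assume v: "v \<in> W N" "X (E r v) \<noteq> 0"
    show "e b = 0" if "b \<notin> S" for b
      using adm1D(3)[OF X Ev[OF v(1)] v(2) that] u(3)[OF that] by (simp add: eshift_apply)
    show "- N \<le> sum e U" if "U \<in> T" for U
      using adm1D(4)[OF X Ev[OF v(1)] v(2) that] mult_left_mono[OF u(2)[of U], of "int r"]
      by (auto simp: sum_eshift su)
  qed
  show "\<exists>B. \<forall>e N r X v. adm1 S T (eshift e (int r) (\<lambda>s. - unitv a s)) X \<longrightarrow> v \<in> W N \<longrightarrow>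
      X (E r v) \<noteq> 0 \<longrightarrow> int r \<le> B e N"
  proof (intro exI[of _ "\<lambda>e N. N"] allI impI)
    fix e N r X v assume *: "adm1 S T (eshift e (int r) (\<lambda>s. - unitv a s)) X" "v \<in> W N" "X (E r v) \<noteq> 0"
    have "E r v \<noteq> 0" using * linD(3)[OF adm1D(2)[OF *(1)]] by auto
    thus "int r \<le> N" using Ev[OF *(2), of r] W_neg[of "N - int r"] by fastforce
  qed
  show "\<forall>v\<in>W N. X (E r v) = Y (E r v)" if "\<forall>v\<in>W N. X v = Y v" for r X Y N
    using that Ev W_mono[of "N - int r" N] by fastforce
qed auto

section \<open>Commutation of the elementary multiplications\<close>

definition cre :: "(nat \<Rightarrow> 'v op) \<Rightarrow> bool" where
  "cre E \<longleftrightarrow> (\<forall>r. graded (int r) (E r))"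

definition ann :: "(nat \<Rightarrow> 'v op) \<Rightarrow> bool" where
  "ann E \<longleftrightarrow> (\<forall>r. graded (- int r) (E r))"

lemma cre_lin: "cre E \<Longrightarrow> lin (E r)" and ann_lin: "ann E \<Longrightarrow> lin (E r)"
  by (auto simp: cre_def ann_def graded_def)

lemma cre_gop: "cre E \<Longrightarrow> a \<in> S \<Longrightarrow> finite S \<Longrightarrow> gop S T (\<lambda>r X v. E r (X v)) (unitv a)"
  by (rule gop_LF) (auto simp: cre_def)

lemma ann_gop: "ann E \<Longrightarrow> a \<in> S \<Longrightarrow> finite S \<Longrightarrow> gop S T (\<lambda>r X v. X (E r v)) (\<lambda>s. - unitv a s)"
  by (rule gop_RG) (auto simp: ann_def)

lemma RAT_adm: "before S T b a \<Longrightarrow> adm S T M \<Longrightarrow> adm S T (RAT h a b M)"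
  unfolding RAT_def by (intro shop_adm gop_RAT)

lemma LF_adm: "cre E \<Longrightarrow> a \<in> S \<Longrightarrow> finite S \<Longrightarrow> adm S T M \<Longrightarrow> adm S T (LF a E M)"
  unfolding LF_def by (intro shop_adm cre_gop)

lemma RG_adm: "ann E \<Longrightarrow> a \<in> S \<Longrightarrow> finite S \<Longrightarrow> adm S T M \<Longrightarrow> adm S T (RG a E M)"
  unfolding RG_def by (intro shop_adm ann_gop)

lemma RAT_RAT:
  "before S T b a \<Longrightarrow> before S T b' a' \<Longrightarrow> adm S T M \<Longrightarrow>
    RAT h a b (RAT h' a' b' M) = RAT h' a' b' (RAT h a b M)"
  unfolding RAT_def by (rule shop_commute[OF gop_RAT gop_RAT]) (auto simp: mult.commute)

lemma LF_RAT:
  "before S T c b \<Longrightarrow> cre E \<Longrightarrow> a \<in> S \<Longrightarrow> finite S \<Longrightarrow> adm S T M \<Longrightarrow>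
    LF a E (RAT h b c M) = RAT h b c (LF a E M)"
  unfolding RAT_def LF_def by (rule shop_commute[OF cre_gop gop_RAT]) (auto simp: linD[OF cre_lin])

lemma RG_RAT:
  "before S T c b \<Longrightarrow> ann E \<Longrightarrow> a \<in> S \<Longrightarrow> finite S \<Longrightarrow> adm S T M \<Longrightarrow>
    RG a E (RAT h b c M) = RAT h b c (RG a E M)"
  unfolding RAT_def RG_def by (rule shop_commute[OF ann_gop gop_RAT]) auto

lemma RG_LF:
  "ann E \<Longrightarrow> a \<in> S \<Longrightarrow> cre E' \<Longrightarrow> b \<in> S \<Longrightarrow> finite S \<Longrightarrow> adm S T M \<Longrightarrow>
    RG a E (LF b E' M) = LF b E' (RG a E M)"
  unfolding LF_def RG_def by (rule shop_commute[OF ann_gop cre_gop]) auto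

lemma LF_LF:
  "cre E \<Longrightarrow> a \<in> S \<Longrightarrow> cre E' \<Longrightarrow> b \<in> S \<Longrightarrow> finite S \<Longrightarrow> adm S T M \<Longrightarrow>
    (\<And>r s v. E r (E' s v) = E' s (E r v)) \<Longrightarrow> LF a E (LF b E' M) = LF b E' (LF a E M)"
  unfolding LF_def by (rule shop_commute[OF cre_gop cre_gop]) auto

lemma RG_RG:
  "ann E \<Longrightarrow> a \<in> S \<Longrightarrow> ann E' \<Longrightarrow> b \<in> S \<Longrightarrow> finite S \<Longrightarrow> adm S T M \<Longrightarrow>
    (\<And>r s v. E r (E' s v) = E' s (E r v)) \<Longrightarrow> RG a E (RG b E' M) = RG b E' (RG a E M)"
  unfolding RG_def by (rule shop_commute[OF ann_gop ann_gop]) auto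

lemma RAT_mult:
  assumes "before S T b a" "adm S T M"
  shows "RAT h a b (RAT h' a b M) = RAT (h * h') a b M"
  unfolding RAT_def shop_compose[OF gop_RAT[OF assms(1)] gop_RAT[OF assms(1)] assms(2)]
  by (simp add: scale_sum_left[symmetric] fps_mult_nth atMost_atLeast0)

lemma RAT_1: "RAT 1 a b M = M"
proof (intro ext)
  fix e v
  have "shop (\<lambda>r X v. sc (fps_nth 1 r) (X v)) (ratio_expo 1 a b) M e v =
    (\<Sum>r\<le>0. sc (fps_nth 1 r) (M (eshift e (int r) (ratio_expo 1 a b)) v))"
    by (rule shop_eq_sum[of 0]) auto
  thus "RAT 1 a b M e v = M e v" by (simp add: RAT_def eshift_0)
qed

lemma LF_compose:
  assumes "cre E" "cre E'" "a \<in> S" "finite S" "adm S T M"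
  shows "LF a E (LF a E' M) = LF a (\<lambda>n v. \<Sum>r\<le>n. E r (E' (n - r) v)) M"
  unfolding LF_def by (rule shop_compose[OF cre_gop cre_gop]) (use assms in auto)

text \<open>Right multiplications compose in reverse order: the factor applied last as an operation
  on series acts first on the vector.\<close>

lemma RG_compose:
  assumes "ann E" "ann E'" "a \<in> S" "finite S" "adm S T M"
  shows "RG a E (RG a E' M) = RG a (\<lambda>n v. \<Sum>r\<le>n. E' (n - r) (E r v)) M"
  unfolding RG_def shop_compose[OF ann_gop[OF assms(1,3,4)] ann_gop[OF assms(2,3,4)] assms(5)]
  by (intro ext) (simp add: shop_def lin_sum[OF adm_lin[OF assms(5)]])

lemma LF_unit: "(\<And>e. M e 0 = 0) \<Longrightarrow> LF a (\<lambda>n v. if n = 0 then v else 0) M = M"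
proof (intro ext)
  fix e v
  show "LF a (\<lambda>n v. if n = 0 then v else 0) M e v = M e v"
    unfolding LF_def by (subst shop_eq_sum[of 0 _ _ _ _ _ 0]) (auto simp: eshift_0)
qed

lemma RG_unit:
  assumes "\<And>e. M e 0 = 0" shows "RG a (\<lambda>n v. if n = 0 then v else 0) M = M"
proof (intro ext)
  fix e v
  show "RG a (\<lambda>n v. if n = 0 then v else 0) M e v = M e v"
    unfolding RG_def by (subst shop_eq_sum[of 0 _ _ _ _ _ 0]) (auto simp: eshift_0 assms)
qed

lemma VS_adm:
  assumes "a \<in> S" "finite S" "adm S T M" shows "adm S T (VS a M)"
  unfolding adm_def
proof
  fix e
  have u: "sum (unitv a) S = 1" "0 \<le> sum (unitv a) U" "s \<notin> S \<Longrightarrow> unitv a s = 0" for U s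
    using assms by (auto simp: unitv_def intro!: sum_nonneg)
  have M: "adm1 S T (eshift e 1 (unitv a)) (M (eshift e 1 (unitv a)))" using assms by (simp add: adm_def)
  show "adm1 S T e (VS a M e)"
    unfolding adm1_def VS_def
  proof (intro conjI allI impI ballI)
    show "graded (sum e S) (M (eshift e 1 (unitv a)))"
      using adm1D(1)[OF M] by (rule graded_mono) (simp add: sum_eshift u)
    fix N v assume v: "v \<in> W N" "M (eshift e 1 (unitv a)) v \<noteq> 0"
    show "e b = 0" if "b \<notin> S" for b
      using adm1D(3)[OF M v that] u(3)[OF that] by (simp add: eshift_apply)
    show "- N \<le> sum e U" if "U \<in> T" for U
      using adm1D(4)[OF M v that] u(2)[of U] by (simp add: sum_eshift)
  qed
qed

lemma shop_VS: "shop \<phi> d (VS a M) = VS a (shop \<phi> d M)"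
  by (intro ext) (simp add: shop_def VS_def eshift_commute)

text \<open>z_a (1 - x z_b/z_a) = z_a - x z_b. This links the polynomial factors in the relations of
  the x with power series in a ratio of variables.\<close>

lemma VS_RAT_linear:
  assumes "a \<noteq> b"
  shows "VS a (RAT (1 - fps_const x * fps_X) b a M) e v = VS a M e v - sc x (VS b M e v)"
proof -
  have "RAT (1 - fps_const x * fps_X) b a M e v = (\<Sum>r\<le>1. sc (fps_nth (1 - fps_const x * fps_X) r) (M (eshift e (int r) (ratio_expo 1 b a)) v))" for e
    unfolding RAT_def by (rule shop_eq_sum[of 1]) (auto simp: fps_X_def)
  moreover have "eshift (eshift e 1 (unitv a)) 1 (ratio_expo 1 b a) = eshift e 1 (unitv b)"
    using assms by (auto simp: eshift_def unitv_def ratio_expo_def)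
  ultimately show ?thesis by (simp add: VS_def eshift_0)
qed

lemma in_ratio_dilate: "in_ratio F c a b = in_ratio (fps_dilate c F) 1 a b"
  by (intro ext) (simp add: in_ratio_def)

text \<open>\<open>dscale\<close> sums over all exponents. Only the nonnegative multiples of the
  exponent of z_a/z_b contribute, and these are indexed by r.\<close>

lemma dscale_in_ratio:
  assumes "a \<noteq> b"
  shows "dscale sc (in_ratio h 1 a b) M = RAT h a b M"
proof (intro ext)
  fix e v
  have "inj (\<lambda>r::nat. ratio_expo (int r) a b)"
  proof (rule injI)
    fix x y assume "ratio_expo (int x) a b = ratio_expo (int y) a b"
    from fun_cong[OF this, of a] show "x = y" by (simp add: ratio_expo_def)
  qed
  hence "dscale sc (in_ratio h 1 a b) M e v =
    Sum_any (\<lambda>r::nat. sc (in_ratio h 1 a b (ratio_expo (int r) a b)) (M (e - ratio_expo (int r) a b) v))"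
    unfolding dscale_def
  proof (rule Sum_any_reindex_inj)
    fix f assume "f \<notin> range (\<lambda>r::nat. ratio_expo (int r) a b)"
    hence "\<not> (f a \<ge> 0 \<and> f = ratio_expo (f a) a b)"
    proof (rule contrapos_nn)
      assume "f a \<ge> 0 \<and> f = ratio_expo (f a) a b"
      hence "f = ratio_expo (int (nat (f a))) a b" by simp
      thus "f \<in> range (\<lambda>r::nat. ratio_expo (int r) a b)" by blast
    qed
    thus "sc (in_ratio h 1 a b f) (M (e - f) v) = 0" by (auto simp: in_ratio_def)
  qed
  moreover have "e - ratio_expo (int r) a b = eshift e (int r) (ratio_expo 1 a b)" for r
    by (auto simp: eshift_def ratio_expo_def fun_eq_iff)
  moreover have "in_ratio h 1 a b (ratio_expo (int r) a b) = fps_nth h r" for r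
    by (auto simp: in_ratio_def ratio_expo_def)
  ultimately show "dscale sc (in_ratio h 1 a b) M e v = RAT h a b M e v"
    by (simp add: RAT_def shop_def)
qed

lemma dscale_var: "dscale sc (var c a) M e v = sc c (VS a M e v)"
proof -
  have u: "(\<lambda>s. if s = a then 1 else 0) = unitv a" by (simp add: unitv_def)
  have "dscale sc (var c a) M e v = (\<Sum>f\<in>{unitv a}. sc (var c a f) (M (e - f) v))"
    unfolding dscale_def by (rule Sum_any.expand_superset) (auto simp: var_def u)
  moreover have "e - unitv a = eshift e 1 (unitv a)" by (auto simp: eshift_def)
  ultimately show ?thesis by (simp add: var_def u VS_def)
qed

lemma dscale_var_diff:
  assumes "a \<noteq> b"
  shows "dscale sc (\<lambda>e. var c a e - var c' b e) M e v = sc c (VS a M e v) - sc c' (VS b M e v)"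
proof -
  have u: "(\<lambda>s. if s = a then 1 else 0) = unitv a" for a by (simp add: unitv_def)
  have ne: "unitv a \<noteq> unitv b" using assms by (auto simp: unitv_def fun_eq_iff)
  have "dscale sc (\<lambda>e. var c a e - var c' b e) M e v =
      (\<Sum>f\<in>{unitv a, unitv b}. sc (var c a f - var c' b f) (M (e - f) v))"
    unfolding dscale_def by (rule Sum_any.expand_superset) (auto simp: var_def u)
  moreover have "e - unitv a = eshift e 1 (unitv a)" for a by (auto simp: eshift_def)
  ultimately show ?thesis using ne by (simp add: var_def u VS_def)
qed

end

section \<open>Products of dressed fields\<close>

text \<open>The maps are known to commute on elements satisfying P only, so P is carried along while
  an entry is bubbled to the front.\<close>

lemma foldr_perm:
  assumes closed: "\<And>x M. x \<in> A \<Longrightarrow> P M \<Longrightarrow> P (f x M)"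
    and comm: "\<And>x y M. x \<in> A \<Longrightarrow> y \<in> A \<Longrightarrow> P M \<Longrightarrow> f x (f y M) = f y (f x M)"
    and M: "P M" and xs: "set xs \<subseteq> A" and eq: "mset xs = mset ys"
  shows "foldr f xs M = foldr f ys M"
proof -
  have P: "P (foldr f zs M)" if "set zs \<subseteq> A" for zs
    using that by (induction zs) (auto intro: closed M)
  have bubble: "foldr f (us @ x # ws) M = f x (foldr f (us @ ws) M)" if "set (us @ x # ws) \<subseteq> A" for us x ws
    using that
  proof (induction us)
    case (Cons u us)
    thus ?case using comm[of u x "foldr f (us @ ws) M"] P[of "us @ ws"] by auto
  qed simp
  show ?thesis using xs eq
  proof (induction xs arbitrary: ys)
    case (Cons x xs)
    have "x \<in> set ys" using Cons.prems(2) by (metis list.set_intros(1) set_mset_mset)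
    then obtain us ws where ys: "ys = us @ x # ws" by (auto simp: in_set_conv_decomp)
    hence "mset xs = mset (us @ ws)" using Cons.prems by auto
    moreover have "set ys \<subseteq> A" using Cons.prems by (metis set_mset_mset)
    moreover have "set xs \<subseteq> A" using Cons.prems by simp
    ultimately have "foldr f xs M = foldr f (us @ ws) M" using Cons.IH by blast
    thus ?case using bubble[of us x ws] ys \<open>set ys \<subseteq> A\<close> by simp
  qed simp
qed

lemma Sum_any_triangle:
  fixes f :: "nat \<Rightarrow> nat \<Rightarrow> 'a::comm_monoid_add"
  assumes z: "\<And>r s. r + s > K \<Longrightarrow> f r s = 0"
  shows "Sum_any (\<lambda>r. Sum_any (f r)) = Sum_any (\<lambda>n. \<Sum>r\<le>n. f r (n - r))"
proof -
  have in_sum: "Sum_any (f r) = (\<Sum>s\<le>K - r. f r s)" for r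
  proof (rule Sum_any.expand_superset)
    show "{s. f r s \<noteq> 0} \<subseteq> {..K - r}"
    proof
      fix s assume "s \<in> {s. f r s \<noteq> 0}"
      thus "s \<in> {..K - r}" using z[of r s] by (cases "r + s > K") auto
    qed
  qed simp
  have "Sum_any (\<lambda>r. Sum_any (f r)) = (\<Sum>r\<le>K. \<Sum>s\<le>K - r. f r s)"
    unfolding in_sum
  proof (rule Sum_any.expand_superset)
    have zz: "(\<Sum>s\<le>K - r. f r s) = 0" if "r > K" for r
      using that by (intro sum.neutral) (auto simp: z)
    show "{r. (\<Sum>s\<le>K - r. f r s) \<noteq> 0} \<subseteq> {..K}"
    proof
      fix r assume "r \<in> {r. (\<Sum>s\<le>K - r. f r s) \<noteq> 0}"
      thus "r \<in> {..K}" using zz[of r] by (cases "r > K") auto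
    qed
  qed simp
  also have "\<dots> = (\<Sum>n\<le>K. \<Sum>r\<le>n. f r (n - r))" by (rule sum_triangle_flip[symmetric])
  also have "\<dots> = Sum_any (\<lambda>n. \<Sum>r\<le>n. f r (n - r))"
  proof (rule Sum_any.expand_superset[symmetric])
    have "(\<Sum>r\<le>n. f r (n - r)) = 0" if "n > K" for n
      using that by (intro sum.neutral) (auto simp: z)
    thus "{n. (\<Sum>r\<le>n. f r (n - r)) \<noteq> 0} \<subseteq> {..K}" by (auto simp: not_le[symmetric])
  qed simp
  finally show ?thesis .
qed

text \<open>In \<open>(b, a) \<in> set (later_pairs vs)\<close> the variable \<open>b\<close> stands to the right of \<open>a\<close>.\<close>

fun tails :: "nat list \<Rightarrow> nat set set" where
  "tails [] = {}"
| "tails (a # vs) = insert (set (a # vs)) (tails vs)"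

fun later_pairs :: "nat list \<Rightarrow> (nat \<times> nat) list" where
  "later_pairs [] = []"
| "later_pairs (a # vs) = later_pairs vs @ map (\<lambda>b. (b, a)) vs"

lemma tails_subset: "U \<in> tails vs \<Longrightarrow> U \<subseteq> set vs"
  by (induction vs) auto

text \<open>The tail that starts right after y contains x but not y. It is the witness demanded by
  \<open>before\<close>, which makes a series in z_x/z_y applicable.\<close>

lemma later_pairs_props:
  assumes "distinct vs" "(x, y) \<in> set (later_pairs vs)"
  shows "x \<noteq> y \<and> x \<in> set vs \<and> y \<in> set vs \<and> (\<forall>U\<in>tails vs. y \<in> U \<longrightarrow> x \<in> U) \<and> (\<exists>U\<in>tails vs. x \<in> U \<and> y \<notin> U)"
  using assms
proof (induction vs)
  case (Cons a vs)
  show ?case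
  proof (cases "(x, y) \<in> set (later_pairs vs)")
    case False
    hence xy: "y = a" "x \<in> set vs" using Cons.prems by auto
    moreover have "set vs \<in> tails vs" using xy by (cases vs) auto
    ultimately show ?thesis using Cons.prems tails_subset by auto
  qed (use Cons in auto)
qed simp

lemma mset_later_pairs_snoc:
  "mset (later_pairs (vs @ [a])) = mset (later_pairs vs) + mset (map (\<lambda>b. (a, b)) vs)"
  by (induction vs) auto

text \<open>In the Serre relations w is inserted into the word of the z; this counts the pairs it
  forms with the variables before and after it.\<close>

lemma mset_later_pairs_insert:
  "mset (later_pairs (us @ a # vs)) =
     mset (later_pairs (us @ vs)) + mset (map (\<lambda>b. (a, b)) us) + mset (map (\<lambda>b. (b, a)) vs)"
  by (induction us) (auto simp: ac_simps)

text \<open>Left multiplication by X(z_a) when a occurs in no other factor. The convolution then has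
  a single term, in which X takes the whole exponent of z_a.\<close>

definition Mul :: "nat \<Rightarrow> (int \<Rightarrow> 'v op) \<Rightarrow> (expo \<Rightarrow> 'v op) \<Rightarrow> expo \<Rightarrow> 'v op" where
  "Mul a X M e v = X (e a) (M (e(a := 0)) v)"

fun fprod :: "(nat \<Rightarrow> int \<Rightarrow> ('v::zero) op) \<Rightarrow> nat list \<Rightarrow> expo \<Rightarrow> 'v op" where
  "fprod X [] = unit_dist"
| "fprod X (a # vs) = Mul a (X a) (fprod X vs)"

lemma fprod_support:
  assumes "\<And>a n. X a n 0 = 0" "fprod X vs e v \<noteq> 0" "b \<notin> set vs"
  shows "e b = 0"
  using assms(2,3)
proof (induction vs arbitrary: e)
  case (Cons a vs)
  have "fprod X vs (e(a := 0)) v \<noteq> 0" using Cons.prems(1) assms(1) by (auto simp: Mul_def)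
  from Cons.IH[OF this] Cons.prems(2) show ?case by auto
qed (auto simp: unit_dist_def split: if_splits)

lemma dprods_eq_fprod:
  fixes X :: "nat \<Rightarrow> int \<Rightarrow> ('v::comm_monoid_add) op"
  assumes z: "\<And>a n. X a n 0 = 0" and "distinct vs"
  shows "dprods (map (\<lambda>a. in_var a (X a)) vs) = fprod X vs"
  using assms(2)
proof (induction vs)
  case (Cons a vs)
  have "(in_var a (X a) \<circledast> fprod X vs) e v = Mul a (X a) (fprod X vs) e v" for e v
  proof -
    define f0 :: expo where "f0 = (\<lambda>s. if s = a then e a else 0)"
    have "f = f0" if "in_var a (X a) f (fprod X vs (e - f) v) \<noteq> 0" for f
    proof -
      have 1: "\<forall>b. b \<noteq> a \<longrightarrow> f b = 0" using that by (auto simp: in_var_def split: if_splits)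
      hence "fprod X vs (e - f) v \<noteq> 0" using that z by (auto simp: in_var_def)
      from fprod_support[OF z this, of a] Cons.prems have "f a = e a" by simp
      thus ?thesis using 1 by (auto simp: f0_def)
    qed
    hence "(in_var a (X a) \<circledast> fprod X vs) e v = (\<Sum>f\<in>{f0}. in_var a (X a) f (fprod X vs (e - f) v))"
      unfolding dprod_def by (intro Sum_any.expand_superset) auto
    moreover have "e - f0 = e(a := 0)" by (auto simp: f0_def)
    ultimately show ?thesis by (simp add: Mul_def in_var_def f0_def)
  qed
  moreover have "dprods (map (\<lambda>a. in_var a (X a)) vs) = fprod X vs" using Cons by simp
  moreover have "dprods (map (\<lambda>a. in_var a (X a)) (a # vs)) = in_var a (X a) \<circledast> dprods (map (\<lambda>a. in_var a (X a)) vs)"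
    by (simp add: dprods_def)
  ultimately show ?case by (intro ext) simp
qed (simp add: dprods_def)

section \<open>Products of fields in distinct variables\<close>

context filtered_space
begin

lemma before_if_later:
  assumes "distinct vs" "(x, y) \<in> set (later_pairs vs)"
  shows "before (set vs) (tails vs) y x"
proof -
  note p = later_pairs_props[OF assms]
  have s: "sum (ratio_expo 1 x y) U = of_bool (x \<in> U) - of_bool (y \<in> U)" if "finite U" for U
  proof -
    have "ratio_expo 1 x y = (\<lambda>s. (if s = x then 1 else 0) - (if s = y then 1 else 0))"
      using conjunct1[OF p] by (auto simp: ratio_expo_def)
    thus ?thesis using that by (simp add: sum_subtractf)
  qed
  have fin: "finite U" if "U \<in> tails vs" for U
    using tails_subset[OF that] by (rule finite_subset) simp
  show ?thesis unfolding before_def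
  proof (intro conjI ballI allI impI)
    show "sum (ratio_expo 1 x y) (set vs) = 0" using p by (simp add: s)
    show "ratio_expo 1 x y z = 0" if "z \<notin> set vs" for z using p that by (auto simp: ratio_expo_def)
    show "0 \<le> sum (ratio_expo 1 x y) U" if "U \<in> tails vs" for U
      using p that by (auto simp: s fin)
    obtain U where U: "U \<in> tails vs" "x \<in> U" "y \<notin> U" using p by blast
    thus "\<exists>U\<in>tails vs. 0 < sum (ratio_expo 1 x y) U" by (intro bexI[of _ U]) (auto simp: s fin)
  qed
qed

text \<open>The new tail is the full set of variables. Its total exponent is the degree of the
  product, so \<open>W_neg\<close> forces the lower bound -N; the old tails do not contain the new
  variable.\<close>

lemma Mul_adm:
  assumes M: "adm S T M" and a: "a \<notin> S" "finite S" "\<And>U. U \<in> T \<Longrightarrow> U \<subseteq> S" and X: "\<And>n. graded n (X n)"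
  shows "adm (insert a S) (insert (insert a S) T) (Mul a X M)"
  unfolding adm_def
proof
  fix e
  have M1: "adm1 S T (e(a := 0)) (M (e(a := 0)))" using M by (simp add: adm_def)
  have su: "sum (e(a := 0)) U = sum e U" if "U \<subseteq> S" for U
    using that a(1) by (intro sum.cong) auto
  have g: "graded (sum e (insert a S)) (Mul a X M e)"
    using graded_comp[OF X[of "e a"] adm1D(1)[OF M1]] a su[of S]
    unfolding Mul_def[abs_def] by simp
  have z: "X n 0 = 0" for n using X gradedD(1) linD(3) by blast
  show "adm1 (insert a S) (insert (insert a S) T) e (Mul a X M e)"
    unfolding adm1_def
  proof (intro conjI g allI impI ballI)
    fix N v assume v: "v \<in> W N" "Mul a X M e v \<noteq> 0"
    hence nz: "M (e(a := 0)) v \<noteq> 0" using z by (auto simp: Mul_def)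
    show "e b = 0" if "b \<notin> insert a S" for b
      using adm1D(3)[OF M1 v(1) nz, of b] that by auto
    show "- N \<le> sum e U" if U: "U \<in> insert (insert a S) T" for U
    proof (cases "U \<in> T")
      case True
      thus ?thesis using adm1D(4)[OF M1 v(1) nz True] su[OF a(3)[OF True]] by simp
    next
      case False
      hence "U = insert a S" using U by simp
      thus ?thesis using graded_zero_vec[OF g v(1)] v(2) by fastforce
    qed
  qed
qed

lemma fprod_adm:
  assumes "distinct vs" "\<And>a n. a \<in> set vs \<Longrightarrow> graded n (X a n)"
  shows "adm (set vs) (tails vs) (fprod X vs)"
  using assms
proof (induction vs)
  case Nil
  have "graded 0 (unit_dist e)" for e
    by (cases "e = (\<lambda>_. 0)") (simp_all add: unit_dist_def[abs_def] graded_0 graded_id)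
  moreover have "e b = 0" if "unit_dist e (v :: 'v) \<noteq> 0" for e b v
    using that by (auto simp: unit_dist_def split: if_splits)
  ultimately show ?case by (auto simp: adm_def adm1_def)
next
  case (Cons a vs)
  have "adm (insert a (set vs)) (insert (insert a (set vs)) (tails vs)) (Mul a (X a) (fprod X vs))"
    by (rule Mul_adm) (use Cons tails_subset in auto)
  thus ?case by simp
qed

lemma Mul_shop:
  assumes "gop S T \<phi> d" "adm S T M" "d a = 0" "\<And>n. lin (X n)"
    "\<And>n r Y v. lin Y \<Longrightarrow> X n (\<phi> r Y v) = \<phi> r (\<lambda>v. X n (Y v)) v"
  shows "Mul a X (shop \<phi> d M) = shop \<phi> d (Mul a X M)"
proof (intro ext)
  fix e v
  have "Mul a X (shop \<phi> d M) e v = Sum_any (\<lambda>r::nat. X (e a) (\<phi> r (M (eshift (e(a := 0)) (int r) d)) v))"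
    unfolding Mul_def shop_def by (rule lin_Sum_any[OF assms(4)]) (rule shop_finite[OF assms(1,2)])
  moreover have "eshift (e(a := 0)) r d = (eshift e r d)(a := 0)" "e a = eshift e r d a" for r
    using assms(3) by (auto simp: eshift_def)
  ultimately show "Mul a X (shop \<phi> d M) e v = shop \<phi> d (Mul a X M) e v"
    unfolding shop_def Mul_def[abs_def] assms(5)[OF adm_lin[OF assms(2)]] by simp
qed

lemma Mul_RAT:
  assumes "before S T c b" "adm S T M" "a \<notin> S" "\<And>n. lin (X n)"
  shows "Mul a X (RAT h b c M) = RAT h b c (Mul a X M)"
  unfolding RAT_def
  by (rule Mul_shop[OF gop_RAT[OF assms(1)] assms(2) _ assms(4)])
     (use assms in \<open>auto simp: before_def linD[OF assms(4)]\<close>)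

lemma Mul_RG:
  assumes "ann E" "b \<in> S" "finite S" "adm S T M" "a \<notin> S" "\<And>n. lin (X n)"
  shows "Mul a X (RG b E M) = RG b E (Mul a X M)"
  unfolding RG_def
  by (rule Mul_shop[OF ann_gop[OF assms(1-3)] assms(4) _ assms(6)]) (use assms in \<open>auto simp: unitv_def\<close>)

text \<open>Summing up the coefficientwise exchange yields the factor h(z_b/z_a): the r modes given
  to X are taken from E. The sum over m and r \<le> m is turned into independent sums over r and s =
  m - r.\<close>

lemma Mul_LF:
  assumes E: "cre E" "b \<in> S" "finite S" and M: "adm S T M" and a: "a \<notin> S" and X: "\<And>n. lin (X n)"
    and exch: "\<And>n m v. X n (E m v) = (\<Sum>r\<le>m. sc (fps_nth h r) (E (m - r) (X (n + int r) v)))"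
  shows "Mul a X (LF b E M) = RAT h b a (LF b E (Mul a X M))"
proof (intro ext)
  fix e v
  have ab: "a \<noteq> b" using E a by auto
  define M' where "M' n = M (eshift (e(a := 0)) (int n) (unitv b)) v" for n
  define f where "f r s = sc (fps_nth h r) (E s (X (e a + int r) (M' (r + s))))" for r s
  obtain N where N: "v \<in> W N" using W_exhaust by blast
  \<comment> \<open>For n > K the vector M' n would lie in a level below 0.\<close>
  define K where "K = nat (N + sum (e(a := 0)) S)"
  have u: "sum (unitv b) S = 1" using E by (simp add: unitv_def)
  have M'0: "M' n = 0" if "n > K" for n
  proof -
    have "adm1 S T (eshift (e(a := 0)) (int n) (unitv b)) (M (eshift (e(a := 0)) (int n) (unitv b)))"
      using M by (simp add: adm_def)
    from graded_zero_vec[OF adm1D(1)[OF this] N] show ?thesis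
      unfolding M'_def sum_eshift u using that by (auto simp: K_def)
  qed
  have L: "lin (E s)" for s using E cre_lin by blast
  have z: "f r s = 0" if "r + s > K" for r s
    using M'0[OF that] by (simp add: f_def linD[OF X] linD[OF L])
  have "Mul a X (LF b E M) e v = X (e a) (Sum_any (\<lambda>m. E m (M' m)))"
    by (simp add: Mul_def LF_def shop_def M'_def)
  also have "\<dots> = Sum_any (\<lambda>m. X (e a) (E m (M' m)))"
  proof (rule lin_Sum_any[OF X])
    have "m \<le> K" if "E m (M' m) \<noteq> 0" for m using M'0[of m] that by (cases "m > K") (auto simp: linD[OF L])
    hence "{m. E m (M' m) \<noteq> 0} \<subseteq> {..K}" by auto
    thus "finite {m. E m (M' m) \<noteq> 0}" by (rule finite_subset) simp
  qed
  also have "\<dots> = Sum_any (\<lambda>m. \<Sum>r\<le>m. f r (m - r))"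
    by (simp add: exch f_def)
  also have "\<dots> = Sum_any (\<lambda>r. Sum_any (f r))"
    by (rule Sum_any_triangle[symmetric, of K]) (rule z)
  also have "\<dots> = Sum_any (\<lambda>r. sc (fps_nth h r) (Sum_any (\<lambda>s. E s (X (e a + int r) (M' (r + s))))))"
  proof (rule Sum_any.cong)
    fix r
    have "s \<le> K" if "E s (X (e a + int r) (M' (r + s))) \<noteq> 0" for s
      using M'0[of "r + s"] that by (cases "s > K") (auto simp: linD[OF L] linD[OF X])
    hence "{s. E s (X (e a + int r) (M' (r + s))) \<noteq> 0} \<subseteq> {..K}" by auto
    hence "finite {s. E s (X (e a + int r) (M' (r + s))) \<noteq> 0}" by (rule finite_subset) simp
    from lin_Sum_any[OF lin_scale[OF lin_id] this]
    show "Sum_any (f r) = sc (fps_nth h r) (Sum_any (\<lambda>s. E s (X (e a + int r) (M' (r + s)))))"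
      by (simp add: f_def[abs_def])
  qed
  also have "\<dots> = RAT h b a (LF b E (Mul a X M)) e v"
  proof -
    have "eshift (eshift e (int r) (ratio_expo 1 b a)) (int s) (unitv b) a = e a + int r" for r s
      using ab by (simp add: eshift_def ratio_expo_def unitv_def)
    moreover have "(eshift (eshift e (int r) (ratio_expo 1 b a)) (int s) (unitv b))(a := 0) =
       eshift (e(a := 0)) (int (r + s)) (unitv b)" for r s
      using ab by (auto simp: eshift_def ratio_expo_def unitv_def fun_eq_iff)
    ultimately show ?thesis by (simp add: RAT_def LF_def shop_def Mul_def M'_def)
  qed
  finally show "Mul a X (LF b E M) e v = RAT h b a (LF b E (Mul a X M)) e v" .
qed

section \<open>Several ratio factors at once\<close>

definition RATs :: "(nat \<Rightarrow> nat \<Rightarrow> complex fps) \<Rightarrow> (nat \<times> nat) list \<Rightarrow> (expo \<Rightarrow> 'v op) \<Rightarrow> expo \<Rightarrow> 'v op" where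
  "RATs h ps = foldr (\<lambda>(x, y). RAT (h x y) x y) ps"

lemma RATs_simps [simp]: "RATs h [] M = M" "RATs h ((x, y) # ps) M = RAT (h x y) x y (RATs h ps M)"
  "RATs h (ps @ qs) M = RATs h ps (RATs h qs M)"
  by (simp_all add: RATs_def)

definition all_before :: "nat set \<Rightarrow> nat set set \<Rightarrow> (nat \<times> nat) list \<Rightarrow> bool" where
  "all_before S T ps \<longleftrightarrow> (\<forall>(x, y)\<in>set ps. before S T y x)"

lemma all_before_simps [simp]: "all_before S T []"
  "all_before S T ((x, y) # ps) \<longleftrightarrow> before S T y x \<and> all_before S T ps"
  "all_before S T (ps @ qs) \<longleftrightarrow> all_before S T ps \<and> all_before S T qs"
  by (auto simp: all_before_def)

lemma all_before_later: "distinct vs \<Longrightarrow> mset ps = mset (later_pairs vs) \<Longrightarrow> all_before (set vs) (tails vs) ps"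
  unfolding all_before_def by (metis (no_types, lifting) before_if_later case_prodI2 set_mset_mset)

lemma RATs_adm: "all_before S T ps \<Longrightarrow> adm S T M \<Longrightarrow> adm S T (RATs h ps M)"
  by (induction ps) (auto intro: RAT_adm)

lemma RAT_RATs: "before S T y x \<Longrightarrow> all_before S T ps \<Longrightarrow> adm S T M \<Longrightarrow>
    RATs h ps (RAT g x y M) = RAT g x y (RATs h ps M)"
proof (induction ps)
  case (Cons p ps)
  thus ?case by (cases p) (auto simp: RAT_RAT[OF _ _ RATs_adm])
qed simp

lemma LF_RATs: "all_before S T ps \<Longrightarrow> cre E \<Longrightarrow> a \<in> S \<Longrightarrow> finite S \<Longrightarrow> adm S T M \<Longrightarrow>
    LF a E (RATs h ps M) = RATs h ps (LF a E M)"
proof (induction ps)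
  case (Cons p ps)
  thus ?case by (cases p) (auto simp: LF_RAT[OF _ _ _ _ RATs_adm])
qed simp

lemma RG_RATs: "all_before S T ps \<Longrightarrow> ann E \<Longrightarrow> a \<in> S \<Longrightarrow> finite S \<Longrightarrow> adm S T M \<Longrightarrow>
    RG a E (RATs h ps M) = RATs h ps (RG a E M)"
proof (induction ps)
  case (Cons p ps)
  thus ?case by (cases p) (auto simp: RG_RAT[OF _ _ _ _ RATs_adm])
qed simp

lemma RATs_mult: "all_before S T ps \<Longrightarrow> adm S T M \<Longrightarrow>
    RATs g ps (RATs h ps M) = RATs (\<lambda>x y. g x y * h x y) ps M"
proof (induction ps)
  case (Cons p ps)
  obtain x y where p: "p = (x, y)" by (cases p)
  have b: "before S T y x" "all_before S T ps" and M: "adm S T M" using Cons.prems by (auto simp: p)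
  show ?case
    unfolding p RATs_simps(2) RAT_RATs[OF b RATs_adm[OF b(2) M]] Cons.IH[OF b(2) M]
    by (rule RAT_mult[OF b(1) RATs_adm[OF b(2) M]])
qed simp

lemma RATs_perm:
  assumes "all_before S T ps" "adm S T M" "mset ps = mset qs"
  shows "RATs h ps M = RATs h qs M"
  unfolding RATs_def
proof (rule foldr_perm[where P = "adm S T" and A = "set ps"])
  show "adm S T ((case p of (x, y) \<Rightarrow> RAT (h x y) x y) M)" if "p \<in> set ps" "adm S T M" for p M
    using that assms(1) by (auto simp: all_before_def intro!: RAT_adm)
  show "(case p of (x, y) \<Rightarrow> RAT (h x y) x y) ((case q of (x, y) \<Rightarrow> RAT (h x y) x y) M) =
    (case q of (x, y) \<Rightarrow> RAT (h x y) x y) ((case p of (x, y) \<Rightarrow> RAT (h x y) x y) M)"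
    if "p \<in> set ps" "q \<in> set ps" "adm S T M" for p q M
  proof -
    obtain x y x' y' where "p = (x, y)" "q = (x', y')" by fastforce
    thus ?thesis using that assms(1) by (auto simp: all_before_def intro: RAT_RAT)
  qed
qed (use assms in auto)

lemma RATs_cong: "(\<And>x y. (x, y) \<in> set ps \<Longrightarrow> g x y = h x y) \<Longrightarrow> RATs g ps M = RATs h ps M"
  by (induction ps) auto

lemma Mul_RATs: "all_before S T ps \<Longrightarrow> adm S T M \<Longrightarrow> a \<notin> S \<Longrightarrow> (\<And>n. lin (X n)) \<Longrightarrow>
    Mul a X (RATs h ps M) = RATs h ps (Mul a X M)"
proof (induction ps)
  case (Cons p ps)
  thus ?case by (cases p) (auto simp: Mul_RAT[OF _ RATs_adm])
qed simp

lemma RAT_sum: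
  assumes "\<And>i. i \<in> A \<Longrightarrow> before S (T i) y x" "\<And>i. i \<in> A \<Longrightarrow> adm S (T i) (Ms i)" "finite A"
  shows "RAT h x y (\<lambda>e v. \<Sum>i\<in>A. Ms i e v) = (\<lambda>e v. \<Sum>i\<in>A. RAT h x y (Ms i) e v)"
  unfolding RAT_def shop_def scale_sum_right
  by (intro ext Sum_any_sum[OF assms(3)]) (rule shop_finite[OF gop_RAT[OF assms(1)] assms(2)])

lemma RATs_sum:
  assumes "\<And>i. i \<in> A \<Longrightarrow> all_before S (T i) ps" "\<And>i. i \<in> A \<Longrightarrow> adm S (T i) (Ms i)" "finite A"
  shows "RATs h ps (\<lambda>e v. \<Sum>i\<in>A. Ms i e v) = (\<lambda>e v. \<Sum>i\<in>A. RATs h ps (Ms i) e v)"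
  using assms(1)
proof (induction ps)
  case (Cons p ps)
  obtain x y where p: "p = (x, y)" by (cases p)
  have 1: "before S (T i) y x" "all_before S (T i) ps" if "i \<in> A" for i
    using Cons.prems[OF that] by (simp_all add: p)
  have IH: "RATs h ps (\<lambda>e v. \<Sum>i\<in>A. Ms i e v) = (\<lambda>e v. \<Sum>i\<in>A. RATs h ps (Ms i) e v)"
    by (rule Cons.IH) (rule 1(2))
  show ?case unfolding p RATs_simps(2) IH
    by (rule RAT_sum[OF 1(1) _ assms(3)]) (use 1(2) assms(2) RATs_adm in blast)+
qed simp

lemma RATs_scale:
  assumes "all_before S T ps" "adm S T M"
  shows "RATs h ps (\<lambda>e v. sc c (M e v)) = (\<lambda>e v. sc c (RATs h ps M e v))"
  using assms(1)
proof (induction ps)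
  case (Cons p ps)
  obtain x y where p: "p = (x, y)" by (cases p)
  have 1: "before S T y x" "all_before S T ps" using Cons.prems by (simp_all add: p)
  show ?case unfolding p RATs_simps Cons.IH[OF 1(2)]
    by (intro ext) (simp only: RAT_def shop_scale[OF gop_RAT[OF 1(1)] RATs_adm[OF 1(2) assms(2)]])
qed simp

lemma dscales_in_ratio:
  assumes "\<And>x y. (x, y) \<in> set ps \<Longrightarrow> x \<noteq> y"
  shows "dscales sc (map (\<lambda>(x, y). in_ratio (h x y) 1 x y) ps) M = RATs h ps M"
  using assms
proof (induction ps)
  case (Cons p ps)
  thus ?case by (cases p) (auto simp: dscales_def dscale_in_ratio)
qed (simp add: dscales_def)

end

text \<open>The fields are \<open>Z\<^sub>t(z) = Em\<^sub>t(z) x\<^sub>t(z) Ep\<^sub>t(z)\<close>. Since \<open>Ep\<close> commutes with all \<open>Z\<close>, moving the factors \<open>Em\<close> to the left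
  with the exchange factors \<open>H\<close> turns a product of \<open>Z\<close>s into the product of the \<open>x\<close>s between all \<open>Em\<close> and all \<open>Ep\<close>.\<close>

locale vertex_fields = filtered_space sc W
  for sc :: "complex \<Rightarrow> 'v::ab_group_add \<Rightarrow> 'v" and W :: "int \<Rightarrow> 'v set" +
  fixes J :: "'i set" and Em Ep :: "'i \<Rightarrow> nat \<Rightarrow> 'v op" and x :: "'i \<Rightarrow> int \<Rightarrow> 'v op"
    and H :: "'i \<Rightarrow> 'i \<Rightarrow> complex fps" and Z :: "'i \<Rightarrow> int \<Rightarrow> 'v op"
  assumes cre_Em: "t \<in> J \<Longrightarrow> cre (Em t)" and ann_Ep: "t \<in> J \<Longrightarrow> ann (Ep t)"
    and graded_x: "t \<in> J \<Longrightarrow> graded n (x t n)"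
    and exchange: "t \<in> J \<Longrightarrow> t' \<in> J \<Longrightarrow>
      x t n (Em t' m v) = (\<Sum>r\<le>m. sc (fps_nth (H t t') r) (Em t' (m - r) (x t (n + int r) v)))"
    and Em_Em: "t \<in> J \<Longrightarrow> t' \<in> J \<Longrightarrow> Em t r (Em t' s v) = Em t' s (Em t r v)"
    and Ep_Ep: "t \<in> J \<Longrightarrow> t' \<in> J \<Longrightarrow> Ep t r (Ep t' s v) = Ep t' s (Ep t r v)"
    and Z_eq: "t \<in> J \<Longrightarrow> Z t n v =
      Sum_any (\<lambda>r::nat. Em t r (Sum_any (\<lambda>s::nat. x t (n - int r + int s) (Ep t s v))))"
    and Ep_Z: "t \<in> J \<Longrightarrow> t' \<in> J \<Longrightarrow> Ep t' s (Z t n v) = Z t n (Ep t' s v)"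
begin

section \<open>Normal ordering of products of dressed fields\<close>

lemma lin_x: "t \<in> J \<Longrightarrow> lin (x t n)"
  using graded_x gradedD by blast

lemma Z_0: "t \<in> J \<Longrightarrow> Z t n 0 = 0"
  by (simp add: Z_eq linD[OF ann_lin[OF ann_Ep]] linD[OF lin_x] linD[OF cre_lin[OF cre_Em]])

text \<open>\<open>Ep\<close> commutes with every coefficient of M, so it may act on the vector
  before M does. A factor from the middle of the product thus becomes a multiplication from the
  right.\<close>

lemma Mul_Z:
  assumes t: "t \<in> J" and M: "\<And>e s v. Ep t s (M e v) = M e (Ep t s v)"
  shows "Mul a (Z t) M = LF a (Em t) (RG a (Ep t) (Mul a (x t) M))"
proof (intro ext)
  fix e v
  have 1: "eshift (eshift e (int r) (unitv a)) (int s) (\<lambda>s. - unitv a s) a = e a - int r + int s" for r s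
    by (simp add: eshift_def unitv_def)
  have 2: "(eshift (eshift e (int r) (unitv a)) (int s) (\<lambda>s. - unitv a s))(a := 0) = e(a := 0)" for r s
    by (auto simp: eshift_def unitv_def)
  show "Mul a (Z t) M e v = LF a (Em t) (RG a (Ep t) (Mul a (x t) M)) e v"
    unfolding Mul_def Z_eq[OF t] LF_def RG_def shop_def 1 2 M ..
qed

definition LFs :: "(nat \<Rightarrow> 'i) \<Rightarrow> nat list \<Rightarrow> (expo \<Rightarrow> 'v op) \<Rightarrow> expo \<Rightarrow> 'v op" where
  "LFs \<tau> = foldr (\<lambda>a. LF a (Em (\<tau> a)))"

definition RGs :: "(nat \<Rightarrow> 'i) \<Rightarrow> nat list \<Rightarrow> (expo \<Rightarrow> 'v op) \<Rightarrow> expo \<Rightarrow> 'v op" where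
  "RGs \<tau> = foldr (\<lambda>a. RG a (Ep (\<tau> a)))"

lemma LFs_simps [simp]: "LFs \<tau> [] M = M" "LFs \<tau> (a # vs) M = LF a (Em (\<tau> a)) (LFs \<tau> vs M)"
  and RGs_simps [simp]: "RGs \<tau> [] M = M" "RGs \<tau> (a # vs) M = RG a (Ep (\<tau> a)) (RGs \<tau> vs M)"
  by (simp_all add: LFs_def RGs_def)

lemma LFs_adm: "set vs \<subseteq> S \<Longrightarrow> finite S \<Longrightarrow> \<tau> ` set vs \<subseteq> J \<Longrightarrow> adm S T M \<Longrightarrow> adm S T (LFs \<tau> vs M)"
  by (induction vs) (auto intro!: LF_adm cre_Em)

lemma RGs_adm: "set vs \<subseteq> S \<Longrightarrow> finite S \<Longrightarrow> \<tau> ` set vs \<subseteq> J \<Longrightarrow> adm S T M \<Longrightarrow> adm S T (RGs \<tau> vs M)"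
  by (induction vs) (auto intro!: RG_adm ann_Ep)

lemma RG_LFs: "set vs \<subseteq> S \<Longrightarrow> finite S \<Longrightarrow> \<tau> ` set vs \<subseteq> J \<Longrightarrow> adm S T M \<Longrightarrow> ann E \<Longrightarrow> a \<in> S \<Longrightarrow>
    RG a E (LFs \<tau> vs M) = LFs \<tau> vs (RG a E M)"
proof (induction vs)
  case (Cons b vs)
  thus ?case using RG_LF[of E a S "Em (\<tau> b)" b T "LFs \<tau> vs M"] LFs_adm[of vs S \<tau> T M] by (auto simp: cre_Em)
qed simp

lemma LFs_RATs: "set vs \<subseteq> S \<Longrightarrow> finite S \<Longrightarrow> \<tau> ` set vs \<subseteq> J \<Longrightarrow> all_before S T ps \<Longrightarrow> adm S T M \<Longrightarrow>
    LFs \<tau> vs (RATs h ps M) = RATs h ps (LFs \<tau> vs M)"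
proof (induction vs)
  case (Cons b vs)
  thus ?case using LF_RATs[of S T ps "Em (\<tau> b)" b "LFs \<tau> vs M"] LFs_adm[of vs S \<tau> T M] by (auto simp: cre_Em)
qed simp

lemma RGs_RATs: "set vs \<subseteq> S \<Longrightarrow> finite S \<Longrightarrow> \<tau> ` set vs \<subseteq> J \<Longrightarrow> all_before S T ps \<Longrightarrow> adm S T M \<Longrightarrow>
    RGs \<tau> vs (RATs h ps M) = RATs h ps (RGs \<tau> vs M)"
proof (induction vs)
  case (Cons b vs)
  thus ?case using RG_RATs[of S T ps "Ep (\<tau> b)" b "RGs \<tau> vs M"] RGs_adm[of vs S \<tau> T M] by (auto simp: ann_Ep)
qed simp

lemma Mul_RGs:
  assumes "finite S" "adm S T M" "a \<notin> S" "\<And>n. lin (X n)"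
  shows "set vs \<subseteq> S \<Longrightarrow> \<tau> ` set vs \<subseteq> J \<Longrightarrow> Mul a X (RGs \<tau> vs M) = RGs \<tau> vs (Mul a X M)"
proof (induction vs)
  case (Cons b vs)
  thus ?case using Mul_RG[of "Ep (\<tau> b)" b S T "RGs \<tau> vs M" a X] RGs_adm[of vs S \<tau> T M] assms by (auto simp: ann_Ep)
qed simp

lemma Mul_LFs:
  assumes S: "finite S" and M: "adm S T M" and a: "a \<notin> S" and t: "t \<in> J"
    and S': "S' = insert a S" and M': "adm S' T' (Mul a (x t) M)" and b: "\<And>b. b \<in> S \<Longrightarrow> before S' T' a b"
  shows "set vs \<subseteq> S \<Longrightarrow> \<tau> ` set vs \<subseteq> J \<Longrightarrow> Mul a (x t) (LFs \<tau> vs M) =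
    RATs (\<lambda>b a. H t (\<tau> b)) (map (\<lambda>b. (b, a)) vs) (LFs \<tau> vs (Mul a (x t) M))"
proof (induction vs)
  case (Cons c vs)
  have c: "c \<in> S" "\<tau> c \<in> J" "set vs \<subseteq> S" "\<tau> ` set vs \<subseteq> J" using Cons.prems by auto
  have ab: "all_before S' T' (map (\<lambda>b. (b, a)) vs)" using c b by (auto simp: all_before_def)
  have A: "adm S' T' (LFs \<tau> vs (Mul a (x t) M))"
    by (rule LFs_adm) (use c M' S S' in auto)
  have "Mul a (x t) (LFs \<tau> (c # vs) M) = RAT (H t (\<tau> c)) c a (LF c (Em (\<tau> c)) (Mul a (x t) (LFs \<tau> vs M)))"
    unfolding LFs_simps
    by (rule Mul_LF[OF cre_Em[OF c(2)] c(1) S LFs_adm[OF c(3) S c(4) M] a lin_x[OF t]]) (rule exchange[OF t c(2)])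
  also have "\<dots> = RAT (H t (\<tau> c)) c a (RATs (\<lambda>b a. H t (\<tau> b)) (map (\<lambda>b. (b, a)) vs) (LF c (Em (\<tau> c)) (LFs \<tau> vs (Mul a (x t) M))))"
    unfolding Cons.IH[OF c(3,4)]
    by (subst LF_RATs[OF ab cre_Em[OF c(2)] _ _ A]) (use c S S' in auto)
  finally show ?case by simp
qed simp

lemma Ep_fprod_Z:
  assumes "\<tau> ` set vs \<subseteq> J" "t \<in> J"
  shows "Ep t s (fprod (\<lambda>a. Z (\<tau> a)) vs e v) = fprod (\<lambda>a. Z (\<tau> a)) vs e (Ep t s v)"
  using assms(1)
proof (induction vs arbitrary: e)
  case Nil
  show ?case using assms(2) by (simp add: unit_dist_def linD[OF ann_lin[OF ann_Ep]])
next
  case (Cons a vs)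
  thus ?case using assms(2) by (simp add: Mul_def Ep_Z)
qed

lemma fprod_x_adm: "distinct vs \<Longrightarrow> \<tau> ` set vs \<subseteq> J \<Longrightarrow> adm (set vs) (tails vs) (fprod (\<lambda>a. x (\<tau> a)) vs)"
  by (rule fprod_adm) (auto simp: graded_x)

theorem fprod_Z:
  assumes "distinct vs" "\<tau> ` set vs \<subseteq> J"
  shows "fprod (\<lambda>a. Z (\<tau> a)) vs =
    RATs (\<lambda>b a. H (\<tau> a) (\<tau> b)) (later_pairs vs) (LFs \<tau> vs (RGs \<tau> vs (fprod (\<lambda>a. x (\<tau> a)) vs)))"
  using assms
proof (induction vs)
  case (Cons a vs)
  define S where "S = set vs"
  define P where "P = fprod (\<lambda>a. x (\<tau> a)) vs"
  define P' where "P' = Mul a (x (\<tau> a)) P"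
  define S' where "S' = set (a # vs)"
  define T' where "T' = tails (a # vs)"
  have d: "distinct vs" "a \<notin> S" and t: "\<tau> a \<in> J" "\<tau> ` set vs \<subseteq> J" using Cons.prems by (auto simp: S_def)
  have P: "adm S (tails vs) P" unfolding P_def S_def by (rule fprod_x_adm[OF d(1) t(2)])
  have P': "adm S' T' P'" using fprod_x_adm[OF Cons.prems] by (simp add: P'_def P_def S'_def T'_def)
  have R: "adm S (tails vs) (RGs \<tau> vs P)" by (rule RGs_adm) (use t P in \<open>auto simp: S_def\<close>)
  have R': "adm S' T' (RGs \<tau> vs P')" by (rule RGs_adm) (use t P' in \<open>auto simp: S'_def\<close>)
  have LR: "adm S (tails vs) (LFs \<tau> vs (RGs \<tau> vs P))" by (rule LFs_adm) (use t R in \<open>auto simp: S_def\<close>)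
  have LR': "adm S' T' (LFs \<tau> vs (RGs \<tau> vs P'))" by (rule LFs_adm) (use t R' in \<open>auto simp: S'_def\<close>)
  have aS': "a \<in> S'" "finite S'" by (simp_all add: S'_def)
  have ab: "all_before S' T' (later_pairs (a # vs))" unfolding S'_def T'_def by (rule all_before_later[OF Cons.prems(1) refl])
  have MulRG: "Mul a (x (\<tau> a)) (RGs \<tau> vs P) = RGs \<tau> vs P'"
    unfolding P'_def by (rule Mul_RGs[OF _ P d(2) lin_x[OF t(1)] _ t(2)]) (simp_all add: S_def)
  \<comment> \<open>This is the only step of the induction that creates scalar factors: one for each
    variable b to the right of a, whose \<open>Em\<close> the new x has to pass.\<close>
  have MulLF: "Mul a (x (\<tau> a)) (LFs \<tau> vs (RGs \<tau> vs P)) =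
    RATs (\<lambda>b a'. H (\<tau> a) (\<tau> b)) (map (\<lambda>b. (b, a)) vs) (LFs \<tau> vs (RGs \<tau> vs P'))"
    unfolding MulRG[symmetric]
  proof (rule Mul_LFs[OF _ R d(2) t(1) _ _ _ _ t(2)])
    show "S' = insert a S" by (simp add: S'_def S_def)
    show "adm S' T' (Mul a (x (\<tau> a)) (RGs \<tau> vs P))" unfolding MulRG by (rule R')
    show "before S' T' a b" if "b \<in> S" for b
      using ab that by (auto simp: all_before_def S_def)
  qed (simp_all add: S_def)
  have eq: "RATs (\<lambda>b a'. H (\<tau> a) (\<tau> b)) (map (\<lambda>b. (b, a)) vs) N = RATs (\<lambda>b a'. H (\<tau> a') (\<tau> b)) (map (\<lambda>b. (b, a)) vs) N" for N
    by (rule RATs_cong) auto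
  have "fprod (\<lambda>a. Z (\<tau> a)) (a # vs) = LF a (Em (\<tau> a)) (RG a (Ep (\<tau> a)) (Mul a (x (\<tau> a)) (fprod (\<lambda>a. Z (\<tau> a)) vs)))"
    unfolding fprod.simps by (rule Mul_Z[OF t(1)]) (rule Ep_fprod_Z[OF t(2,1)])
  also have "\<dots> = LF a (Em (\<tau> a)) (RG a (Ep (\<tau> a)) (RATs (\<lambda>b a. H (\<tau> a) (\<tau> b)) (later_pairs vs)
      (Mul a (x (\<tau> a)) (LFs \<tau> vs (RGs \<tau> vs P)))))"
    unfolding Cons.IH[OF d(1) t(2)] P_def[symmetric]
    by (subst Mul_RATs[OF _ LR d(2) lin_x[OF t(1)]])
       (simp_all add: S_def all_before_later[OF d(1) refl])
  also have "\<dots> = LF a (Em (\<tau> a)) (RG a (Ep (\<tau> a)) (RATs (\<lambda>b a. H (\<tau> a) (\<tau> b)) (later_pairs (a # vs))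
      (LFs \<tau> vs (RGs \<tau> vs P'))))"
    unfolding MulLF eq by simp
  also have "\<dots> = RATs (\<lambda>b a. H (\<tau> a) (\<tau> b)) (later_pairs (a # vs))
     (LF a (Em (\<tau> a)) (RG a (Ep (\<tau> a)) (LFs \<tau> vs (RGs \<tau> vs P'))))"
    unfolding RG_RATs[OF ab ann_Ep[OF t(1)] aS' LR']
    by (rule LF_RATs[OF ab cre_Em[OF t(1)] aS' RG_adm[OF ann_Ep[OF t(1)] aS' LR']])
  also have "RG a (Ep (\<tau> a)) (LFs \<tau> vs (RGs \<tau> vs P')) = LFs \<tau> vs (RG a (Ep (\<tau> a)) (RGs \<tau> vs P'))"
    by (rule RG_LFs[OF _ aS'(2) t(2) R' ann_Ep[OF t(1)] aS'(1)]) (auto simp: S'_def)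
  finally show ?case by (simp add: P'_def P_def)
qed simp

text \<open>As an operation on series this is linear, commutes with multiplication by variables and
  by admissible ratios, and does not depend on the order of vs. Hence it can be applied to a
  relation whose terms are products in different orders.\<close>

definition sand :: "(nat \<Rightarrow> 'i) \<Rightarrow> nat list \<Rightarrow> (expo \<Rightarrow> 'v op) \<Rightarrow> expo \<Rightarrow> 'v op" where
  "sand \<tau> vs M = LFs \<tau> vs (RGs \<tau> vs M)"

lemma sand_adm: "set vs \<subseteq> S \<Longrightarrow> finite S \<Longrightarrow> \<tau> ` set vs \<subseteq> J \<Longrightarrow> adm S T M \<Longrightarrow> adm S T (sand \<tau> vs M)"
  unfolding sand_def by (intro LFs_adm RGs_adm)

text \<open>F is the factor prescribed for the dressed fields, G the one for the bare fields. Each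
  relation thereby comes down to F H = G for every pair of variables.\<close>

theorem RATs_fprod_Z:
  assumes vs: "distinct vs" "\<tau> ` set vs \<subseteq> J" and ps: "mset ps = mset (later_pairs vs)"
    and F: "\<And>b a. (b, a) \<in> set ps \<Longrightarrow> F b a * H (\<tau> a) (\<tau> b) = G b a"
  shows "RATs F ps (fprod (\<lambda>a. Z (\<tau> a)) vs) = sand \<tau> vs (RATs G ps (fprod (\<lambda>a. x (\<tau> a)) vs))"
proof -
  define P where "P = fprod (\<lambda>a. x (\<tau> a)) vs"
  have P: "adm (set vs) (tails vs) P" unfolding P_def by (rule fprod_x_adm[OF vs])
  have sP: "adm (set vs) (tails vs) (sand \<tau> vs P)" by (rule sand_adm) (use vs P in auto)
  have R: "adm (set vs) (tails vs) (RGs \<tau> vs P)" by (rule RGs_adm) (use vs P in auto)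
  note ab = all_before_later[OF vs(1) ps]
  have "RATs F ps (fprod (\<lambda>a. Z (\<tau> a)) vs) = RATs F ps (RATs (\<lambda>b a. H (\<tau> a) (\<tau> b)) ps (sand \<tau> vs P))"
    unfolding fprod_Z[OF vs] RATs_perm[OF ab sP ps, symmetric, unfolded sand_def] sand_def P_def[symmetric] ..
  also have "\<dots> = RATs (\<lambda>b a. F b a * H (\<tau> a) (\<tau> b)) ps (sand \<tau> vs P)"
    by (rule RATs_mult[OF ab sP])
  also have "\<dots> = RATs G ps (sand \<tau> vs P)"
    by (rule RATs_cong) (rule F)
  also have "\<dots> = sand \<tau> vs (RATs G ps P)"
    unfolding sand_def
    by (subst RGs_RATs[OF _ _ vs(2) ab P], simp_all, subst LFs_RATs[OF _ _ vs(2) ab R], simp_all)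
  finally show ?thesis by (simp add: P_def)
qed

text \<open>The \<open>Em\<close> commute with each other and so do the \<open>Ep\<close>. The
  family T is arbitrary, so M may be a combination of products in several orders.\<close>

lemma sand_perm:
  assumes "mset us = mset vs" "set us \<subseteq> S" "finite S" "\<tau> ` set us \<subseteq> J" "adm S T M"
  shows "sand \<tau> us M = sand \<tau> vs M"
proof -
  have vs: "set vs \<subseteq> S" "\<tau> ` set vs \<subseteq> J" using assms by (metis set_mset_mset)+
  have 1: "RGs \<tau> us M = RGs \<tau> vs M"
    unfolding RGs_def
    by (rule foldr_perm[where P = "adm S T" and A = "set us"])
       (use assms in \<open>auto intro!: RG_adm ann_Ep RG_RG[of _ _ S _ _ T] Ep_Ep\<close>)
  have R: "adm S T (RGs \<tau> vs M)" by (rule RGs_adm[OF vs(1) assms(3) vs(2) assms(5)])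
  show ?thesis
    unfolding sand_def 1 unfolding LFs_def
    by (rule foldr_perm[where P = "adm S T" and A = "set us"])
       (use assms R in \<open>auto intro!: LF_adm cre_Em LF_LF[of _ _ S _ _ T] Em_Em\<close>)
qed

lemma LFs_sum:
  assumes "set vs \<subseteq> S" "finite S" "\<tau> ` set vs \<subseteq> J" "finite A" "\<And>i. i \<in> A \<Longrightarrow> adm S (T i) (Ms i)"
  shows "LFs \<tau> vs (\<lambda>e v. \<Sum>i\<in>A. Ms i e v) = (\<lambda>e v. \<Sum>i\<in>A. LFs \<tau> vs (Ms i) e v)"
  using assms(1,3)
proof (induction vs)
  case (Cons a vs)
  hence a: "a \<in> S" "\<tau> a \<in> J" "set vs \<subseteq> S" "\<tau> ` set vs \<subseteq> J" by auto
  show ?case unfolding LFs_simps Cons.IH[OF a(3,4)] LF_def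
    by (intro ext shop_sum[where S = S and T = T, OF _ _ assms(4)] cre_gop cre_Em a assms(2)) (rule LFs_adm[OF a(3) assms(2) a(4) assms(5)])
qed simp

lemma RGs_sum:
  assumes "set vs \<subseteq> S" "finite S" "\<tau> ` set vs \<subseteq> J" "finite A" "\<And>i. i \<in> A \<Longrightarrow> adm S (T i) (Ms i)"
  shows "RGs \<tau> vs (\<lambda>e v. \<Sum>i\<in>A. Ms i e v) = (\<lambda>e v. \<Sum>i\<in>A. RGs \<tau> vs (Ms i) e v)"
  using assms(1,3)
proof (induction vs)
  case (Cons a vs)
  hence a: "a \<in> S" "\<tau> a \<in> J" "set vs \<subseteq> S" "\<tau> ` set vs \<subseteq> J" by auto
  show ?case unfolding RGs_simps Cons.IH[OF a(3,4)] RG_def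
    by (intro ext shop_sum[where S = S and T = T, OF _ _ assms(4)] ann_gop ann_Ep a assms(2)) (rule RGs_adm[OF a(3) assms(2) a(4) assms(5)])
qed simp

lemma sand_sum:
  assumes "set vs \<subseteq> S" "finite S" "\<tau> ` set vs \<subseteq> J" "finite A" "\<And>i. i \<in> A \<Longrightarrow> adm S (T i) (Ms i)"
  shows "sand \<tau> vs (\<lambda>e v. \<Sum>i\<in>A. Ms i e v) = (\<lambda>e v. \<Sum>i\<in>A. sand \<tau> vs (Ms i) e v)"
proof -
  have "RGs \<tau> vs (\<lambda>e v. \<Sum>i\<in>A. Ms i e v) = (\<lambda>e v. \<Sum>i\<in>A. RGs \<tau> vs (Ms i) e v)"
    by (rule RGs_sum[OF assms(1-4)]) (rule assms(5))
  thus ?thesis unfolding sand_def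
    by (simp only:) (rule LFs_sum[OF assms(1-4)], rule RGs_adm[OF assms(1-3) assms(5)])
qed

lemma LFs_scale:
  assumes "set vs \<subseteq> S" "finite S" "\<tau> ` set vs \<subseteq> J" "adm S T M"
  shows "LFs \<tau> vs (\<lambda>e v. sc c (M e v)) = (\<lambda>e v. sc c (LFs \<tau> vs M e v))"
  using assms(1,3)
proof (induction vs)
  case (Cons a vs)
  hence a: "a \<in> S" "\<tau> a \<in> J" "set vs \<subseteq> S" "\<tau> ` set vs \<subseteq> J" by auto
  show ?case unfolding LFs_simps Cons.IH[OF a(3,4)] LF_def
    by (intro ext shop_scale[of S T] cre_gop cre_Em a assms(2)) (rule LFs_adm[OF a(3) assms(2) a(4) assms(4)])
qed simp

lemma RGs_scale:
  assumes "set vs \<subseteq> S" "finite S" "\<tau> ` set vs \<subseteq> J" "adm S T M"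
  shows "RGs \<tau> vs (\<lambda>e v. sc c (M e v)) = (\<lambda>e v. sc c (RGs \<tau> vs M e v))"
  using assms(1,3)
proof (induction vs)
  case (Cons a vs)
  hence a: "a \<in> S" "\<tau> a \<in> J" "set vs \<subseteq> S" "\<tau> ` set vs \<subseteq> J" by auto
  show ?case unfolding RGs_simps Cons.IH[OF a(3,4)] RG_def
    by (intro ext shop_scale[of S T] ann_gop ann_Ep a assms(2)) (rule RGs_adm[OF a(3) assms(2) a(4) assms(4)])
qed simp

lemma sand_scale:
  assumes "set vs \<subseteq> S" "finite S" "\<tau> ` set vs \<subseteq> J" "adm S T M"
  shows "sand \<tau> vs (\<lambda>e v. sc c (M e v)) = (\<lambda>e v. sc c (sand \<tau> vs M e v))"
  unfolding sand_def RGs_scale[OF assms]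
  by (rule LFs_scale[OF assms(1-3)]) (rule RGs_adm[OF assms])

lemma sand_add:
  assumes vs: "set vs \<subseteq> S" "finite S" "\<tau> ` set vs \<subseteq> J" and M: "adm S T M" "adm S T' M'"
  shows "sand \<tau> vs (\<lambda>e v. M e v + M' e v) = (\<lambda>e v. sand \<tau> vs M e v + sand \<tau> vs M' e v)"
proof -
  have "adm S (if i then T else T') (if i then M else M')" for i using M by simp
  from sand_sum[OF vs, of "UNIV :: bool set" "\<lambda>i. if i then T else T'" "\<lambda>i. if i then M else M'", OF _ this]
  show ?thesis by (simp add: UNIV_bool add.commute)
qed

lemma sand_VS: "sand \<tau> vs (VS a M) = VS a (sand \<tau> vs M)"
proof -
  have "RGs \<tau> vs (VS a M) = VS a (RGs \<tau> vs M)" by (induction vs) (auto simp: RG_def shop_VS)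
  moreover have "LFs \<tau> vs (VS a M') = VS a (LFs \<tau> vs M')" for M' by (induction vs) (auto simp: LF_def shop_VS)
  ultimately show ?thesis by (simp add: sand_def)
qed

end

section \<open>Delta functions\<close>

text \<open>This is \<open>\<delta>(c w/z) M(w)\<close>, where \<open>w\<close> is variable \<open>0\<close> and \<open>z\<close> is variable \<open>1\<close>.\<close>

definition dilated_delta :: "(complex \<Rightarrow> 'v op) \<Rightarrow> complex \<Rightarrow> (expo \<Rightarrow> 'v op) \<Rightarrow> expo \<Rightarrow> 'v op" where
  "dilated_delta sc c M e v = sc (c powi (- e 1)) (M (e(0 := e 0 + e 1, 1 := 0)) v)"

lemma Sum_any_shift:
  fixes f :: "nat \<Rightarrow> 'a::comm_monoid_add"
  shows "Sum_any (\<lambda>r. if p \<le> r then f (r - p) else 0) = Sum_any f"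
proof -
  have "Sum_any (\<lambda>r. if p \<le> r then f (r - p) else 0) = Sum_any (\<lambda>r. if p \<le> r + p then f (r + p - p) else 0)"
  proof (rule Sum_any_reindex_inj)
    show "(if p \<le> r then f (r - p) else 0) = 0" if "r \<notin> range (\<lambda>r. r + p)" for r
      using that by (metis le_add_diff_inverse2 rangeI)
  qed (auto simp: inj_def)
  thus ?thesis by simp
qed

lemma dprod_unit_dist:
  assumes "\<And>e. X e 0 = 0" shows "X \<circledast> unit_dist = X"
proof (intro ext)
  fix e v
  have "X f (unit_dist (e - f) v) = 0" if "f \<noteq> e" for f
  proof -
    have "\<exists>b. f b \<noteq> e b" using that by (auto simp: fun_eq_iff)
    then obtain b where "f b \<noteq> e b" ..
    hence "(e - f) b \<noteq> 0" by simp
    hence "e - f \<noteq> (\<lambda>_. 0)" by metis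
    thus ?thesis using assms by (simp add: unit_dist_def)
  qed
  hence "(X \<circledast> unit_dist) e v = (\<Sum>f\<in>{e}. X f (unit_dist (e - f) v))"
    unfolding dprod_def by (intro Sum_any.expand_superset) auto
  thus "(X \<circledast> unit_dist) e v = X e v" by (simp add: unit_dist_def fun_diff_def)
qed

lemma dprod_two:
  fixes X :: "nat \<Rightarrow> int \<Rightarrow> ('v::comm_monoid_add) op"
  assumes "\<And>a n. X a n 0 = 0" "a \<noteq> b"
  shows "in_var a (X a) \<circledast> in_var b (X b) = fprod X [a, b]"
proof -
  have "in_var b (X b) \<circledast> unit_dist = in_var b (X b)"
    by (rule dprod_unit_dist) (simp add: in_var_def assms)
  moreover have "dprods (map (\<lambda>a. in_var a (X a)) [a, b]) = fprod X [a, b]"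
    by (rule dprods_eq_fprod) (use assms in auto)
  ultimately show ?thesis by (simp add: dprods_def)
qed

context filtered_space
begin

lemma additive_Sum_any:
  fixes B :: "'v op"
  assumes "\<And>x y. B (x + y) = B x + B y" "finite {a. g a \<noteq> 0}"
  shows "B (Sum_any g) = Sum_any (\<lambda>a. B (g a))"
proof -
  have z: "B 0 = 0" using assms(1)[of 0 0] by simp
  have "B (sum g A) = (\<Sum>a\<in>A. B (g a))" for A
    by (induction A rule: infinite_finite_induct) (auto simp: z assms(1))
  moreover have "Sum_any (\<lambda>a. B (g a)) = (\<Sum>a | g a \<noteq> 0. B (g a))"
    using assms(2) by (intro Sum_any.expand_superset) (auto simp: z)
  ultimately show ?thesis by (simp add: Sum_any.expand_set)
qed

text \<open>For infinite support both sides are the default value 0, as scaling by c \<noteq> 0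
  preserves the support.\<close>

lemma scale_Sum_any: "c \<noteq> 0 \<Longrightarrow> sc c (Sum_any g) = Sum_any (\<lambda>a. sc c (g a))"
proof (cases "finite {a. g a \<noteq> 0}")
  case True
  thus ?thesis by (rule lin_Sum_any[OF lin_scale[OF lin_id]])
qed simp

section \<open>Operators passing through a dressed field\<close>

definition dressed :: "(nat \<Rightarrow> 'v op) \<Rightarrow> (int \<Rightarrow> 'v op) \<Rightarrow> (nat \<Rightarrow> 'v op) \<Rightarrow> int \<Rightarrow> 'v op" where
  "dressed E X E' n v = Sum_any (\<lambda>r::nat. E r (Sum_any (\<lambda>s::nat. X (n - int r + int s) (E' s v))))"

context
  fixes E E' :: "nat \<Rightarrow> 'v op" and X :: "int \<Rightarrow> 'v op"
  assumes E: "cre E" and E': "ann E'" and X: "\<And>n. graded n (X n)"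
begin

lemma lin_EX: "lin (E r)" "lin (E' r)" "lin (X n)"
  using E E' X cre_lin ann_lin gradedD by blast+

lemma half_dressed_finite: "finite {s. X (n + int s) (E' s v) \<noteq> 0}"
proof -
  obtain N where "v \<in> W N" using W_exhaust by blast
  hence "E' s v = 0" if "s > nat N" for s
    using E' that by (intro graded_zero_vec[of "- int s"]) (auto simp: ann_def)
  hence "{s. X (n + int s) (E' s v) \<noteq> 0} \<subseteq> {..nat N}" by (auto simp: linD[OF lin_EX(3)] intro: leI)
  thus ?thesis by (rule finite_subset) simp
qed

lemma half_dressed_0:
  assumes "v \<in> W N" "N + n < 0" shows "Sum_any (\<lambda>s::nat. X (n + int s) (E' s v)) = 0"
proof -
  have "X (n + int s) (E' s v) = 0" for s
  proof (rule graded_zero_vec[OF X])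
    show "E' s v \<in> W (N + - int s)" using E' assms(1) by (intro gradedD(2)) (auto simp: ann_def)
  qed (use assms in simp)
  thus ?thesis by simp
qed

lemma dressed_finite: "finite {r. E r (Sum_any (\<lambda>s::nat. X (n - int r + int s) (E' s v))) \<noteq> 0}"
proof -
  obtain N where "v \<in> W N" using W_exhaust by blast
  hence "Sum_any (\<lambda>s::nat. X (n - int r + int s) (E' s v)) = 0" if "r > nat (N + n)" for r
    using that by (intro half_dressed_0) auto
  hence "{r. E r (Sum_any (\<lambda>s::nat. X (n - int r + int s) (E' s v))) \<noteq> 0} \<subseteq> {..nat (N + n)}"
    by (auto simp: linD[OF lin_EX(1)] intro: leI)
  thus ?thesis by (rule finite_subset) simp
qed

lemma half_dressed_add: "Sum_any (\<lambda>s::nat. X (n + int s) (E' s (v + w))) =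
    Sum_any (\<lambda>s::nat. X (n + int s) (E' s v)) + Sum_any (\<lambda>s::nat. X (n + int s) (E' s w))"
  unfolding linD(1)[OF lin_EX(2)] linD(1)[OF lin_EX(3)]
  by (rule Sum_any.distrib) (rule half_dressed_finite)+

lemma half_dressed_scale: "Sum_any (\<lambda>s::nat. X (n + int s) (E' s (sc c v))) = sc c (Sum_any (\<lambda>s::nat. X (n + int s) (E' s v)))"
  unfolding linD(2)[OF lin_EX(2)] linD(2)[OF lin_EX(3)]
  by (rule lin_Sum_any[OF lin_scale[OF lin_id] half_dressed_finite, symmetric])

lemma lin_dressed: "lin (dressed E X E' n)"
  unfolding lin_def
proof (intro conjI allI)
  fix v w c
  show "dressed E X E' n (v + w) = dressed E X E' n v + dressed E X E' n w"
    unfolding dressed_def half_dressed_add linD(1)[OF lin_EX(1)]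
    by (rule Sum_any.distrib) (rule dressed_finite)+
  show "dressed E X E' n (sc c v) = sc c (dressed E X E' n v)"
    unfolding dressed_def half_dressed_scale linD(2)[OF lin_EX(1)]
    by (rule lin_Sum_any[OF lin_scale[OF lin_id] dressed_finite, symmetric])
qed

text \<open>B becomes B' when it passes X. This covers functions of the dynamical variables, whose
  argument is shifted, and the K, which pick up a scalar.\<close>

lemma dressed_transfer:
  assumes B: "\<And>x y. B (x + y) = B x + B y" and BE: "\<And>r v. B (E r v) = E r (B v)"
    and BX: "\<And>n v. B (X n v) = X n (B' v)" and BE': "\<And>r v. B' (E' r v) = E' r (B' v)"
  shows "B (dressed E X E' n v) = dressed E X E' n (B' v)"
  unfolding dressed_def additive_Sum_any[OF B dressed_finite] BE
    additive_Sum_any[OF B half_dressed_finite] BX BE' ..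

text \<open>B plays a creation mode: it commutes with E, and what it gains from E' in the term s is
  what it loses to X in the term s - p.\<close>

lemma dressed_commute_creation:
  assumes B: "lin B" and p: "p > 0" and BE: "\<And>r v. B (E r v) = E r (B v)"
    and BX: "\<And>n v. B (X n v) = X n (B v) - sc c (X (n + int p) v)"
    and BE': "\<And>r v. B (E' r v) = E' r (B v) + (if p \<le> r then sc c (E' (r - p) v) else 0)"
  shows "B (dressed E X E' n v) = dressed E X E' n (B v)"
proof -
  have Y: "B (Sum_any (\<lambda>s::nat. X (n + int s) (E' s v))) = Sum_any (\<lambda>s::nat. X (n + int s) (E' s (B v)))" for n
  proof -
    define f where "f s = sc c (X (n + int p + int s) (E' s v))" for s
    have fin: "finite {s. f s \<noteq> 0}"
      by (rule finite_subset[OF _ half_dressed_finite[of "n + int p" v]]) (auto simp: f_def)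
    have fin2: "finite {s. (if p \<le> s then f (s - p) else 0) \<noteq> 0}"
      by (rule finite_subset[of _ "(\<lambda>s. s + p) ` {s. f s \<noteq> 0}"])
         (use fin in \<open>auto simp: image_iff intro!: exI[of _ "_ - p"] split: if_splits\<close>)
    have "B (X (n + int s) (E' s v)) = X (n + int s) (E' s (B v)) + ((if p \<le> s then f (s - p) else 0) + - f s)" for s
      unfolding BX BE' f_def by (simp add: linD[OF lin_EX(3)] of_nat_diff add_ac)
    hence "B (Sum_any (\<lambda>s::nat. X (n + int s) (E' s v))) =
        Sum_any (\<lambda>s::nat. X (n + int s) (E' s (B v)) + ((if p \<le> s then f (s - p) else 0) + - f s))"
      by (simp only: lin_Sum_any[OF B half_dressed_finite])
    also have "\<dots> = Sum_any (\<lambda>s::nat. X (n + int s) (E' s (B v))) + Sum_any (\<lambda>s. (if p \<le> s then f (s - p) else 0) + - f s)"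
    proof (rule Sum_any.distrib[OF half_dressed_finite])
      show "finite {s. (if p \<le> s then f (s - p) else 0) + - f s \<noteq> 0}"
        by (rule finite_subset[OF _ finite_UnI[OF fin fin2]]) auto
    qed
    also have "Sum_any (\<lambda>s. (if p \<le> s then f (s - p) else 0) + - f s) = Sum_any f + Sum_any (\<lambda>s. - f s)"
      using Sum_any.distrib[OF fin2, of "\<lambda>s. - f s"] fin by (simp add: Sum_any_shift)
    also have "\<dots> = 0"
      using lin_Sum_any[OF _ fin, of "\<lambda>x. - x", symmetric] by (simp add: lin_def)
    finally show ?thesis by simp
  qed
  show ?thesis
    unfolding dressed_def lin_Sum_any[OF B dressed_finite] BE Y ..
qed

text \<open>Mirror image: an annihilation mode commutes with E', and its contribution from E cancels
  the one from X. As E stands outside, the commutator with the inner product of X and E' is computed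
  beforehand.\<close>

lemma dressed_commute_annihilation:
  assumes B: "lin B" and p: "p > 0" and BE': "\<And>r v. B (E' r v) = E' r (B v)"
    and BX: "\<And>n v. B (X n v) = X n (B v) - sc c (X (n - int p) v)"
    and BE: "\<And>r v. B (E r v) = E r (B v) + (if p \<le> r then sc c (E (r - p) v) else 0)"
  shows "B (dressed E X E' n v) = dressed E X E' n (B v)"
proof -
  define Y where "Y n v = Sum_any (\<lambda>s::nat. X (n + int s) (E' s v))" for n v
  have Y: "B (Y n v) = Y n (B v) - sc c (Y (n - int p) v)" for n
  proof -
    have fin: "finite {s. sc c (X (n - int p + int s) (E' s v)) \<noteq> 0}"
      by (rule finite_subset[OF _ half_dressed_finite[of "n - int p" v]]) auto
    have eq: "n + int s - int p = n - int p + int s" for s by simp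
    have "B (Y n v) = Sum_any (\<lambda>s::nat. X (n + int s) (E' s (B v)) + sc (- c) (X (n - int p + int s) (E' s v)))"
      unfolding Y_def lin_Sum_any[OF B half_dressed_finite] BX BE' eq by simp
    also have "\<dots> = Y n (B v) + Sum_any (\<lambda>s::nat. sc (- c) (X (n - int p + int s) (E' s v)))"
      unfolding Y_def using fin by (intro Sum_any.distrib half_dressed_finite) simp
    also have "Sum_any (\<lambda>s::nat. sc (- c) (X (n - int p + int s) (E' s v))) = sc (- c) (Y (n - int p) v)"
      unfolding Y_def by (rule lin_Sum_any[OF lin_scale[OF lin_id] half_dressed_finite, symmetric])
    finally show ?thesis by simp
  qed
  define f where "f r = sc c (E r (Y (n - int p - int r) v))" for r
  have fin: "finite {r. f r \<noteq> 0}"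
    by (rule finite_subset[OF _ dressed_finite[of "n - int p" v]]) (auto simp: f_def Y_def)
  have fin2: "finite {s. (if p \<le> s then f (s - p) else 0) \<noteq> 0}"
    by (rule finite_subset[of _ "(\<lambda>s. s + p) ` {s. f s \<noteq> 0}"])
       (use fin in \<open>auto simp: image_iff intro!: exI[of _ "_ - p"] split: if_splits\<close>)
  have fY: "finite {r. E r (Y (n - int r) v) \<noteq> 0}" for v unfolding Y_def by (rule dressed_finite)
  have "B (E r (Y (n - int r) v)) = E r (Y (n - int r) (B v)) + ((if p \<le> r then f (r - p) else 0) + - f r)" for r
    unfolding BE Y f_def by (simp add: linD[OF lin_EX(1)] of_nat_diff diff_diff_eq add_ac)
  hence "B (dressed E X E' n v) = Sum_any (\<lambda>r. E r (Y (n - int r) (B v)) + ((if p \<le> r then f (r - p) else 0) + - f r))"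
    unfolding dressed_def Y_def[symmetric] by (simp only: lin_Sum_any[OF B fY])
  also have "\<dots> = Sum_any (\<lambda>r. E r (Y (n - int r) (B v))) + Sum_any (\<lambda>s. (if p \<le> s then f (s - p) else 0) + - f s)"
  proof (rule Sum_any.distrib[OF fY])
    show "finite {s. (if p \<le> s then f (s - p) else 0) + - f s \<noteq> 0}"
      by (rule finite_subset[OF _ finite_UnI[OF fin fin2]]) auto
  qed
  also have "Sum_any (\<lambda>s. (if p \<le> s then f (s - p) else 0) + - f s) = Sum_any f + Sum_any (\<lambda>s. - f s)"
    using Sum_any.distrib[OF fin2, of "\<lambda>s. - f s"] fin by (simp add: Sum_any_shift)
  also have "\<dots> = 0"
    using lin_Sum_any[OF _ fin, of "\<lambda>x. - x", symmetric] by (simp add: lin_def)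
  finally show ?thesis by (simp add: dressed_def Y_def)
qed

end

lemma dprod_eq_dressed:
  assumes "\<And>n. lin (X n)" "\<And>n. lin (E n)"
  shows "(in_z E \<circledast> X \<circledast> in_inv_z E') n v = dressed E X E' n v"
proof -
  have 1: "(X \<circledast> in_inv_z E') n v = Sum_any (\<lambda>s::nat. X (n + int s) (E' s v))" for n
  proof -
    have "(X \<circledast> in_inv_z E') n v = Sum_any (\<lambda>s::nat. X (n + int s) (in_inv_z E' (n - (n + int s)) v))"
      unfolding dprod_def
    proof (rule Sum_any_reindex_inj)
      fix g assume g: "g \<notin> range (\<lambda>s::nat. n + int s)"
      have "n - g > 0"
      proof (rule ccontr)
        assume "\<not> n - g > 0"
        hence "g = n + int (nat (g - n))" by simp
        thus False using g by blast
      qed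
      thus "X g (in_inv_z E' (n - g) v) = 0" by (simp add: in_inv_z_def linD[OF assms(1)])
    qed (auto simp: inj_def)
    thus ?thesis by (simp add: in_inv_z_def)
  qed
  have "(in_z E \<circledast> X \<circledast> in_inv_z E') n v = Sum_any (\<lambda>r::nat. in_z E (int r) ((X \<circledast> in_inv_z E') (n - int r) v))"
    unfolding dprod_def[of "in_z E"]
  proof (rule Sum_any_reindex_inj)
    fix f :: int assume f: "f \<notin> range int"
    hence "f < 0" by (metis nat_0_le not_le rangeI)
    thus "in_z E f ((X \<circledast> in_inv_z E') (n - f) v) = 0" by (simp add: in_z_def)
  qed (auto simp: inj_def)
  thus ?thesis by (simp add: 1 in_z_def dressed_def)
qed

lemma cre_mult: "cre E \<Longrightarrow> cre E' \<Longrightarrow> cre (\<lambda>n v. \<Sum>r\<le>n. E r (E' (n - r) v))"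
  unfolding cre_def
proof (intro allI graded_sum)
  fix n r :: nat assume *: "\<forall>r. graded (int r) (E r)" "\<forall>r. graded (int r) (E' r)" "r \<in> {..n}"
  have "graded (int r + int (n - r)) (\<lambda>v. E r (E' (n - r) v))"
    by (rule graded_comp[where f = "E r" and g = "E' (n - r)"]) (use * in blast)+
  thus "graded (int n) (\<lambda>v. E r (E' (n - r) v))" using *(3) by simp
qed

lemma ann_mult: "ann E \<Longrightarrow> ann E' \<Longrightarrow> ann (\<lambda>n v. \<Sum>r\<le>n. E r (E' (n - r) v))"
  unfolding ann_def
proof (intro allI graded_sum)
  fix n r :: nat assume *: "\<forall>r. graded (- int r) (E r)" "\<forall>r. graded (- int r) (E' r)" "r \<in> {..n}"
  have "graded (- int r + - int (n - r)) (\<lambda>v. E r (E' (n - r) v))"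
    by (rule graded_comp[where f = "E r" and g = "E' (n - r)"]) (use * in blast)+
  thus "graded (- int n) (\<lambda>v. E r (E' (n - r) v))" using *(3) by simp
qed

text \<open>The product is an exponential whose exponent is 0, and uniqueness together with
  \<open>exp_of_zero\<close> identifies it with the constant series 1.\<close>

lemma exp_of_mult3:
  assumes E: "exp_of A1 E1" "exp_of A2 E2" "exp_of A3 E3"
    and lin: "\<And>m. m > 0 \<Longrightarrow> lin (A1 m)" "\<And>m. m > 0 \<Longrightarrow> lin (A2 m)" "\<And>m. m > 0 \<Longrightarrow> lin (A3 m)"
    and linE: "\<And>n. lin (E1 n)" "\<And>n. lin (E2 n)"
    and comm: "\<And>m n v. m > 0 \<Longrightarrow> n > 0 \<Longrightarrow> A1 m (A2 n v) = A2 n (A1 m v)"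
      "\<And>m n v. m > 0 \<Longrightarrow> n > 0 \<Longrightarrow> A1 m (A3 n v) = A3 n (A1 m v)"
      "\<And>m n v. m > 0 \<Longrightarrow> n > 0 \<Longrightarrow> A2 m (A3 n v) = A3 n (A2 m v)"
    and sum: "\<And>m v. m > 0 \<Longrightarrow> A1 m v + (A2 m v + A3 m v) = 0"
  shows "(\<lambda>n v. \<Sum>r\<le>n. E1 r (\<Sum>s\<le>n - r. E2 s (E3 (n - r - s) v))) = (\<lambda>n v. if n = 0 then v else 0)"
proof -
  have "exp_of (\<lambda>m v. A2 m v + A3 m v) (\<lambda>n v. \<Sum>s\<le>n. E2 s (E3 (n - s) v))"
  proof (rule exp_of_mult[OF E(2,3) _ linE(2)])
    show "E2 n (A3 m v) = A3 m (E2 n v)" if m: "m > 0" for n m v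
      by (rule exp_of_commute[OF E(2) lin(3)[OF m]]) (rule comm(3)[OF _ m])
  qed (use lin in auto)
  hence "exp_of (\<lambda>m v. A1 m v + (A2 m v + A3 m v)) (\<lambda>n v. \<Sum>r\<le>n. E1 r (\<Sum>s\<le>n - r. E2 s (E3 (n - r - s) v)))"
  proof (rule exp_of_mult[OF E(1) _ lin(1) linE(1)])
    fix n m v assume m: "(m::nat) > 0"
    show "E1 n (A2 m v + A3 m v) = A2 m (E1 n v) + A3 m (E1 n v)"
    proof (rule exp_of_commute[OF E(1), where B = "\<lambda>v. A2 m v + A3 m v"])
      show "lin (\<lambda>v. A2 m v + A3 m v)" using m lin by (intro lin_add) auto
      show "A1 r (A2 m v + A3 m v) = A2 m (A1 r v) + A3 m (A1 r v)" if "r > 0" for r v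
        using comm(1,2)[OF that m] by (simp add: linD[OF lin(1)[OF that]])
    qed
    show "lin (\<lambda>v. A2 m v + A3 m v)" using m lin by (intro lin_add) auto
  qed auto
  from exp_of_unique[OF this exp_of_zero] show ?thesis by (intro ext) (simp add: sum)
qed

section \<open>Substitution on the support of a delta function\<close>

definition post :: "'v op \<Rightarrow> (expo \<Rightarrow> 'v op) \<Rightarrow> expo \<Rightarrow> 'v op" where
  "post K M e v = K (M e v)"

lemma LF_post:
  assumes "lin K" "cre E" "a \<in> S" "finite S" "adm S T M" "\<And>r v. E r (K v) = K (E r v)"
  shows "LF a E (post K M) = post K (LF a E M)"
proof (intro ext)
  fix e v
  show "LF a E (post K M) e v = post K (LF a E M) e v"
    unfolding LF_def post_def shop_def assms(6)
    by (rule lin_Sum_any[OF assms(1) shop_finite[OF cre_gop[OF assms(2-4)] assms(5)], symmetric])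
qed

lemma RG_post:
  assumes "lin K" "ann E" "a \<in> S" "finite S" "adm S T M"
  shows "RG a E (post K M) = post K (RG a E M)"
proof (intro ext)
  fix e v
  show "RG a E (post K M) e v = post K (RG a E M) e v"
    unfolding RG_def post_def shop_def
    by (rule lin_Sum_any[OF assms(1) shop_finite[OF ann_gop[OF assms(2-4)] assms(5)], symmetric])
qed

lemma expo_upd_shift:
  "(eshift e r (unitv 0))(0 := eshift e r (unitv 0) 0 + e 1, 1 := 0) =
     eshift (e(0 := e 0 + e 1, 1 := 0)) r (unitv 0)"
  "(eshift e r (unitv 1))(0 := eshift e r (unitv 1) 0 + (e 1 - r), 1 := 0) =
     eshift (e(0 := e 0 + e 1, 1 := 0)) r (unitv 0)"
  "eshift e r (unitv 0) 1 = e 1" "eshift e r (unitv 1) 1 = e 1 - r"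
  by (auto simp: eshift_def unitv_def fun_eq_iff)

lemma expo_upd_shift':
  "(eshift e r (\<lambda>s. - unitv 0 s))(0 := eshift e r (\<lambda>s. - unitv 0 s) 0 + e 1, 1 := 0) =
     eshift (e(0 := e 0 + e 1, 1 := 0)) r (\<lambda>s. - unitv 0 s)"
  "(eshift e r (\<lambda>s. - unitv 1 s))(0 := eshift e r (\<lambda>s. - unitv 1 s) 0 + (e 1 + r), 1 := 0) =
     eshift (e(0 := e 0 + e 1, 1 := 0)) r (\<lambda>s. - unitv 0 s)"
  "eshift e r (\<lambda>s. - unitv 0 s) 1 = e 1" "eshift e r (\<lambda>s. - unitv 1 s) 1 = e 1 + r"
  by (auto simp: eshift_def unitv_def fun_eq_iff)

text \<open>On the support of \<delta>(c w/z) one has z = c w, so a series in z becomes a series in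
  w with its r-th coefficient multiplied by c^r. In \<open>RG_delta\<close> the expansion is in 1/z,
  which gives the inverse powers.\<close>

lemma LF_delta:
  assumes "c \<noteq> 0" "\<And>r. lin (E r)"
  shows "LF 0 E (dilated_delta sc c M) = dilated_delta sc c (LF 0 E M)"
    "LF 1 E (dilated_delta sc c M) = dilated_delta sc c (LF 0 (\<lambda>r v. sc (c ^ r) (E r v)) M)"
proof -
  have nz: "c powi n \<noteq> 0" for n using assms(1) by simp
  show "LF 0 E (dilated_delta sc c M) = dilated_delta sc c (LF 0 E M)"
    unfolding LF_def dilated_delta_def[abs_def] shop_def scale_Sum_any[OF nz]
    by (simp only: expo_upd_shift linD(2)[OF assms(2)])
  have "c powi (- (n - int r)) = c powi (- n) * c ^ r" for n r
  proof -
    have "- (n - int r) = - n + int r" by simp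
    thus ?thesis using assms(1) by (simp only: power_int_add power_int_of_nat simp_thms)
  qed
  thus "LF 1 E (dilated_delta sc c M) = dilated_delta sc c (LF 0 (\<lambda>r v. sc (c ^ r) (E r v)) M)"
    unfolding LF_def dilated_delta_def[abs_def] shop_def scale_Sum_any[OF nz]
    by (simp only: expo_upd_shift linD(2)[OF assms(2)] scale_scale)
qed

lemma RG_delta:
  assumes "c \<noteq> 0" "\<And>e. lin (M e)"
  shows "RG 0 E (dilated_delta sc c M) = dilated_delta sc c (RG 0 E M)"
    "RG 1 E (dilated_delta sc c M) = dilated_delta sc c (RG 0 (\<lambda>r v. sc (inverse c ^ r) (E r v)) M)"
proof -
  have nz: "c powi n \<noteq> 0" for n using assms(1) by simp
  show "RG 0 E (dilated_delta sc c M) = dilated_delta sc c (RG 0 E M)"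
    unfolding RG_def dilated_delta_def[abs_def] shop_def scale_Sum_any[OF nz]
    by (simp only: expo_upd_shift')
  have "c powi (- (n + int r)) = c powi (- n) * inverse c ^ r" for n r
  proof -
    have "- (n + int r) = - n + - int r" by simp
    thus ?thesis using assms(1)
      by (simp only: power_int_add power_int_of_nat simp_thms power_int_minus[of c "int r"] power_inverse)
  qed
  thus "RG 1 E (dilated_delta sc c M) = dilated_delta sc c (RG 0 (\<lambda>r v. sc (inverse c ^ r) (E r v)) M)"
    unfolding RG_def dilated_delta_def[abs_def] shop_def scale_Sum_any[OF nz]
    by (simp only: expo_upd_shift' linD(2)[OF assms(2)] scale_scale)
qed

text \<open>The exponentials inside \<phi> are written as left and right multiplications of the unit
  distribution. In this form they can be merged with the dressing exponentials.\<close>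

lemma in_var_phi:
  assumes "lin K" "\<And>r. lin (A r)" and "\<And>n v. \<phi> n v = K ((in_z A \<circledast> in_inv_z B) n v)"
  shows "in_var 0 \<phi> = post K (LF 0 A (RG 0 B unit_dist))"
proof (intro ext)
  fix e v
  have inner: "Sum_any (\<lambda>s::nat. unit_dist (eshift (eshift e (int r) (unitv 0)) (int s) (\<lambda>s. - unitv 0 s)) (B s v)) =
    (if \<forall>b. b \<noteq> 0 \<longrightarrow> e b = 0 then in_inv_z B (e 0 - int r) v else 0)" for r :: nat
  proof -
    have iff: "eshift (eshift e (int r) (unitv 0)) (int s) (\<lambda>s. - unitv 0 s) = (\<lambda>_. 0) \<longleftrightarrow>
      (\<forall>b. b \<noteq> 0 \<longrightarrow> e b = 0) \<and> e 0 - int r + int s = 0" for s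
      by (auto simp: fun_eq_iff eshift_def unitv_def split: if_splits)
    show ?thesis
    proof (cases "(\<forall>b. b \<noteq> 0 \<longrightarrow> e b = 0) \<and> e 0 - int r \<le> 0")
      case True
      define s0 where "s0 = nat (int r - e 0)"
      have s0: "e 0 - int r + int s = 0 \<longleftrightarrow> s = s0" for s using True by (auto simp: s0_def)
      have "Sum_any (\<lambda>s::nat. unit_dist (eshift (eshift e (int r) (unitv 0)) (int s) (\<lambda>s. - unitv 0 s)) (B s v)) =
        Sum_any (\<lambda>s. if s = s0 then B s v else 0)"
        unfolding unit_dist_def iff s0 using True by simp
      also have "\<dots> = B s0 v" by (rule Sum_any.delta)
      finally show ?thesis using True by (simp add: in_inv_z_def s0_def)
    next
      case False
      hence "unit_dist (eshift (eshift e (int r) (unitv 0)) (int s) (\<lambda>s. - unitv 0 s)) (B s v) = 0" for s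
        by (auto simp: unit_dist_def iff)
      thus ?thesis using False by (auto simp: in_inv_z_def)
    qed
  qed
  have 2: "(in_z A \<circledast> in_inv_z B) n v = Sum_any (\<lambda>r::nat. A r (in_inv_z B (n - int r) v))" for n
  proof -
    have "(in_z A \<circledast> in_inv_z B) n v = Sum_any (\<lambda>r::nat. in_z A (int r) (in_inv_z B (n - int r) v))"
      unfolding dprod_def
    proof (rule Sum_any_reindex_inj)
      fix f :: int assume f: "f \<notin> range int"
      hence "f < 0" by (metis nat_0_le not_le rangeI)
      thus "in_z A f (in_inv_z B (n - f) v) = 0" by (simp add: in_z_def)
    qed (auto simp: inj_def)
    thus ?thesis by (simp add: in_z_def)
  qed
  show "in_var 0 \<phi> e v = post K (LF 0 A (RG 0 B unit_dist)) e v"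
  proof (cases "\<forall>b. b \<noteq> 0 \<longrightarrow> e b = 0")
    case True
    show ?thesis unfolding in_var_def post_def LF_def RG_def shop_def inner assms(3) 2 if_P[OF True] ..
  next
    case False
    show ?thesis unfolding in_var_def post_def LF_def RG_def shop_def inner assms(3) 2 if_not_P[OF False]
      by (simp only: linD(3)[OF assms(1)] linD(3)[OF assms(2)] Sum_any.neutral)
  qed
qed

text \<open>Both delta terms are brought to the form of a delta function times a series in w. In the
  second one the current is given at c z, which equals w on the support of \<delta>(w/(c
  z)).\<close>

lemma delta_ratio_dprod:
  assumes "c \<noteq> 0" "\<And>n. \<phi> n 0 = 0"
  shows "dscale sc (delta_ratio c 0 1) (in_var 0 \<phi>) = dilated_delta sc c (in_var 0 \<phi>)"
    "dscale sc (delta_ratio (inverse c) 0 1) (in_var 1 (rescale sc c \<phi>)) = dilated_delta sc (inverse c) (in_var 0 \<phi>)"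
proof -
  show "dscale sc (delta_ratio c 0 1) (in_var 0 \<phi>) = dilated_delta sc c (in_var 0 \<phi>)"
  proof (intro ext)
    fix e :: expo and v
    \<comment> \<open>The current does not involve z, so the exponent of z comes entirely from the
      delta function.\<close>
    define f0 where "f0 = ratio_expo (- e 1) 0 1"
    have "f = f0" if "sc (delta_ratio c 0 1 f) (in_var 0 \<phi> (e - f) v) \<noteq> 0" for f
    proof -
      have "f = ratio_expo (f 0) 0 1" "in_var 0 \<phi> (e - f) v \<noteq> 0"
        using that by (auto simp: delta_ratio_def split: if_splits)
      hence f: "f = ratio_expo (f 0) 0 1" "(e - f) 1 = 0" by (auto simp: in_var_def split: if_splits)
      have "f 1 = - f 0" using fun_cong[OF f(1), of 1] by (simp add: ratio_expo_def)
      hence "f 0 = - e 1" using f(2) by simp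
      thus ?thesis using f(1) by (simp add: f0_def)
    qed
    hence "dscale sc (delta_ratio c 0 1) (in_var 0 \<phi>) e v = (\<Sum>f\<in>{f0}. sc (delta_ratio c 0 1 f) (in_var 0 \<phi> (e - f) v))"
      unfolding dscale_def by (intro Sum_any.expand_superset) auto
    moreover have "e - f0 = e(0 := e 0 + e 1, 1 := 0)" by (auto simp: f0_def ratio_expo_def)
    moreover have "delta_ratio c 0 1 f0 = c powi (- e 1)" by (simp add: delta_ratio_def f0_def ratio_expo_def)
    ultimately show "dscale sc (delta_ratio c 0 1) (in_var 0 \<phi>) e v = dilated_delta sc c (in_var 0 \<phi>) e v"
      by (simp add: dilated_delta_def)
  qed
  show "dscale sc (delta_ratio (inverse c) 0 1) (in_var 1 (rescale sc c \<phi>)) = dilated_delta sc (inverse c) (in_var 0 \<phi>)"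
  proof (intro ext)
    fix e :: expo and v
    \<comment> \<open>Now the current does not involve w, so the delta function carries the whole
      exponent of w.\<close>
    define f0 where "f0 = ratio_expo (e 0) 0 1"
    have "f = f0" if "sc (delta_ratio (inverse c) 0 1 f) (in_var 1 (rescale sc c \<phi>) (e - f) v) \<noteq> 0" for f
    proof -
      have "f = ratio_expo (f 0) 0 1" "in_var 1 (rescale sc c \<phi>) (e - f) v \<noteq> 0"
        using that by (auto simp: delta_ratio_def split: if_splits)
      hence f: "f = ratio_expo (f 0) 0 1" "(e - f) 0 = 0" by (auto simp: in_var_def split: if_splits)
      hence "f 0 = e 0" by simp
      thus ?thesis using f(1) by (simp add: f0_def)
    qed
    hence "dscale sc (delta_ratio (inverse c) 0 1) (in_var 1 (rescale sc c \<phi>)) e v =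
      (\<Sum>f\<in>{f0}. sc (delta_ratio (inverse c) 0 1 f) (in_var 1 (rescale sc c \<phi>) (e - f) v))"
      unfolding dscale_def by (intro Sum_any.expand_superset) auto
    moreover have "e - f0 = e(0 := 0, 1 := e 0 + e 1)" by (auto simp: f0_def ratio_expo_def)
    moreover have "delta_ratio (inverse c) 0 1 f0 = inverse c powi e 0" by (simp add: delta_ratio_def f0_def ratio_expo_def)
    moreover have "(\<forall>b. b \<noteq> Suc 0 \<longrightarrow> (e(0 := 0, Suc 0 := e 0 + e (Suc 0))) b = 0) \<longleftrightarrow>
      (\<forall>b. b \<noteq> 0 \<longrightarrow> (e(0 := e 0 + e (Suc 0), Suc 0 := 0)) b = 0)" by auto
    moreover have "inverse c powi e 0 * c powi (e 0 + e 1) = inverse c powi (- e 1)"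
      using assms(1) by (simp add: power_int_add power_int_minus power_int_inverse field_simps)
    ultimately show "dscale sc (delta_ratio (inverse c) 0 1) (in_var 1 (rescale sc c \<phi>)) e v =
       dilated_delta sc (inverse c) (in_var 0 \<phi>) e v"
      by (simp add: dilated_delta_def in_var_def rescale_def)
  qed
qed

lemma dilated_delta_unit:
  assumes "c \<noteq> 0" "K 0 = 0"
  shows "dilated_delta sc c (post K unit_dist) e v = sc (delta_ratio c 0 1 e) (K v)"
proof -
  have "e(0 := e 0 + e 1, 1 := 0) = (\<lambda>_. 0) \<longleftrightarrow> e = ratio_expo (e 0) 0 1"
    by (auto simp: fun_eq_iff ratio_expo_def)
  moreover have "e 1 = - e 0" if "e = ratio_expo (e 0) 0 1"
    using fun_cong[OF that, of 1] by (simp add: ratio_expo_def)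
  ultimately show ?thesis
    by (auto simp: dilated_delta_def post_def unit_dist_def delta_ratio_def assms(2))
qed

end

context filtered_space
begin

lemma LF_cancel3:
  assumes E: "exp_of A1 E1" "exp_of A2 E2" "exp_of A3 E3"
    and gr: "\<And>m. m > 0 \<Longrightarrow> graded (int m) (A1 m)" "\<And>m. m > 0 \<Longrightarrow> graded (int m) (A2 m)" "\<And>m. m > 0 \<Longrightarrow> graded (int m) (A3 m)"
    and comm: "\<And>m n v. m > 0 \<Longrightarrow> n > 0 \<Longrightarrow> A1 m (A2 n v) = A2 n (A1 m v)"
      "\<And>m n v. m > 0 \<Longrightarrow> n > 0 \<Longrightarrow> A1 m (A3 n v) = A3 n (A1 m v)"
      "\<And>m n v. m > 0 \<Longrightarrow> n > 0 \<Longrightarrow> A2 m (A3 n v) = A3 n (A2 m v)"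
    and sum: "\<And>m v. m > 0 \<Longrightarrow> A1 m v + (A2 m v + A3 m v) = 0"
    and a: "a \<in> S" "finite S" and M: "adm S T M"
  shows "LF a E1 (LF a E2 (LF a E3 M)) = M"
proof -
  have c: "cre E1" "cre E2" "cre E3"
    unfolding cre_def using exp_of_graded[OF E(1), of 1] exp_of_graded[OF E(2), of 1] exp_of_graded[OF E(3), of 1] gr
    by auto
  have "LF a E1 (LF a E2 (LF a E3 M)) = LF a (\<lambda>n v. \<Sum>r\<le>n. E1 r (\<Sum>s\<le>n - r. E2 s (E3 (n - r - s) v))) M"
    unfolding LF_compose[OF c(2,3) a M] by (rule LF_compose[OF c(1) cre_mult[OF c(2,3)] a M])
  also have "(\<lambda>n v. \<Sum>r\<le>n. E1 r (\<Sum>s\<le>n - r. E2 s (E3 (n - r - s) v))) = (\<lambda>n v. if n = 0 then v else 0)"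
    by (rule exp_of_mult3[OF E gradedD(1)[OF gr(1)] gradedD(1)[OF gr(2)] gradedD(1)[OF gr(3)]
          cre_lin[OF c(1)] cre_lin[OF c(2)] comm sum]; simp)
  also have "LF a (\<lambda>n v. if n = 0 then v else 0) M = M"
    by (rule LF_unit) (simp add: linD[OF adm_lin[OF M]])
  finally show ?thesis .
qed

lemma RG_cancel3:
  assumes E: "exp_of A1 E1" "exp_of A2 E2" "exp_of A3 E3"
    and gr: "\<And>m. m > 0 \<Longrightarrow> graded (- int m) (A1 m)" "\<And>m. m > 0 \<Longrightarrow> graded (- int m) (A2 m)" "\<And>m. m > 0 \<Longrightarrow> graded (- int m) (A3 m)"
    and comm: "\<And>m n v. m > 0 \<Longrightarrow> n > 0 \<Longrightarrow> A1 m (A2 n v) = A2 n (A1 m v)"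
      "\<And>m n v. m > 0 \<Longrightarrow> n > 0 \<Longrightarrow> A1 m (A3 n v) = A3 n (A1 m v)"
      "\<And>m n v. m > 0 \<Longrightarrow> n > 0 \<Longrightarrow> A2 m (A3 n v) = A3 n (A2 m v)"
    and sum: "\<And>m v. m > 0 \<Longrightarrow> A1 m v + (A2 m v + A3 m v) = 0"
    and a: "a \<in> S" "finite S" and M: "adm S T M"
  shows "RG a E3 (RG a E2 (RG a E1 M)) = M"
proof -
  have c: "ann E1" "ann E2" "ann E3"
    unfolding ann_def using exp_of_graded[OF E(1), of "-1"] exp_of_graded[OF E(2), of "-1"] exp_of_graded[OF E(3), of "-1"] gr
    by auto
  \<comment> \<open>Reflecting the summation index compensates the reversed order in which right
    multiplications compose.\<close>
  have flip: "(\<Sum>r\<le>n. F (n - r) (G r v)) = (\<Sum>r\<le>n. F r (G (n - r) v))" for F G :: "nat \<Rightarrow> 'v op" and n v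
    by (rule sum.reindex_bij_witness[of _ "\<lambda>r. n - r" "\<lambda>r. n - r"]) auto
  have "RG a E3 (RG a E2 (RG a E1 M)) = RG a E3 (RG a (\<lambda>n v. \<Sum>r\<le>n. E1 r (E2 (n - r) v)) M)"
    unfolding RG_compose[OF c(2,1) a M] flip ..
  also have "\<dots> = RG a (\<lambda>n v. \<Sum>r\<le>n. (\<Sum>s\<le>n - r. E1 s (E2 (n - r - s) (E3 r v)))) M"
    by (rule RG_compose[OF c(3) ann_mult[OF c(1,2)] a M])
  also have "(\<lambda>n v. \<Sum>r\<le>n. (\<Sum>s\<le>n - r. E1 s (E2 (n - r - s) (E3 r v)))) =
      (\<lambda>n v. \<Sum>r\<le>n. E1 r (\<Sum>s\<le>n - r. E2 s (E3 (n - r - s) v)))"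
  proof (intro ext)
    fix n v
    have "(\<Sum>r\<le>n. (\<Sum>s\<le>n - r. E1 s (E2 (n - r - s) (E3 r v)))) = (\<Sum>s\<le>n. (\<Sum>r\<le>n - s. E1 s (E2 (n - r - s) (E3 r v))))"
      by (rule sum_triangle_swap)
    also have "\<dots> = (\<Sum>s\<le>n. E1 s (\<Sum>r\<le>n - s. E2 (n - s - r) (E3 r v)))"
      by (simp add: lin_sum[OF ann_lin[OF c(1)]] add_ac)
    also have "\<dots> = (\<Sum>r\<le>n. E1 r (\<Sum>s\<le>n - r. E2 s (E3 (n - r - s) v)))"
      by (simp only: flip[of E2 _ E3])
    finally show "(\<Sum>r\<le>n. (\<Sum>s\<le>n - r. E1 s (E2 (n - r - s) (E3 r v)))) = \<dots>" .
  qed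
  also have "\<dots> = (\<lambda>n v. if n = 0 then v else 0)"
    by (rule exp_of_mult3[OF E gradedD(1)[OF gr(1)] gradedD(1)[OF gr(2)] gradedD(1)[OF gr(3)]
          ann_lin[OF c(1)] ann_lin[OF c(2)] comm sum]; simp)
  also have "RG a (\<lambda>n v. if n = 0 then v else 0) M = M"
    by (rule RG_unit) (simp add: linD[OF adm_lin[OF M]])
  finally show ?thesis .
qed

lemma dilated_delta_adm:
  assumes c: "c \<noteq> 0" and M: "adm {0} {} M"
  shows "adm {0, 1} {} (dilated_delta sc c M)"
  unfolding adm_def
proof
  fix e :: expo
  define e' where "e' = e(0 := e 0 + e 1, 1 := 0)"
  have M1: "adm1 {0} {} e' (M e')" using M by (simp add: adm_def)
  have "adm1 {0, 1} {} e (\<lambda>v. M e' v)"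
    unfolding adm1_def
  proof (intro conjI allI impI)
    show "graded (sum e {0, 1}) (\<lambda>v. M e' v)" using adm1D(1)[OF M1] by (simp add: e'_def)
    show "e b = 0" if "v \<in> W N" "M e' v \<noteq> 0" "b \<notin> {0, 1}" for v N b
      using adm1D(3)[OF M1 that(1,2), of b] that(3) by (simp add: e'_def)
  qed auto
  thus "adm1 {0, 1} {} e (dilated_delta sc c M e)"
    unfolding dilated_delta_def[abs_def] e'_def[symmetric] by (rule adm1_scale)
qed

text \<open>The hypotheses on \<open>A, B\<close> say that on the support of \<open>\<delta>(c w / z)\<close> the dressing exponentials cancel
  the exponentials in the current \<open>\<phi>\<close>.\<close>

lemma delta_dressing_cancel:
  assumes K: "lin K" "\<And>r v. E0 r (K v) = K (E0 r v)" "\<And>r v. E1 r (K v) = K (E1 r v)"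
    and phi: "\<And>n v. \<phi> n v = K ((in_z A \<circledast> in_inv_z B) n v)" and c: "c \<noteq> 0"
    and E: "exp_of a0 E0" "exp_of a1 E1" "exp_of a2 A" "exp_of b0 F0" "exp_of b1 F1" "exp_of b2 B"
    and gr: "\<And>m a. m > 0 \<Longrightarrow> a \<in> {a0, a1, a2} \<Longrightarrow> graded (int m) (a m)"
      "\<And>m b. m > 0 \<Longrightarrow> b \<in> {b0, b1, b2} \<Longrightarrow> graded (- int m) (b m)"
    and comm: "\<And>m n v a a'. m > 0 \<Longrightarrow> n > 0 \<Longrightarrow> a \<in> {a0, a1, a2} \<Longrightarrow> a' \<in> {a0, a1, a2} \<Longrightarrow> a m (a' n v) = a' n (a m v)"
      "\<And>m n v b b'. m > 0 \<Longrightarrow> n > 0 \<Longrightarrow> b \<in> {b0, b1, b2} \<Longrightarrow> b' \<in> {b0, b1, b2} \<Longrightarrow> b m (b' n v) = b' n (b m v)"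
    and sum: "\<And>m v. m > 0 \<Longrightarrow> sc (c ^ m) (a1 m v) + (a0 m v + a2 m v) = 0"
      "\<And>m v. m > 0 \<Longrightarrow> b2 m v + (b0 m v + sc (inverse c ^ m) (b1 m v)) = 0"
  shows "LF 1 E1 (LF 0 E0 (RG 1 F1 (RG 0 F0 (dilated_delta sc c (in_var 0 \<phi>))))) e v = sc (delta_ratio c 0 1 e) (K v)"
proof -
  have cr: "cre E0" "cre E1" "cre A"
    unfolding cre_def using exp_of_graded[OF E(1), of 1] exp_of_graded[OF E(2), of 1] exp_of_graded[OF E(3), of 1] gr(1)
    by auto
  have an: "ann F0" "ann F1" "ann B"
    unfolding ann_def using exp_of_graded[OF E(4), of "-1"] exp_of_graded[OF E(5), of "-1"] exp_of_graded[OF E(6), of "-1"] gr(2)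
    by auto
  have li: "lin (a0 m)" "lin (a1 m)" "lin (a2 m)" "lin (b0 m)" "lin (b1 m)" "lin (b2 m)" if "m > 0" for m
    using gr[OF that] gradedD(1) by auto
  \<comment> \<open>E1(z) and F1(z) after the substitution z = c w.\<close>
  define E1' where "E1' r v = sc (c ^ r) (E1 r v)" for r v
  define F1' where "F1' r v = sc (inverse c ^ r) (F1 r v)" for r v
  have cr': "cre E1'" and an': "ann F1'"
    unfolding cre_def ann_def E1'_def[abs_def] F1'_def[abs_def] using cr(2) an(2)
    by (auto simp: cre_def ann_def intro: graded_scale)
  have f: "0 \<in> ({0} :: nat set)" "finite ({0} :: nat set)" by auto
  have U: "adm {0} {} unit_dist"
  proof -
    have "graded 0 (unit_dist e)" for e
      by (cases "e = (\<lambda>_. 0)") (simp_all add: unit_dist_def[abs_def] graded_0 graded_id)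
    moreover have "e = (\<lambda>_. 0)" if "unit_dist e (v :: 'v) \<noteq> 0" for e v
      using that by (auto simp: unit_dist_def split: if_splits)
    moreover have "graded (e 0) (unit_dist e)" for e :: expo
      using calculation(1)[of e] graded_0 by (cases "e = (\<lambda>_. 0)") (auto simp: unit_dist_def[abs_def])
    ultimately show ?thesis by (fastforce simp: adm_def adm1_def)
  qed
  have R1: "adm {0} {} (RG 0 B unit_dist)" by (rule RG_adm[OF an(3) f U])
  have N: "adm {0} {} (LF 0 A (RG 0 B unit_dist))" by (rule LF_adm[OF cr(3) f R1])
  have postlin: "lin (post K M e)" if "lin (M e)" for M e
    unfolding post_def[abs_def] by (rule lin_comp[OF K(1) that])
  have R2: "adm {0} {} (RG 0 F0 (LF 0 A (RG 0 B unit_dist)))" by (rule RG_adm[OF an(1) f N])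
  have R3: "adm {0} {} (RG 0 F1' (RG 0 F0 (LF 0 A (RG 0 B unit_dist))))" by (rule RG_adm[OF an' f R2])
  have L1: "adm {0} {} (LF 0 E0 (RG 0 F1' (RG 0 F0 (LF 0 A (RG 0 B unit_dist)))))" by (rule LF_adm[OF cr(1) f R3])
  have K1': "E1' r (K v) = K (E1' r v)" for r v by (simp add: E1'_def K(3) linD[OF K(1)])
  have eqE: "E1' = (\<lambda>r v. sc (c ^ r) (E1 r v))" by (intro ext) (simp add: E1'_def)
  have eqF: "F1' = (\<lambda>r v. sc (inverse c ^ r) (F1 r v))" by (intro ext) (simp add: F1'_def)
  define N where "N = LF 0 A (RG 0 B unit_dist)"
  have s0: "in_var 0 \<phi> = post K N" unfolding N_def by (rule in_var_phi[OF K(1) cre_lin[OF cr(3)] phi])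
  have p1: "RG 0 F0 (post K N) = post K (RG 0 F0 N)"
    unfolding N_def by (rule RG_post[OF K(1) an(1) f N])
  have p2: "RG 0 F1' (post K (RG 0 F0 N)) = post K (RG 0 F1' (RG 0 F0 N))"
    unfolding N_def by (rule RG_post[OF K(1) an' f R2])
  have p3: "LF 0 E0 (post K (RG 0 F1' (RG 0 F0 N))) = post K (LF 0 E0 (RG 0 F1' (RG 0 F0 N)))"
    unfolding N_def by (rule LF_post[where S = "{0}" and T = "{}"]) (simp_all only: K(1) cr f R3 K(2))
  have p4: "LF 0 E1' (post K (LF 0 E0 (RG 0 F1' (RG 0 F0 N)))) = post K (LF 0 E1' (LF 0 E0 (RG 0 F1' (RG 0 F0 N))))"
    unfolding N_def by (rule LF_post[where S = "{0}" and T = "{}"]) (simp_all only: K(1) cr' f L1 K1')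
  have s1: "RG 0 F0 (dilated_delta sc c (post K N)) = dilated_delta sc c (post K (RG 0 F0 N))"
    unfolding p1[symmetric]
    by (rule RG_delta(1)[OF c postlin]) (rule adm_lin[OF N, folded N_def])
  have s2: "RG 1 F1 (dilated_delta sc c (post K (RG 0 F0 N))) = dilated_delta sc c (post K (RG 0 F1' (RG 0 F0 N)))"
    unfolding p2[symmetric] unfolding eqF
    by (rule RG_delta(2)[OF c postlin]) (rule adm_lin[OF R2, folded N_def])
  have s3: "LF 0 E0 (dilated_delta sc c (post K (RG 0 F1' (RG 0 F0 N)))) = dilated_delta sc c (post K (LF 0 E0 (RG 0 F1' (RG 0 F0 N))))"
    unfolding p3[symmetric] by (rule LF_delta(1)[OF c cre_lin[OF cr(1)]])
  have s4: "LF 1 E1 (dilated_delta sc c (post K (LF 0 E0 (RG 0 F1' (RG 0 F0 N))))) = dilated_delta sc c (post K (LF 0 E1' (LF 0 E0 (RG 0 F1' (RG 0 F0 N)))))"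
    unfolding p4[symmetric] unfolding eqE by (rule LF_delta(2)[OF c cre_lin[OF cr(2)]])
  have "LF 1 E1 (LF 0 E0 (RG 1 F1 (RG 0 F0 (dilated_delta sc c (in_var 0 \<phi>))))) =
    dilated_delta sc c (post K (LF 0 E1' (LF 0 E0 (RG 0 F1' (RG 0 F0 (LF 0 A (RG 0 B unit_dist)))))))"
    unfolding s0 s1 s2 s3 s4 unfolding N_def ..
  \<comment> \<open>The right multiplications pass the left multiplication by A. Three exponentials
    in w then stand together on each side, with exponents adding up to 0.\<close>
  also have "RG 0 F1' (RG 0 F0 (LF 0 A (RG 0 B unit_dist))) = LF 0 A (RG 0 F1' (RG 0 F0 (RG 0 B unit_dist)))"
    by (simp only: RG_LF[OF an(1) f(1) cr(3) f R1] RG_LF[OF an' f(1) cr(3) f RG_adm[OF an(1) f R1]])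
  also have "RG 0 F1' (RG 0 F0 (RG 0 B unit_dist)) = unit_dist"
  proof (rule RG_cancel3[where ?A1.0 = b2 and ?A2.0 = b0 and ?A3.0 = "\<lambda>m v. sc (inverse c ^ m) (b1 m v)" and S = "{0}" and T = "{}"])
    show "exp_of (\<lambda>m v. sc (inverse c ^ m) (b1 m v)) F1'"
      unfolding F1'_def[abs_def] by (rule exp_of_rescale[OF E(5) li(5)])
    show "graded (- int m) (\<lambda>v. sc (inverse c ^ m) (b1 m v))" if "m > 0" for m
      using gr(2)[OF that] by (auto intro: graded_scale)
  qed (use gr(2) comm(2) sum(2) E U in \<open>auto simp: linD[OF li(4)] linD[OF li(6)]\<close>)
  also have "LF 0 E1' (LF 0 E0 (LF 0 A unit_dist)) = unit_dist"
  proof (rule LF_cancel3[where ?A1.0 = "\<lambda>m v. sc (c ^ m) (a1 m v)" and ?A2.0 = a0 and ?A3.0 = a2 and S = "{0}" and T = "{}"])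
    show "exp_of (\<lambda>m v. sc (c ^ m) (a1 m v)) E1'"
      unfolding E1'_def[abs_def] by (rule exp_of_rescale[OF E(2) li(2)])
    show "graded (int m) (\<lambda>v. sc (c ^ m) (a1 m v))" if "m > 0" for m
      using gr(1)[OF that] by (auto intro: graded_scale)
  qed (use gr(1) comm(1) sum(1) E U in \<open>auto simp: linD[OF li(1)] linD[OF li(3)]\<close>)
  finally show "LF 1 E1 (LF 0 E0 (RG 1 F1 (RG 0 F0 (dilated_delta sc c (in_var 0 \<phi>))))) e v = sc (delta_ratio c 0 1 e) (K v)"
    by (simp add: dilated_delta_unit[where K = K, OF c linD(3)[OF K(1)]])
qed

end

context vertex_fields
begin

section \<open>Transfer of relations from the bare to the dressed fields\<close>

lemma fprod_Z_adm:
  assumes "distinct vs" "\<tau> ` set vs \<subseteq> J"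
  shows "adm (set vs) (tails vs) (fprod (\<lambda>a. Z (\<tau> a)) vs)"
  unfolding fprod_Z[OF assms]
  by (intro RATs_adm LFs_adm RGs_adm all_before_later fprod_x_adm) (use assms in auto)

lemma RAT_two:
  assumes "\<tau> ` {a, b} \<subseteq> J" "a \<noteq> b" "F * H (\<tau> a) (\<tau> b) = G"
  shows "RAT F b a (fprod (\<lambda>a. Z (\<tau> a)) [a, b]) = sand \<tau> [a, b] (RAT G b a (fprod (\<lambda>a. x (\<tau> a)) [a, b]))"
  using RATs_fprod_Z[of "[a, b]" \<tau> "[(b, a)]" "\<lambda>_ _. F" "\<lambda>_ _. G"] assms by simp

lemma RAT_two_adm:
  assumes "\<tau> ` {a, b} \<subseteq> J" "a \<noteq> b"
  shows "adm {a, b} {} (RAT G b a (fprod (\<lambda>a. x (\<tau> a)) [a, b]))"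
proof -
  have d: "distinct [a, b]" "\<tau> ` set [a, b] \<subseteq> J" using assms by auto
  have "before (set [a, b]) (tails [a, b]) a b"
    by (rule before_if_later[OF d(1)]) simp
  from RAT_adm[OF this fprod_x_adm[OF d]] show ?thesis
    using adm_mono[of "{a, b}" "tails [a, b]" _ "{}"] by simp
qed

text \<open>The linear factors 1 - u w/z and 1 - u' z/w are multiplied into G and G', which leaves
  the plain variables z and w in front of the dressed products. In the application \<gamma> is minus
  a power of kappa.\<close>

theorem exchange_relation:
  assumes t: "\<tau> ` {0, 1} \<subseteq> J"
    and F: "F * H (\<tau> 1) (\<tau> 0) = (1 - fps_const u * fps_X) * G" "F' * H (\<tau> 0) (\<tau> 1) = (1 - fps_const u' * fps_X) * G'"
    and rel: "\<And>e v. VS 1 (RAT G 0 1 (fprod (\<lambda>a. x (\<tau> a)) [1, 0])) e v - sc u (VS 0 (RAT G 0 1 (fprod (\<lambda>a. x (\<tau> a)) [1, 0])) e v) =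
      sc \<gamma> (VS 0 (RAT G' 1 0 (fprod (\<lambda>a. x (\<tau> a)) [0, 1])) e v - sc u' (VS 1 (RAT G' 1 0 (fprod (\<lambda>a. x (\<tau> a)) [0, 1])) e v))"
  shows "VS 1 (RAT F 0 1 (fprod (\<lambda>a. Z (\<tau> a)) [1, 0])) e v = sc \<gamma> (VS 0 (RAT F' 1 0 (fprod (\<lambda>a. Z (\<tau> a)) [0, 1])) e v)"
proof -
  define P1 where "P1 = fprod (\<lambda>a. x (\<tau> a)) [1, 0]"
  define P2 where "P2 = fprod (\<lambda>a. x (\<tau> a)) [0, 1]"
  have b: "before {0, 1} (tails [1, 0]) 1 0" "before {0, 1} (tails [0, 1]) 0 1"
    using before_if_later[of "[1, 0]" 0 1] before_if_later[of "[0, 1]" 1 0] by (simp_all add: insert_commute)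
  have P: "adm {0, 1} (tails [1, 0]) P1" "adm {0, 1} (tails [0, 1]) P2"
    using fprod_x_adm[of "[1, 0]" \<tau>] fprod_x_adm[of "[0, 1]" \<tau>] t by (simp_all add: P1_def P2_def insert_commute)
  have A: "adm {0, 1} {} (VS a (RAT g 1 0 P2))" if "a \<in> {0, 1}" for a g
    by (rule adm_mono[OF VS_adm[OF that _ RAT_adm[OF b(2) P(2)]]]) simp_all
  have 1: "VS 1 (RAT ((1 - fps_const u * fps_X) * G) 0 1 P1) = (\<lambda>e v. VS 1 (RAT G 0 1 P1) e v - sc u (VS 0 (RAT G 0 1 P1) e v))"
    unfolding RAT_mult[OF b(1) P(1), symmetric] by (intro ext VS_RAT_linear) simp
  have 2: "VS 0 (RAT ((1 - fps_const u' * fps_X) * G') 1 0 P2) = (\<lambda>e v. VS 0 (RAT G' 1 0 P2) e v - sc u' (VS 1 (RAT G' 1 0 P2) e v))"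
    unfolding RAT_mult[OF b(2) P(2), symmetric] by (intro ext VS_RAT_linear) simp
  have "VS 1 (RAT F 0 1 (fprod (\<lambda>a. Z (\<tau> a)) [1, 0])) = sand \<tau> [1, 0] (VS 1 (RAT ((1 - fps_const u * fps_X) * G) 0 1 P1))"
    using RAT_two[of \<tau> 1 0, OF _ _ F(1)] t by (simp add: sand_VS P1_def insert_commute)
  also have "\<dots> = sand \<tau> [1, 0] (\<lambda>e v. sc \<gamma> (VS 0 (RAT ((1 - fps_const u' * fps_X) * G') 1 0 P2) e v))"
    by (simp only: 1 2 rel[folded P1_def P2_def])
  also have "\<dots> = sand \<tau> [0, 1] (\<lambda>e v. sc \<gamma> (VS 0 (RAT ((1 - fps_const u' * fps_X) * G') 1 0 P2) e v))"
    by (rule sand_perm[where S = "{0, 1}" and T = "{}"]) (use t A in \<open>auto intro!: adm_scale\<close>)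
  also have "\<dots> = (\<lambda>e v. sc \<gamma> (sand \<tau> [0, 1] (VS 0 (RAT ((1 - fps_const u' * fps_X) * G') 1 0 P2)) e v))"
    by (rule sand_scale[where S = "{0, 1}" and T = "{}"]) (use t A in auto)
  also have "sand \<tau> [0, 1] (VS 0 (RAT ((1 - fps_const u' * fps_X) * G') 1 0 P2)) = VS 0 (RAT F' 1 0 (fprod (\<lambda>a. Z (\<tau> a)) [0, 1]))"
    using RAT_two[of \<tau> 0 1, OF _ _ F(2)] t by (simp add: sand_VS P2_def)
  finally show ?thesis by simp
qed

text \<open>F and F' are inverse to the exchange factors, so no scalar series survives and the bare
  commutator itself is sandwiched.\<close>

theorem commutator_relation:
  assumes t: "\<tau> ` {0, 1} \<subseteq> J" and F: "F * H (\<tau> 1) (\<tau> 0) = 1" "F' * H (\<tau> 0) (\<tau> 1) = 1"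
  shows "RAT F 0 1 (fprod (\<lambda>a. Z (\<tau> a)) [1, 0]) e v - RAT F' 1 0 (fprod (\<lambda>a. Z (\<tau> a)) [0, 1]) e v =
    sand \<tau> [1, 0] (\<lambda>e v. fprod (\<lambda>a. x (\<tau> a)) [1, 0] e v - fprod (\<lambda>a. x (\<tau> a)) [0, 1] e v) e v"
proof -
  define P1 where "P1 = fprod (\<lambda>a. x (\<tau> a)) [1, 0]"
  define P2 where "P2 = fprod (\<lambda>a. x (\<tau> a)) [0, 1]"
  have A: "adm {0, 1} {} P1" "adm {0, 1} {} P2"
    using RAT_two_adm[of \<tau> 1 0 1] RAT_two_adm[of \<tau> 0 1 1] t by (simp_all add: RAT_1 P1_def P2_def insert_commute)
  have "RAT F 0 1 (fprod (\<lambda>a. Z (\<tau> a)) [1, 0]) = sand \<tau> [1, 0] P1"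
    using RAT_two[of \<tau> 1 0, OF _ _ F(1)] t by (simp add: RAT_1 P1_def insert_commute)
  moreover have "RAT F' 1 0 (fprod (\<lambda>a. Z (\<tau> a)) [0, 1]) = sand \<tau> [0, 1] P2"
    using RAT_two[of \<tau> 0 1, OF _ _ F(2)] t by (simp add: RAT_1 P2_def)
  moreover have "sand \<tau> [0, 1] P2 = sand \<tau> [1, 0] P2"
    by (rule sand_perm[where S = "{0, 1}" and T = "{}"]) (use t A in auto)
  moreover have "sand \<tau> [1, 0] (\<lambda>e v. P1 e v + sc (- 1) (P2 e v)) e v = sand \<tau> [1, 0] P1 e v + sc (- 1) (sand \<tau> [1, 0] P2 e v)"
    using sand_add[where S = "{0, 1}" and vs = "[1, 0]" and \<tau> = \<tau>, OF _ _ _ A(1) adm_scale[OF A(2)], of "- 1"] t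
      sand_scale[where S = "{0, 1}" and vs = "[1, 0]" and \<tau> = \<tau>, OF _ _ _ A(2), of "- 1"] by simp
  ultimately show ?thesis by (simp add: P1_def P2_def)
qed

definition serre_vars :: "nat \<Rightarrow> (nat \<Rightarrow> nat) \<Rightarrow> nat \<Rightarrow> nat list" where
  "serre_vars a \<sigma> r = map \<sigma> [1..<r + 1] @ 0 # map \<sigma> [r + 1..<a + 1]"

definition serre_outer :: "nat \<Rightarrow> (nat \<Rightarrow> nat) \<Rightarrow> (nat \<times> nat) list" where
  "serre_outer a \<sigma> = [(\<sigma> m, \<sigma> t). m \<leftarrow> [1..<a + 1], t \<leftarrow> [1..<m]]"

definition serre_inner :: "nat \<Rightarrow> (nat \<Rightarrow> nat) \<Rightarrow> nat \<Rightarrow> (nat \<times> nat) list" where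
  "serre_inner a \<sigma> r = [(0, \<sigma> s). s \<leftarrow> [1..<r + 1]] @ [(\<sigma> s, 0). s \<leftarrow> [r + 1..<a + 1]]"

lemma mset_serre_outer: "mset (serre_outer a \<sigma>) = mset (later_pairs (map \<sigma> [1..<a + 1]))"
proof (induction a)
  case (Suc a)
  have "serre_outer (Suc a) \<sigma> = serre_outer a \<sigma> @ map (\<lambda>t. (\<sigma> (Suc a), t)) (map \<sigma> [1..<Suc a])"
    by (simp add: serre_outer_def o_def)
  moreover have "map \<sigma> [1..<Suc a + 1] = map \<sigma> [1..<Suc a] @ [\<sigma> (Suc a)]" by simp
  ultimately show ?case using Suc by (simp only: mset_append mset_later_pairs_snoc) simp
qed (simp add: serre_outer_def)

text \<open>Each summand of a Serre relation carries exactly one factor for every pair of variables,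
  with the later variable in the numerator. This is what permits comparing the factors pair by pair
  after normal ordering.\<close>

lemma mset_serre_pairs:
  assumes "r \<le> a"
  shows "mset (serre_outer a \<sigma> @ serre_inner a \<sigma> r) = mset (later_pairs (serre_vars a \<sigma> r))"
proof -
  have "[1..<a + 1] = [1..<r + 1] @ [r + 1..<a + 1]"
    using upt_add_eq_append[of 1 "r + 1" "a - r"] assms by simp
  hence "map \<sigma> [1..<r + 1] @ map \<sigma> [r + 1..<a + 1] = map \<sigma> [1..<a + 1]" by (metis map_append)
  thus ?thesis
    unfolding serre_vars_def mset_later_pairs_insert mset_append mset_serre_outer
    by (simp add: serre_inner_def o_def add_ac)
qed

lemma serre_vars_props:
  assumes "\<sigma> permutes {1..a}" "r \<le> a"
  shows "distinct (serre_vars a \<sigma> r)" "set (serre_vars a \<sigma> r) = {0..a}" "\<sigma> s = 0 \<longleftrightarrow> s = 0"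
proof -
  have inj: "inj \<sigma>" using assms(1) by (rule permutes_inj)
  have im: "\<sigma> ` {1..a} = {1..a}" using assms(1) by (rule permutes_image)
  have "\<sigma> 0 = 0" using assms(1) by (rule permutes_not_in) simp
  thus "\<sigma> s = 0 \<longleftrightarrow> s = 0" using inj by (metis injD)
  have up: "set [1..<a + 1] = {1..a}" by auto
  have "[1..<a + 1] = [1..<r + 1] @ [r + 1..<a + 1]"
    using upt_add_eq_append[of 1 "r + 1" "a - r"] assms by simp
  hence sp: "map \<sigma> [1..<r + 1] @ map \<sigma> [r + 1..<a + 1] = map \<sigma> [1..<a + 1]" by (metis map_append)
  have m: "mset (serre_vars a \<sigma> r) = mset (0 # map \<sigma> [1..<a + 1])"
    unfolding sp[symmetric] serre_vars_def by simp
  have d: "distinct (0 # map \<sigma> [1..<a + 1])"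
  proof -
    have "0 \<notin> \<sigma> ` {1..a}" unfolding im by simp
    thus ?thesis using inj_on_subset[OF inj subset_UNIV] by (simp only: distinct.simps distinct_map set_map up distinct_upt simp_thms not_False_eq_True)
  qed
  show "distinct (serre_vars a \<sigma> r)" using m d by (metis mset_eq_imp_distinct_iff)
  have "set (serre_vars a \<sigma> r) = insert 0 (\<sigma> ` {1..a})"
  proof -
    have "set (serre_vars a \<sigma> r) = set (0 # map \<sigma> [1..<a + 1])" using m by (metis set_mset_mset)
    thus ?thesis by (simp only: list.set set_map up)
  qed
  also have "\<dots> = insert 0 {1..a}" by (simp only: im)
  also have "\<dots> = {0..a}" by auto
  finally show "set (serre_vars a \<sigma> r) = {0..a}" .
qed

text \<open>The outer product is moved under the sum over r, so that each summand is a word of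
  fields with a single list of pair factors. One function F suffices, because variable 0 in the
  numerator or in the denominator reveals which power of kappa belongs to the pair.\<close>

lemma serre_sum_eq:
  fixes D :: toroidal_data and i j :: nat and Y :: "nat \<Rightarrow> int \<Rightarrow> 'v op"
  defines "a \<equiv> nat (1 - aa D i j)"
  assumes Y0: "\<And>b n. Y b n 0 = 0" and Y: "\<And>b. Y b = (if b = 0 then Yj else Yi)"
    and F: "\<And>p q. F p q = (if p = 0 then fps_dilate (kap D powi (- mm D i j)) Gij else
       if q = 0 then fps_dilate (kap D powi mm D i j) Gij else Gii)"
    and ad: "\<And>\<sigma> r. \<sigma> permutes {1..a} \<Longrightarrow> r \<le> a \<Longrightarrow> adm {0..a} (tails (serre_vars a \<sigma> r)) (fprod Y (serre_vars a \<sigma> r))"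
  shows "serre_sum D sc i j Gii Gij Yi Yj = (\<lambda>e v. \<Sum>\<sigma> | \<sigma> permutes {1..a}. \<Sum>r\<le>a.
    sc ((- 1) ^ r * qbinomial (qi D i) a r) (RATs F (serre_outer a \<sigma> @ serre_inner a \<sigma> r) (fprod Y (serre_vars a \<sigma> r)) e v))"
proof (intro ext)
  fix e v
  have "dscales sc [in_ratio Gii 1 (\<sigma> m) (\<sigma> t). m \<leftarrow> [1..<a + 1], t \<leftarrow> [1..<m]]
          (\<lambda>e v. \<Sum>r\<le>a. sc ((- 1) ^ r * qbinomial (qi D i) a r)
             (dscales sc
                ([in_ratio Gij (kap D powi (- mm D i j)) 0 (\<sigma> s). s \<leftarrow> [1..<r + 1]] @
                 [in_ratio Gij (kap D powi mm D i j) (\<sigma> s) 0. s \<leftarrow> [r + 1..<a + 1]])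
                (dprods ([in_var (\<sigma> s) Yi. s \<leftarrow> [1..<r + 1]] @ [in_var 0 Yj] @
                         [in_var (\<sigma> s) Yi. s \<leftarrow> [r + 1..<a + 1]]))
                e v)) = (\<lambda>e v. \<Sum>r\<le>a.
    sc ((- 1) ^ r * qbinomial (qi D i) a r) (RATs F (serre_outer a \<sigma> @ serre_inner a \<sigma> r) (fprod Y (serre_vars a \<sigma> r)) e v))"
    if \<sigma>: "\<sigma> permutes {1..a}" for \<sigma>
  proof -
    define T where "T r = tails (serre_vars a \<sigma> r)" for r
    have nz: "\<sigma> s = 0 \<longleftrightarrow> s = 0" for s by (rule serre_vars_props(3)[OF \<sigma> order.refl])
    have inj: "\<sigma> s = \<sigma> t \<longleftrightarrow> s = t" for s t using permutes_inj[OF \<sigma>] by (auto dest: injD)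
    have ab: "all_before {0..a} (T r) (serre_outer a \<sigma> @ serre_inner a \<sigma> r)" if "r \<le> a" for r
      using all_before_later[OF serre_vars_props(1)[OF \<sigma> that] mset_serre_pairs[OF that]]
      unfolding T_def serre_vars_props(2)[OF \<sigma> that] .
    have ad': "adm {0..a} (T r) (fprod Y (serre_vars a \<sigma> r))" if "r \<le> a" for r
      unfolding T_def by (rule ad[OF \<sigma> that])
    have pr: "dprods ([in_var (\<sigma> s) Yi. s \<leftarrow> [1..<r + 1]] @ [in_var 0 Yj] @ [in_var (\<sigma> s) Yi. s \<leftarrow> [r + 1..<a + 1]]) =
        fprod Y (serre_vars a \<sigma> r)" if "r \<le> a" for r
    proof -
      have "[in_var (\<sigma> s) Yi. s \<leftarrow> [1..<r + 1]] @ [in_var 0 Yj] @ [in_var (\<sigma> s) Yi. s \<leftarrow> [r + 1..<a + 1]] =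
        map (\<lambda>b. in_var b (Y b)) (serre_vars a \<sigma> r)"
      proof -
        have "[in_var (\<sigma> s) Yi. s \<leftarrow> [1..<r + 1]] = map (\<lambda>s. in_var (\<sigma> s) (Y (\<sigma> s))) [1..<r + 1]"
          by (intro map_cong refl) (auto simp: Y nz)
        moreover have "[in_var (\<sigma> s) Yi. s \<leftarrow> [r + 1..<a + 1]] = map (\<lambda>s. in_var (\<sigma> s) (Y (\<sigma> s))) [r + 1..<a + 1]"
          by (intro map_cong refl) (auto simp: Y nz)
        moreover have "in_var 0 Yj = in_var 0 (Y 0)" by (simp add: Y)
        ultimately show ?thesis by (simp only: serre_vars_def map_append map_map o_def list.map append_Cons append_Nil)
      qed
      thus ?thesis using dprods_eq_fprod[where X = Y, OF Y0 serre_vars_props(1)[OF \<sigma> that]] by simp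
    qed
    have inn: "dscales sc ([in_ratio Gij (kap D powi (- mm D i j)) 0 (\<sigma> s). s \<leftarrow> [1..<r + 1]] @
                 [in_ratio Gij (kap D powi mm D i j) (\<sigma> s) 0. s \<leftarrow> [r + 1..<a + 1]]) M = RATs F (serre_inner a \<sigma> r) M"
      if "r \<le> a" for r and M :: "expo \<Rightarrow> 'v op"
    proof -
      have "[in_ratio Gij (kap D powi (- mm D i j)) 0 (\<sigma> s). s \<leftarrow> [1..<r + 1]] @
                 [in_ratio Gij (kap D powi mm D i j) (\<sigma> s) 0. s \<leftarrow> [r + 1..<a + 1]] =
        map (\<lambda>(p, q). in_ratio (F p q) 1 p q) (serre_inner a \<sigma> r)"
      proof -
        have "[in_ratio Gij (kap D powi (- mm D i j)) 0 (\<sigma> s). s \<leftarrow> [1..<r + 1]] = map (\<lambda>s. in_ratio (F 0 (\<sigma> s)) 1 0 (\<sigma> s)) [1..<r + 1]"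
          by (intro map_cong refl) (simp add: F in_ratio_dilate[of Gij "kap D powi (- mm D i j)"])
        moreover have "[in_ratio Gij (kap D powi mm D i j) (\<sigma> s) 0. s \<leftarrow> [r + 1..<a + 1]] = map (\<lambda>s. in_ratio (F (\<sigma> s) 0) 1 (\<sigma> s) 0) [r + 1..<a + 1]"
          by (intro map_cong refl) (auto simp: F nz in_ratio_dilate[of Gij "kap D powi mm D i j"])
        ultimately show ?thesis by (simp only: serre_inner_def map_append map_map o_def prod.case)
      qed
      moreover have "p \<noteq> q" if "(p, q) \<in> set (serre_inner a \<sigma> r)" for p q
      proof -
        from that have "(\<exists>s\<in>{1..<r + 1}. (p, q) = (0, \<sigma> s)) \<or> (\<exists>s\<in>{r + 1..<a + 1}. (p, q) = (\<sigma> s, 0))"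
          unfolding serre_inner_def set_append set_map set_upt by blast
        thus ?thesis
        proof
          assume "\<exists>s\<in>{1..<r + 1}. (p, q) = (0, \<sigma> s)"
          then obtain s where "s \<in> {1..<r + 1}" "(p, q) = (0, \<sigma> s)" ..
          thus ?thesis using nz[of s] by (cases "\<sigma> s = 0") auto
        next
          assume "\<exists>s\<in>{r + 1..<a + 1}. (p, q) = (\<sigma> s, 0)"
          then obtain s where "s \<in> {r + 1..<a + 1}" "(p, q) = (\<sigma> s, 0)" ..
          thus ?thesis using nz[of s] by auto
        qed
      qed
      ultimately show ?thesis using dscales_in_ratio[of "serre_inner a \<sigma> r" F M] by simp
    qed
    have out: "dscales sc [in_ratio Gii 1 (\<sigma> m) (\<sigma> t). m \<leftarrow> [1..<a + 1], t \<leftarrow> [1..<m]] M = RATs F (serre_outer a \<sigma>) M"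
      for M :: "expo \<Rightarrow> 'v op"
    proof -
      have "[in_ratio Gii 1 (\<sigma> m) (\<sigma> t). m \<leftarrow> [1..<a + 1], t \<leftarrow> [1..<m]] =
        map (\<lambda>(p, q). in_ratio (F p q) 1 p q) (serre_outer a \<sigma>)"
        unfolding serre_outer_def map_concat map_map o_def
        by (intro arg_cong[where f = concat] map_cong refl) (use nz in \<open>auto simp: F\<close>)
      moreover have "p \<noteq> q" if "(p, q) \<in> set (serre_outer a \<sigma>)" for p q
        using that by (auto simp: serre_outer_def inj)
      ultimately show ?thesis using dscales_in_ratio[of "serre_outer a \<sigma>" F M] by simp
    qed
    have "dscales sc [in_ratio Gii 1 (\<sigma> m) (\<sigma> t). m \<leftarrow> [1..<a + 1], t \<leftarrow> [1..<m]]
          (\<lambda>e v. \<Sum>r\<le>a. sc ((- 1) ^ r * qbinomial (qi D i) a r)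
             (dscales sc
                ([in_ratio Gij (kap D powi (- mm D i j)) 0 (\<sigma> s). s \<leftarrow> [1..<r + 1]] @
                 [in_ratio Gij (kap D powi mm D i j) (\<sigma> s) 0. s \<leftarrow> [r + 1..<a + 1]])
                (dprods ([in_var (\<sigma> s) Yi. s \<leftarrow> [1..<r + 1]] @ [in_var 0 Yj] @
                         [in_var (\<sigma> s) Yi. s \<leftarrow> [r + 1..<a + 1]]))
                e v)) = RATs F (serre_outer a \<sigma>) (\<lambda>e v. \<Sum>r\<le>a. sc ((- 1) ^ r * qbinomial (qi D i) a r)
                   (RATs F (serre_inner a \<sigma> r) (fprod Y (serre_vars a \<sigma> r)) e v))"
      unfolding out by (intro arg_cong[where f = "RATs F (serre_outer a \<sigma>)"] ext sum.cong refl) (simp only: atMost_iff inn pr)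
    also have "\<dots> = (\<lambda>e v. \<Sum>r\<le>a. RATs F (serre_outer a \<sigma>) (\<lambda>e v. sc ((- 1) ^ r * qbinomial (qi D i) a r)
                   (RATs F (serre_inner a \<sigma> r) (fprod Y (serre_vars a \<sigma> r)) e v)) e v)"
      by (rule RATs_sum[where S = "{0..a}" and T = T]) (use ab ad' in \<open>auto intro!: adm_scale RATs_adm\<close>)
    also have "\<dots> = (\<lambda>e v. \<Sum>r\<le>a. sc ((- 1) ^ r * qbinomial (qi D i) a r)
                   (RATs F (serre_outer a \<sigma> @ serre_inner a \<sigma> r) (fprod Y (serre_vars a \<sigma> r)) e v))"
    proof (intro ext sum.cong refl)
      fix e v r assume "r \<in> {..a}"
      hence r: "r \<le> a" by simp
      have "all_before {0..a} (T r) (serre_outer a \<sigma>)" "adm {0..a} (T r) (RATs F (serre_inner a \<sigma> r) (fprod Y (serre_vars a \<sigma> r)))"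
        using ab[OF r] ad'[OF r] by (auto intro: RATs_adm)
      from RATs_scale[OF this] show "RATs F (serre_outer a \<sigma>) (\<lambda>e v. sc ((- 1) ^ r * qbinomial (qi D i) a r)
                   (RATs F (serre_inner a \<sigma> r) (fprod Y (serre_vars a \<sigma> r)) e v)) e v =
         sc ((- 1) ^ r * qbinomial (qi D i) a r) (RATs F (serre_outer a \<sigma> @ serre_inner a \<sigma> r) (fprod Y (serre_vars a \<sigma> r)) e v)"
        by simp
    qed
    finally show ?thesis .
  qed
  thus "serre_sum D sc i j Gii Gij Yi Yj e v = (\<Sum>\<sigma> | \<sigma> permutes {1..a}. \<Sum>r\<le>a.
    sc ((- 1) ^ r * qbinomial (qi D i) a r) (RATs F (serre_outer a \<sigma> @ serre_inner a \<sigma> r) (fprod Y (serre_vars a \<sigma> r)) e v))"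
    unfolding serre_sum_def Let_def a_def[symmetric] by simp
qed

theorem serre_relation:
  fixes D :: toroidal_data and i j :: nat
  assumes t: "ti \<in> J" "tj \<in> J"
    and F: "Fii * H ti ti = Gii" "fps_dilate (kap D powi (- mm D i j)) Fij * H ti tj = fps_dilate (kap D powi (- mm D i j)) Gij"
      "fps_dilate (kap D powi mm D i j) Fij * H tj ti = fps_dilate (kap D powi mm D i j) Gij"
    and rel: "serre_sum D sc i j Gii Gij (x ti) (x tj) = (\<lambda>e v. 0)"
  shows "serre_sum D sc i j Fii Fij (Z ti) (Z tj) = (\<lambda>e v. 0)"
proof -
  define a where "a = nat (1 - aa D i j)"
  define \<tau> where "\<tau> b = (if b = (0::nat) then tj else ti)" for b
  define F where "F p q = (if p = (0::nat) then fps_dilate (kap D powi (- mm D i j)) Fij else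
       if q = (0::nat) then fps_dilate (kap D powi mm D i j) Fij else Fii)" for p q
  define G where "G p q = (if p = (0::nat) then fps_dilate (kap D powi (- mm D i j)) Gij else
       if q = (0::nat) then fps_dilate (kap D powi mm D i j) Gij else Gii)" for p q
  define ps where "ps \<sigma> r = serre_outer a \<sigma> @ serre_inner a \<sigma> r" for \<sigma> r
  define c where "c r = (- 1) ^ r * qbinomial (qi D i) a r" for r
  define M where "M \<sigma> r = RATs G (ps \<sigma> r) (fprod (\<lambda>b. x (\<tau> b)) (serre_vars a \<sigma> r))" for \<sigma> r
  have tau: "\<tau> ` U \<subseteq> J" for U using t by (auto simp: \<tau>_def)
  have FG: "F p q * H (\<tau> q) (\<tau> p) = G p q" if "p \<noteq> q" for p q
    using that F by (auto simp: F_def G_def \<tau>_def)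
  have Zsum: "serre_sum D sc i j Fii Fij (Z ti) (Z tj) = (\<lambda>e v. \<Sum>\<sigma> | \<sigma> permutes {1..a}. \<Sum>r\<le>a.
      sc (c r) (RATs F (ps \<sigma> r) (fprod (\<lambda>b. Z (\<tau> b)) (serre_vars a \<sigma> r)) e v))"
    unfolding a_def c_def ps_def
  proof (rule serre_sum_eq)
    fix \<sigma> r assume "\<sigma> permutes {1..nat (1 - aa D i j)}" "r \<le> nat (1 - aa D i j)"
    note p = serre_vars_props[OF this]
    from fprod_Z_adm[OF p(1) tau]
    show "adm {0..nat (1 - aa D i j)} (tails (serre_vars (nat (1 - aa D i j)) \<sigma> r))
         (fprod (\<lambda>b. Z (\<tau> b)) (serre_vars (nat (1 - aa D i j)) \<sigma> r))" unfolding p(2) .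
  qed (auto simp: \<tau>_def F_def Z_0 t)
  have xsum: "serre_sum D sc i j Gii Gij (x ti) (x tj) = (\<lambda>e v. \<Sum>\<sigma> | \<sigma> permutes {1..a}. \<Sum>r\<le>a. sc (c r) (M \<sigma> r e v))"
    unfolding a_def c_def ps_def M_def
  proof (rule serre_sum_eq)
    fix \<sigma> r assume "\<sigma> permutes {1..nat (1 - aa D i j)}" "r \<le> nat (1 - aa D i j)"
    note p = serre_vars_props[OF this]
    from fprod_x_adm[OF p(1) tau]
    show "adm {0..nat (1 - aa D i j)} (tails (serre_vars (nat (1 - aa D i j)) \<sigma> r))
         (fprod (\<lambda>b. x (\<tau> b)) (serre_vars (nat (1 - aa D i j)) \<sigma> r))" unfolding p(2) .
  qed (auto simp: \<tau>_def G_def linD[OF lin_x] t)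
  define S where "S = {0..a}"
  \<comment> \<open>One order for the dressing exponentials, common to all \<sigma> and r;
    \<open>sand_perm\<close> brings every word to it.\<close>
  define vs where "vs = [0..<a + 1]"
  have vs: "set vs \<subseteq> S" "finite S" "\<tau> ` set vs \<subseteq> J" using tau by (auto simp: vs_def S_def)
  have M: "adm S {} (M \<sigma> r)" "RATs F (ps \<sigma> r) (fprod (\<lambda>b. Z (\<tau> b)) (serre_vars a \<sigma> r)) = sand \<tau> vs (M \<sigma> r)"
    if "\<sigma> permutes {1..a}" "r \<le> a" for \<sigma> r
  proof -
    note p = serre_vars_props[OF that] and m = mset_serre_pairs[OF that(2), of \<sigma>, folded ps_def]
    have "adm S (tails (serre_vars a \<sigma> r)) (M \<sigma> r)"
      using RATs_adm[OF all_before_later[OF p(1) m] fprod_x_adm[OF p(1) tau], of G] unfolding p(2) M_def S_def .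
    thus ad: "adm S {} (M \<sigma> r)" by (rule adm_mono) simp
    have "RATs F (ps \<sigma> r) (fprod (\<lambda>b. Z (\<tau> b)) (serre_vars a \<sigma> r)) = sand \<tau> (serre_vars a \<sigma> r) (M \<sigma> r)"
      unfolding M_def
    proof (rule RATs_fprod_Z[OF p(1) tau m])
      fix b b' assume "(b, b') \<in> set (ps \<sigma> r)"
      hence "(b, b') \<in> set (later_pairs (serre_vars a \<sigma> r))" using m by (metis set_mset_mset)
      from later_pairs_props[OF p(1) this] show "F b b' * H (\<tau> b') (\<tau> b) = G b b'" by (intro FG) simp
    qed
    also have "\<dots> = sand \<tau> vs (M \<sigma> r)"
    proof (rule sand_perm[OF _ _ vs(2) tau ad])
      have "distinct vs" "set vs = set (serre_vars a \<sigma> r)" unfolding p(2) by (auto simp: vs_def)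
      thus "mset (serre_vars a \<sigma> r) = mset vs" using p(1) by (metis set_eq_iff_mset_eq_distinct)
    qed (simp add: p(2) S_def)
    finally show "RATs F (ps \<sigma> r) (fprod (\<lambda>b. Z (\<tau> b)) (serre_vars a \<sigma> r)) = sand \<tau> vs (M \<sigma> r)" .
  qed
  have fin: "finite {\<sigma>. \<sigma> permutes {1..a}}" by (rule finite_permutations) simp
  have "serre_sum D sc i j Fii Fij (Z ti) (Z tj) = (\<lambda>e v. \<Sum>\<sigma> | \<sigma> permutes {1..a}. \<Sum>r\<le>a. sc (c r) (sand \<tau> vs (M \<sigma> r) e v))"
    unfolding Zsum by (intro ext sum.cong refl) (use M(2) in auto)
  also have "\<dots> = (\<lambda>e v. \<Sum>\<sigma> | \<sigma> permutes {1..a}. \<Sum>r\<le>a. sand \<tau> vs (\<lambda>e v. sc (c r) (M \<sigma> r e v)) e v)"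
    by (intro ext sum.cong refl) (use sand_scale[OF vs M(1)] in auto)
  also have "\<dots> = (\<lambda>e v. \<Sum>\<sigma> | \<sigma> permutes {1..a}. sand \<tau> vs (\<lambda>e v. \<Sum>r\<le>a. sc (c r) (M \<sigma> r e v)) e v)"
    by (intro ext sum.cong refl, subst sand_sum[OF vs, where T = "\<lambda>_. {}"]) (auto intro!: adm_scale M(1))
  also have "\<dots> = sand \<tau> vs (\<lambda>e v. \<Sum>\<sigma> | \<sigma> permutes {1..a}. \<Sum>r\<le>a. sc (c r) (M \<sigma> r e v))"
    by (subst sand_sum[OF vs fin, where T = "\<lambda>_. {}"]) (auto intro!: adm_sum adm_scale M(1))
  also have "(\<lambda>e v. \<Sum>\<sigma> | \<sigma> permutes {1..a}. \<Sum>r\<le>a. sc (c r) (M \<sigma> r e v)) = (\<lambda>e v. 0)"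
    unfolding xsum[symmetric] by (rule rel)
  also have "sand \<tau> vs (\<lambda>e v. 0) = (\<lambda>e v. 0)"
    using sand_sum[OF vs, of "{} :: nat set" "\<lambda>_. {}" "\<lambda>_ _ _. 0"] by simp
  finally show ?thesis .
qed

end

section \<open>Modules over the toroidal algebra\<close>

definition energy_filtration :: "toroidal_data \<Rightarrow> ('v::ab_group_add) tor_rep \<Rightarrow> int \<Rightarrow> 'v set" where
  "energy_filtration D V N = module.span (scl V)
     (\<Union>\<omega>\<in>{\<omega>. \<forall>n>N. omega_space D V (\<omega> + of_int n) = {0}}. omega_space D V \<omega>)"

lemma mm_antisym: "mm D j i = - mm D i j"
proof (cases "ltype D")
  case (TA n)
  have "(j mod (n + 1) = (i + 1) mod (n + 1)) = ((i + 1) mod (n + 1) = j mod (n + 1))"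
    "((j + 1) mod (n + 1) = i mod (n + 1)) = (i mod (n + 1) = (j + 1) mod (n + 1))" by auto
  thus ?thesis by (simp only: mm_def TA kappa_exponent.simps minus_diff_eq)
qed (simp_all add: mm_def)

lemma mm_same: "mm D i i = 0"
  using mm_antisym[of D i i] by simp

lemma qpoch_quot_eq_pexp:
  assumes "norm s < 1"
  shows "qpoch_quot x y s = pexp (\<lambda>m. (y ^ m - x ^ m) / (of_nat m * (1 - s ^ m)))"
  unfolding qpoch_quot_def qpoch_eq_pexp[OF assms] pexp_divide
  by (rule pexp_cong) (simp add: diff_divide_distrib)

lemma qint_mult:
  fixes q :: complex assumes "q \<noteq> 0"
  shows "qint (q ^ d) n = (q powi (int d * n) - q powi (- (int d * n))) / (q ^ d - inverse (q ^ d))"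
proof -
  have "(q ^ d) powi n = q powi (int d * n)" for n by (simp add: power_int_mult)
  thus ?thesis by (simp add: qint_def)
qed

locale tor_module = dynamical_rep D k V
  for D :: toroidal_data and k :: complex and V :: "('v::ab_group_add) tor_rep" +
  fixes l :: complex
  assumes ok: "toroidal_data_ok D" and p_lt: "norm (pp D) < 1" and ps_lt: "norm (pstar D k) < 1"
    and Q_lt: "norm (qq D powr (2 * k)) < 1" and cat: "category_C D k l V"
begin

section \<open>Parameters of a module of level k\<close>

definition qk :: complex where "qk = qq D powr k"

lemma q_nz: "qq D \<noteq> 0" and kap_nz: "kap D \<noteq> 0" and p_nz: "pp D \<noteq> 0"
  and q_root: "n > 0 \<Longrightarrow> qq D ^ n \<noteq> 1"
  and symm_pos: "i \<in> nodes D \<Longrightarrow> symm D i > 0"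
  and bb_sym: "i \<in> nodes D \<Longrightarrow> j \<in> nodes D \<Longrightarrow> bb D i j = bb D j i"
  using ok by (auto simp: toroidal_data_ok_def)

text \<open>The logarithm of q is fixed, so complex powers at integer multiples of k are integer
  powers of the single number \<open>qk\<close>. This reduces the coefficients to field
  arithmetic.\<close>

lemma q_powr: "qq D powr (of_int n * k) = qk powi n" "qq D powr (- of_int n * k) = qk powi (- n)"
    "qq D powr (k * of_nat m) = qk ^ m" "qq D powr (- k * of_nat m) = inverse (qk ^ m)"
    "qq D powr (- k) = inverse qk" "qq D powr (2 * k) = qk\<^sup>2" "qq D powr (- 2 * k) = inverse (qk\<^sup>2)"
proof -
  have *: "qq D powr (of_int n * k) = qk powi n" for n
  proof -
    have "exp (k * Ln (qq D)) powi n = exp (of_int n * (k * Ln (qq D)))" by (rule exp_power_int)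
    thus ?thesis using q_nz by (simp add: qk_def powr_def mult.assoc)
  qed
  show "qq D powr (of_int n * k) = qk powi n" by (rule *)
  show "qq D powr (- of_int n * k) = qk powi (- n)" using *[of "- n"] by simp
  show "qq D powr (k * of_nat m) = qk ^ m" using *[of "int m"] by (simp add: mult.commute)
  show "qq D powr (- k * of_nat m) = inverse (qk ^ m)"
    using *[of "- int m"] by (simp add: mult.commute power_int_minus)
  show "qq D powr (- k) = inverse qk" using *[of "- 1"] by (simp add: power_int_minus)
  show "qq D powr (2 * k) = qk\<^sup>2" using *[of "2"] by (simp add: power2_eq_square power_int_def)
  show "qq D powr (- 2 * k) = inverse (qk\<^sup>2)" using *[of "- 2"] by (simp add: power2_eq_square power_int_def)
qed

lemma qk_nz: "qk \<noteq> 0" using q_nz by (simp add: qk_def)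

lemma Q_norm: "norm (qk\<^sup>2) < 1" using Q_lt by (simp add: q_powr)

lemma pstar_eq: "pp D = pstar D k * qk\<^sup>2"
  unfolding pstar_def q_powr(7) using qk_nz by simp

lemma ps_nz: "pstar D k \<noteq> 0" using p_nz pstar_eq by auto

text \<open>The coefficient identities are stated in Y = qk^m, P = p^m and S = pstar^m. The norm
  conditions exclude the values 1 for Y^2, P and S, hence zeros of the denominators formed from
  them.\<close>

lemma power_facts:
  assumes "m > 0"
  shows "pp D ^ m \<noteq> 1" "pstar D k ^ m \<noteq> 1" "(qk ^ m)\<^sup>2 \<noteq> 1" "qk ^ m \<noteq> 0" "pp D ^ m \<noteq> 0" "pstar D k ^ m \<noteq> 0"
    "pp D ^ m = pstar D k ^ m * (qk ^ m)\<^sup>2"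
proof -
  show "pp D ^ m \<noteq> 1" "pstar D k ^ m \<noteq> 1" using power_neq_1_if_norm_less p_lt ps_lt assms by auto
  have "(qk\<^sup>2) ^ m \<noteq> 1" using power_neq_1_if_norm_less[OF Q_norm assms] .
  thus "(qk ^ m)\<^sup>2 \<noteq> 1" by (metis power_mult mult.commute)
  show "qk ^ m \<noteq> 0" "pp D ^ m \<noteq> 0" "pstar D k ^ m \<noteq> 0" using qk_nz p_nz ps_nz by auto
  show "pp D ^ m = pstar D k ^ m * (qk ^ m)\<^sup>2"
    by (subst pstar_eq) (simp add: power_mult_distrib power_mult[symmetric] mult.commute)
qed

lemma qi_diff_nz: "i \<in> nodes D \<Longrightarrow> qi D i - inverse (qi D i) \<noteq> 0" and q_diff_nz: "qq D - inverse (qq D) \<noteq> 0"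
proof -
  have *: "qq D ^ d - inverse (qq D ^ d) \<noteq> 0" if "d > 0" for d
  proof
    assume "qq D ^ d - inverse (qq D ^ d) = 0"
    hence "qq D ^ d * qq D ^ d = 1" using q_nz by (simp add: field_simps)
    hence "qq D ^ (d + d) = 1" by (simp add: power_add)
    thus False using q_root[of "d + d"] that by simp
  qed
  show "i \<in> nodes D \<Longrightarrow> qi D i - inverse (qi D i) \<noteq> 0" using *[OF symm_pos] by (simp add: qi_def)
  show "qq D - inverse (qq D) \<noteq> 0" using *[of 1] by simp
qed

text \<open>Numerator of the q-number of \<open>b_ij n\<close>. Unlike the q_i-number of
  \<open>a_ij n\<close> it is symmetric in i and j.\<close>

definition beta :: "nat \<Rightarrow> nat \<Rightarrow> int \<Rightarrow> complex" where
  "beta i j n = qq D powi (bb D i j * n) - qq D powi (- bb D i j * n)"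

lemma beta_sym: "i \<in> nodes D \<Longrightarrow> j \<in> nodes D \<Longrightarrow> beta i j n = beta j i n"
  by (simp add: beta_def bb_sym)

lemma beta_minus: "beta i j (- n) = - beta i j n"
  by (simp add: beta_def)

lemma qint_aa: "qint (qi D i) (aa D i j * n) = beta i j n / (qi D i - inverse (qi D i))"
  unfolding qi_def qint_mult[OF q_nz] beta_def bb_def by (simp add: mult.assoc)

lemma qint_symm: "qint (qq D) (int (symm D i)) = (qi D i - inverse (qi D i)) / (qq D - inverse (qq D))"
  by (simp add: qint_def qi_def power_int_minus)

lemma linear_scl: "Vector_Spaces.linear (scl V) (scl V) f \<Longrightarrow>
    (\<forall>x y. f (x + y) = f x + f y) \<and> (\<forall>c x. f (scl V c x) = scl V c (f x))"
  unfolding Vector_Spaces.linear_iff by blast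

section \<open>The energy filtration\<close>

interpretation vs: vector_space "scl V" by (rule vector_space)

sublocale filtered_space "scl V" "energy_filtration D V"
proof (intro filtered_space.intro filtered_space_axioms.intro vector_space)
  fix N show "vs.subspace (energy_filtration D V N)" unfolding energy_filtration_def by (rule vs.subspace_span)
next
  fix M N :: int assume "M \<le> N"
  thus "energy_filtration D V M \<subseteq> energy_filtration D V N"
    unfolding energy_filtration_def by (intro vs.span_mono UN_mono) auto
next
  fix N :: int assume "N < 0"
  \<comment> \<open>For N < 0 the value n = 0 is among the n > N, so the eigenspace at \<omega>
    itself is zero.\<close>
  hence "(\<Union>\<omega>\<in>{\<omega>. \<forall>n>N. omega_space D V (\<omega> + of_int n) = {0}}. omega_space D V \<omega>) \<subseteq> {0}"
    by (force dest: spec[of _ 0])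
  hence "energy_filtration D V N \<subseteq> {0}"
    unfolding energy_filtration_def by (rule vs.span_minimal) (simp add: vs.subspace_def)
  thus "energy_filtration D V N = {0}" unfolding energy_filtration_def using vs.span_zero by blast
next
  fix v
  have mono: "energy_filtration D V M \<subseteq> energy_filtration D V N" if "M \<le> N" for M N
    using that unfolding energy_filtration_def by (intro vs.span_mono UN_mono) auto
  have sub: "vs.subspace (energy_filtration D V N)" for N unfolding energy_filtration_def by (rule vs.subspace_span)
  have "v \<in> vs.span (\<Union>\<omega>. omega_space D V \<omega>)" using cat by (simp add: category_C_def)
  moreover have "vs.subspace {v. \<exists>N. v \<in> energy_filtration D V N}"
    unfolding vs.subspace_def
  proof (intro conjI ballI allI)
    show "0 \<in> {v. \<exists>N. v \<in> energy_filtration D V N}" using sub by (auto simp: vs.subspace_def)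
    fix x y assume "x \<in> {v. \<exists>N. v \<in> energy_filtration D V N}" "y \<in> {v. \<exists>N. v \<in> energy_filtration D V N}"
    then obtain M N where "x \<in> energy_filtration D V M" "y \<in> energy_filtration D V N" by auto
    hence "x \<in> energy_filtration D V (max M N)" "y \<in> energy_filtration D V (max M N)"
      using mono[of M "max M N"] mono[of N "max M N"] by auto
    thus "x + y \<in> {v. \<exists>N. v \<in> energy_filtration D V N}" using sub by (auto simp: vs.subspace_def)
  next
    fix c x assume "x \<in> {v. \<exists>N. v \<in> energy_filtration D V N}"
    then obtain N where "x \<in> energy_filtration D V N" by auto
    hence "scl V c x \<in> energy_filtration D V N" using sub by (simp add: vs.subspace_def)
    thus "scl V c x \<in> {v. \<exists>N. v \<in> energy_filtration D V N}" by blast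
  qed
  moreover have "(\<Union>\<omega>. omega_space D V \<omega>) \<subseteq> {v. \<exists>N. v \<in> energy_filtration D V N}"
  proof
    fix x assume "x \<in> (\<Union>\<omega>. omega_space D V \<omega>)"
    then obtain \<omega> where x: "x \<in> omega_space D V \<omega>" by blast
    obtain n0 :: nat where n0: "\<forall>n>n0. omega_space D V (\<omega> + of_nat n) = {0}"
    proof -
      have "\<forall>\<omega>. \<exists>n0::nat. \<forall>n>n0. omega_space D V (\<omega> + of_nat n) = {0}"
        using cat by (simp add: category_C_def)
      thus ?thesis using that by (elim allE[of _ \<omega>] exE) blast
    qed
    have "omega_space D V (\<omega> + of_int n) = {0}" if "n > int n0" for n
    proof -
      have "omega_space D V (\<omega> + of_nat (nat n)) = {0}" using n0[rule_format, of "nat n"] that by linarith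
      thus ?thesis using that by (simp add: of_nat_nat)
    qed
    hence "x \<in> energy_filtration D V (int n0)"
      unfolding energy_filtration_def using x by (intro vs.span_base) blast
    thus "x \<in> {v. \<exists>N. v \<in> energy_filtration D V N}" by blast
  qed
  ultimately show "\<exists>N. v \<in> energy_filtration D V N" using vs.span_minimal by blast
qed

lemma linear_lin: "Vector_Spaces.linear (scl V) (scl V) f \<Longrightarrow> lin f"
  using linear_scl by (simp add: lin_def)

lemma q_powr_add: "qq D powr (\<omega> + of_int n) = qq D powi n * qq D powr \<omega>"
  by (simp add: powr_add complex_powr_of_int[OF disjI1[OF q_nz]])

text \<open>Raising \<omega> by d is a motion of d steps towards the top of the spectrum, hence
  degree -d for the filtration.\<close>

lemma graded_if_energy_shift:
  assumes f: "lin f" and sh: "\<And>v. qd V (f v) = scl V (qq D powi d) (f (qd V v))"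
  shows "graded (- d) f"
  unfolding graded_def
proof (intro conjI f allI impI)
  fix N v assume "v \<in> energy_filtration D V N"
  moreover have "vs.subspace {v. f v \<in> energy_filtration D V (N + - d)}"
    using W_subspace[of "N + - d"] by (auto simp: vs.subspace_def linD[OF f])
  moreover have "(\<Union>\<omega>\<in>{\<omega>. \<forall>n>N. omega_space D V (\<omega> + of_int n) = {0}}. omega_space D V \<omega>) \<subseteq> {v. f v \<in> energy_filtration D V (N + - d)}"
  proof (rule UN_least)
    fix \<omega> assume \<omega>: "\<omega> \<in> {\<omega>. \<forall>n>N. omega_space D V (\<omega> + of_int n) = {0}}"
    show "omega_space D V \<omega> \<subseteq> {v. f v \<in> energy_filtration D V (N + - d)}"
    proof
      fix v assume "v \<in> omega_space D V \<omega>"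
      hence "f v \<in> omega_space D V (\<omega> + of_int d)"
        by (simp add: omega_space_def sh linD[OF f] q_powr_add)
      moreover have "omega_space D V (\<omega> + of_int d + of_int n) = {0}" if "n > N + - d" for n
      proof -
        have "\<omega> + of_int d + of_int n = \<omega> + of_int (d + n)" by simp
        moreover have "d + n > N" using that by simp
        ultimately show ?thesis using \<omega> by (simp only: mem_Collect_eq)
      qed
      ultimately show "v \<in> {v. f v \<in> energy_filtration D V (N + - d)}"
        unfolding energy_filtration_def by (intro CollectI vs.span_base) blast
    qed
  qed
  ultimately show "f v \<in> energy_filtration D V (N + - d)"
    unfolding energy_filtration_def[of D V N] using vs.span_minimal by blast
qed

section \<open>Heisenberg modes, dressing exponentials and currents\<close>

lemma graded_av: "i \<in> nodes D \<Longrightarrow> n \<noteq> 0 \<Longrightarrow> graded (- n) (av V i n)"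
  by (rule graded_if_energy_shift) (auto intro: linear_lin linear_av qd_av)

lemma lin_av: "i \<in> nodes D \<Longrightarrow> n \<noteq> 0 \<Longrightarrow> lin (av V i n)"
  using linear_lin linear_av by blast

lemma lin_K: "i \<in> nodes D \<Longrightarrow> K \<in> {Kp V, Km V} \<Longrightarrow> lin (K i)"
  using linear_K linear_lin by auto

text \<open>The index \<open>(True, i)\<close> refers to \<open>x\<^sub>i\<^sup>+\<close> and \<open>\<Z>\<^sub>i\<^sup>+\<close>, and \<open>(False, i)\<close> to \<open>x\<^sub>i\<^sup>-\<close> and \<open>\<Z>\<^sub>i\<^sup>-\<close>.\<close>

definition cur :: "bool \<times> nat \<Rightarrow> int \<Rightarrow> 'v op" where
  "cur t = current ((if fst t then xp V else xm V) (snd t))"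

lemma graded_cur: "snd t \<in> nodes D \<Longrightarrow> graded n (cur t n)"
  using graded_if_energy_shift[of "cur t n" "- n"] linear_x[of "snd t" "- n"] qd_x[of "snd t"]
  by (cases "fst t") (auto simp: cur_def current_def linear_lin)

text \<open>The central value of the commutator of \<open>av V i n\<close> with
  \<open>av V j (- n)\<close>. Its companion \<open>xi\<close> is the scalar such that the
  commutator of \<open>av V i n\<close> with x_t(z) is \<open>xi\<close> z^n x_t(z).\<close>

definition pairing :: "nat \<Rightarrow> nat \<Rightarrow> int \<Rightarrow> complex" where
  "pairing i j n = beta i j n / (qi D i - inverse (qi D i)) / of_int n
        * ((qk powi n - qk powi (- n)) / (qi D j - inverse (qi D j)))
        * ((1 - pp D powi n) / (1 - pstar D k powi n))
        * kap D powi (- n * mm D i j) * qk powi (- n)"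

definition xi :: "nat \<Rightarrow> bool \<times> nat \<Rightarrow> int \<Rightarrow> complex" where
  "xi i t n = (if fst t
     then beta i (snd t) n / (qi D i - inverse (qi D i)) / of_int n * ((1 - pp D powi n) / (1 - pstar D k powi n))
         * qk powi (- n) * kap D powi (- n * mm D i (snd t))
     else - (beta i (snd t) n / (qi D i - inverse (qi D i)) / of_int n) * kap D powi (- n * mm D i (snd t)))"

lemma av_av': "i \<in> nodes D \<Longrightarrow> j \<in> nodes D \<Longrightarrow> n \<noteq> 0 \<Longrightarrow> m \<noteq> 0 \<Longrightarrow>
    av V i n (av V j m v) - av V j m (av V i n v) = scl V (if n + m = 0 then pairing i j n else 0) v"
  unfolding av_av qint_aa q_powr pairing_def ..

lemma av_cur: "i \<in> nodes D \<Longrightarrow> snd t \<in> nodes D \<Longrightarrow> m \<noteq> 0 \<Longrightarrow>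
    av V i m (cur t n v) - cur t n (av V i m v) = scl V (xi i t m) (cur t (n - m) v)"
  using av_xp[of i "snd t" m "- n" v] av_xm[of i "snd t" m "- n" v]
  unfolding cur_def current_def xi_def qint_aa q_powr by (cases "fst t") simp_all

text \<open>The factor relating \<open>alpha\<close> (for s) or \<open>alpha'\<close> (otherwise) to
  the generator \<open>av\<close>; the last quotient is [d_i].\<close>

definition dress :: "bool \<Rightarrow> nat \<Rightarrow> int \<Rightarrow> complex" where
  "dress s i n = (if s then 1 else (1 - pstar D k powi n) / (1 - pp D powi n) * qk powi n) *
     ((qi D i - inverse (qi D i)) / (qq D - inverse (qq D)))"

definition cmode :: "bool \<times> nat \<Rightarrow> nat \<Rightarrow> 'v op" where
  "cmode t m v = scl V ((if fst t then - 1 else 1) * (qq D - inverse (qq D)) /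
     (qq D powr (k * of_nat m) - qq D powr (- k * of_nat m)))
       ((if fst t then alpha D V else alpha' D k V) (snd t) (- int m) v)"

definition amode :: "bool \<times> nat \<Rightarrow> nat \<Rightarrow> 'v op" where
  "amode t m v = scl V ((if fst t then 1 else - 1) * (qq D - inverse (qq D)) /
     (qq D powr (k * of_nat m) - qq D powr (- k * of_nat m)))
       ((if fst t then alpha D V else alpha' D k V) (snd t) (int m) v)"

definition ccoef :: "bool \<times> nat \<Rightarrow> nat \<Rightarrow> complex" where
  "ccoef t m = (if fst t then - 1 else 1) * (qq D - inverse (qq D)) / (qk ^ m - inverse (qk ^ m)) * dress (fst t) (snd t) (- int m)"

definition acoef :: "bool \<times> nat \<Rightarrow> nat \<Rightarrow> complex" where
  "acoef t m = (if fst t then 1 else - 1) * (qq D - inverse (qq D)) / (qk ^ m - inverse (qk ^ m)) * dress (fst t) (snd t) (int m)"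

lemma cmode_eq: "cmode t m v = scl V (ccoef t m) (av V (snd t) (- int m) v)"
  and amode_eq: "amode t m v = scl V (acoef t m) (av V (snd t) (int m) v)"
proof -
  have of: "qq D powr (of_int n * k) = qk powi n" for n by (rule q_powr)
  show "cmode t m v = scl V (ccoef t m) (av V (snd t) (- int m) v)"
    by (cases "fst t"; simp only: cmode_def ccoef_def dress_def alpha_def alpha'_def qint_symm q_powr(3,4) of
        vs.scale_scale if_True if_False; simp add: mult_ac)
  show "amode t m v = scl V (acoef t m) (av V (snd t) (int m) v)"
    by (cases "fst t"; simp only: amode_def acoef_def dress_def alpha_def alpha'_def qint_symm q_powr(3,4) of
        vs.scale_scale if_True if_False; simp add: mult_ac)
qed

text \<open>Here Y = qk^m, S = pstar^m, P = p^m, N = q - 1/q; Ni and Nj are the same for q_i and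
  q_j, B is \<open>beta\<close>, M is m and \<kappa> a power of kappa. The equations treat the plus
  and the minus field, for creation modes and then for annihilation modes, in the shape to which the
  definitions unfold, so that they serve as rewrite rules.\<close>

lemma dressing_coefficient_identities:
  fixes Y S P N Ni Nj B M \<kappa> :: complex
  assumes "Y \<noteq> 0" "Y\<^sup>2 \<noteq> 1" "P \<noteq> 1" "S \<noteq> 1" "S \<noteq> 0" "P = S * Y\<^sup>2" "N \<noteq> 0" "Ni \<noteq> 0" "Nj \<noteq> 0" "M \<noteq> 0" "\<kappa> \<noteq> 0"
  shows "(- 1 * N / (Y - inverse Y) * (1 * (Nj / N))) * (B / Ni / M * ((Y - inverse Y) / Nj) * ((1 - P) / (1 - S)) * \<kappa> * inverse Y)
      = - (B / Ni / M * ((1 - P) / (1 - S)) * inverse Y * \<kappa>)"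
    "(1 * N / (Y - inverse Y) * (((1 - inverse S) / (1 - inverse P) * inverse Y) * (Nj / N))) * (B / Ni / M * ((Y - inverse Y) / Nj) * ((1 - P) / (1 - S)) * \<kappa> * inverse Y)
      = B / Ni / M * \<kappa>"
    "(1 * N / (Y - inverse Y) * (1 * (Nj / N))) * (- B / Ni / - M * ((inverse Y - Y) / Nj) * ((1 - inverse P) / (1 - inverse S)) * \<kappa> * Y)
      = - (- B / Ni / - M * ((1 - inverse P) / (1 - inverse S)) * Y * \<kappa>)"
    "(- 1 * N / (Y - inverse Y) * (((1 - S) / (1 - P) * Y) * (Nj / N))) * (- B / Ni / - M * ((inverse Y - Y) / Nj) * ((1 - inverse P) / (1 - inverse S)) * \<kappa> * Y)
      = - B / Ni / - M * \<kappa>"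
proof -
  define d where "d = Y - inverse Y"
  have d: "d \<noteq> 0" "inverse Y - Y = - d" using assms(1,2) by (auto simp: d_def field_simps power2_eq_square)
  have P: "P \<noteq> 0" using assms by auto
  have nz: "1 - P \<noteq> 0" "1 - S \<noteq> 0" "P - 1 \<noteq> 0" "S - 1 \<noteq> 0" using assms by auto
  have inv: "1 - inverse P = (P - 1) / P" "1 - inverse S = (S - 1) / S" using P assms by (auto simp: field_simps)
  show "(- 1 * N / (Y - inverse Y) * (1 * (Nj / N))) * (B / Ni / M * ((Y - inverse Y) / Nj) * ((1 - P) / (1 - S)) * \<kappa> * inverse Y)
      = - (B / Ni / M * ((1 - P) / (1 - S)) * inverse Y * \<kappa>)"
    unfolding d_def[symmetric] using assms d(1) by (simp add: mult_ac)
  show "(1 * N / (Y - inverse Y) * (1 * (Nj / N))) * (- B / Ni / - M * ((inverse Y - Y) / Nj) * ((1 - inverse P) / (1 - inverse S)) * \<kappa> * Y)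
      = - (- B / Ni / - M * ((1 - inverse P) / (1 - inverse S)) * Y * \<kappa>)"
    unfolding d_def[symmetric] d(2) using assms d(1) by (simp add: mult_ac)
  \<comment> \<open>The factor distinguishing \<open>alpha'\<close> from \<open>alpha\<close>
    cancels the dependence of the central term on p: the product is P/(S Y^2) = 1.\<close>
  have 2: "(1 - inverse S) / (1 - inverse P) * inverse Y * ((1 - P) / (1 - S)) * inverse Y = 1"
    unfolding inv using assms nz P by (simp add: divide_simps power2_eq_square) (simp add: algebra_simps)?
  have "(1 * N / d * (((1 - inverse S) / (1 - inverse P) * inverse Y) * (Nj / N))) * (B / Ni / M * (d / Nj) * ((1 - P) / (1 - S)) * \<kappa> * inverse Y)
      = B / Ni / M * \<kappa> * ((1 - inverse S) / (1 - inverse P) * inverse Y * ((1 - P) / (1 - S)) * inverse Y)"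
    using assms(7-10) d(1) by (simp add: mult_ac)
  thus "(1 * N / (Y - inverse Y) * (((1 - inverse S) / (1 - inverse P) * inverse Y) * (Nj / N))) * (B / Ni / M * ((Y - inverse Y) / Nj) * ((1 - P) / (1 - S)) * \<kappa> * inverse Y)
      = B / Ni / M * \<kappa>" unfolding 2 d_def by simp
  have 4: "(1 - S) / (1 - P) * Y * ((1 - inverse P) / (1 - inverse S)) * Y = 1"
    unfolding inv using assms nz P by (simp add: divide_simps power2_eq_square) (simp add: algebra_simps)?
  have "(- 1 * N / d * (((1 - S) / (1 - P) * Y) * (Nj / N))) * (- B / Ni / - M * (- d / Nj) * ((1 - inverse P) / (1 - inverse S)) * \<kappa> * Y)
      = - B / Ni / - M * \<kappa> * ((1 - S) / (1 - P) * Y * ((1 - inverse P) / (1 - inverse S)) * Y)"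
    using assms(7-10) d(1) by (simp add: mult_ac)
  thus "(- 1 * N / (Y - inverse Y) * (((1 - S) / (1 - P) * Y) * (Nj / N))) * (- B / Ni / - M * ((inverse Y - Y) / Nj) * ((1 - inverse P) / (1 - inverse S)) * \<kappa> * Y)
      = - B / Ni / - M * \<kappa>" unfolding 4 d(2)[symmetric] d_def[symmetric] by simp
qed

text \<open>This is what fixes the constants in the exponents of E^- and E^+: the commutator of a
  Heisenberg mode with the exponential has to compensate its commutator with x.\<close>

lemma ccoef_pairing:
  assumes "i \<in> nodes D" "snd t \<in> nodes D" "m > 0"
  shows "ccoef t m * pairing i (snd t) (int m) = - xi i t (int m)"
    "acoef t m * pairing i (snd t) (- int m) = - xi i t (- int m)"
proof -
  note pf = power_facts[OF assms(3)]
  have nz: "qq D - inverse (qq D) \<noteq> 0" "qi D i - inverse (qi D i) \<noteq> 0" "qi D (snd t) - inverse (qi D (snd t)) \<noteq> 0"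
    "(of_nat m :: complex) \<noteq> 0" "kap D powi n \<noteq> 0" for n
    using q_diff_nz qi_diff_nz assms kap_nz by auto
  note s = dressing_coefficient_identities[OF pf(4,3,1,2,6,7) nz(1-4)]
  show "ccoef t m * pairing i (snd t) (int m) = - xi i t (int m)"
    by (cases "fst t"; simp only: ccoef_def pairing_def xi_def dress_def power_int_minus[of _ "int m"] power_int_of_nat
        of_int_of_nat_eq if_True if_False s(1,2)[OF nz(5)]; simp)
  show "acoef t m * pairing i (snd t) (- int m) = - xi i t (- int m)"
    by (cases "fst t"; simp only: acoef_def pairing_def xi_def dress_def minus_minus beta_minus of_int_minus
        power_int_minus[of _ "int m"] power_int_of_nat of_int_of_nat_eq if_True if_False s(3,4)[OF nz(5)]; simp)
qed

lemma lin_modes: "snd t \<in> nodes D \<Longrightarrow> m > 0 \<Longrightarrow> lin (cmode t m)"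
    "snd t \<in> nodes D \<Longrightarrow> m > 0 \<Longrightarrow> lin (amode t m)"
  unfolding cmode_eq[abs_def] amode_eq[abs_def] by (auto intro!: lin_scale lin_av)

lemma graded_modes: "snd t \<in> nodes D \<Longrightarrow> m > 0 \<Longrightarrow> graded (int m) (cmode t m)"
    "snd t \<in> nodes D \<Longrightarrow> m > 0 \<Longrightarrow> graded (- int m) (amode t m)"
  unfolding cmode_eq[abs_def] amode_eq[abs_def]
  using graded_av[of "snd t" "- int m"] graded_av[of "snd t" "int m"] by (auto intro!: graded_scale)

lemma av_commute: "i \<in> nodes D \<Longrightarrow> j \<in> nodes D \<Longrightarrow> n \<noteq> 0 \<Longrightarrow> m \<noteq> 0 \<Longrightarrow> n + m \<noteq> 0 \<Longrightarrow>
    av V i n (av V j m v) = av V j m (av V i n v)"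
  using av_av'[of i j n m v] by simp

lemma av_mode_commute:
  assumes "i \<in> nodes D" "snd t \<in> nodes D" "m > 0" "n > 0"
  shows "av V i (- int n) (cmode t m v) = cmode t m (av V i (- int n) v)"
    "av V i (int n) (amode t m v) = amode t m (av V i (int n) v)"
  using assms av_commute[of i "snd t" "- int n" "- int m" v] av_commute[of i "snd t" "int n" "int m" v]
  by (simp_all add: cmode_eq amode_eq linD[OF lin_av])

lemma mode_commute:
  assumes "snd t \<in> nodes D" "snd t' \<in> nodes D" "m > 0" "n > 0"
  shows "cmode t m (cmode t' n v) = cmode t' n (cmode t m v)"
    "amode t m (amode t' n v) = amode t' n (amode t m v)"
  using av_mode_commute[OF assms(1,2,4,3), of v] assms(1,3)
  by (simp_all add: cmode_eq[of t] amode_eq[of t] linD[OF lin_modes(1)[OF assms(2,4)]] linD[OF lin_modes(2)[OF assms(2,4)]])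

lemma av_mode_commutator:
  assumes "i \<in> nodes D" "snd t \<in> nodes D" "m > 0" "n > 0"
  shows "av V i (int n) (cmode t m v) - cmode t m (av V i (int n) v) = (if m = n then scl V (- xi i t (int n)) v else 0)"
    "av V i (- int n) (amode t m v) - amode t m (av V i (- int n) v) = (if m = n then scl V (- xi i t (- int n)) v else 0)"
proof -
  have "av V i (int n) (cmode t m v) - cmode t m (av V i (int n) v) =
    scl V (ccoef t m) (av V i (int n) (av V (snd t) (- int m) v) - av V (snd t) (- int m) (av V i (int n) v))"
    using assms by (simp add: cmode_eq linD[OF lin_av] vs.scale_right_diff_distrib)
  also have "\<dots> = (if m = n then scl V (ccoef t m * pairing i (snd t) (int n)) v else 0)"
    using assms by (subst av_av') auto
  finally show "av V i (int n) (cmode t m v) - cmode t m (av V i (int n) v) = (if m = n then scl V (- xi i t (int n)) v else 0)"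
    using ccoef_pairing(1)[OF assms(1,2,4)] by auto
  have "av V i (- int n) (amode t m v) - amode t m (av V i (- int n) v) =
    scl V (acoef t m) (av V i (- int n) (av V (snd t) (int m) v) - av V (snd t) (int m) (av V i (- int n) v))"
    using assms by (simp add: amode_eq linD[OF lin_av] vs.scale_right_diff_distrib)
  also have "\<dots> = (if m = n then scl V (acoef t m * pairing i (snd t) (- int n)) v else 0)"
    using assms by (subst av_av') auto
  finally show "av V i (- int n) (amode t m v) - amode t m (av V i (- int n) v) = (if m = n then scl V (- xi i t (- int n)) v else 0)"
    using ccoef_pairing(2)[OF assms(1,2,4)] by auto
qed

text \<open>The exponent of the exchange factor: minus the scalar in the commutator of the creation
  mode of t' with x_t, as \<open>exp_of_exchange\<close> requires.\<close>

definition hlog :: "bool \<times> nat \<Rightarrow> bool \<times> nat \<Rightarrow> nat \<Rightarrow> complex" where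
  "hlog t t' m = - (ccoef t' m * xi (snd t') t (- int m))"

lemma cmode_cur:
  assumes "snd t \<in> nodes D" "snd t' \<in> nodes D" "m > 0"
  shows "cmode t' m (cur t n v) - cur t n (cmode t' m v) = scl V (- hlog t t' m) (cur t (n + int m) v)"
proof -
  have "cmode t' m (cur t n v) - cur t n (cmode t' m v) =
    scl V (ccoef t' m) (av V (snd t') (- int m) (cur t n v) - cur t n (av V (snd t') (- int m) v))"
    by (simp add: cmode_eq linD[OF gradedD(1)[OF graded_cur[OF assms(1)]]] vs.scale_right_diff_distrib)
  thus ?thesis using assms by (simp add: av_cur hlog_def)
qed

definition Em :: "bool \<times> nat \<Rightarrow> nat \<Rightarrow> 'v op" where "Em t = op_exp (scl V) (cmode t)"
definition Ep :: "bool \<times> nat \<Rightarrow> nat \<Rightarrow> 'v op" where "Ep t = op_exp (scl V) (amode t)"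
definition Zf :: "bool \<times> nat \<Rightarrow> int \<Rightarrow> 'v op" where "Zf t = (if fst t then Zplus else Zminus) D k V (snd t)"

lemma exp_Em: "snd t \<in> nodes D \<Longrightarrow> exp_of (cmode t) (Em t)"
  and exp_Ep: "snd t \<in> nodes D \<Longrightarrow> exp_of (amode t) (Ep t)"
  unfolding Em_def Ep_def by (auto intro!: exp_of_op_exp lin_modes mode_commute)

lemma cre_Em': "snd t \<in> nodes D \<Longrightarrow> cre (Em t)"
  unfolding cre_def using exp_of_graded[OF exp_Em, of t 1] graded_modes by auto

lemma ann_Ep': "snd t \<in> nodes D \<Longrightarrow> ann (Ep t)"
  unfolding ann_def using exp_of_graded[OF exp_Ep, of t "- 1"] graded_modes by auto

lemma Zf_eq:
  assumes "snd t \<in> nodes D"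
  shows "Zf t n v = dressed (Em t) (cur t) (Ep t) n v"
proof -
  have "Zf t = in_z (Em t) \<circledast> cur t \<circledast> in_inv_z (Ep t)"
    by (cases t; cases "fst t") (simp_all add: Zf_def Zplus_def Zminus_def Em_def Ep_def cur_def vertex_minus_def vertex_plus_def
        cmode_def[abs_def] amode_def[abs_def])
  thus ?thesis
    using dprod_eq_dressed[of "cur t" "Em t" "Ep t"] gradedD(1)[OF graded_cur[OF assms]] cre_lin[OF cre_Em'[OF assms]] by simp
qed

lemma lin_Zf: "snd t \<in> nodes D \<Longrightarrow> lin (Zf t n)"
proof -
  assume t: "snd t \<in> nodes D"
  have "Zf t n = dressed (Em t) (cur t) (Ep t) n" by (intro ext Zf_eq[OF t])
  thus ?thesis using lin_dressed[OF cre_Em' ann_Ep' graded_cur] t by simp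
qed

lemma Zf_transfer:
  assumes "snd t \<in> nodes D" and B: "lin B" "lin B'"
    and "\<And>m v. m \<noteq> 0 \<Longrightarrow> B (av V (snd t) m v) = av V (snd t) m (B v)"
    and "\<And>m v. m \<noteq> 0 \<Longrightarrow> B' (av V (snd t) m v) = av V (snd t) m (B' v)"
    and "\<And>n v. B (cur t n v) = cur t n (B' v)"
  shows "B (Zf t n v) = Zf t n (B' v)"
  unfolding Zf_eq[OF assms(1)]
proof (rule dressed_transfer[where B = B and B' = B', OF cre_Em' ann_Ep' graded_cur])
  show "B (u + w) = B u + B w" for u w by (simp add: linD[OF B(1)])
  show "B (Em t r v) = Em t r (B v)" for r v
    by (rule exp_of_commute[OF exp_Em B(1), symmetric]) (use assms in \<open>auto simp: cmode_eq linD[OF B(1)]\<close>)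
  show "B' (Ep t r v) = Ep t r (B' v)" for r v
    by (rule exp_of_commute[OF exp_Ep B(2), symmetric]) (use assms in \<open>auto simp: amode_eq linD[OF B(2)]\<close>)
qed (use assms in auto)

text \<open>A mode with r > 0 commutes with \<open>Ep\<close>, and its commutators with
  \<open>Em\<close> and x cancel. For r < 0 the roles of \<open>Em\<close> and \<open>Ep\<close> are
  exchanged.\<close>

lemma av_Zf:
  assumes "i \<in> nodes D" "snd t \<in> nodes D" "r \<noteq> 0"
  shows "av V i r (Zf t n v) = Zf t n (av V i r v)"
proof (cases "r > 0")
  case True
  define p where "p = nat r"
  have p: "p > 0" "r = int p" using True by (auto simp: p_def)
  have L: "lin (av V i r)" by (rule lin_av[OF assms(1,3)])
  show ?thesis unfolding Zf_eq[OF assms(2)]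
  proof (rule dressed_commute_annihilation[OF cre_Em' ann_Ep' graded_cur L p(1), where c = "- xi i t r"])
    show "av V i r (Ep t s v) = Ep t s (av V i r v)" for s v
      by (rule exp_of_commute[OF exp_Ep L, symmetric]) (use assms p av_mode_commute(2) in auto)
    show "av V i r (cur t n v) = cur t n (av V i r v) - scl V (- xi i t r) (cur t (n - int p) v)" for n v
      using av_cur[OF assms, of n v] p by (simp add: algebra_simps)
    show "av V i r (Em t s v) = Em t s (av V i r v) + (if p \<le> s then scl V (- xi i t r) (Em t (s - p) v) else 0)" for s v
      by (rule exp_of_derive[OF exp_Em lin_modes(1) L cre_lin[OF cre_Em'] p(1)])
         (use assms p av_mode_commutator(1)[of i t _ p] in auto)
  qed (use assms in auto)
next
  case False
  define p where "p = nat (- r)"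
  have p: "p > 0" "r = - int p" using False assms(3) by (auto simp: p_def)
  have L: "lin (av V i r)" by (rule lin_av[OF assms(1,3)])
  show ?thesis unfolding Zf_eq[OF assms(2)]
  proof (rule dressed_commute_creation[OF cre_Em' ann_Ep' graded_cur L p(1), where c = "- xi i t r"])
    show "av V i r (Em t s v) = Em t s (av V i r v)" for s v
      by (rule exp_of_commute[OF exp_Em L, symmetric]) (use assms p av_mode_commute(1) in auto)
    show "av V i r (cur t n v) = cur t n (av V i r v) - scl V (- xi i t r) (cur t (n + int p) v)" for n v
      using av_cur[OF assms, of n v] p by (simp add: algebra_simps)
    show "av V i r (Ep t s v) = Ep t s (av V i r v) + (if p \<le> s then scl V (- xi i t r) (Ep t (s - p) v) else 0)" for s v
      by (rule exp_of_derive[OF exp_Ep lin_modes(2) L ann_lin[OF ann_Ep'] p(1)])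
         (use assms p av_mode_commutator(2)[of i t _ p] in auto)
  qed (use assms in auto)
qed

sublocale vf: vertex_fields "scl V" "energy_filtration D V" "UNIV \<times> nodes D" Em Ep cur "\<lambda>t t'. pexp (hlog t t')" Zf
proof
  fix t t' :: "bool \<times> nat" and n :: int and m r s :: nat and v
  assume t: "t \<in> UNIV \<times> nodes D"
  hence t1: "snd t \<in> nodes D" by auto
  show "cre (Em t)" by (rule cre_Em'[OF t1])
  show "ann (Ep t)" by (rule ann_Ep'[OF t1])
  show "graded n (cur t n)" by (rule graded_cur[OF t1])
  show "Zf t n v = Sum_any (\<lambda>r::nat. Em t r (Sum_any (\<lambda>s::nat. cur t (n - int r + int s) (Ep t s v))))"
    unfolding Zf_eq[OF t1] dressed_def ..
  assume "t' \<in> UNIV \<times> nodes D"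
  hence t2: "snd t' \<in> nodes D" by auto
  have E1: "Em t r (cmode t' m v) = cmode t' m (Em t r v)" if "m > 0" for r m v
    by (rule exp_of_commute[OF exp_Em[OF t1] lin_modes(1)[OF t2 that]]) (use mode_commute(1)[OF t1 t2 _ that] in auto)
  show "Em t r (Em t' s v) = Em t' s (Em t r v)"
    by (rule exp_of_commute[OF exp_Em[OF t2] cre_lin[OF cre_Em'[OF t1]], symmetric]) (simp add: E1)
  have E2: "Ep t r (amode t' m v) = amode t' m (Ep t r v)" if "m > 0" for r m v
    by (rule exp_of_commute[OF exp_Ep[OF t1] lin_modes(2)[OF t2 that]]) (use mode_commute(2)[OF t1 t2 _ that] in auto)
  show "Ep t r (Ep t' s v) = Ep t' s (Ep t r v)"
    by (rule exp_of_commute[OF exp_Ep[OF t2] ann_lin[OF ann_Ep'[OF t1]], symmetric]) (simp add: E2)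
  show "Ep t' s (Zf t n v) = Zf t n (Ep t' s v)"
    by (rule exp_of_commute[OF exp_Ep[OF t2] lin_Zf[OF t1]]) (simp add: amode_eq av_Zf[OF t2 t1] linD[OF lin_Zf[OF t1]])
  show "cur t n (Em t' m v) = (\<Sum>r\<le>m. scl V (fps_nth (pexp (hlog t t')) r) (Em t' (m - r) (cur t (n + int r) v)))"
    by (rule exp_of_exchange[OF exp_Em[OF t2] lin_modes(1)[OF t2] gradedD(1)[OF graded_cur[OF t1]] cmode_cur[OF t1 t2]])
       (simp_all add: pexp_rec)
qed

end

section \<open>Structure functions\<close>

lemma fps_dilate_1: "fps_dilate 1 F = F"
  by (rule fps_ext) simp

text \<open>The four cases of \<open>hlog\<close>, in the order ++, --, +-, -+ of the signs of the
  two fields. For equal signs a rational function of P, S and Y remains; for opposite signs p is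
  absent from the result.\<close>

lemma exchange_coefficient_identities:
  fixes Y S P N Nj B M \<kappa> :: complex
  assumes "Y \<noteq> 0" "Y\<^sup>2 \<noteq> 1" "P \<noteq> 1" "S \<noteq> 1" "S \<noteq> 0" "P = S * Y\<^sup>2" "N \<noteq> 0" "Nj \<noteq> 0" "M \<noteq> 0"
  shows "- ((- 1 * N / (Y - inverse Y) * (1 * (Nj / N))) * (- B / Nj / - M * ((1 - inverse P) / (1 - inverse S)) * Y * \<kappa>))
      = - (B / M) * \<kappa> * ((1 - P) / ((1 - Y\<^sup>2) * (1 - S)))"
    "- ((1 * N / (Y - inverse Y) * (((1 - inverse S) / (1 - inverse P) * inverse Y) * (Nj / N))) * (- (- B / Nj / - M) * \<kappa>))
      = - (B / M) * \<kappa> * ((Y\<^sup>2 - P) / ((1 - Y\<^sup>2) * (1 - P)))"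
    "- ((1 * N / (Y - inverse Y) * (((1 - inverse S) / (1 - inverse P) * inverse Y) * (Nj / N))) * (- B / Nj / - M * ((1 - inverse P) / (1 - inverse S)) * Y * \<kappa>))
      = B / M * \<kappa> * (Y / (1 - Y\<^sup>2))"
    "- ((- 1 * N / (Y - inverse Y) * (1 * (Nj / N))) * (- (- B / Nj / - M) * \<kappa>)) = B / M * \<kappa> * (Y / (1 - Y\<^sup>2))"
proof -
  have P: "P \<noteq> 0" using assms by auto
  have nz: "1 - P \<noteq> 0" "1 - S \<noteq> 0" "P - 1 \<noteq> 0" "S - 1 \<noteq> 0" "1 - Y\<^sup>2 \<noteq> 0" using assms by auto
  have inv: "1 - inverse P = (P - 1) / P" "1 - inverse S = (S - 1) / S" using P assms by (auto simp: field_simps)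
  have d: "inverse (Y - inverse Y) = - Y / (1 - Y\<^sup>2)"
  proof -
    have "Y - inverse Y = - (1 - Y\<^sup>2) / Y" using assms(1) by (simp add: field_simps power2_eq_square)
    hence "(Y - inverse Y) * (- Y / (1 - Y\<^sup>2)) = (- (1 - Y\<^sup>2) / Y) * (- Y / (1 - Y\<^sup>2))" by (rule arg_cong)
    also have "\<dots> = 1"
    proof -
      have "(- e / Y) * (- Y / e) = 1" if "e \<noteq> 0" for e using that assms(1) by simp
      thus ?thesis using nz(5) by blast
    qed
    finally show ?thesis by (rule inverse_unique)
  qed
  have e1: "(1 - inverse P) / (1 - inverse S) * Y * Y = (1 - P) / (1 - S)"
    unfolding inv using assms nz P by (simp add: divide_simps power2_eq_square) (simp add: algebra_simps)?
  have e2: "(1 - inverse S) / (1 - inverse P) * inverse Y * Y = (Y\<^sup>2 - P) / (1 - P)"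
    unfolding inv using assms nz P by (simp add: divide_simps power2_eq_square) (simp add: algebra_simps)?
  have e3: "(1 - inverse S) / (1 - inverse P) * ((1 - inverse P) / (1 - inverse S)) = 1"
    unfolding inv using assms nz P by (simp add: divide_simps)
  have "- ((- 1 * N / (Y - inverse Y) * (1 * (Nj / N))) * (- B / Nj / - M * ((1 - inverse P) / (1 - inverse S)) * Y * \<kappa>))
    = - (B / M) * \<kappa> * (((1 - inverse P) / (1 - inverse S) * Y * Y) / (1 - Y\<^sup>2))"
    unfolding divide_inverse[of _ "Y - inverse Y"] d using assms(7-9) by (simp add: mult_ac)
  thus "- ((- 1 * N / (Y - inverse Y) * (1 * (Nj / N))) * (- B / Nj / - M * ((1 - inverse P) / (1 - inverse S)) * Y * \<kappa>))
      = - (B / M) * \<kappa> * ((1 - P) / ((1 - Y\<^sup>2) * (1 - S)))" unfolding e1 by (simp add: mult_ac)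
  have "- ((1 * N / (Y - inverse Y) * (((1 - inverse S) / (1 - inverse P) * inverse Y) * (Nj / N))) * (- (- B / Nj / - M) * \<kappa>))
    = - (B / M) * \<kappa> * (((1 - inverse S) / (1 - inverse P) * inverse Y * Y) / (1 - Y\<^sup>2))"
    unfolding divide_inverse[of _ "Y - inverse Y"] d using assms(7-9) by (simp add: mult_ac)
  thus "- ((1 * N / (Y - inverse Y) * (((1 - inverse S) / (1 - inverse P) * inverse Y) * (Nj / N))) * (- (- B / Nj / - M) * \<kappa>))
      = - (B / M) * \<kappa> * ((Y\<^sup>2 - P) / ((1 - Y\<^sup>2) * (1 - P)))" unfolding e2 by (simp add: mult_ac)
  have "- ((1 * N / (Y - inverse Y) * (((1 - inverse S) / (1 - inverse P) * inverse Y) * (Nj / N))) * (- B / Nj / - M * ((1 - inverse P) / (1 - inverse S)) * Y * \<kappa>))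
    = B / M * \<kappa> * (Y / (1 - Y\<^sup>2)) * ((1 - inverse S) / (1 - inverse P) * ((1 - inverse P) / (1 - inverse S)))"
    unfolding divide_inverse[of _ "Y - inverse Y"] d using assms(1,7-9) by (simp add: mult_ac)
  thus "- ((1 * N / (Y - inverse Y) * (((1 - inverse S) / (1 - inverse P) * inverse Y) * (Nj / N))) * (- B / Nj / - M * ((1 - inverse P) / (1 - inverse S)) * Y * \<kappa>))
      = B / M * \<kappa> * (Y / (1 - Y\<^sup>2))" unfolding e3 by simp
  show "- ((- 1 * N / (Y - inverse Y) * (1 * (Nj / N))) * (- (- B / Nj / - M) * \<kappa>)) = B / M * \<kappa> * (Y / (1 - Y\<^sup>2))"
    unfolding divide_inverse[of _ "Y - inverse Y"] d using assms(7-9) by (simp add: mult_ac)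
qed

text \<open>Comparison of logarithms, with u = q^(bm) and u' = q^(-bm). The left side is the
  quotient of infinite products together with \<open>hlog\<close>; the right side is the exponent of
  g at pstar or of 1/g at p, accompanied in the first and third equation by that of a linear
  factor.\<close>

lemma structure_exponent_identities:
  fixes Y S P u u' M :: complex
  assumes "Y\<^sup>2 \<noteq> 1" "P \<noteq> 1" "S \<noteq> 1" "P = S * Y\<^sup>2"
  shows "(Y\<^sup>2 * u - u') / (1 - Y\<^sup>2) - (u - u') * ((1 - P) / ((1 - Y\<^sup>2) * (1 - S))) = - u - (u - u') / (1 - S) * S"
    "(u - u') / (1 - Y\<^sup>2) - (u - u') * ((1 - P) / ((1 - Y\<^sup>2) * (1 - S))) = - (u - u') / (1 - S) * S"
    "(Y\<^sup>2 * u - u') / (1 - Y\<^sup>2) - (u - u') * ((Y\<^sup>2 - P) / ((1 - Y\<^sup>2) * (1 - P))) = - u' + (u - u') / (1 - P) * P"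
    "(u * Y\<^sup>2 - u' * Y\<^sup>2) / (1 - Y\<^sup>2) - (u - u') * ((Y\<^sup>2 - P) / ((1 - Y\<^sup>2) * (1 - P))) = (u - u') / (1 - P) * P"
proof -
  have nz: "1 - P \<noteq> 0" "1 - S \<noteq> 0" "1 - Y\<^sup>2 \<noteq> 0" using assms by auto
  \<comment> \<open>Partial fractions: the pole in Y^2 belongs to the infinite products, the pole in
    S or P to the structure function.\<close>
  have 1: "(1 - P) / ((1 - Y\<^sup>2) * (1 - S)) = 1 / (1 - Y\<^sup>2) + S / (1 - S)"
    using nz by (simp add: add_frac_eq) (simp add: assms(4) algebra_simps)
  have 2: "(Y\<^sup>2 - P) / ((1 - Y\<^sup>2) * (1 - P)) = Y\<^sup>2 / (1 - Y\<^sup>2) - P / (1 - P)"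
    using nz by (simp add: diff_frac_eq) (simp add: algebra_simps)
  define a where "a = inverse (1 - Y\<^sup>2)"
  have a: "a * (1 - Y\<^sup>2) = 1" using nz by (simp add: a_def)
  have "(Y\<^sup>2 * u - u') * a - (u - u') * (a + S / (1 - S)) = - u * (a * (1 - Y\<^sup>2)) - (u - u') * (S / (1 - S))"
    by (simp add: algebra_simps)
  thus "(Y\<^sup>2 * u - u') / (1 - Y\<^sup>2) - (u - u') * ((1 - P) / ((1 - Y\<^sup>2) * (1 - S))) = - u - (u - u') / (1 - S) * S"
    unfolding 1 a by (simp add: divide_inverse a_def mult_ac)
  show "(u - u') / (1 - Y\<^sup>2) - (u - u') * ((1 - P) / ((1 - Y\<^sup>2) * (1 - S))) = - (u - u') / (1 - S) * S"
    unfolding 1 by (simp add: divide_inverse algebra_simps)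
  have "(Y\<^sup>2 * u - u') * a - (u - u') * (Y\<^sup>2 * a - P / (1 - P)) = - u' * (a * (1 - Y\<^sup>2)) + (u - u') * (P / (1 - P))"
    by (simp add: algebra_simps)
  thus "(Y\<^sup>2 * u - u') / (1 - Y\<^sup>2) - (u - u') * ((Y\<^sup>2 - P) / ((1 - Y\<^sup>2) * (1 - P))) = - u' + (u - u') / (1 - P) * P"
    unfolding 2 a by (simp add: divide_inverse a_def mult_ac)
  show "(u * Y\<^sup>2 - u' * Y\<^sup>2) / (1 - Y\<^sup>2) - (u - u') * ((Y\<^sup>2 - P) / ((1 - Y\<^sup>2) * (1 - P))) = (u - u') / (1 - P) * P"
    unfolding 2 by (simp add: divide_inverse algebra_simps)
qed

text \<open>The exponents of x^+, of x^- and of the current add up to 0 once z is replaced by q^k w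
  for \<phi>^+ and by q^(-k) w for \<phi>^-. The equations are those for \<phi>^+ and \<phi>^-, at
  positive and then at negative powers of w.\<close>

lemma phi_coefficient_identities:
  fixes Y S P N Ni :: complex
  assumes "Y \<noteq> 0" "Y\<^sup>2 \<noteq> 1" "P \<noteq> 1" "S \<noteq> 1" "S \<noteq> 0" "P = S * Y\<^sup>2" "N \<noteq> 0"
  shows "Y * (- 1 * N / (Y - inverse Y) * (1 * (Ni / N))) + (1 * N / (Y - inverse Y) * (((1 - inverse S) / (1 - inverse P) * inverse Y) * (Ni / N))
      + - Ni * P / (1 - P)) = 0"
    "inverse Y * (- 1 * N / (Y - inverse Y) * (1 * (Ni / N))) + (1 * N / (Y - inverse Y) * (((1 - inverse S) / (1 - inverse P) * inverse Y) * (Ni / N))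
      + - Ni / (1 - P)) = 0"
    "Ni / (1 - P) + (- 1 * N / (Y - inverse Y) * (((1 - S) / (1 - P) * Y) * (Ni / N)) + inverse Y * (1 * N / (Y - inverse Y) * (1 * (Ni / N)))) = 0"
    "Ni * P / (1 - P) + (- 1 * N / (Y - inverse Y) * (((1 - S) / (1 - P) * Y) * (Ni / N)) + Y * (1 * N / (Y - inverse Y) * (1 * (Ni / N)))) = 0"
proof -
  have P: "P \<noteq> 0" using assms by auto
  have nz: "1 - P \<noteq> 0" "1 - S \<noteq> 0" "P - 1 \<noteq> 0" "S - 1 \<noteq> 0" "1 - Y\<^sup>2 \<noteq> 0" using assms by auto
  have inv: "1 - inverse P = (P - 1) / P" "1 - inverse S = (S - 1) / S" using P assms by (auto simp: field_simps)
  define D where "D = inverse (Y - inverse Y)"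
  define e where "e = 1 - Y\<^sup>2"
  define c where "c = (1 - S) / (1 - P) * Y"
  have enz: "e \<noteq> 0" using nz by (simp add: e_def)
  have d: "D = - Y / e"
  proof -
    have "Y - inverse Y = - e / Y" unfolding e_def using assms(1) by (simp add: field_simps power2_eq_square)
    hence "(Y - inverse Y) * (- Y / e) = (- e / Y) * (- Y / e)" by (rule arg_cong)
    also have "\<dots> = 1" using enz assms(1) by simp
    finally show ?thesis unfolding D_def by (rule inverse_unique)
  qed
  have e: "(1 - inverse S) / (1 - inverse P) * inverse Y = c"
    unfolding inv c_def using assms nz P by (simp add: divide_simps power2_eq_square) (simp add: algebra_simps)?
  have k1: "D * (c - Y) = P / (1 - P)"
  proof -
    have "c - Y = Y * (P - S) / (1 - P)" unfolding c_def using nz by (simp add: field_simps)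
    also have "P - S = - (S * e)" by (simp add: assms(6) e_def algebra_simps)
    finally show ?thesis unfolding d using enz by (simp add: assms(6) power2_eq_square)
  qed
  have k2: "D * (c - inverse Y) = 1 / (1 - P)"
  proof -
    have "c - inverse Y = ((1 - S) * Y\<^sup>2 - (1 - P)) / (Y * (1 - P))"
      unfolding c_def using nz assms(1) by (simp add: field_simps power2_eq_square)
    also have "(1 - S) * Y\<^sup>2 - (1 - P) = - e" by (simp add: assms(6) e_def algebra_simps)
    finally show ?thesis unfolding d using enz assms(1) by simp
  qed
  have g: "Z * (- 1 * N / (Y - inverse Y) * (1 * (Ni / N))) + (1 * N / (Y - inverse Y) * (c * (Ni / N)) + - Ni * A / B) = Ni * (D * (c - Z)) - Ni * (A / B)"
    "Ni * A / B + (- 1 * N / (Y - inverse Y) * (c * (Ni / N)) + Z * (1 * N / (Y - inverse Y) * (1 * (Ni / N)))) = Ni * (A / B) - Ni * (D * (c - Z))"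
    for Z A B :: complex
    unfolding divide_inverse[of _ "Y - inverse Y"] D_def[symmetric] using assms(7) by (simp_all add: right_diff_distrib mult_ac)
  show "Y * (- 1 * N / (Y - inverse Y) * (1 * (Ni / N))) + (1 * N / (Y - inverse Y) * (((1 - inverse S) / (1 - inverse P) * inverse Y) * (Ni / N))
      + - Ni * P / (1 - P)) = 0"
    unfolding e g k1 by simp
  show "inverse Y * (- 1 * N / (Y - inverse Y) * (1 * (Ni / N))) + (1 * N / (Y - inverse Y) * (((1 - inverse S) / (1 - inverse P) * inverse Y) * (Ni / N))
      + - Ni / (1 - P)) = 0"
    using g(1)[of "inverse Y" 1 "1 - P"] unfolding e k2 by simp
  show "Ni / (1 - P) + (- 1 * N / (Y - inverse Y) * (((1 - S) / (1 - P) * Y) * (Ni / N)) + inverse Y * (1 * N / (Y - inverse Y) * (1 * (Ni / N)))) = 0"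
    using g(2)[of 1 "1 - P" "inverse Y"] unfolding c_def[symmetric] k2 by simp
  show "Ni * P / (1 - P) + (- 1 * N / (Y - inverse Y) * (((1 - S) / (1 - P) * Y) * (Ni / N)) + Y * (1 * N / (Y - inverse Y) * (1 * (Ni / N)))) = 0"
    unfolding c_def[symmetric] g k1 by simp
qed

text \<open>Bookkeeping over opaque variables; in the applications these are powers and quotients
  that the simplifier must not take apart.\<close>

lemma regroup_identities:
  fixes a b d e M u u' w c S Y \<kappa> :: complex
  shows "\<kappa> * (a / (M * d)) + - (b / M) * \<kappa> * e = \<kappa> / M * (a / d - b * e)"
    "\<kappa> / M * (- u - c * S) = - (u * \<kappa>) / M + \<kappa> * (- (1 / M) * c * S)"
    "\<kappa> / M * (- u + c * S) = - (u * \<kappa>) / M + \<kappa> * (- (- (1 / M) * c * S))"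
    "\<kappa> / M * (- w / d * S) = \<kappa> * (- (1 / M) * (w / d) * S)"
    "\<kappa> / M * (c * S) = \<kappa> * (- (- (1 / M) * c * S))"
    "\<kappa> * ((u' * Y - u * Y) / (M * d)) + (u - u') / M * \<kappa> * (Y / d) = 0"
  by (simp_all add: divide_inverse algebra_simps)

context tor_module
begin

section \<open>Exchange factors against structure functions\<close>

abbreviation kp :: "nat \<Rightarrow> nat \<Rightarrow> complex" where "kp i j \<equiv> kap D powi (- mm D i j)"

lemma hlog_eq:
  assumes "i \<in> nodes D" "j \<in> nodes D" "m > 0"
  shows "hlog (True, i) (True, j) m = - (beta i j (int m) / of_nat m) * kp i j ^ m * ((1 - pp D ^ m) / ((1 - (qk ^ m)\<^sup>2) * (1 - pstar D k ^ m)))"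
    "hlog (False, i) (False, j) m = - (beta i j (int m) / of_nat m) * kp i j ^ m * (((qk ^ m)\<^sup>2 - pp D ^ m) / ((1 - (qk ^ m)\<^sup>2) * (1 - pp D ^ m)))"
    "hlog (True, i) (False, j) m = beta i j (int m) / of_nat m * kp i j ^ m * (qk ^ m / (1 - (qk ^ m)\<^sup>2))"
    "hlog (False, i) (True, j) m = beta i j (int m) / of_nat m * kp i j ^ m * (qk ^ m / (1 - (qk ^ m)\<^sup>2))"
proof -
  note pf = power_facts[OF assms(3)]
  have nz: "qq D - inverse (qq D) \<noteq> 0" "qi D j - inverse (qi D j) \<noteq> 0" "(of_nat m :: complex) \<noteq> 0"
    using q_diff_nz qi_diff_nz assms by auto
  note s = exchange_coefficient_identities[OF pf(4,3,1,2,6,7) nz]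
  \<comment> \<open>Antisymmetry of m_ij turns the power of kappa for the pair (j, i) into the one
    for (i, j).\<close>
  have kap: "kap D powi (int m * mm D j i) = kp i j ^ m"
    by (simp add: mm_antisym[of D j i] power_int_mult[symmetric] mult.commute flip: power_int_of_nat)
  note u = hlog_def ccoef_def xi_def dress_def fst_conv snd_conv if_True if_False minus_minus beta_minus of_int_minus
        power_int_minus[of _ "int m"] power_int_of_nat of_int_of_nat_eq kap beta_sym[OF assms(2,1)]
  show "hlog (True, i) (True, j) m = - (beta i j (int m) / of_nat m) * kp i j ^ m * ((1 - pp D ^ m) / ((1 - (qk ^ m)\<^sup>2) * (1 - pstar D k ^ m)))"
    by (simp only: u s)
  show "hlog (False, i) (False, j) m = - (beta i j (int m) / of_nat m) * kp i j ^ m * (((qk ^ m)\<^sup>2 - pp D ^ m) / ((1 - (qk ^ m)\<^sup>2) * (1 - pp D ^ m)))"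
    by (simp only: u s)
  show "hlog (True, i) (False, j) m = beta i j (int m) / of_nat m * kp i j ^ m * (qk ^ m / (1 - (qk ^ m)\<^sup>2))"
    by (simp only: u s)
  show "hlog (False, i) (True, j) m = beta i j (int m) / of_nat m * kp i j ^ m * (qk ^ m / (1 - (qk ^ m)\<^sup>2))"
    by (simp only: u s)
qed

definition shift_b :: "bool \<Rightarrow> nat \<Rightarrow> nat \<Rightarrow> int" where
  "shift_b s i j = (if s then bb D i j else - bb D i j)"

definition struct :: "bool \<Rightarrow> nat \<Rightarrow> nat \<Rightarrow> complex fps" where
  "struct s i j = (if s then gser D i j (pstar D k) else inverse (gser D i j (pp D)))"

lemma inverse_gser: "inverse (gser D i j s) = pexp (\<lambda>m. - (- (1 / of_nat m) * (beta i j (int m) / (1 - s ^ m)) * s ^ m))"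
  unfolding gser_eq_pexp pexp_inverse beta_def ..

text \<open>With Q = q^(2k) and (x) for the infinite product (x u; Q), the quotient (q^-b)/(Q q^b)
  equals both (1 - q^b u) (q^-b)/(q^b) and (1 - q^-b u) (Q q^-b)/(Q q^b). The first reading belongs
  to the plus fields and the second to the minus fields, which is why one quotient serves both
  signs.\<close>

lemma struct_exchange:
  assumes ij: "i \<in> nodes D" "j \<in> nodes D"
  shows "fps_dilate (kp i j) (qpoch_quot (qq D powi (- bb D i j)) (qk\<^sup>2 * qq D powi bb D i j) (qk\<^sup>2)) * pexp (hlog (s, i) (s, j)) =
    (1 - fps_const (qq D powi shift_b s i j * kp i j) * fps_X) * fps_dilate (kp i j) (struct s i j)"
proof (cases s)
  case True
  have st: "struct s i j = pexp (\<lambda>m. - (1 / of_nat m) * (beta i j (int m) / (1 - pstar D k ^ m)) * pstar D k ^ m)"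
    using True by (simp only: struct_def gser_eq_pexp beta_def if_True)
  show ?thesis unfolding st qpoch_quot_eq_pexp[OF Q_norm] fps_dilate_pexp pexp_linear[symmetric] pexp_mult
  proof (rule pexp_cong)
    fix m :: nat assume m: "m > 0"
    note pf = power_facts[OF m]
    define u u' where "u = qq D powi (bb D i j * int m)" and "u' = qq D powi (- bb D i j * int m)"
    have pw: "(qq D powi bb D i j) ^ m = u" "(qq D powi (- bb D i j)) ^ m = u'" "beta i j (int m) = u - u'"
      by (simp_all only: u_def u'_def beta_def power_int_mult power_int_of_nat)
    have Q: "(qk\<^sup>2) ^ m = (qk ^ m)\<^sup>2" by (simp add: power_mult[symmetric] mult.commute)
    have "kp i j ^ m * (((qk ^ m)\<^sup>2 * u - u') / (of_nat m * (1 - (qk ^ m)\<^sup>2))) + - ((u - u') / of_nat m) * kp i j ^ m * ((1 - pp D ^ m) / ((1 - (qk ^ m)\<^sup>2) * (1 - pstar D k ^ m)))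
      = kp i j ^ m / of_nat m * (((qk ^ m)\<^sup>2 * u - u') / (1 - (qk ^ m)\<^sup>2) - (u - u') * ((1 - pp D ^ m) / ((1 - (qk ^ m)\<^sup>2) * (1 - pstar D k ^ m))))"
      by (rule regroup_identities(1))
    also have "\<dots> = kp i j ^ m / of_nat m * (- u - (u - u') / (1 - pstar D k ^ m) * pstar D k ^ m)"
      unfolding structure_exponent_identities(1)[OF pf(3,1,2,7)] ..
    also have "\<dots> = - (u * kp i j ^ m) / of_nat m + kp i j ^ m * (- (1 / of_nat m) * ((u - u') / (1 - pstar D k ^ m)) * pstar D k ^ m)"
      by (rule regroup_identities(2))
    finally show "kp i j ^ m * (((qk\<^sup>2 * qq D powi bb D i j) ^ m - (qq D powi (- bb D i j)) ^ m) / (of_nat m * (1 - (qk\<^sup>2) ^ m))) + hlog (s, i) (s, j) m =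
      - ((qq D powi shift_b s i j * kp i j) ^ m) / of_nat m + kp i j ^ m * (- (1 / of_nat m) * (beta i j (int m) / (1 - pstar D k ^ m)) * pstar D k ^ m)"
      using True by (simp only: power_mult_distrib pw Q hlog_eq(1)[OF ij m] shift_b_def if_True)
  qed
next
  case False
  have st: "struct s i j = pexp (\<lambda>m. - (- (1 / of_nat m) * (beta i j (int m) / (1 - pp D ^ m)) * pp D ^ m))"
    using False by (simp only: struct_def inverse_gser if_False)
  show ?thesis unfolding st qpoch_quot_eq_pexp[OF Q_norm] fps_dilate_pexp pexp_linear[symmetric] pexp_mult
  proof (rule pexp_cong)
    fix m :: nat assume m: "m > 0"
    note pf = power_facts[OF m]
    define u u' where "u = qq D powi (bb D i j * int m)" and "u' = qq D powi (- bb D i j * int m)"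
    have pw: "(qq D powi bb D i j) ^ m = u" "(qq D powi (- bb D i j)) ^ m = u'" "beta i j (int m) = u - u'"
      by (simp_all only: u_def u'_def beta_def power_int_mult power_int_of_nat)
    have Q: "(qk\<^sup>2) ^ m = (qk ^ m)\<^sup>2" by (simp add: power_mult[symmetric] mult.commute)
    have "kp i j ^ m * (((qk ^ m)\<^sup>2 * u - u') / (of_nat m * (1 - (qk ^ m)\<^sup>2))) + - ((u - u') / of_nat m) * kp i j ^ m * (((qk ^ m)\<^sup>2 - pp D ^ m) / ((1 - (qk ^ m)\<^sup>2) * (1 - pp D ^ m)))
      = kp i j ^ m / of_nat m * (((qk ^ m)\<^sup>2 * u - u') / (1 - (qk ^ m)\<^sup>2) - (u - u') * (((qk ^ m)\<^sup>2 - pp D ^ m) / ((1 - (qk ^ m)\<^sup>2) * (1 - pp D ^ m))))"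
      by (rule regroup_identities(1))
    also have "\<dots> = kp i j ^ m / of_nat m * (- u' + (u - u') / (1 - pp D ^ m) * pp D ^ m)"
      unfolding structure_exponent_identities(3)[OF pf(3,1,2,7)] ..
    also have "\<dots> = - (u' * kp i j ^ m) / of_nat m + kp i j ^ m * (- (- (1 / of_nat m) * ((u - u') / (1 - pp D ^ m)) * pp D ^ m))"
      by (rule regroup_identities(3))
    finally show "kp i j ^ m * (((qk\<^sup>2 * qq D powi bb D i j) ^ m - (qq D powi (- bb D i j)) ^ m) / (of_nat m * (1 - (qk\<^sup>2) ^ m))) + hlog (s, i) (s, j) m =
      - ((qq D powi shift_b s i j * kp i j) ^ m) / of_nat m + kp i j ^ m * (- (- (1 / of_nat m) * (beta i j (int m) / (1 - pp D ^ m)) * pp D ^ m))"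
      using False by (simp only: power_mult_distrib pw Q hlog_eq(2)[OF ij m] shift_b_def if_False)
  qed
qed

definition serre_struct :: "bool \<Rightarrow> nat \<Rightarrow> nat \<Rightarrow> complex fps" where
  "serre_struct s i j = (if s then qpoch_quot (qq D powi (- bb D i j)) (qq D powi bb D i j) (qk\<^sup>2)
     else qpoch_quot (qq D powi (- bb D i j) * qk\<^sup>2) (qq D powi bb D i j * qk\<^sup>2) (qk\<^sup>2))"

text \<open>The comparison of \<open>struct_exchange\<close> without the linear factor, as the Serre
  relations of the x contain no polynomial factors. The two readings of the quotient now give
  different series for the two signs.\<close>

lemma struct_serre:
  assumes ij: "i \<in> nodes D" "j \<in> nodes D"
  shows "fps_dilate (kp i j) (serre_struct s i j) * pexp (hlog (s, i) (s, j)) = fps_dilate (kp i j) (struct s i j)"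
proof (cases s)
  case True
  have st: "struct s i j = pexp (\<lambda>m. - (1 / of_nat m) * (beta i j (int m) / (1 - pstar D k ^ m)) * pstar D k ^ m)"
    and ss: "serre_struct s i j = qpoch_quot (qq D powi (- bb D i j)) (qq D powi bb D i j) (qk\<^sup>2)"
    using True by (simp_all only: struct_def gser_eq_pexp beta_def if_True serre_struct_def)
  show ?thesis unfolding st ss qpoch_quot_eq_pexp[OF Q_norm] fps_dilate_pexp pexp_mult
  proof (rule pexp_cong)
    fix m :: nat assume m: "m > 0"
    note pf = power_facts[OF m]
    define u u' where "u = qq D powi (bb D i j * int m)" and "u' = qq D powi (- bb D i j * int m)"
    have pw: "(qq D powi bb D i j) ^ m = u" "(qq D powi (- bb D i j)) ^ m = u'" "beta i j (int m) = u - u'"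
      by (simp_all only: u_def u'_def beta_def power_int_mult power_int_of_nat)
    have Q: "(qk\<^sup>2) ^ m = (qk ^ m)\<^sup>2" by (simp add: power_mult[symmetric] mult.commute)
    have "kp i j ^ m * ((u - u') / (of_nat m * (1 - (qk ^ m)\<^sup>2))) + - ((u - u') / of_nat m) * kp i j ^ m * ((1 - pp D ^ m) / ((1 - (qk ^ m)\<^sup>2) * (1 - pstar D k ^ m)))
      = kp i j ^ m / of_nat m * ((u - u') / (1 - (qk ^ m)\<^sup>2) - (u - u') * ((1 - pp D ^ m) / ((1 - (qk ^ m)\<^sup>2) * (1 - pstar D k ^ m))))"
      by (rule regroup_identities(1))
    also have "\<dots> = kp i j ^ m / of_nat m * (- (u - u') / (1 - pstar D k ^ m) * pstar D k ^ m)"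
      unfolding structure_exponent_identities(2)[OF pf(3,1,2,7)] ..
    also have "\<dots> = kp i j ^ m * (- (1 / of_nat m) * ((u - u') / (1 - pstar D k ^ m)) * pstar D k ^ m)"
      by (rule regroup_identities(4))
    finally show "kp i j ^ m * (((qq D powi bb D i j) ^ m - (qq D powi (- bb D i j)) ^ m) / (of_nat m * (1 - (qk\<^sup>2) ^ m))) + hlog (s, i) (s, j) m =
      kp i j ^ m * (- (1 / of_nat m) * (beta i j (int m) / (1 - pstar D k ^ m)) * pstar D k ^ m)"
      using True by (simp only: pw Q hlog_eq(1)[OF ij m])
  qed
next
  case False
  have st: "struct s i j = pexp (\<lambda>m. - (- (1 / of_nat m) * (beta i j (int m) / (1 - pp D ^ m)) * pp D ^ m))"
    and ss: "serre_struct s i j = qpoch_quot (qq D powi (- bb D i j) * qk\<^sup>2) (qq D powi bb D i j * qk\<^sup>2) (qk\<^sup>2)"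
    using False by (simp_all only: struct_def inverse_gser if_False serre_struct_def)
  show ?thesis unfolding st ss qpoch_quot_eq_pexp[OF Q_norm] fps_dilate_pexp pexp_mult
  proof (rule pexp_cong)
    fix m :: nat assume m: "m > 0"
    note pf = power_facts[OF m]
    define u u' where "u = qq D powi (bb D i j * int m)" and "u' = qq D powi (- bb D i j * int m)"
    have pw: "(qq D powi bb D i j) ^ m = u" "(qq D powi (- bb D i j)) ^ m = u'" "beta i j (int m) = u - u'"
      by (simp_all only: u_def u'_def beta_def power_int_mult power_int_of_nat)
    have Q: "(qk\<^sup>2) ^ m = (qk ^ m)\<^sup>2" by (simp add: power_mult[symmetric] mult.commute)
    have "kp i j ^ m * ((u * (qk ^ m)\<^sup>2 - u' * (qk ^ m)\<^sup>2) / (of_nat m * (1 - (qk ^ m)\<^sup>2))) + - ((u - u') / of_nat m) * kp i j ^ m * (((qk ^ m)\<^sup>2 - pp D ^ m) / ((1 - (qk ^ m)\<^sup>2) * (1 - pp D ^ m)))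
      = kp i j ^ m / of_nat m * ((u * (qk ^ m)\<^sup>2 - u' * (qk ^ m)\<^sup>2) / (1 - (qk ^ m)\<^sup>2) - (u - u') * (((qk ^ m)\<^sup>2 - pp D ^ m) / ((1 - (qk ^ m)\<^sup>2) * (1 - pp D ^ m))))"
      by (rule regroup_identities(1))
    also have "\<dots> = kp i j ^ m / of_nat m * ((u - u') / (1 - pp D ^ m) * pp D ^ m)"
      unfolding structure_exponent_identities(4)[OF pf(3,1,2,7)] ..
    also have "\<dots> = kp i j ^ m * (- (- (1 / of_nat m) * ((u - u') / (1 - pp D ^ m)) * pp D ^ m))"
      by (rule regroup_identities(5))
    finally show "kp i j ^ m * (((qq D powi bb D i j * qk\<^sup>2) ^ m - (qq D powi (- bb D i j) * qk\<^sup>2) ^ m) / (of_nat m * (1 - (qk\<^sup>2) ^ m))) + hlog (s, i) (s, j) m =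
      kp i j ^ m * (- (- (1 / of_nat m) * (beta i j (int m) / (1 - pp D ^ m)) * pp D ^ m))"
      using False by (simp only: power_mult_distrib pw Q hlog_eq(2)[OF ij m])
  qed
qed

text \<open>The relation between x^+ and x^- is a plain commutator without structure function, so
  here the quotient has to be the inverse of the exchange factor.\<close>

lemma struct_mixed:
  assumes ij: "i \<in> nodes D" "j \<in> nodes D"
  shows "fps_dilate (kp i j) (qpoch_quot (qq D powi bb D i j * qk) (qq D powi (- bb D i j) * qk) (qk\<^sup>2)) * pexp (hlog (s, i) (\<not> s, j)) = 1"
  unfolding qpoch_quot_eq_pexp[OF Q_norm] fps_dilate_pexp pexp_mult pexp_zero[symmetric]
proof (rule pexp_cong)
  fix m :: nat assume m: "m > 0"
  define u u' where "u = qq D powi (bb D i j * int m)" and "u' = qq D powi (- bb D i j * int m)"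
  have pw: "(qq D powi bb D i j) ^ m = u" "(qq D powi (- bb D i j)) ^ m = u'" "beta i j (int m) = u - u'"
    by (simp_all only: u_def u'_def beta_def power_int_mult power_int_of_nat)
  have Q: "(qk\<^sup>2) ^ m = (qk ^ m)\<^sup>2" by (simp add: power_mult[symmetric] mult.commute)
  have h: "hlog (s, i) (\<not> s, j) m = beta i j (int m) / of_nat m * kp i j ^ m * (qk ^ m / (1 - (qk ^ m)\<^sup>2))"
    using hlog_eq(3,4)[OF ij m] by (cases s) simp_all
  have "kp i j ^ m * ((u' * qk ^ m - u * qk ^ m) / (of_nat m * (1 - (qk ^ m)\<^sup>2))) + (u - u') / of_nat m * kp i j ^ m * (qk ^ m / (1 - (qk ^ m)\<^sup>2)) = 0"
    by (rule regroup_identities(6))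
  thus "kp i j ^ m * (((qq D powi (- bb D i j) * qk) ^ m - (qq D powi bb D i j * qk) ^ m) / (of_nat m * (1 - (qk\<^sup>2) ^ m))) + hlog (s, i) (\<not> s, j) m = 0"
    by (simp only: power_mult_distrib pw Q h)
qed

section \<open>The relations\<close>

definition weight_comp :: "'v \<Rightarrow> hweight \<Rightarrow> 'v" where
  "weight_comp v = (THE c. decomposes V v c)"

lemma weight_comp: "decomposes V v (weight_comp v)"
  unfolding weight_comp_def by (rule theI'[OF wsp_direct_sum])

lemma weight_comp_eqI: "decomposes V v c \<Longrightarrow> weight_comp v = c"
  unfolding weight_comp_def by (rule the1_equality[OF wsp_direct_sum])

lemma act_eq: "act V g v = Sum_any (\<lambda>\<eta>. scl V (g \<eta>) (weight_comp v \<eta>))"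
  by (simp add: act_def weight_comp_def)

lemma weight_comp_finite: "finite {\<eta>. weight_comp v \<eta> \<noteq> 0}"
  using weight_comp by (simp add: decomposes_def)

lemma scaled_weight_comp_finite: "finite {\<eta>. scl V (g \<eta>) (weight_comp v \<eta>) \<noteq> 0}"
  by (rule finite_subset[OF _ weight_comp_finite[of v]]) auto

lemma weight_comp_add: "weight_comp (v + w) = (\<lambda>\<eta>. weight_comp v \<eta> + weight_comp w \<eta>)"
proof (rule weight_comp_eqI)
  have "finite {\<eta>. weight_comp v \<eta> + weight_comp w \<eta> \<noteq> 0}"
    by (rule finite_subset[OF _ finite_UnI[OF weight_comp_finite[of v] weight_comp_finite[of w]]]) auto
  moreover have "weight_comp v \<eta> + weight_comp w \<eta> \<in> wsp V \<eta>" for \<eta>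
    using weight_comp[of v] weight_comp[of w] wsp_subspace[of \<eta>] by (auto simp: decomposes_def subspace_def)
  moreover have "v + w = Sum_any (\<lambda>\<eta>. weight_comp v \<eta> + weight_comp w \<eta>)"
    using weight_comp[of v] weight_comp[of w] Sum_any.distrib[OF weight_comp_finite[of v] weight_comp_finite[of w]]
    by (simp add: decomposes_def)
  ultimately show "decomposes V (v + w) (\<lambda>\<eta>. weight_comp v \<eta> + weight_comp w \<eta>)" by (simp add: decomposes_def)
qed

lemma weight_comp_image:
  assumes "lin X" "shifts_weights V \<theta> X"
  shows "weight_comp (X v) = (\<lambda>\<eta>. X (weight_comp v (\<lambda>b. \<eta> b - \<theta> b)))"
proof (rule weight_comp_eqI)
  define h where "h \<eta> = (\<lambda>b. \<eta> b - \<theta> b)" for \<eta> :: hweight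
  have h: "inj h" "range h = UNIV"
  proof -
    show "inj h" by (rule injI) (auto simp: h_def fun_eq_iff)
    have "\<eta> = h (\<lambda>b. \<eta> b + \<theta> b)" for \<eta> by (simp add: h_def)
    thus "range h = UNIV" by blast
  qed
  have "finite {\<eta>. X (weight_comp v (h \<eta>)) \<noteq> 0}"
  proof (rule finite_subset)
    show "{\<eta>. X (weight_comp v (h \<eta>)) \<noteq> 0} \<subseteq> h -` {\<eta>. weight_comp v \<eta> \<noteq> 0}" by (auto simp: linD[OF assms(1)])
    show "finite (h -` {\<eta>. weight_comp v \<eta> \<noteq> 0})" by (rule finite_vimageI[OF weight_comp_finite h(1)])
  qed
  moreover have "X (weight_comp v (h \<eta>)) \<in> wsp V \<eta>" for \<eta>
  proof -
    have "weight_comp v (h \<eta>) \<in> wsp V (h \<eta>)" using weight_comp[of v] by (simp add: decomposes_def)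
    hence "X (weight_comp v (h \<eta>)) \<in> wsp V (\<lambda>b. h \<eta> b + \<theta> b)" using assms(2) by (simp add: shifts_weights_def)
    thus ?thesis by (simp add: h_def)
  qed
  moreover have "X v = Sum_any (\<lambda>\<eta>. X (weight_comp v (h \<eta>)))"
  proof -
    have "v = Sum_any (weight_comp v)" using weight_comp[of v] by (simp add: decomposes_def)
    also have "\<dots> = Sum_any (\<lambda>\<eta>. weight_comp v (h \<eta>))"
      by (rule Sum_any_reindex_inj[OF h(1)]) (use h(2) in auto)
    finally have v: "v = Sum_any (\<lambda>\<eta>. weight_comp v (h \<eta>))" .
    have fin: "finite {\<eta>. weight_comp v (h \<eta>) \<noteq> 0}"
      using finite_vimageI[OF weight_comp_finite[of v] h(1)] by (simp add: vimage_def)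
    show ?thesis using lin_Sum_any[OF assms(1) fin] v by simp
  qed
  ultimately have "decomposes V (X v) (\<lambda>\<eta>. X (weight_comp v (h \<eta>)))" unfolding decomposes_def by blast
  thus "decomposes V (X v) (\<lambda>\<eta>. X (weight_comp v (\<lambda>b. \<eta> b - \<theta> b)))" by (simp add: h_def)
qed

text \<open>X carries the weight \<eta> to \<eta> + \<theta>, so multiplication by g after X is
  multiplication by the translate of g before X.\<close>

lemma act_shift:
  assumes "lin X" "shifts_weights V \<theta> X"
  shows "act V g (X v) = X (act V (translate \<theta> g) v)"
proof -
  define h where "h \<eta> = (\<lambda>b. \<eta> b - \<theta> b)" for \<eta> :: hweight
  define f where "f \<eta> = scl V (translate \<theta> g \<eta>) (X (weight_comp v \<eta>))" for \<eta>
  have h: "inj h" "range h = UNIV"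
  proof -
    show "inj h" by (rule injI) (auto simp: h_def fun_eq_iff)
    have "\<eta> = h (\<lambda>b. \<eta> b + \<theta> b)" for \<eta> by (simp add: h_def)
    thus "range h = UNIV" by blast
  qed
  have "act V g (X v) = Sum_any (\<lambda>\<eta>. f (h \<eta>))"
    unfolding act_eq weight_comp_image[OF assms] by (simp add: f_def h_def translate_def)
  also have "\<dots> = Sum_any f"
    by (rule Sum_any_reindex_inj[OF h(1), symmetric]) (use h(2) in auto)
  also have "\<dots> = X (act V (translate \<theta> g) v)"
    unfolding act_eq lin_Sum_any[OF assms(1) scaled_weight_comp_finite] by (simp add: f_def[abs_def] linD[OF assms(1)])
  finally show ?thesis .
qed

lemma translate_0: "translate (\<lambda>_. 0) g = g"
  by (simp add: translate_def fun_eq_iff)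

lemma lin_act: "lin (act V g)"
  unfolding lin_def
proof (intro conjI allI)
  fix v w c
  show "act V g (v + w) = act V g v + act V g w"
    unfolding act_eq weight_comp_add scale_right_distrib
    by (rule Sum_any.distrib) (rule scaled_weight_comp_finite)+
  \<comment> \<open>Scalar multiplication preserves the weight spaces, so homogeneity is the case
    \<theta> = 0 of \<open>act_shift\<close>.\<close>
  have "shifts_weights V (\<lambda>_. 0) (scl V c)"
    using wsp_subspace by (auto simp: shifts_weights_def subspace_def)
  from act_shift[OF lin_scale[OF lin_id] this]
  show "act V g (scl V c v) = scl V c (act V g v)" by (simp add: translate_0)
qed

lemma act_av_commute: "i \<in> nodes D \<Longrightarrow> m \<noteq> 0 \<Longrightarrow> act V g (av V i m v) = av V i m (act V g v)"
  using act_shift[OF lin_av shift_av, of i m g v] by (simp add: translate_0)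

lemma act_Zf:
  assumes "snd t \<in> nodes D"
    and "\<theta> = (if fst t then (\<lambda>b. alpha_wt D (snd t) b - Q_wt D (snd t) b) else (\<lambda>b. - alpha_wt D (snd t) b))"
  shows "act V g (Zf t n v) = Zf t n (act V (translate \<theta> g) v)"
proof (rule Zf_transfer[OF assms(1) lin_act lin_act])
  show "act V g (cur t n v) = cur t n (act V (translate \<theta> g) v)" for n v
    by (rule act_shift[OF gradedD(1)[OF graded_cur[OF assms(1)]]])
       (use assms shift_xp shift_xm in \<open>auto simp: cur_def current_def\<close>)
qed (use act_av_commute assms in auto)

lemma alpha_Zf: "i \<in> nodes D \<Longrightarrow> snd t \<in> nodes D \<Longrightarrow> r \<noteq> 0 \<Longrightarrow> alpha D V i r (Zf t n v) = Zf t n (alpha D V i r v)"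
  by (simp add: alpha_def av_Zf linD[OF lin_Zf])

lemma lin_Kprod:
  assumes "K \<in> {Kp V, Km V}" shows "lin (Kprod D K)"
proof -
  have pw: "lin (K i ^^ c)" if "i \<in> nodes D" for i c
    using lin_K[OF that assms] by (induction c) (auto simp: lin_def)
  have "lin (foldr (\<lambda>i f. (K i ^^ colabel (ltype D) i) \<circ> f) is id)" if "set is \<subseteq> nodes D" for "is"
    using that
  proof (induction "is")
    case Nil show ?case by (simp add: lin_def)
  next
    case (Cons i js)
    thus ?case using lin_comp[OF pw[of i "colabel (ltype D) i"], of "foldr (\<lambda>i f. (K i ^^ colabel (ltype D) i) \<circ> f) js id"]
      by (simp add: o_def id_def)
  qed
  moreover have "set [0..<rk (ltype D) + 1] \<subseteq> nodes D" by (auto simp: nodes_def)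
  ultimately show ?thesis unfolding Kprod_def by blast
qed

lemma Kprod_Zf:
  assumes "K \<in> {Kp V, Km V}" "snd t \<in> nodes D"
  shows "Kprod D K (Zf t n v) = Zf t n (Kprod D K v)"
  by (rule Zf_transfer[OF assms(2) lin_Kprod lin_Kprod])
     (use assms Kprod_central[OF assms(1)] in \<open>auto simp: cur_def current_def\<close>)

lemma K_Zf:
  assumes K: "K \<in> {Kp V, Km V}" "i \<in> nodes D" and t: "snd t \<in> nodes D"
    and rel: "\<And>n v. K i (cur t n (inv (K i) v)) = scl V c (cur t n v)"
  shows "K i (Zf t n (inv (K i) v)) = scl V c (Zf t n v)"
proof -
  have bij: "bij (K i)" using invertible(1)[OF K(2)] K(1) by auto
  have iK: "inv (K i) (K i u) = u" "K i (inv (K i) u) = u" for u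
    using bij by (auto simp: bij_def surj_f_inv_f)
  have L: "lin (K i)" by (rule lin_K[OF K(2,1)])
  have av: "K i (av V (snd t) m v) = av V (snd t) m (K i v)" if "m \<noteq> 0" for m v
    by (rule K_av[OF K(2) t that K(1)])
  \<comment> \<open>The conjugation is rewritten without the inverse; this gives the form B Z = Z B'
    with B' = c K.\<close>
  have "K i (Zf t n u) = Zf t n (scl V c (K i u))" for u
  proof (rule Zf_transfer[where B' = "\<lambda>u. scl V c (K i u)", OF t L lin_scale[OF L] av])
    show "scl V c (K i (av V (snd t) m v)) = av V (snd t) m (scl V c (K i v))" if "m \<noteq> 0" for m v
      by (simp add: av[OF that] linD[OF lin_av[OF t that]])
    show "K i (cur t n v) = cur t n (scl V c (K i v))" for n v
      using rel[of n "K i v"] by (simp add: iK linD[OF gradedD(1)[OF graded_cur[OF t]]])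
  qed simp
  thus ?thesis by (simp add: iK linD[OF lin_Zf[OF t]])
qed

lemma K_Zf_relations:
  assumes "i \<in> nodes D" "j \<in> nodes D"
  shows "Kp V i (Zf (True, j) n (inv (Kp V i) v)) = scl V (qq D powi aa D i j) (Zf (True, j) n v)"
    "Km V i (Zf (True, j) n (inv (Km V i) v)) = scl V (qq D powi (- aa D i j)) (Zf (True, j) n v)"
    "Kp V i (Zf (False, j) n (inv (Kp V i) v)) = scl V (qq D powi (- aa D i j)) (Zf (False, j) n v)"
    "Km V i (Zf (False, j) n (inv (Km V i) v)) = scl V (qq D powi aa D i j) (Zf (False, j) n v)"
  by (rule K_Zf[OF _ assms(1)]; use assms Kp_xp[OF assms] Km_xp[OF assms] Kp_xm[OF assms] Km_xm[OF assms] in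
      \<open>simp add: cur_def current_def\<close>)+

section \<open>Quadratic relations of equal sign and Serre relations\<close>

lemma two_fields:
  assumes "t \<in> UNIV \<times> nodes D" "t' \<in> UNIV \<times> nodes D"
    and \<tau>_def: "\<tau> = (\<lambda>a::nat. if a = 0 then t' else t)"
  shows "in_var 1 (Zf t) \<circledast> in_var 0 (Zf t') = fprod (\<lambda>a. Zf (\<tau> a)) [1, 0]"
    "in_var 0 (Zf t') \<circledast> in_var 1 (Zf t) = fprod (\<lambda>a. Zf (\<tau> a)) [0, 1]"
    "in_var 1 (cur t) \<circledast> in_var 0 (cur t') = fprod (\<lambda>a. cur (\<tau> a)) [1, 0]"
    "in_var 0 (cur t') \<circledast> in_var 1 (cur t) = fprod (\<lambda>a. cur (\<tau> a)) [0, 1]"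
    "\<tau> ` U \<subseteq> UNIV \<times> nodes D"
proof -
  have z: "Zf (\<tau> a) n 0 = 0" "cur (\<tau> a) n 0 = 0" for a n
    using assms by (auto simp: \<tau>_def linD[OF lin_Zf] linD[OF gradedD(1)[OF graded_cur]])
  show "in_var 1 (Zf t) \<circledast> in_var 0 (Zf t') = fprod (\<lambda>a. Zf (\<tau> a)) [1, 0]"
    using dprod_two[of "\<lambda>a. Zf (\<tau> a)" 1 0, OF z(1)] by (simp add: \<tau>_def)
  show "in_var 0 (Zf t') \<circledast> in_var 1 (Zf t) = fprod (\<lambda>a. Zf (\<tau> a)) [0, 1]"
    using dprod_two[of "\<lambda>a. Zf (\<tau> a)" 0 1, OF z(1)] by (simp add: \<tau>_def)
  show "in_var 1 (cur t) \<circledast> in_var 0 (cur t') = fprod (\<lambda>a. cur (\<tau> a)) [1, 0]"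
    using dprod_two[of "\<lambda>a. cur (\<tau> a)" 1 0, OF z(2)] by (simp add: \<tau>_def)
  show "in_var 0 (cur t') \<circledast> in_var 1 (cur t) = fprod (\<lambda>a. cur (\<tau> a)) [0, 1]"
    using dprod_two[of "\<lambda>a. cur (\<tau> a)" 0 1, OF z(2)] by (simp add: \<tau>_def)
  show "\<tau> ` U \<subseteq> UNIV \<times> nodes D" using assms by (auto simp: \<tau>_def)
qed

lemma dscale_in_ratio':
  "a \<noteq> b \<Longrightarrow> dscale (scl V) (in_ratio F c a b) M = RAT (fps_dilate c F) a b M"
  unfolding in_ratio_dilate[of F c] by (rule dscale_in_ratio)

lemma cur_cur:
  assumes "i \<in> nodes D" "j \<in> nodes D"
  shows "dscale (scl V) (\<lambda>e. var (kap D powi mm D i j) 1 e - var (qq D powi shift_b s i j) 0 e)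
        (dscale (scl V) (in_ratio (struct s i j) (kap D powi (- mm D i j)) 0 1) (in_var 1 (cur (s, i)) \<circledast> in_var 0 (cur (s, j)))) =
      dscale (scl V) (\<lambda>e. var (kap D powi mm D i j * qq D powi shift_b s i j) 1 e - var 1 0 e)
        (dscale (scl V) (in_ratio (struct s i j) (kap D powi mm D i j) 1 0) (in_var 0 (cur (s, j)) \<circledast> in_var 1 (cur (s, i))))"
  using xp_xp[OF assms] xm_xm[OF assms] by (cases s) (simp_all add: shift_b_def struct_def cur_def)

lemma kp_inverse: "kp j i = kap D powi mm D i j" "kp i j * kap D powi mm D i j = 1"
  using kap_nz by (simp_all add: mm_antisym[of D j i] power_int_minus)

lemma struct_sym: "i \<in> nodes D \<Longrightarrow> j \<in> nodes D \<Longrightarrow> struct s j i = struct s i j"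
  and shift_b_sym: "i \<in> nodes D \<Longrightarrow> j \<in> nodes D \<Longrightarrow> shift_b s j i = shift_b s i j"
  by (simp_all only: struct_def shift_b_def gser_def bb_sym[of j i])

lemma Zf_exchange:
  assumes ij: "i \<in> nodes D" "j \<in> nodes D"
  defines "F \<equiv> qpoch_quot (qq D powi (- bb D i j)) (qq D powr (2 * k) * qq D powi bb D i j) (qq D powr (2 * k))"
  shows "dscale (scl V) (var 1 1) (dscale (scl V) (in_ratio F (kap D powi (- mm D i j)) 0 1) (in_var 1 (Zf (s, i)) \<circledast> in_var 0 (Zf (s, j)))) =
    dscale (scl V) (var (- (kap D powi (- mm D i j))) 0) (dscale (scl V) (in_ratio F (kap D powi mm D i j) 1 0) (in_var 0 (Zf (s, j)) \<circledast> in_var 1 (Zf (s, i))))"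
proof (intro ext)
  fix e v
  define \<tau> where "\<tau> = (\<lambda>a::nat. if a = 0 then (s, j) else (s, i))"
  have J: "(s, i) \<in> UNIV \<times> nodes D" "(s, j) \<in> UNIV \<times> nodes D" using ij by auto
  have tau: "\<tau> 0 = (s, j)" "\<tau> (Suc 0) = (s, i)" by (simp_all add: \<tau>_def)
  note tf = two_fields[OF J \<tau>_def]
  have F: "F = qpoch_quot (qq D powi (- bb D i j)) (qk\<^sup>2 * qq D powi bb D i j) (qk\<^sup>2)"
    by (simp only: F_def q_powr(6))
  have F2: "F = qpoch_quot (qq D powi (- bb D j i)) (qk\<^sup>2 * qq D powi bb D j i) (qk\<^sup>2)"
    by (simp only: F bb_sym[OF ij])
  define c c' where "c = kp i j" and "c' = kap D powi mm D i j"
  have cc: "c * c' = 1" unfolding c_def c'_def by (rule kp_inverse)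
  define u where "u = qq D powi shift_b s i j"
  define M1 where "M1 = RAT (fps_dilate c (struct s i j)) 0 1 (fprod (\<lambda>a. cur (\<tau> a)) [1, 0])"
  define M2 where "M2 = RAT (fps_dilate c' (struct s i j)) 1 0 (fprod (\<lambda>a. cur (\<tau> a)) [0, 1])"
  have h: "fps_dilate c F * pexp (hlog (\<tau> 1) (\<tau> 0)) = (1 - fps_const (u * c) * fps_X) * fps_dilate c (struct s i j)"
    using struct_exchange[OF ij, of s] by (simp add: \<tau>_def F c_def u_def)
  have h': "fps_dilate c' F * pexp (hlog (\<tau> 0) (\<tau> 1)) = (1 - fps_const (u * c') * fps_X) * fps_dilate c' (struct s i j)"
    using struct_exchange[OF ij(2,1), of s]
    by (simp add: \<tau>_def F2 c'_def u_def kp_inverse(1) struct_sym[OF ij] shift_b_sym[OF ij])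
  have rel: "VS 1 M1 e v - scl V (u * c) (VS 0 M1 e v) = scl V (- c) (VS 0 M2 e v - scl V (u * c') (VS 1 M2 e v))" for e v
  proof -
    have "scl V c' (VS 1 M1 e v) - scl V u (VS 0 M1 e v) = scl V (c' * u) (VS 1 M2 e v) - scl V 1 (VS 0 M2 e v)"
      using fun_cong[OF fun_cong[OF cur_cur[OF ij, of s]], of e v]
      by (simp add: dscale_var_diff tau tf[simplified, simplified tau] dscale_in_ratio' M1_def M2_def c_def c'_def u_def)
    \<comment> \<open>Multiplication by c = 1/c' makes the coefficient of z equal to 1; taking out
      the sign on the right leaves the factor -c of the claim.\<close>
    hence "scl V c (scl V c' (VS 1 M1 e v) - scl V u (VS 0 M1 e v)) = scl V c (scl V (c' * u) (VS 1 M2 e v) - scl V 1 (VS 0 M2 e v))"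
      by simp
    thus ?thesis using cc by (simp add: scale_right_diff_distrib mult_ac)
  qed
  have "VS 1 (RAT (fps_dilate c F) 0 1 (fprod (\<lambda>a. Zf (\<tau> a)) [1, 0])) e v =
    scl V (- c) (VS 0 (RAT (fps_dilate c' F) 1 0 (fprod (\<lambda>a. Zf (\<tau> a)) [0, 1])) e v)"
    by (rule vf.exchange_relation[OF tf(5) h h']) (rule rel[unfolded M1_def M2_def])
  thus "dscale (scl V) (var 1 1) (dscale (scl V) (in_ratio F (kap D powi (- mm D i j)) 0 1) (in_var 1 (Zf (s, i)) \<circledast> in_var 0 (Zf (s, j)))) e v =
    dscale (scl V) (var (- (kap D powi (- mm D i j))) 0) (dscale (scl V) (in_ratio F (kap D powi mm D i j) 1 0) (in_var 0 (Zf (s, j)) \<circledast> in_var 1 (Zf (s, i)))) e v"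
    by (simp add: dscale_var dscale_in_ratio' tau tf[simplified, simplified tau] c_def c'_def)
qed

lemma Zf_serre:
  assumes ij: "i \<in> nodes D" "j \<in> nodes D" "i \<noteq> j"
  shows "serre_sum D (scl V) i j (serre_struct s i i) (serre_struct s i j) (Zf (s, i)) (Zf (s, j)) = (\<lambda>e v. 0)"
proof (rule vf.serre_relation)
  show "(s, i) \<in> UNIV \<times> nodes D" "(s, j) \<in> UNIV \<times> nodes D" using ij by auto
  show "serre_struct s i i * pexp (hlog (s, i) (s, i)) = struct s i i"
    using struct_serre[OF ij(1,1), of s] by (simp add: mm_same fps_dilate_1)
  show "fps_dilate (kap D powi (- mm D i j)) (serre_struct s i j) * pexp (hlog (s, i) (s, j)) = fps_dilate (kap D powi (- mm D i j)) (struct s i j)"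
    by (rule struct_serre[OF ij(1,2)])
  have "serre_struct s j i = serre_struct s i j" by (simp add: serre_struct_def bb_sym[OF ij(1,2)])
  thus "fps_dilate (kap D powi mm D i j) (serre_struct s i j) * pexp (hlog (s, j) (s, i)) = fps_dilate (kap D powi mm D i j) (struct s i j)"
    using struct_serre[OF ij(2,1), of s] by (simp add: kp_inverse(1) struct_sym[OF ij(1,2)])
  show "serre_sum D (scl V) i j (struct s i i) (struct s i j) (cur (s, i)) (cur (s, j)) = (\<lambda>e v. 0)"
    using serre_p[OF ij] serre_m[OF ij] by (cases s) (simp_all add: struct_def cur_def)
qed

text \<open>The diagonal entry is b_ii = 2 d_i, so q^(b_ii) is q_i^2.\<close>

lemma serre_struct_diag:
  "serre_struct True i i = qpoch_quot (qi D i powi (- 2)) (qi D i powi 2) (qk\<^sup>2)"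
  "serre_struct False i i = qpoch_quot (qi D i powi (- 2) * qk\<^sup>2) (qi D i powi 2 * qk\<^sup>2) (qk\<^sup>2)"
proof -
  have "bb D i i = int (symm D i) * 2" by (simp add: bb_def aa_def affine_cartan_def)
  hence "qq D powi (- bb D i i) = qi D i powi (- 2)" "qq D powi bb D i i = qi D i powi 2"
    unfolding qi_def power_int_of_nat[symmetric] by (simp_all only: power_int_mult[symmetric] mult_minus_right)
  thus "serre_struct True i i = qpoch_quot (qi D i powi (- 2)) (qi D i powi 2) (qk\<^sup>2)"
    "serre_struct False i i = qpoch_quot (qi D i powi (- 2) * qk\<^sup>2) (qi D i powi 2 * qk\<^sup>2) (qk\<^sup>2)"
    by (simp_all only: serre_struct_def if_True if_False)
qed

section \<open>The currents phi and the commutator of opposite signs\<close>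

definition pcoef :: "bool \<Rightarrow> nat \<Rightarrow> nat \<Rightarrow> complex" where
  "pcoef s i m = (if s then - (qi D i - inverse (qi D i)) * pp D ^ m / (1 - pp D ^ m)
     else - (qi D i - inverse (qi D i)) / (1 - pp D ^ m))"

definition ncoef :: "bool \<Rightarrow> nat \<Rightarrow> nat \<Rightarrow> complex" where
  "ncoef s i m = (if s then (qi D i - inverse (qi D i)) / (1 - pp D ^ m)
     else (qi D i - inverse (qi D i)) * pp D ^ m / (1 - pp D ^ m))"

definition cscaled :: "nat \<Rightarrow> (nat \<Rightarrow> complex) \<Rightarrow> nat \<Rightarrow> 'v op" where
  "cscaled i g m v = scl V (g m) (av V i (- int m) v)"

definition ascaled :: "nat \<Rightarrow> (nat \<Rightarrow> complex) \<Rightarrow> nat \<Rightarrow> 'v op" where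
  "ascaled i g m v = scl V (g m) (av V i (int m) v)"

definition phi :: "bool \<Rightarrow> nat \<Rightarrow> int \<Rightarrow> 'v op" where
  "phi s = (if s then phi_plus else phi_minus) D V"

definition Kf :: "bool \<Rightarrow> nat \<Rightarrow> 'v op" where
  "Kf s = (if s then Kp V else Km V)"

lemma phi_eq: "phi s i n v =
    Kf s i ((in_z (op_exp (scl V) (cscaled i (pcoef s i))) \<circledast> in_inv_z (op_exp (scl V) (ascaled i (ncoef s i)))) n v)"
  unfolding phi_def Kf_def cscaled_def[abs_def] ascaled_def[abs_def] pcoef_def ncoef_def
  by (cases s) (simp_all add: phi_plus_def phi_minus_def)

lemma graded_scaled:
  assumes "i \<in> nodes D" "m > 0"
  shows "graded (int m) (cscaled i g m)" "graded (- int m) (ascaled i g m)"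
  unfolding cscaled_def[abs_def] ascaled_def[abs_def]
  using assms graded_av[of i "- int m"] graded_av[of i "int m"] by (auto intro!: graded_scale)

lemma scaled_commute:
  assumes "i \<in> nodes D" "m > 0" "n > 0"
  shows "cscaled i g m (cscaled i h n v) = cscaled i h n (cscaled i g m v)"
    "ascaled i g m (ascaled i h n v) = ascaled i h n (ascaled i g m v)"
  unfolding cscaled_def ascaled_def
  using assms av_commute[of i i "- int m" "- int n" v] av_commute[of i i "int m" "int n" v]
  by (simp_all add: linD[OF lin_av] mult.commute)

lemma exp_scaled:
  assumes "i \<in> nodes D"
  shows "exp_of (cscaled i g) (op_exp (scl V) (cscaled i g))" "exp_of (ascaled i g) (op_exp (scl V) (ascaled i g))"
  using assms by (auto intro!: exp_of_op_exp scaled_commute gradedD(1)[OF graded_scaled(1)] gradedD(1)[OF graded_scaled(2)])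

lemma lin_exp_scaled:
  assumes "i \<in> nodes D"
  shows "lin (op_exp (scl V) (cscaled i g) n)" "lin (op_exp (scl V) (ascaled i g) n)"
  by (rule gradedD(1)[OF exp_of_graded[OF exp_scaled(1)[OF assms], where d = 1]])
     (rule gradedD(1)[OF exp_of_graded[OF exp_scaled(2)[OF assms], where d = "- 1"]] | use graded_scaled[OF assms] in simp)+

lemma lin_Kf: "i \<in> nodes D \<Longrightarrow> lin (Kf s i)"
  using lin_K by (simp add: Kf_def)

lemma phi_zero:
  assumes i: "i \<in> nodes D" shows "phi s i n 0 = 0"
proof -
  have "op_exp (scl V) (cscaled i g) m 0 = 0" "op_exp (scl V) (ascaled i g) m 0 = 0" for g m
    using lin_exp_scaled[OF i, of g m] by (simp_all add: linD(3))
  hence "in_z (op_exp (scl V) (cscaled i g)) m 0 = 0" "in_inv_z (op_exp (scl V) (ascaled i g)) m 0 = 0" for g m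
    by (simp_all add: in_z_def in_inv_z_def)
  thus ?thesis by (simp add: phi_eq dprod_def linD(3)[OF lin_Kf[OF i]])
qed

definition pair_type :: "nat \<Rightarrow> nat \<Rightarrow> nat \<Rightarrow> bool \<times> nat" where
  "pair_type i j = (\<lambda>a. if a = 0 then (False, j) else (True, i))"

lemma cur_commutator:
  assumes ij: "i \<in> nodes D" "j \<in> nodes D"
  shows "fprod (\<lambda>a. cur (pair_type i j a)) [1, 0] e v - fprod (\<lambda>a. cur (pair_type i j a)) [0, 1] e v =
    scl V (of_bool (i = j) / (qi D i - inverse (qi D i)))
      (dilated_delta (scl V) qk (in_var 0 (phi True i)) e v - dilated_delta (scl V) (inverse qk) (in_var 0 (phi False i)) e v)"
proof -
  have J: "(True, i) \<in> UNIV \<times> nodes D" "(False, j) \<in> UNIV \<times> nodes D" using ij by auto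
  note tf = two_fields[OF J pair_type_def]
  have xcs: "cur (True, i) = current (xp V i)" "cur (False, j) = current (xm V j)" by (simp_all add: cur_def)
  have phis: "phi_plus D V i = phi True i" "phi_minus D V i = phi False i" by (simp_all add: phi_def)
  show ?thesis
    using xp_xm[OF ij, of e v]
    unfolding phis qk_def[symmetric] q_powr(5) delta_ratio_dprod(1)[where \<phi> = "phi True i", OF qk_nz phi_zero[OF ij(1)]]
      delta_ratio_dprod(2)[where \<phi> = "phi False i", OF qk_nz phi_zero[OF ij(1)]] xcs[symmetric] tf(3,4) .
qed

lemma adm_graded: "adm S T M \<Longrightarrow> graded (sum e S) (M e)"
  unfolding adm_def adm1_def by blast

text \<open>The \<open>K\<^sub>i\<^sup>\<plusminus>\<close> are not assumed to preserve the energy filtration; that the modes of \<open>\<phi>\<^sub>i\<^sup>\<plusminus>\<close> shift it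
  correctly is recovered from two coefficients of the commutator \<open>[x\<^sub>i\<^sup>+(z), x\<^sub>i\<^sup>-(w)]\<close>.\<close>

lemma graded_phi:
  assumes i: "i \<in> nodes D"
  shows "graded n (phi s i n)"
proof -
  define c where "c = qi D i - inverse (qi D i)"
  have c: "c \<noteq> 0" unfolding c_def by (rule qi_diff_nz[OF i])
  define C where "C e v = scl V c (fprod (\<lambda>a. cur (pair_type i i a)) [1, 0] e v - fprod (\<lambda>a. cur (pair_type i i a)) [0, 1] e v)" for e v
  have J: "pair_type i i ` set [1, 0] \<subseteq> UNIV \<times> nodes D" "pair_type i i ` set [0, 1] \<subseteq> UNIV \<times> nodes D"
    using i by (auto simp: pair_type_def)
  have grC: "graded (e 0 + e 1) (C e)" for e
  proof -
    have "graded (sum e (set [1, 0])) (fprod (\<lambda>a. cur (pair_type i i a)) [1, 0] e)"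
      by (rule adm_graded[OF vf.fprod_x_adm[OF _ J(1)]]) simp
    moreover have "graded (sum e (set [0, 1])) (fprod (\<lambda>a. cur (pair_type i i a)) [0, 1] e)"
      by (rule adm_graded[OF vf.fprod_x_adm[OF _ J(2)]]) simp
    ultimately have "graded (e 0 + e 1) (\<lambda>v. fprod (\<lambda>a. cur (pair_type i i a)) [1, 0] e v + scl V (- 1) (fprod (\<lambda>a. cur (pair_type i i a)) [0, 1] e v))"
      by (intro graded_add graded_scale) (simp_all add: add.commute)
    from graded_scale[OF this, of c] show ?thesis unfolding C_def[abs_def] by simp
  qed
  have C: "C e v = dilated_delta (scl V) qk (in_var 0 (phi True i)) e v - dilated_delta (scl V) (inverse qk) (in_var 0 (phi False i)) e v" for e v
    unfolding C_def cur_commutator[OF i i] using c by (simp add: c_def[symmetric])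
  \<comment> \<open>Two exponents of total degree n. Their coefficients are \<phi>^+ - \<phi>^- and
    qk^(-1) \<phi>^+ - qk \<phi>^- in mode n, and these two equations can be solved because qk^2
    \<noteq> 1.\<close>
  define e0 where "e0 = (\<lambda>_::nat. 0::int)(0 := n)"
  define e1 where "e1 = (\<lambda>_::nat. 0::int)(0 := n - 1, 1 := 1)"
  have C0: "C e0 v = phi True i n v - phi False i n v" for v
    unfolding C by (simp add: dilated_delta_def in_var_def e0_def)
  have C1: "C e1 v = scl V (inverse qk) (phi True i n v) - scl V qk (phi False i n v)" for v
    unfolding C by (simp add: dilated_delta_def in_var_def e1_def power_int_minus)
  have g: "graded n (C e0)" "graded n (C e1)" using grC[of e0] grC[of e1] by (simp_all add: e0_def e1_def)
  define d where "d = qk - inverse qk"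
  have d: "d \<noteq> 0"
    using power_facts(3)[of 1] qk_nz by (auto simp: d_def field_simps power2_eq_square)
  have P: "phi True i n v = scl V (inverse d) (scl V qk (C e0 v) + scl V (- 1) (C e1 v))" for v
  proof -
    have "scl V qk (C e0 v) + scl V (- 1) (C e1 v) = scl V d (phi True i n v)"
      unfolding C0 C1 d_def by (simp add: scale_right_diff_distrib scale_left_diff_distrib)
    thus ?thesis using d by simp
  qed
  have gP: "graded n (phi True i n)"
    unfolding P[abs_def] by (intro graded_scale graded_add g)
  have "phi False i n = (\<lambda>v. phi True i n v + scl V (- 1) (C e0 v))" by (simp add: C0 fun_eq_iff)
  moreover have "graded n (\<lambda>v. phi True i n v + scl V (- 1) (C e0 v))" by (intro graded_scale graded_add g gP)
  ultimately show ?thesis using gP by (cases s) auto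
qed

lemma phi_adm:
  assumes "i \<in> nodes D"
  shows "adm {0} {} (in_var 0 (phi s i))"
  unfolding adm_def adm1_def
proof (intro allI conjI impI)
  fix e :: expo
  show "graded (sum e {0}) (in_var 0 (phi s i) e)"
  proof (cases "\<forall>b. b \<noteq> 0 \<longrightarrow> e b = 0")
    case True
    hence "in_var 0 (phi s i) e = phi s i (e 0)" by (simp add: in_var_def fun_eq_iff)
    thus ?thesis using graded_phi[OF assms, of "e 0" s] by simp
  next
    case False
    hence "in_var 0 (phi s i) e = (\<lambda>v. 0)" by (auto simp: in_var_def fun_eq_iff)
    thus ?thesis using graded_0[of "e 0"] by simp
  qed
  fix N v and a :: nat assume "in_var 0 (phi s i) e v \<noteq> 0" "a \<notin> {0}"
  thus "e a = 0" by (auto simp: in_var_def split: if_splits)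
qed auto

definition delta_scale :: "bool \<Rightarrow> complex" where "delta_scale s = (if s then qk else inverse qk)"

text \<open>Only K is left of the current. It stays in front because it commutes with the Heisenberg
  modes and hence with all exponentials.\<close>

lemma dressed_delta_phi:
  assumes i: "i \<in> nodes D"
  shows "vf.sand (pair_type i i) [1, 0] (dilated_delta (scl V) (delta_scale s) (in_var 0 (phi s i))) e v = scl V (delta_ratio (delta_scale s) 0 1 e) (Kf s i v)"
proof -
  have E0: "exp_of (cscaled i (ccoef (False, i))) (Em (False, i))" and E1: "exp_of (cscaled i (ccoef (True, i))) (Em (True, i))"
    and F0: "exp_of (ascaled i (acoef (False, i))) (Ep (False, i))" and F1: "exp_of (ascaled i (acoef (True, i))) (Ep (True, i))"
    using exp_Em[of "(False, i)"] exp_Em[of "(True, i)"] exp_Ep[of "(False, i)"] exp_Ep[of "(True, i)"] i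
    by (simp_all add: cscaled_def[abs_def] ascaled_def[abs_def] cmode_eq[abs_def] amode_eq[abs_def])
  have avK: "av V i m (Kf s i v) = Kf s i (av V i m v)" if "m \<noteq> 0" for m v
    using K_av[OF i i that] by (simp add: Kf_def)
  have KE: "Em t r (Kf s i v) = Kf s i (Em t r v)" if "snd t = i" for t r v
    by (rule exp_of_commute[OF exp_Em lin_Kf[OF i]]) (use that i in \<open>simp_all add: cmode_eq linD[OF lin_Kf[OF i]] avK\<close>)
  have "LF 1 (Em (True, i)) (LF 0 (Em (False, i)) (RG 1 (Ep (True, i)) (RG 0 (Ep (False, i)) (dilated_delta (scl V) (delta_scale s) (in_var 0 (phi s i)))))) e v =
    scl V (delta_ratio (delta_scale s) 0 1 e) (Kf s i v)"
  proof (rule delta_dressing_cancel[OF lin_Kf[OF i] KE KE phi_eq _ E0 E1 exp_scaled(1)[OF i] F0 F1 exp_scaled(2)[OF i]])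
    show "delta_scale s \<noteq> 0" using qk_nz by (simp add: delta_scale_def)
    fix m :: nat and v :: 'v assume m: "m > 0"
    note pf = power_facts[OF m]
    note s4 = phi_coefficient_identities[OF pf(4,3,1,2,6,7) q_diff_nz, of "qi D i - inverse (qi D i)"]
    note u = ccoef_def acoef_def pcoef_def ncoef_def dress_def fst_conv snd_conv if_True if_False minus_minus
      power_int_minus[of _ "int m"] power_int_of_nat inverse_inverse_eq power_inverse
    have "delta_scale s ^ m * ccoef (True, i) m + (ccoef (False, i) m + pcoef s i m) = 0"
      by (cases s; simp only: delta_scale_def u s4)
    thus "scl V (delta_scale s ^ m) (cscaled i (ccoef (True, i)) m v) + (cscaled i (ccoef (False, i)) m v + cscaled i (pcoef s i) m v) = 0"
      by (simp add: cscaled_def flip: scale_left_distrib)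
    have "ncoef s i m + (acoef (False, i) m + inverse (delta_scale s) ^ m * acoef (True, i) m) = 0"
      by (cases s; simp only: delta_scale_def u s4)
    thus "ascaled i (ncoef s i) m v + (ascaled i (acoef (False, i)) m v + scl V (inverse (delta_scale s) ^ m) (ascaled i (acoef (True, i)) m v)) = 0"
      by (simp add: ascaled_def flip: scale_left_distrib)
  qed (use i in \<open>auto intro: graded_scaled scaled_commute\<close>)
  thus ?thesis unfolding vf.sand_def by (simp add: pair_type_def)
qed

lemma Zf_commutator:
  assumes ij: "i \<in> nodes D" "j \<in> nodes D"
  defines "F \<equiv> qpoch_quot (qq D powi bb D i j * qq D powr k) (qq D powi (- bb D i j) * qq D powr k) (qq D powr (2 * k))"
  shows "dscale (scl V) (in_ratio F (kap D powi (- mm D i j)) 0 1) (in_var 1 (Zf (True, i)) \<circledast> in_var 0 (Zf (False, j))) e v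
     - dscale (scl V) (in_ratio F (kap D powi mm D i j) 1 0) (in_var 0 (Zf (False, j)) \<circledast> in_var 1 (Zf (True, i))) e v =
    scl V (of_bool (i = j) / (qi D i - inverse (qi D i)))
        (scl V (delta_ratio (qq D powr k) 0 1 e) (Kp V i v) - scl V (delta_ratio (qq D powr (- k)) 0 1 e) (Km V i v))"
proof -
  define \<tau> where "\<tau> = pair_type i j"
  define c where "c = of_bool (i = j) / (qi D i - inverse (qi D i))"
  define M where "M s = dilated_delta (scl V) (delta_scale s) (in_var 0 (phi s i))" for s
  have J: "(True, i) \<in> UNIV \<times> nodes D" "(False, j) \<in> UNIV \<times> nodes D" using ij by auto
  have tau: "\<tau> 0 = (False, j)" "\<tau> (Suc 0) = (True, i)" by (simp_all add: \<tau>_def pair_type_def)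
  note tf = two_fields[OF J pair_type_def, folded \<tau>_def]
  have F: "F = qpoch_quot (qq D powi bb D i j * qk) (qq D powi (- bb D i j) * qk) (qk\<^sup>2)"
    by (simp only: F_def q_powr(6) qk_def)
  have F2: "F = qpoch_quot (qq D powi bb D j i * qk) (qq D powi (- bb D j i) * qk) (qk\<^sup>2)"
    by (simp only: F bb_sym[OF ij])
  have h: "fps_dilate (kp i j) F * pexp (hlog (\<tau> 1) (\<tau> 0)) = 1"
    using struct_mixed[OF ij, of True] by (simp add: tau F)
  have h': "fps_dilate (kap D powi mm D i j) F * pexp (hlog (\<tau> 0) (\<tau> 1)) = 1"
    using struct_mixed[OF ij(2,1), of False] by (simp add: tau F2 kp_inverse(1))
  have "(\<lambda>e v. fprod (\<lambda>a. cur (\<tau> a)) [1, 0] e v - fprod (\<lambda>a. cur (\<tau> a)) [0, 1] e v) =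
    (\<lambda>e v. scl V c (M True e v - M False e v))"
    unfolding \<tau>_def cur_commutator[OF ij] c_def M_def delta_scale_def by simp
  hence "dscale (scl V) (in_ratio F (kap D powi (- mm D i j)) 0 1) (in_var 1 (Zf (True, i)) \<circledast> in_var 0 (Zf (False, j))) e v
     - dscale (scl V) (in_ratio F (kap D powi mm D i j) 1 0) (in_var 0 (Zf (False, j)) \<circledast> in_var 1 (Zf (True, i))) e v =
    vf.sand \<tau> [1, 0] (\<lambda>e v. scl V c (M True e v - M False e v)) e v"
    using vf.commutator_relation[OF tf(5) h h', of e v]
    by (simp add: dscale_in_ratio' tau tf[simplified, simplified tau])
  also have "\<dots> = scl V c (scl V (delta_ratio qk 0 1 e) (Kp V i v) - scl V (delta_ratio (inverse qk) 0 1 e) (Km V i v))"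
  \<comment> \<open>For i \<noteq> j the factor c is 0. For i = j the two delta terms are treated
    separately, which linearity of the sandwich allows once both are known to be admissible.\<close>
  proof (cases "i = j")
    case True
    have S: "set [1, 0] \<subseteq> {0, 1::nat}" "finite {0, 1::nat}" "\<tau> ` set [1, 0] \<subseteq> UNIV \<times> nodes D"
      using ij by (auto simp: tau)
    have A: "adm {0, 1} {} (M s)" for s
      unfolding M_def by (rule dilated_delta_adm[OF _ phi_adm[OF ij(1)]]) (use qk_nz in \<open>simp add: delta_scale_def\<close>)
    have A': "adm {0, 1} {} (\<lambda>e v. scl V (- 1) (M False e v))"
      using A[of False] graded_scale[of _ "M False _" "- 1"] unfolding adm_def adm1_def by simp
    have A2: "adm {0, 1} {} (\<lambda>e v. M True e v + scl V (- 1) (M False e v))"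
      unfolding adm_def adm1_def
    proof (intro allI conjI impI)
      fix e :: expo
      show "graded (sum e {0, 1}) (\<lambda>v. M True e v + scl V (- 1) (M False e v))"
        by (rule graded_add[OF adm_graded[OF A] adm_graded[OF A']])
      fix N v and a :: nat
      assume v: "v \<in> energy_filtration D V N" and nz: "M True e v + scl V (- 1) (M False e v) \<noteq> 0" and a: "a \<notin> {0, 1}"
      from nz obtain s where "M s e v \<noteq> 0" by (metis scale_zero_right add_0)
      moreover have "adm1 {0, 1} {} e (M s e)" using A[of s] unfolding adm_def ..
      ultimately show "e a = 0" using v a adm1D(3) by blast
    qed auto
    have "vf.sand \<tau> [1, 0] (\<lambda>e v. scl V c (M True e v - M False e v)) e v =
      scl V c (vf.sand \<tau> [1, 0] (\<lambda>e v. M True e v + scl V (- 1) (M False e v)) e v)"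
      using vf.sand_scale[OF S A2, of c] by simp
    also have "\<dots> = scl V c (vf.sand \<tau> [1, 0] (M True) e v + scl V (- 1) (vf.sand \<tau> [1, 0] (M False) e v))"
      unfolding vf.sand_add[OF S A A'] vf.sand_scale[OF S A] ..
    also have "\<dots> = scl V c (scl V (delta_ratio qk 0 1 e) (Kp V i v) - scl V (delta_ratio (inverse qk) 0 1 e) (Km V i v))"
    proof -
      have "vf.sand \<tau> [1, 0] (M s) e v = scl V (delta_ratio (delta_scale s) 0 1 e) (Kf s i v)" for s
        using dressed_delta_phi[OF ij(1)] True unfolding \<tau>_def M_def by blast
      thus ?thesis by (simp add: delta_scale_def Kf_def)
    qed
    finally show ?thesis .
  next
    case False
    have "vf.sand \<tau> [1, 0] (\<lambda>e v. 0) = (\<lambda>e v. 0)"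
      using vf.sand_sum[of "[1, 0]" "{0, 1}" \<tau> "{} :: nat set" "\<lambda>_. {}" "\<lambda>_ _ _. 0"] ij by (simp add: tau)
    thus ?thesis using False by (simp add: c_def)
  qed
  finally show ?thesis unfolding c_def qk_def[symmetric] q_powr(5) .
qed

end

theorem theorem5p2:
  fixes D :: toroidal_data and k l :: complex and V :: "('v::ab_group_add) tor_rep"
  assumes "toroidal_data_ok D" and "k \<noteq> 0"
    and "norm (pp D) < 1" and "norm (pstar D k) < 1" and "norm (qq D powr (2 * k)) < 1"
    and "category_C D k l V"
  defines "q \<equiv> qq D" and "\<kappa> \<equiv> kap D" and "I \<equiv> nodes D"
    and "a \<equiv> aa D" and "b \<equiv> bb D" and "m \<equiv> mm D"
    and "Q \<equiv> qq D powr (2 * k)" and "scalmul \<equiv> dscale (scl V)"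
    and "Zp \<equiv> Zplus D k V" and "Zm \<equiv> Zminus D k V"
    and "z \<equiv> 1 :: nat" and "w \<equiv> 0 :: nat"
  shows
    \<comment> \<open>1\<close>
    "(\<forall>i\<in>I. \<forall>j\<in>I. \<forall>r. r \<noteq> 0 \<longrightarrow> (\<forall>Z\<in>{Zp, Zm}. \<forall>n v.
        alpha D V i r (Z j n v) - Z j n (alpha D V i r v) = 0)) \<and>
    \<comment> \<open>2\<close>
     (\<forall>K\<in>{Kp V, Km V}. \<forall>j\<in>I. \<forall>n v. Kprod D K (Zp j n v) - Zp j n (Kprod D K v) = 0) \<and>
    \<comment> \<open>3\<close>
     (\<forall>g\<in>merF D. \<forall>i\<in>I.
        (\<forall>n v. act V g (Zp i n v) = Zp i n (act V (translate (\<lambda>x. alpha_wt D i x - Q_wt D i x) g) v)) \<and>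
        (\<forall>n v. act V g (Zm i n v) = Zm i n (act V (translate (\<lambda>x. - alpha_wt D i x) g) v)) \<and>
        (\<forall>K\<in>{Kp V, Km V}. \<forall>v. act V g (K i v) = K i (act V (translate (\<lambda>x. - Q_wt D i x) g) v))) \<and>
    \<comment> \<open>4\<close>
     (\<forall>i\<in>I. \<forall>j\<in>I. \<forall>n v.
        Kp V i (Zp j n (inv (Kp V i) v)) = scl V (q powi a i j) (Zp j n v) \<and>
        Km V i (Zp j n (inv (Km V i) v)) = scl V (q powi (- a i j)) (Zp j n v) \<and>
        Kp V i (Zm j n (inv (Kp V i) v)) = scl V (q powi (- a i j)) (Zm j n v) \<and>
        Km V i (Zm j n (inv (Km V i) v)) = scl V (q powi a i j) (Zm j n v)) \<and>
    \<comment> \<open>5\<close>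
     (\<forall>i\<in>I. \<forall>j\<in>I. \<forall>Z\<in>{Zp, Zm}.
        scalmul (var 1 z)
          (scalmul (in_ratio (qpoch_quot (q powi (- b i j)) (Q * q powi b i j) Q) (\<kappa> powi (- m i j)) w z)
            (in_var z (Z i) \<circledast> in_var w (Z j))) =
        scalmul (var (- (\<kappa> powi (- m i j))) w)
          (scalmul (in_ratio (qpoch_quot (q powi (- b i j)) (Q * q powi b i j) Q) (\<kappa> powi m i j) z w)
            (in_var w (Z j) \<circledast> in_var z (Z i)))) \<and>
    \<comment> \<open>6\<close>
     (\<forall>i\<in>I. \<forall>j\<in>I. \<forall>e v.
        scalmul (in_ratio (qpoch_quot (q powi b i j * q powr k) (q powi (- b i j) * q powr k) Q)
                 (\<kappa> powi (- m i j)) w z)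
            (in_var z (Zp i) \<circledast> in_var w (Zm j)) e v
        - scalmul (in_ratio (qpoch_quot (q powi b i j * q powr k) (q powi (- b i j) * q powr k) Q)
                   (\<kappa> powi m i j) z w)
            (in_var w (Zm j) \<circledast> in_var z (Zp i)) e v
        = scl V (of_bool (i = j) / (qi D i - inverse (qi D i)))
            (scl V (delta_ratio (q powr k) w z e) (Kp V i v)
             - scl V (delta_ratio (q powr (- k)) w z e) (Km V i v))) \<and>
    \<comment> \<open>7\<close>
     (\<forall>i\<in>I. \<forall>j\<in>I. i \<noteq> j \<longrightarrow>
        serre_sum D (scl V) i j
          (qpoch_quot (qi D i powi (- 2)) (qi D i powi 2) Q)
          (qpoch_quot (q powi (- b i j)) (q powi b i j) Q) (Zp i) (Zp j) = (\<lambda>e v. 0) \<and>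
        serre_sum D (scl V) i j
          (qpoch_quot (qi D i powi (- 2) * Q) (qi D i powi 2 * Q) Q)
          (qpoch_quot (q powi (- b i j) * Q) (q powi b i j * Q) Q) (Zm i) (Zm j) = (\<lambda>e v. 0))"
proof -
  interpret dynamical_rep D k V using assms(6) by (simp add: category_C_def)
  interpret tor_module D k V l by unfold_locales (use assms(1-6) in auto)
  have Q: "Q = qk\<^sup>2" unfolding Q_def by (rule q_powr(6))
  have Z: "Zp = (\<lambda>i. Zf (True, i))" "Zm = (\<lambda>i. Zf (False, i))"
    by (simp_all add: Zp_def Zm_def Zf_def fun_eq_iff)
  have Kprod_Zp: "Kprod D K (Zp j n v) - Zp j n (Kprod D K v) = 0" if "K \<in> {Kp V, Km V}" "j \<in> I" for K j n v
    using Kprod_Zf[OF that(1), of "(True, j)"] that(2) by (simp add: Z I_def)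
  have serre: "serre_sum D (scl V) i j (qpoch_quot (qi D i powi (- 2)) (qi D i powi 2) Q)
          (qpoch_quot (q powi (- b i j)) (q powi b i j) Q) (Zp i) (Zp j) = (\<lambda>e v. 0)"
    "serre_sum D (scl V) i j (qpoch_quot (qi D i powi (- 2) * Q) (qi D i powi 2 * Q) Q)
          (qpoch_quot (q powi (- b i j) * Q) (q powi b i j * Q) Q) (Zm i) (Zm j) = (\<lambda>e v. 0)"
    if "i \<in> I" "j \<in> I" "i \<noteq> j" for i j
    using Zf_serre[OF that[unfolded I_def], of True] Zf_serre[OF that[unfolded I_def], of False]
    unfolding serre_struct_diag unfolding serre_struct_def if_True if_False Q Z q_def b_def by blast+
  show ?thesis
  proof (intro conjI ballI allI impI)
    fix i j r Z n v assume "i \<in> I" "j \<in> I" "r \<noteq> (0::int)" "Z \<in> {Zp, Zm}"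
    thus "alpha D V i r (Z j n v) - Z j n (alpha D V i r v) = 0"
      using alpha_Zf[of i "(True, j)" r n v] alpha_Zf[of i "(False, j)" r n v] by (auto simp: Z I_def)
  next
    fix i j Z assume ij: "i \<in> I" "j \<in> I" and "Z \<in> {Zp, Zm}"
    then obtain s where "Z = (\<lambda>i. Zf (s, i))" by (auto simp: Z)
    thus "scalmul (var 1 z) (scalmul (in_ratio (qpoch_quot (q powi (- b i j)) (Q * q powi b i j) Q) (\<kappa> powi (- m i j)) w z)
            (in_var z (Z i) \<circledast> in_var w (Z j))) =
        scalmul (var (- (\<kappa> powi (- m i j))) w)
          (scalmul (in_ratio (qpoch_quot (q powi (- b i j)) (Q * q powi b i j) Q) (\<kappa> powi m i j) z w)
            (in_var w (Z j) \<circledast> in_var z (Z i)))"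
      using Zf_exchange[OF ij[unfolded I_def], of s]
      unfolding scalmul_def q_def b_def Q_def \<kappa>_def m_def z_def w_def by blast
  next
    fix i j e v assume "i \<in> I" "j \<in> I"
    thus "scalmul (in_ratio (qpoch_quot (q powi b i j * q powr k) (q powi (- b i j) * q powr k) Q) (\<kappa> powi (- m i j)) w z)
            (in_var z (Zp i) \<circledast> in_var w (Zm j)) e v
        - scalmul (in_ratio (qpoch_quot (q powi b i j * q powr k) (q powi (- b i j) * q powr k) Q) (\<kappa> powi m i j) z w)
            (in_var w (Zm j) \<circledast> in_var z (Zp i)) e v
        = scl V (of_bool (i = j) / (qi D i - inverse (qi D i)))
            (scl V (delta_ratio (q powr k) w z e) (Kp V i v) - scl V (delta_ratio (q powr (- k)) w z e) (Km V i v))"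
      unfolding I_def scalmul_def q_def b_def Q_def \<kappa>_def m_def z_def w_def Z by (rule Zf_commutator)
  qed (use Kprod_Zp serre act_Zf[of "(True, _)"] act_Zf[of "(False, _)"] act_K K_Zf_relations in
      \<open>simp_all add: Z I_def q_def a_def\<close>)
qed

end
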